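(* Let $Z$ be an irreducible hermitian Jordan triple of tube type, of rank $r$, with characteristic multiplicity $a$ and genus $p=2+a(r-1)$, and let $0<\ell<r$. Then there exists a non-zero $\mathring K_0$-invariant holomorphic differential form $\Theta$ of top degree $d_\ell=\dim_{\mathbb C}\mathring Z_\ell$ on the Kepler manifold $\mathring Z_\ell$ if and only if $p-a\ell=2+a(r-\ell-1)$ is even. (Among all tube type triples, $p-a\ell$ is odd only for the symmetric matrices $Z=\mathbb C^{r\times r}_{sym}$ with $r-\ell$ even.)
   Context: A hermitian Jordan triple is a finite-dimensional complex vector space $Z$ with a triple product $\{u;v;w\}=:D(u,v)w$, complex linear and symmetric in $u,w$, conjugate linear in $v$, satisfying $[D(x,y),D(u,v)]=D(\{x;y;u\},v)-D(u,\{v;x;y\})$, with $(u,v)\mapsto\operatorname{tr}D(u,v)$ a positive definite hermitian form; irreducible means not a direct sum of two non-zero ideals. Put $Q_uz=\frac12\{u;z;u\}$ and $B(u,v)=\mathrm{id}-D(u,v)+Q_uQ_v$. A tripotent is $c$ with $Q_cc=c$. Let $e_1,\dots,e_r$ be a frame (maximal system of orthogonal minimal tripotents), and for $0\le i\le j\le r$, $(i,j)\ne(0,0)$, let $Z_{ij}=\{z: D(e_k,e_k)z=(\delta_i^k+\delta_j^k)z\ \forall\, 1\le k\le r\}$. Then $a=\dim Z_{ij}$ for $1\le i<j\le r$ and $b=\dim Z_{0j}$ for $1\le j\le r$; the genus is $p=2+a(r-1)+b$. Tube type means $b=0$. $K$ is the identity component of the linear automorphism group of the triple. Every $z\in Z$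 is $z=k(\sum_i\lambda_ie_i)$ with $k\in K$, $\lambda_1\ge\dots\ge\lambda_r\ge0$ unique; $\operatorname{rank}z$ is the number of non-zero $\lambda_i$. The Kepler manifold is $\mathring Z_\ell=\{z\in Z:\operatorname{rank}z=\ell\}$, a complex manifold. $\mathring K$ is the connected complex Lie group of linear transformations of $Z$ generated by all invertible $B(u,v)$; it preserves the rank. $\mathring K_0$ is the closed subgroup of $\mathring K$ generated by all commutators in $\mathring K$; it acts transitively on $\mathring Z_\ell$ for tube type $Z$ and $0<\ell<r$. Invariance of $\Theta$ means $g^*\Theta=\Theta$ for all $g\in\mathring K_0$. *)

theory Defs
  imports "HOL-Analysis.Analysis"
begin

text \<open>
  The underlying complex vector space is \<open>complex^'n\<close> with complex scaling \<open>(*s)\<close>; complex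
  subspaces and dimensions are \<open>vec.subspace\<close> and \<open>vec.dim\<close>.  A triple product
  \<open>{u;v;w}\<close> is a function \<open>T u v w\<close>, so \<open>D(u,v)\<close> is \<open>T u v\<close>.  Linear transformations that form
  groups are represented by their matrices.
\<close>

type_synonym 'n triple = "complex^'n \<Rightarrow> complex^'n \<Rightarrow> complex^'n \<Rightarrow> complex^'n"

section \<open>Hermitian Jordan triples\<close>

definition hermitian_jordan_triple :: "('n::finite) triple \<Rightarrow> bool" where
  "hermitian_jordan_triple T \<longleftrightarrow>
     (\<forall>v w. Vector_Spaces.linear (*s) (*s) (\<lambda>u. T u v w)) \<and>
     (\<forall>u v w. T u v w = T w v u) \<and>
     (\<forall>u v v' w. T u (v + v') w = T u v w + T u v' w) \<and>
     (\<forall>c u v w. T u (c *s v) w = cnj c *s T u v w) \<and>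
     (\<forall>x y u v w. T x y (T u v w) - T u v (T x y w) = T (T x y u) v w - T u (T v x y) w) \<and>
     (\<forall>u v. trace (matrix (T v u)) = cnj (trace (matrix (T u v)))) \<and>
     (\<forall>u. u \<noteq> 0 \<longrightarrow> Re (trace (matrix (T u u))) > 0)"

definition triple_ideal :: "('n::finite) triple \<Rightarrow> (complex^'n) set \<Rightarrow> bool" where
  "triple_ideal T I \<longleftrightarrow> vec.subspace I \<and> (\<forall>x\<in>I. \<forall>u v. T u v x \<in> I \<and> T u x v \<in> I)"

definition irreducible_triple :: "('n::finite) triple \<Rightarrow> bool" where
  "irreducible_triple T \<longleftrightarrow>
     \<not> (\<exists>I J. triple_ideal T I \<and> triple_ideal T J \<and> I \<noteq> {0} \<and> J \<noteq> {0} \<and>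
            I \<inter> J = {0} \<and> {x + y |x y. x \<in> I \<and> y \<in> J} = UNIV)"

definition quad_op :: "('n::finite) triple \<Rightarrow> complex^'n \<Rightarrow> complex^'n \<Rightarrow> complex^'n" where
  "quad_op T u z = (1/2) *s T u z u"

definition bergman_op :: "('n::finite) triple \<Rightarrow> complex^'n \<Rightarrow> complex^'n \<Rightarrow> complex^'n \<Rightarrow> complex^'n" where
  "bergman_op T u v z = z - T u v z + quad_op T u (quad_op T v z)"

section \<open>Tripotents, frames and characteristic multiplicities\<close>

definition tripotent :: "('n::finite) triple \<Rightarrow> complex^'n \<Rightarrow> bool" where
  "tripotent T c \<longleftrightarrow> quad_op T c c = c"

definition jordan_orthogonal :: "('n::finite) triple \<Rightarrow> complex^'n \<Rightarrow> complex^'n \<Rightarrow> bool" where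
  "jordan_orthogonal T c d \<longleftrightarrow> (\<forall>z. T c d z = 0)"

text \<open>Minimality refers to the order in which \<open>c' \<le> c\<close> iff \<open>c - c'\<close> is a tripotent
  orthogonal to \<open>c'\<close>.\<close>

definition minimal_tripotent :: "('n::finite) triple \<Rightarrow> complex^'n \<Rightarrow> bool" where
  "minimal_tripotent T c \<longleftrightarrow> tripotent T c \<and> c \<noteq> 0 \<and>
     \<not> (\<exists>c' c''. tripotent T c' \<and> tripotent T c'' \<and> c' \<noteq> 0 \<and> c'' \<noteq> 0 \<and>
              jordan_orthogonal T c' c'' \<and> c = c' + c'')"

text \<open>Only the values \<open>e 1, \<dots>, e r\<close> matter; the number \<open>r\<close> of members is the rank of the triple.\<close>

definition frame :: "('n::finite) triple \<Rightarrow> nat \<Rightarrow> (nat \<Rightarrow> complex^'n) \<Rightarrow> bool" where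
  "frame T r e \<longleftrightarrow>
     (\<forall>i\<in>{1..r}. minimal_tripotent T (e i)) \<and>
     (\<forall>i\<in>{1..r}. \<forall>j\<in>{1..r}. i \<noteq> j \<longrightarrow> jordan_orthogonal T (e i) (e j)) \<and>
     \<not> (\<exists>c. minimal_tripotent T c \<and> (\<forall>i\<in>{1..r}. jordan_orthogonal T c (e i)))"

definition peirce :: "('n::finite) triple \<Rightarrow> nat \<Rightarrow> (nat \<Rightarrow> complex^'n) \<Rightarrow> nat \<Rightarrow> nat \<Rightarrow> (complex^'n) set" where
  "peirce T r e i j =
     {z. \<forall>k\<in>{1..r}. T (e k) (e k) z = (of_bool (i = k) + of_bool (j = k)) *s z}"

definition characteristic_multiplicities ::
    "('n::finite) triple \<Rightarrow> nat \<Rightarrow> (nat \<Rightarrow> complex^'n) \<Rightarrow> nat \<Rightarrow> nat \<Rightarrow> bool" where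
  "characteristic_multiplicities T r e a b \<longleftrightarrow>
     (\<forall>i j. 1 \<le> i \<and> i < j \<and> j \<le> r \<longrightarrow> vec.dim (peirce T r e i j) = a) \<and>
     (\<forall>j. 1 \<le> j \<and> j \<le> r \<longrightarrow> vec.dim (peirce T r e 0 j) = b)"

definition genus :: "nat \<Rightarrow> nat \<Rightarrow> nat \<Rightarrow> nat" where
  "genus r a b = 2 + a * (r - 1) + b"

section \<open>Groups, rank and Kepler manifolds\<close>

definition triple_automorphisms :: "('n::finite) triple \<Rightarrow> (complex^'n^'n) set" where
  "triple_automorphisms T =
     {A. invertible A \<and> (\<forall>u v w. A *v T u v w = T (A *v u) (A *v v) (A *v w))}"

definition K_group :: "('n::finite) triple \<Rightarrow> (complex^'n^'n) set" where
  "K_group T = connected_component_set (triple_automorphisms T) (mat 1)"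

definition matrix_group :: "(complex^'n^'n::finite) set \<Rightarrow> bool" where
  "matrix_group H \<longleftrightarrow> mat 1 \<in> H \<and> (\<forall>A\<in>H. invertible A \<and> matrix_inv A \<in> H) \<and>
     (\<forall>A\<in>H. \<forall>B\<in>H. A ** B \<in> H)"

text \<open>The group generated by all invertible \<open>B(u,v)\<close>.\<close>

definition K_ring :: "('n::finite) triple \<Rightarrow> (complex^'n^'n) set" where
  "K_ring T = matrix_group hull
     {matrix (bergman_op T u v) |u v. invertible (matrix (bergman_op T u v))}"

text \<open>The smallest closed subgroup of \<open>K_ring T\<close> containing all commutators.\<close>

definition K_ring0 :: "('n::finite) triple \<Rightarrow> (complex^'n^'n) set" where
  "K_ring0 T =
     (\<lambda>H. matrix_group H \<and> closedin (top_of_set (K_ring T)) H) hull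
       {A ** B ** matrix_inv A ** matrix_inv B |A B. A \<in> K_ring T \<and> B \<in> K_ring T}"

definition has_rank :: "('n::finite) triple \<Rightarrow> nat \<Rightarrow> (nat \<Rightarrow> complex^'n) \<Rightarrow> complex^'n \<Rightarrow> nat \<Rightarrow> bool" where
  "has_rank T r e z m \<longleftrightarrow>
     (\<exists>k\<in>K_group T. \<exists>s :: nat \<Rightarrow> real.
        z = k *v (\<Sum>i=1..r. complex_of_real (s i) *s e i) \<and>
        (\<forall>i j. 1 \<le> i \<and> i \<le> j \<and> j \<le> r \<longrightarrow> s j \<le> s i) \<and>
        (\<forall>i\<in>{1..r}. 0 \<le> s i) \<and>
        m = card {i\<in>{1..r}. s i \<noteq> 0})"

definition kepler :: "('n::finite) triple \<Rightarrow> nat \<Rightarrow> (nat \<Rightarrow> complex^'n) \<Rightarrow> nat \<Rightarrow> (complex^'n) set" where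
  "kepler T r e l = {z. has_rank T r e z l}"

section \<open>Holomorphic forms on complex submanifolds\<close>

text \<open>
  \<open>sc\<close> is the complex scaling of the codomain.  \<open>S\<close> will be open, or relatively open in a
  complex subspace; in the latter case only the restriction of \<open>f'\<close> to that subspace is
  determined.
\<close>

definition holomorphic_wrt ::
    "(complex \<Rightarrow> 'b \<Rightarrow> 'b) \<Rightarrow> (complex^'n::finite \<Rightarrow> 'b::real_normed_vector) \<Rightarrow> (complex^'n) set \<Rightarrow> bool" where
  "holomorphic_wrt sc f S \<longleftrightarrow>
     (\<forall>x\<in>S. \<exists>f'. (f has_derivative f') (at x within S) \<and> (\<forall>c v. f' (c *s v) = sc c (f' v)))"

text \<open>\<open>f\<close> is biholomorphic on the open set \<open>W\<close> with inverse \<open>g\<close> and maps \<open>W \<inter> M\<close> onto an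
  open piece of the \<open>d\<close>-dimensional complex subspace \<open>V\<close>.\<close>

definition slice_chart ::
    "nat \<Rightarrow> (complex^'n::finite) set \<Rightarrow> (complex^'n) set \<Rightarrow> (complex^'n \<Rightarrow> complex^'n) \<Rightarrow>
     (complex^'n \<Rightarrow> complex^'n) \<Rightarrow> (complex^'n) set \<Rightarrow> bool" where
  "slice_chart d M W f g V \<longleftrightarrow>
     open W \<and> open (f ` W) \<and> holomorphic_wrt (*s) f W \<and> holomorphic_wrt (*s) g (f ` W) \<and>
     (\<forall>x\<in>W. g (f x) = x) \<and>
     vec.subspace V \<and> vec.dim V = d \<and> f ` (W \<inter> M) = f ` W \<inter> V"

definition complex_submanifold :: "nat \<Rightarrow> (complex^'n::finite) set \<Rightarrow> bool" where
  "complex_submanifold d M \<longleftrightarrow> (\<forall>z\<in>M. \<exists>W f g V. z \<in> W \<and> slice_chart d M W f g V)"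

definition complex_dim :: "(complex^'n::finite) set \<Rightarrow> nat" where
  "complex_dim M = (THE d. complex_submanifold d M)"

text \<open>Velocities at \<open>z\<close> of curves in \<open>M\<close>.\<close>

definition tangent_space :: "(complex^'n::finite) set \<Rightarrow> complex^'n \<Rightarrow> (complex^'n) set" where
  "tangent_space M z =
     {v. \<exists>\<gamma> :: real \<Rightarrow> complex^'n. \<gamma> 0 = z \<and> (\<forall>\<^sub>F t in nhds 0. \<gamma> t \<in> M) \<and>
           (\<gamma> has_vector_derivative v) (at 0)}"

text \<open>A form of degree \<open>d\<close> takes a point and a list of \<open>d\<close> tangent vectors; its other values
  are irrelevant.\<close>

definition alternating_form ::
    "nat \<Rightarrow> (complex^'n::finite) set \<Rightarrow> ((complex^'n) list \<Rightarrow> complex) \<Rightarrow> bool" where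
  "alternating_form d V \<omega> \<longleftrightarrow>
     (\<forall>vs i x y c. length vs = d \<and> set vs \<subseteq> V \<and> i < d \<and> x \<in> V \<and> y \<in> V \<longrightarrow>
        \<omega> (vs[i := c *s x + y]) = c * \<omega> (vs[i := x]) + \<omega> (vs[i := y])) \<and>
     (\<forall>vs i j. length vs = d \<and> set vs \<subseteq> V \<and> i < j \<and> j < d \<and> vs ! i = vs ! j \<longrightarrow> \<omega> vs = 0)"

text \<open>Holomorphy means that the coefficients in every chart of the complex submanifold \<open>M\<close>
  (of dimension \<open>m\<close>), i.e. the values of the pullback under the inverse chart on constant vector fields, are holomorphic.\<close>

definition holomorphic_form ::
    "nat \<Rightarrow> (complex^'n::finite) set \<Rightarrow> (complex^'n \<Rightarrow> (complex^'n) list \<Rightarrow> complex) \<Rightarrow> bool" where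
  "holomorphic_form d M \<Theta> \<longleftrightarrow>
     (\<forall>z\<in>M. alternating_form d (tangent_space M z) (\<Theta> z)) \<and>
     (\<forall>m W f g V vs. slice_chart m M W f g V \<and> length vs = d \<and> set vs \<subseteq> V \<longrightarrow>
        holomorphic_wrt (*) (\<lambda>x. \<Theta> (g x) (map (frechet_derivative g (at x)) vs)) (f ` W \<inter> V))"

definition nonzero_form ::
    "nat \<Rightarrow> (complex^'n::finite) set \<Rightarrow> (complex^'n \<Rightarrow> (complex^'n) list \<Rightarrow> complex) \<Rightarrow> bool" where
  "nonzero_form d M \<Theta> \<longleftrightarrow>
     (\<exists>z\<in>M. \<exists>vs. length vs = d \<and> set vs \<subseteq> tangent_space M z \<and> \<Theta> z vs \<noteq> 0)"

text \<open>Invariance under a group of linear maps preserving \<open>M\<close>; the differential of a linear map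
  is the map itself.\<close>

definition invariant_form ::
    "(complex^'n^'n) set \<Rightarrow> nat \<Rightarrow> (complex^'n::finite) set \<Rightarrow>
     (complex^'n \<Rightarrow> (complex^'n) list \<Rightarrow> complex) \<Rightarrow> bool" where
  "invariant_form G d M \<Theta> \<longleftrightarrow>
     (\<forall>A\<in>G. \<forall>z\<in>M. \<forall>vs. length vs = d \<and> set vs \<subseteq> tangent_space M z \<longrightarrow>
        \<Theta> (A *v z) (map ((*v) A) vs) = \<Theta> z vs)"

section \<open>The triple of symmetric matrices\<close>

text \<open>Matrices of variable size \<open>r\<close> are functions vanishing outside \<open>{..<r} \<times> {..<r}\<close>.\<close>

definition symmetric_matrices :: "nat \<Rightarrow> (nat \<Rightarrow> nat \<Rightarrow> complex) set" where
  "symmetric_matrices r =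
     {A. (\<forall>i j. A i j = A j i) \<and> (\<forall>i j. \<not> (i < r \<and> j < r) \<longrightarrow> A i j = 0)}"

text \<open>The triple product is \<open>U V\<^sup>* W + W V\<^sup>* U\<close>.\<close>

definition matrix_triple ::
    "nat \<Rightarrow> (nat \<Rightarrow> nat \<Rightarrow> complex) \<Rightarrow> (nat \<Rightarrow> nat \<Rightarrow> complex) \<Rightarrow> (nat \<Rightarrow> nat \<Rightarrow> complex) \<Rightarrow> nat \<Rightarrow> nat \<Rightarrow> complex" where
  "matrix_triple r U V W i j =
     (\<Sum>k<r. \<Sum>m<r. U i k * cnj (V m k) * W m j + W i k * cnj (V m k) * U m j)"

definition iso_symmetric_matrices :: "('n::finite) triple \<Rightarrow> nat \<Rightarrow> bool" where
  "iso_symmetric_matrices T r \<longleftrightarrow>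
     (\<exists>\<phi> :: complex^'n \<Rightarrow> nat \<Rightarrow> nat \<Rightarrow> complex.
        bij_betw \<phi> UNIV (symmetric_matrices r) \<and>
        (\<forall>x y i j. \<phi> (x + y) i j = \<phi> x i j + \<phi> y i j) \<and>
        (\<forall>c x i j. \<phi> (c *s x) i j = c * \<phi> x i j) \<and>
        (\<forall>u v w. \<phi> (T u v w) = matrix_triple r (\<phi> u) (\<phi> v) (\<phi> w)))"

end

theory Submission
 imports Defs "HOL-Complex_Analysis.Complex_Analysis"
begin

text \<open>
  Let \<open>e\<^sub>1, \<dots>, e\<^sub>r\<close> be the frame.  For tube type the triple is the Jordan algebra \<open>Z\<^sub>2(un)\<close> of the tripotent
  \<open>un = e\<^sub>1 + \<dots> + e\<^sub>r\<close>, with a norm polynomial \<open>Nm\<close> of degree \<open>r\<close>.  The spectral theorem shows that the Kepler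
  manifold \<open>M\<close> is the orbit of \<open>c = e\<^sub>1 + \<dots> + e\<^sub>l\<close> under the structure group \<open>Str\<close>.  Near \<open>c\<close> it is the graph of
  a holomorphic map \<open>Z\<^sub>2(c) \<oplus> Z\<^sub>1(c) \<rightarrow> Z\<^sub>0(c)\<close> (\<open>base_chart\<close>), and its tangent space at \<open>c\<close> is
  \<open>Z\<^sub>2(c) \<oplus> Z\<^sub>1(c)\<close>.

  An invariant form on an orbit exists as soon as stabilisers act on the tangent space with determinant \<open>1\<close>.
  The structure group acts on the norm by a character, \<open>Nm(gz) = \<chi>(g) Nm(z)\<close> (\<open>Nm_Str\<close>), which is
  trivial on commutators, as is the determinant on \<open>Z\<close>.  If \<open>g\<close> fixes \<open>c\<close>, its determinant on the tangent space is
  \<open>det g\<close> divided by the determinant \<open>h\<close> of its compression to \<open>Z\<^sub>0(c)\<close> (\<open>det_normalised\<close>).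
  The compression \<open>H\<close> satisfies \<open>H H\<^sup>t = P(w)\<close> on \<open>Z\<^sub>0(c)\<close> for the image \<open>w\<close> of its unit, and \<open>P(w)\<close> has determinant
  \<open>Nm(c + w)\<^sup>m\<close> there, where \<open>m = 2 + a(r - l - 1) = p - al\<close> (\<open>Det_block0\<close>, \<open>Det_hb_square\<close>).  Hence
  \<open>h\<^sup>2 = \<chi>(g)\<^sup>m\<close>, and parity decides whether the square root is a character.

  Let \<open>m = 2q\<close>.  Every element of the group \<open>KR\<close> is joined to \<open>1\<close> by a polynomial path
  (\<open>KR_poly_path\<close>) along which the sign in \<open>h = \<plusminus> \<chi>\<^sup>q\<close> is constant (\<open>Det_hb_KR\<close>).  So \<open>\<kappa> = det / \<chi>\<^sup>q\<close> is a
  character of \<open>KR\<close> that gives the determinant on tangent spaces (\<open>vol_transform\<close>).  Transporting a volume form from \<open>c\<close>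
  with factor \<open>\<kappa>\<close> defines \<open>Theta\<close>, which is holomorphic by an explicit formula in the chart and
  invariant under the kernel of \<open>\<kappa>\<close>, hence under the closure of the commutator group.

  Let \<open>m\<close> be odd.  Then \<open>a\<close> and \<open>r - l - 1\<close> are odd.  The product of the reflections in \<open>e\<^sub>1\<close> and in \<open>e\<^sub>r\<close> is a
  commutator, fixes \<open>c\<close> and has determinant \<open>-1\<close> on the tangent space (\<open>gam_commutator\<close>, \<open>gam_form_vanishes\<close>), so an
  invariant form vanishes at \<open>c\<close>.  Conjugating with the structure group gives this at every point of
  \<open>M\<close> (\<open>odd_no_form\<close>).

  Moreover \<open>r \<ge> 3\<close> in the odd case.  Two orthogonal unit vectors of \<open>Z\<^sub>1\<^sub>2\<close> would satisfy a Clifford relation and give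
  an invertible skew operator on the \<open>a\<close>-dimensional space \<open>Z\<^sub>2\<^sub>3\<close>, which is impossible for odd \<open>a\<close>; so \<open>a = 1\<close>
  (\<open>odd_multiplicity_one\<close>).  With \<open>a = 1\<close>, unit vectors in the \<open>Z\<^sub>1\<^sub>j\<close> and their products have the multiplication table
  of the matrices \<open>E\<^sub>i\<^sub>j + E\<^sub>j\<^sub>i\<close>, and the triple is that of the symmetric matrices (\<open>iso_symmetric\<close>).

  The spectral theorem itself is obtained by maximising \<open>Re \<langle>z, km\<rangle>\<close> over automorphisms \<open>k\<close>, for a fixed diagonal
  \<open>m\<close> with distinct entries: rotations in the planes of \<open>e\<^sub>i, e\<^sub>j\<close> show that a maximum is attained
  at a diagonal element.
\<close>

no_notation fps_nth (infixl \<open>$\<close> 75)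

section \<open>Complex linear algebra\<close>

abbreviation clin :: "(complex^'n => complex^'m) => bool" where
 "clin f \<equiv> Vector_Spaces.linear (*s) (*s) f"

lemma clin_iff: "clin f \<longleftrightarrow> (ALL x y. f (x + y) = f x + f y) & (ALL c x. f (c *s x) = c *s f x)"
 unfolding Vector_Spaces.linear_iff by (simp add: vec.vector_space_axioms)

lemma clinI: "(!!x y. f (x + y) = f x + f y) ==> (!!c x. f (c *s x) = c *s f x) ==> clin f" by (simp add: clin_iff)

lemma
 assumes "clin f" shows clin_add: "f (x + y) = f x + f y" and clin_scale: "f (c *s x) = c *s f x" and clin_zero: "f 0 = 0"
  and clin_minus: "f (- x) = - f x" and clin_diff: "f (x - y) = f x - f y" and clin_sum: "f (\<Sum>i\<in>A. g i) = (\<Sum>i\<in>A. f (g i))"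
proof -
 interpret Vector_Spaces.linear "(*s)" "(*s)" f by fact
 show "f (x + y) = f x + f y" by (rule add)
 show "f (c *s x) = c *s f x" by (rule scale)
 show "f 0 = 0" by (rule zero)
 show "f (- x) = - f x" by (rule neg)
 show "f (x - y) = f x - f y" by (rule diff)
 show "f (\<Sum>i\<in>A. g i) = (\<Sum>i\<in>A. f (g i))" by (rule sum)
qed

lemma clin_id: "clin (%x. x)" and clin_const0: "clin (%x. 0)" and clin_plus: "clin f ==> clin g ==> clin (%x. f x + g x)"
 and clin_sub: "clin f ==> clin g ==> clin (%x. f x - g x)" and clin_cmul: "clin f ==> clin (%x. c *s f x)"
 and clin_comp: "clin h ==> clin f ==> clin (%x. h (f x))"
 by (auto simp: clin_iff vec.scale_right_distrib vec.scale_right_diff_distrib mult.commute)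

lemma clin_matrix [simp]: "clin ((*v) (A::complex^'n^'m))" by (rule matrix_vector_mul_linear_gen)
lemma matrix_comp: "clin f ==> clin g ==> matrix (%x. f (g x)) = matrix f ** matrix g" using matrix_compose_gen[of g f] by (simp add: o_def)

lemmas mv_mult = matrix_vector_mul_assoc[symmetric]

lemma matrix_eqI: "(!!x. A *v x = B *v x) ==> A = (B::complex^'n^'m)" by (simp add: matrix_eq)
lemma matrix_add_fun: "matrix (%x. f x + g x) = matrix f + (matrix g :: complex^'n^'m)" by (simp add: matrix_def vec_eq_iff)
lemma matrix_diff_fun: "matrix (%x. f x - g x) = matrix f - (matrix g :: complex^'n^'m)" by (simp add: matrix_def vec_eq_iff)

lemma trace_scale_fun: "trace (matrix (%x. c *s f x)) = c * trace (matrix f :: complex^'n^'n)"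
 by (simp add: matrix_def trace_def sum_distrib_left)

lemma trace_comp_commute:
 "clin f ==> clin g ==> trace (matrix (%x. f (g x))) = trace (matrix (%x. g (f x) :: complex^'n))"
 by (simp only: matrix_comp) (rule trace_mul_sym)

lemma scaleR_eq_scale: "t *\<^sub>R (x::complex^'n) = complex_of_real t *s x"
 by (subst vec_eq_iff) (simp add: scaleR_conv_of_real[where 'a=complex])

lemma clin_imp_linear: "clin f ==> linear (f :: complex^'n => complex^'m)" by (rule linearI) (simp_all add: clin_iff scaleR_eq_scale)

lemma clin_bounded_linear: "clin f ==> bounded_linear (f :: complex^'n => complex^'m)"
 using clin_imp_linear linear_conv_bounded_linear by blast

lemma clin_continuous: "clin f ==> continuous_on S (f :: complex^'n => complex^'m)" by (intro linear_continuous_on clin_bounded_linear)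

abbreviation Det :: "(complex^'n => complex^'n) => complex" where
 "Det f \<equiv> det (matrix f)"

lemma Det_comp: "clin f ==> clin g ==> Det (%x. f (g x)) = Det f * Det g" by (simp add: matrix_comp det_mul)
lemma Det_id: "Det (%x. x) = 1" unfolding id_def[symmetric] by (rule matrix_id)

lemma Det_nz_iff: "clin f ==> Det f ~= 0 \<longleftrightarrow> bij f" proof -
 assume f: "clin f"
 have "(*v) (matrix f) = f" by (rule ext) (simp add: matrix_works[OF f])
 thus ?thesis using invertible_eq_bij[of "matrix f"] by (simp add: invertible_det_nz)
qed

lemma clin_bij_iff_inj: "clin (f::complex^'n => complex^'n) ==> bij f \<longleftrightarrow> (ALL x. f x = 0 --> x = 0)" proof -
 assume f: "clin f"
 have "bij f \<longleftrightarrow> inj f" using vec.linear_injective_imp_surjective[OF f] by (auto simp: bij_def)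
 moreover have "inj f \<longleftrightarrow> (ALL x. f x = 0 --> x = 0)" using clin_diff[OF f] clin_zero[OF f] unfolding inj_def
  by (metis eq_iff_diff_eq_0)
 ultimately show ?thesis by simp
qed

lemma clin_inv_bij: "clin f ==> bij f ==> clin (inv f)"
 for f :: "complex^'n => complex^'n" proof (rule clinI)
 assume f: "clin f" "bij f"
 have *: "f (inv f x) = x" for x using f(2) by (simp add: bij_is_surj surj_f_inv_f)
 have **: "inv f (f x) = x" for x using f(2) by (simp add: bij_is_inj)
 show "inv f (x + y) = inv f x + inv f y" for x y using **[of "inv f x + inv f y"] by (simp add: clin_add[OF f(1)] *)
 show "inv f (c *s x) = c *s inv f x" for c x using **[of "c *s inv f x"] by (simp add: clin_scale[OF f(1)] *)
qed

lemma invertible_iff_bij: "clin f ==> invertible (matrix f) \<longleftrightarrow> bij (f::complex^'n => complex^'n)"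
 by (simp add: Det_nz_iff invertible_det_nz)

text \<open>A finite family of complementary projections, given as operators that annihilate each
  other and sum up to the identity.\<close>

definition resolution :: "'k set => ('k => complex^'n => complex^'n) => bool" where
 "resolution I p \<longleftrightarrow> finite I & (\<forall>k\<in>I. clin (p k)) &
   (\<forall>k\<in>I. \<forall>m\<in>I. ALL x. p k (p m x) = (if k = m then p k x else 0)) & (ALL x. (\<Sum>k\<in>I. p k x) = x)"

text \<open>Concatenating bases of the ranges of complementary projections gives a basis of the whole
  space, which is indexed by the coordinate type \<open>'n\<close> so that determinants and traces can be read
  off from it.\<close>

lemma adapted_basis:
 fixes p :: "'k => complex^'n => complex^'n"
 assumes "resolution I p"
 obtains ty :: "'n => 'k" and b :: "'n => complex^'n" where
  "ALL x. ty x \<in> I" "ALL x. p (ty x) (b x) = b x" "invertible (\<chi> i j. b j $ i)"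
  "\<forall>k\<in>I. card {x. ty x = k} = vec.dim (range (p k))" proof -
 have fin: "finite I" and lin: "!!k. k \<in> I ==> clin (p k)"
  and pp: "!!k m x. k \<in> I ==> m \<in> I ==> p k (p m x) = (if k = m then p k x else 0)" and sum_p: "!!x. (\<Sum>k\<in>I. p k x) = x"
  using assms unfolding resolution_def by auto
 have "ALL k. EX B. B \<subseteq> range (p k) & vec.independent B & range (p k) \<subseteq> vec.span B
   & card B = vec.dim (range (p k))" using vec.basis_exists by meson
 then obtain B where B: "!!k. B k \<subseteq> range (p k)" "!!k. vec.independent (B k)"
  "!!k. range (p k) \<subseteq> vec.span (B k)" "!!k. card (B k) = vec.dim (range (p k))" by metis
 have finB: "finite (B k)" for k using B(2) vec.finiteI_independent by blast
 have pB: "p k x = x" if "k \<in> I" "x \<in> B k" for k x using B(1)[of k] that pp[of k k] by auto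
 have pB0: "p m x = 0" if "k \<in> I" "m \<in> I" "m ~= k" "x \<in> B k" for k m x using B(1)[of k] that pp[of m k] by auto
 have nz: "x ~= 0" if "x \<in> B k" for k x using B(2)[of k] that vec.dependent_zero by blast
 have disj: "k = m" if "k \<in> I" "m \<in> I" "x \<in> B k" "x \<in> B m" for k m x using pB0[of k m x] pB[of m x] nz that by force
 define BB where "BB = (\<Union>k\<in>I. B k)"
 have finBB: "finite BB" using fin finB by (auto simp: BB_def)
 have ind: "vec.independent BB" unfolding vec.independent_explicit_module proof (intro allI impI)
  fix t u x
  assume t: "finite t" "t \<subseteq> BB" and s: "(\<Sum>v\<in>t. u v *s v) = 0" and x: "x \<in> t"
  obtain k where k: "k \<in> I" "x \<in> B k" using t x by (auto simp: BB_def)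
  have "0 = p k (\<Sum>v\<in>t. u v *s v)" using s clin_zero[OF lin[OF k(1)]] by simp
  also have "... = (\<Sum>v\<in>t. u v *s p k v)" by (simp add: clin_sum[OF lin[OF k(1)]] clin_scale[OF lin[OF k(1)]])
  also have "... = (\<Sum>v\<in>t \<inter> B k. u v *s v)" proof (rule sum.mono_neutral_cong_right[OF t(1)])
   show "\<forall>i\<in>t - t \<inter> B k. u i *s p k i = 0" proof
    fix i assume i: "i \<in> t - t \<inter> B k"
    then obtain m where "m \<in> I" "i \<in> B m" using t by (auto simp: BB_def)
    thus "u i *s p k i = 0" using pB0[of m k i] i k by (metis Diff_iff IntI vec.scale_zero_right)
   qed
   show "!!v. v \<in> t \<inter> B k ==> u v *s p k v = u v *s v" using pB[OF k(1)] by simp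
  qed simp
  finally have "(\<Sum>v\<in>t \<inter> B k. u v *s v) = 0" by simp
  thus "u x = 0" using vec.independentD[OF B(2)[of k], of "t \<inter> B k" u x] t x k by simp
 qed
 have spn: "vec.span BB = UNIV" proof -
  have "x \<in> vec.span BB" for x proof -
   have "p k x \<in> vec.span BB" if "k \<in> I" for k using B(3)[of k] vec.span_mono[of "B k" BB] that by (auto simp: BB_def)
   hence "(\<Sum>k\<in>I. p k x) \<in> vec.span BB" by (rule vec.span_sum)
   thus ?thesis by (simp add: sum_p)
  qed
  thus ?thesis by blast
 qed
 have "card BB = vec.dim (UNIV :: (complex^'n) set)" using ind spn vec.basis_card_eq_dim[of BB UNIV] by simp
 hence "card BB = CARD('n)" by (simp only: vec_dim_card)
 then obtain b :: "'n => complex^'n" where b: "bij_betw b UNIV BB" using finite_same_card_bij[of "UNIV::'n set" BB] finBB by auto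
 define ty where "ty x = (THE k. k \<in> I & b x \<in> B k)" for x
 have ty: "ty x \<in> I & b x \<in> B (ty x)" for x proof -
  have "b x \<in> BB" using b by (auto simp: bij_betw_def)
  hence "\<exists>!k. k \<in> I & b x \<in> B k" using disj by (auto simp: BB_def)
  from theI'[OF this] show ?thesis unfolding ty_def .
 qed
 have img: "b ` {x. ty x = k} = B k" if "k \<in> I" for k proof
  show "b ` {x. ty x = k} \<subseteq> B k" using ty by auto
  show "B k \<subseteq> b ` {x. ty x = k}" proof
   fix y assume y: "y \<in> B k"
   hence "y \<in> BB" using that by (auto simp: BB_def)
   then obtain x where "y = b x" using b by (auto simp: bij_betw_def)
   thus "y \<in> b ` {x. ty x = k}" using ty[of x] disj[of "ty x" k y] y that by auto
  qed
 qed
 have injb: "inj b" using b by (auto simp: bij_betw_def)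
 have inv: "invertible (\<chi> i j. b j $ i)" proof -
  let ?M = "(\<chi> i j. b j $ i) :: complex^'n^'n"
  have "columns ?M = b ` UNIV" by (auto simp: columns_def column_def)
  hence "vec.span (columns ?M) = UNIV" using b spn by (simp add: bij_betw_def)
  thus ?thesis using matrix_right_invertible_span_columns[of ?M] by (auto simp: invertible_right_inverse)
 qed
 have "card {x. ty x = k} = vec.dim (range (p k))" if "k \<in> I" for k
  using card_image[OF inj_on_subset[OF injb subset_UNIV], of "{x. ty x = k}"] img[OF that] B(4)[of k] by simp
 moreover have "ty x \<in> I" "p (ty x) (b x) = b x" for x using ty[of x] pB by auto
 ultimately show ?thesis using inv by (intro that[of ty b] allI ballI) auto
qed

lemma
 fixes b :: "'n::finite => complex^'n"
 assumes f: "clin f" and b: "invertible (\<chi> i j. b j $ i)" and fb: "!!x. f (b x) = c x *s b x"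
 shows Det_eigenbasis: "Det f = (\<Prod>x\<in>UNIV. c x)" and trace_eigenbasis: "trace (matrix f) = (\<Sum>x\<in>UNIV. c x)" proof -
 let ?M = "(\<chi> i j. b j $ i) :: complex^'n^'n" and ?D = "(\<chi> i j. if i = j then c i else 0) :: complex^'n^'n"
 have "matrix f ** ?M = ?M ** ?D" proof -
  have "(matrix f ** ?M) $ i $ j = (f (b j)) $ i" for i j using matrix_works[OF f, of "b j"]
   by (simp add: matrix_matrix_mult_def matrix_vector_mult_def vec_eq_iff)
  moreover have "(?M ** ?D) $ i $ j = (c j *s b j) $ i" for i j by (simp add: matrix_matrix_mult_def if_distrib cong: if_cong)
  ultimately show ?thesis by (simp add: vec_eq_iff fb)
 qed
 moreover obtain N where N: "?M ** N = mat 1" "N ** ?M = mat 1" using b by (auto simp: invertible_def)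
 ultimately have "matrix f ** (?M ** N) = ?M ** ?D ** N" by (metis matrix_mul_assoc)
 hence *: "matrix f = ?M ** ?D ** N" by (simp only: N matrix_mul_rid)
 have "det ?M * det N = 1" using det_mul[of ?M N] by (simp only: N det_I)
 hence "Det f = det ?D" unfolding * det_mul by (simp only: mult.commute[of "det ?M"] mult.assoc mult_1_right)
 thus "Det f = (\<Prod>x\<in>UNIV. c x)" by (simp add: det_diagonal)
 have "trace (matrix f) = trace (N ** (?M ** ?D))" unfolding * by (rule trace_mul_sym)
 also have "... = trace ?D" using N by (simp add: matrix_mul_assoc)
 finally show "trace (matrix f) = (\<Sum>x\<in>UNIV. c x)" by (simp add: trace_def)
qed

lemma basis_expand:
 fixes b :: "'n::finite => complex^'n"
 assumes "invertible (\<chi> i j. b j $ i)"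
 obtains y where "x = (\<Sum>j\<in>UNIV. y j *s b j)" proof -
 let ?M = "(\<chi> i j. b j $ i) :: complex^'n^'n"
 have "surj ((*v) ?M)" using assms by (simp add: invertible_eq_bij bij_def)
 then obtain z where "x = ?M *v z" by (metis surjD)
 hence "x = (\<Sum>j\<in>UNIV. z $ j *s b j)" by (simp add: vec_eq_iff matrix_vector_mult_def mult.commute)
 thus ?thesis by (rule that)
qed

lemma trace_idempotent:
 assumes P: "clin P" and PP: "!!x. P (P x) = P (x::complex^'n)" shows "trace (matrix P) = of_nat (vec.dim (range P))" proof -
 let ?p = "%k::bool. if k then P else (%x. x - P x)"
 have res: "resolution UNIV ?p" unfolding resolution_def proof (intro conjI ballI allI)
  show "clin (?p k)" for k by (cases k) (simp_all add: P clin_sub clin_id)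
  show "?p k (?p m x) = (if k = m then ?p k x else 0)" for k m x by (cases k; cases m) (simp_all add: PP clin_diff[OF P])
  show "(\<Sum>k\<in>UNIV. ?p k x) = x" for x by (simp add: UNIV_bool)
 qed simp
 obtain ty :: "'n => bool" and b :: "'n => complex^'n" where
  b: "ALL x. ty x \<in> UNIV" "ALL x. ?p (ty x) (b x) = b x" "invertible (\<chi> i j. b j $ i)"
  "\<forall>k\<in>UNIV. card {x. ty x = k} = vec.dim (range (?p k))" by (rule adapted_basis[OF res], rule that)
 have "P (b x) = (if ty x then 1 else 0) *s b x" for x using b(2)[rule_format, of x] by (cases "ty x") (auto simp: diff_eq_eq)
 from trace_eigenbasis[OF P b(3) this]
 have "trace (matrix P) = (\<Sum>x\<in>UNIV. if ty x then 1 else 0)" by simp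
 also have "... = of_nat (card {x. ty x})" by (simp add: sum.If_cases)
 finally show ?thesis using b(4)[rule_format, of True] by simp
qed

section \<open>Holomorphic functions of several variables\<close>

definition cdiff :: "(complex^'n => complex) => complex^'n => bool" where
 "cdiff f x \<longleftrightarrow> (EX f'. (f has_derivative f') (at x) & (ALL c v. f' (c *s v) = c * f' v))"

lemma cdiffI: "(f has_derivative f') (at x) ==> (!!c v. f' (c *s v) = c * f' v) ==> cdiff f x" by (auto simp: cdiff_def)

lemma cdiffE:
 assumes "cdiff f x"
 obtains f' where "(f has_derivative f') (at x)" "!!c v. f' (c *s v) = c * f' v" using assms by (auto simp: cdiff_def)

lemma cdiff_const: "cdiff (%x. c) x" by (rule cdiffI[of _ "%x. 0"]) auto
lemma bounded_linear_coord: "bounded_linear (%x::complex^'n. x $ i)" by (rule bounded_linear_vec_nth)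

lemma cdiff_coord: "cdiff (%x. x $ i) x"
 by (rule cdiffI[of _ "%x. x $ i"]) (auto intro: bounded_linear_imp_has_derivative bounded_linear_coord)

lemma cdiff_add: assumes "cdiff f x" "cdiff g x" shows "cdiff (%x. f x + g x) x" proof -
 obtain f' g' where "(f has_derivative f') (at x)" "!!c v. f' (c *s v) = c * f' v"
  "(g has_derivative g') (at x)" "!!c v. g' (c *s v) = c * g' v" using assms by (elim cdiffE) blast
 thus ?thesis by (intro cdiffI[of _ "%h. f' h + g' h"] has_derivative_add) (auto simp: algebra_simps)
qed

lemma cdiff_mult: assumes "cdiff f x" "cdiff g x" shows "cdiff (%x. f x * g x) x" proof -
 obtain f' g' where "(f has_derivative f') (at x)" "!!c v. f' (c *s v) = c * f' v"
  "(g has_derivative g') (at x)" "!!c v. g' (c *s v) = c * g' v" using assms by (elim cdiffE) blast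
 thus ?thesis by (intro cdiffI[of _ "%h. f x * g' h + f' h * g x"] has_derivative_mult) (auto simp: algebra_simps)
qed

lemma cdiff_minus: "cdiff f x ==> cdiff (%x. - f x) x" using cdiff_mult[OF cdiff_const[of "-1"], of f x] by simp
lemma cdiff_diff: "cdiff f x ==> cdiff g x ==> cdiff (%x. f x - g x) x" using cdiff_add[OF _ cdiff_minus[of g x], of f] by simp

lemma cdiff_inverse: assumes "cdiff f x" "f x ~= 0" shows "cdiff (%x. inverse (f x)) x" proof -
 obtain f' where f': "(f has_derivative f') (at x)" "!!c v. f' (c *s v) = c * f' v" using assms by (elim cdiffE) blast
 have "((%x. inverse (f x)) has_derivative (%h. - (inverse (f x) * f' h * inverse (f x)))) (at x)"
  by (rule Deriv.has_derivative_inverse[OF assms(2) f'(1)])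
 thus ?thesis by (rule cdiffI) (simp add: f' algebra_simps)
qed

lemma cdiff_divide: "cdiff f x ==> cdiff g x ==> g x ~= 0 ==> cdiff (%x. f x / g x) x"
 unfolding divide_inverse by (intro cdiff_mult cdiff_inverse)

lemma cdiff_power: "cdiff f x ==> cdiff (%x. f x ^ k) x" by (induction k) (auto intro: cdiff_const cdiff_mult)

lemma cdiff_sum: "(!!i. i \<in> A ==> cdiff (f i) x) ==> cdiff (%x. \<Sum>i\<in>A. f i x) x"
 by (induction A rule: infinite_finite_induct) (auto intro: cdiff_const cdiff_add)

lemma cdiff_prod: "(!!i. i \<in> A ==> cdiff (f i) x) ==> cdiff (%x. \<Prod>i\<in>A. f i x) x"
 by (induction A rule: infinite_finite_induct) (auto intro: cdiff_const cdiff_mult)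

lemma cdiff_det: "(!!i j. cdiff (%x. M x $ i $ j) x) ==> cdiff (%x. det (M x)) x"
 unfolding det_def by (intro cdiff_sum cdiff_mult cdiff_const cdiff_prod)

lemmas cdiff_intros = cdiff_const cdiff_coord cdiff_add cdiff_mult cdiff_minus cdiff_diff
 cdiff_divide cdiff_power cdiff_sum cdiff_prod

lemma cdiff_continuous: "cdiff f x ==> isCont f x" by (elim cdiffE) (rule has_derivative_continuous)

lemma clin_derivative:
 assumes "(f has_derivative f') (at x)" "!!c v. f' (c *s v) = c *s f' v" shows "clin (f' :: complex^'n => complex^'m)"
 using linear_add[OF has_derivative_linear[OF assms(1)]] assms(2) by (intro clinI) auto

lemma has_derivative_vec_coords:
 fixes g :: "'a::real_normed_vector => complex^'m"
 assumes "!!i. ((%x. g x $ i) has_derivative (%h. g' h $ i)) F" shows "(g has_derivative g') F" proof -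
 have bl: "bounded_linear (%c::complex. c *s (axis i 1 :: complex^'m))" for i by (rule linear_conv_bounded_linear[THEN iffD1], rule linearI)
    (auto simp: vec_eq_iff axis_def scaleR_conv_of_real[where 'a=complex] algebra_simps)
 have "((%x. \<Sum>i\<in>UNIV. g x $ i *s (axis i 1 :: complex^'m)) has_derivative
    (%h. \<Sum>i\<in>UNIV. g' h $ i *s (axis i 1 :: complex^'m))) F"
  by (intro has_derivative_sum bounded_linear.has_derivative[OF bl] assms)
 thus ?thesis by (simp add: basis_expansion)
qed

lemma cdiff_vec:
 fixes g :: "complex^'n => complex^'m"
 assumes "!!i. cdiff (%x. g x $ i) x"
 obtains g' where "(g has_derivative g') (at x)" "!!c v. g' (c *s v) = c *s g' v" proof -
 obtain d where d: "!!i. ((%x. g x $ i) has_derivative d i) (at x)" "!!i c v. d i (c *s v) = c * d i v"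
  using assms unfolding cdiff_def by metis
 show thesis proof (rule that[of "%h. \<chi> i. d i h"])
  show "(g has_derivative (%h. \<chi> i. d i h)) (at x)" by (rule has_derivative_vec_coords) (simp add: d)
 qed (simp add: d vec_eq_iff)
qed

lemma cdiff_coord_of_derivative:
 assumes "(g has_derivative g') (at x)" "!!c v. g' (c *s v) = c *s g' v" shows "cdiff (%x. g x $ i) x" by (rule cdiffI[of _ "%h. g' h $ i"])
   (auto simp: assms intro: bounded_linear.has_derivative[OF bounded_linear_coord])

lemma cdiff_compose:
 fixes g :: "complex^'n => complex^'m"
 assumes "cdiff f (g x)" "!!i. cdiff (%x. g x $ i) x" shows "cdiff (%x. f (g x)) x" proof -
 obtain f' where f': "(f has_derivative f') (at (g x))" "!!c v. f' (c *s v) = c * f' v" using assms by (elim cdiffE) blast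
 obtain g' where g': "(g has_derivative g') (at x)" "!!c v. g' (c *s v) = c *s g' v" using cdiff_vec[OF assms(2)] by blast
 show ?thesis by (rule cdiffI[OF has_derivative_compose[OF g'(1) f'(1)]]) (simp add: f' g')
qed

lemma cdiff_clin: "clin f ==> cdiff (%x. f x $ i) x"
 by (rule cdiff_coord_of_derivative[OF bounded_linear_imp_has_derivative[OF clin_bounded_linear]])
   (auto simp: clin_scale)

text \<open>Cauchy's formula on the complex line through \<open>y\<close> in direction \<open>v\<close>: a directional derivative is
  an average of values of the function.\<close>

lemma Cauchy_directional:
 fixes g :: "complex^'n => complex"
 assumes hol: "!!\<zeta>. cmod \<zeta> <= R ==> (g has_derivative g' (y + \<zeta> *s v)) (at (y + \<zeta> *s v)) &
   (ALL c w. g' (y + \<zeta> *s v) (c *s w) = c * g' (y + \<zeta> *s v) w)" and R: "R > 0"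
 shows "((%t. g (y + circlepath 0 R t *s v) / circlepath 0 R t) has_integral g' y v) {0..1}" proof -
 let ?\<phi> = "%\<zeta>. g (y + \<zeta> *s v)"
 have lin: "((%\<zeta>. y + \<zeta> *s v) has_derivative (%c. c *s v)) (at \<zeta>)" for \<zeta>
  by (rule has_derivative_vec_coords) (auto intro!: derivative_eq_intros)
 have d: "(?\<phi> has_field_derivative g' (y + \<zeta> *s v) v) (at \<zeta>)" if "cmod \<zeta> <= R" for \<zeta>
  using has_derivative_compose[OF lin conjunct1[OF hol[OF that]]] hol[OF that]
  by (simp add: has_field_derivative_def mult.commute[of _ "g' (y + \<zeta> *s v) v"])
 have "((%u. ?\<phi> u / (u - 0) ^ Suc 1) has_contour_integral (2 * pi * \<i>) / fact 1 * (deriv ^^ 1) ?\<phi> 0) (circlepath 0 R)"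
 proof (rule Cauchy_has_contour_integral_higher_derivative_circlepath)
  show "continuous_on (cball 0 R) ?\<phi>" using d by (intro continuous_at_imp_continuous_on ballI DERIV_isCont) auto
  show "?\<phi> holomorphic_on ball 0 R" unfolding holomorphic_on_def field_differentiable_def
   using d by (intro ballI) (metis dist_0_norm has_field_derivative_at_within less_eq_real_def mem_ball)
 qed (use R in auto)
 hence "((%t. ?\<phi> (circlepath 0 R t) / (circlepath 0 R t - 0) ^ Suc 1 * vector_derivative (circlepath 0 R) (at t within {0..1}))
   has_integral (2 * pi * \<i>) / fact 1 * (deriv ^^ 1) ?\<phi> 0) {0..1}" by (simp only: has_contour_integral_def)
 moreover have "vector_derivative (circlepath 0 R) (at t within {0..1}) = 2 * pi * \<i> * circlepath 0 R t" if "t \<in> {0..1}" for t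
  using vector_derivative_circlepath01[of t 0 R] that by (simp add: circlepath)
 hence "?\<phi> (circlepath 0 R t) / (circlepath 0 R t - 0) ^ Suc 1 * vector_derivative (circlepath 0 R) (at t within {0..1})
   = 2 * pi * \<i> * (?\<phi> (circlepath 0 R t) / circlepath 0 R t)" if "t \<in> {0..1}" for t using that R by (simp add: circlepath)
 ultimately have "((%t. 2 * pi * \<i> * (?\<phi> (circlepath 0 R t) / circlepath 0 R t))
   has_integral (2 * pi * \<i>) / fact 1 * (deriv ^^ 1) ?\<phi> 0) {0..1}" by (rule has_integral_eq[rotated])
 from has_integral_mult_right[OF this, of "1 / (2 * pi * \<i>)"] show ?thesis using DERIV_imp_deriv[OF d[of 0]] R by (simp add: field_simps)
qed

text \<open>Directional derivatives of a holomorphic function are holomorphic: differentiate Cauchy's formula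
  under the integral sign.  The continuity of the derivative that this needs follows from Cauchy's
  formula for the difference of two translates of the function.\<close>

lemma cdiff_directional_derivative:
 fixes g :: "complex^'n => complex"
 assumes "open U" and hol: "!!z. z \<in> U ==> (g has_derivative g' z) (at z) & (ALL c v. g' z (c *s v) = c * g' z v)" and x: "x \<in> U"
 shows "cdiff (%z. g' z v) x" proof -
 have norm_scale: "norm (\<zeta> *s w) = cmod \<zeta> * norm w" for \<zeta> and w :: "complex^'n"
  by (simp add: norm_vec_def L2_set_right_distrib norm_mult)
 define G where "G z = Blinfun (g' z)" for z
 have G: "blinfun_apply (G z) h = g' z h" if "z \<in> U" for z h
  unfolding G_def bounded_linear_Blinfun_apply[OF has_derivative_bounded_linear[OF conjunct1[OF hol[OF that]]]] ..
 have contg: "continuous_on U g" using hol by (intro continuous_at_imp_continuous_on) (blast intro: has_derivative_continuous)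
 have contG: "continuous_on U G" unfolding continuous_on_iff proof (intro ballI allI impI)
  fix w and e :: real assume w: "w \<in> U" and e: "e > 0"
  obtain r where r: "r > 0" "cball w (2 * r) \<subseteq> U" using open_contains_cball[THEN iffD1, OF `open U`, rule_format, OF w]
   by (metis field_sum_of_halves half_gt_zero mult_2)
  have "uniformly_continuous_on (cball w (2 * r)) g" using compact_uniformly_continuous[OF continuous_on_subset[OF contg r(2)]] by simp
  then obtain d where d: "d > 0"
   "!!a b. a \<in> cball w (2 * r) ==> b \<in> cball w (2 * r) ==> dist b a < d ==> dist (g b) (g a) < e / 2 * r"
   using uniformly_continuous_onE[of _ g "e / 2 * r"] e r(1) by (metis half_gt_zero mult_pos_pos)
  have "dist (G w') (G w) < e" if w': "dist w' w < min d r" for w' proof -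
   have mem: "w + u \<in> cball w (2 * r)" "w' + u \<in> cball w (2 * r)" if "norm u <= r" for u
    using that w' r(1) norm_triangle_ineq[of "w' - w" u] by (auto simp: dist_norm norm_minus_commute algebra_simps)
   have U: "w + u \<in> U" "w' + u \<in> U" if "norm u <= r" for u using mem[OF that] r(2) by auto
   have "norm (g' (w' + 0) h - g' (w + 0) h) <= e / 2 * norm h" for h proof (cases "h = 0")
    case True
    have "g' z 0 = 0" if "z \<in> U" for z using linear_0[OF has_derivative_linear[OF conjunct1[OF hol[OF that]]]] .
    with True show ?thesis using U[of 0] r(1) by simp
   next
    case False
    define R where "R = r / norm h"
    have R: "R > 0" using False r(1) by (simp add: R_def)
    have small: "norm (0 + \<zeta> *s h) <= r" if "cmod \<zeta> <= R" for \<zeta>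
     using that False by (simp add: norm_scale R_def field_simps)
    have "((%t. (%u. g (w' + u) - g (w + u)) (0 + circlepath 0 R t *s h) / circlepath 0 R t)
     has_integral (%u h. g' (w' + u) h - g' (w + u) h) 0 h) {0..1}" proof (rule Cauchy_directional[OF _ R], intro conjI allI)
     fix \<zeta> :: complex assume "cmod \<zeta> <= R"
     note H = hol[OF U(2)[OF small[OF this]]] hol[OF U(1)[OF small[OF this]]]
     have tr: "((%u. a + u) has_derivative (%h. h)) F" for a :: "complex^'n" and F by (auto intro!: derivative_eq_intros)
     show "((%u. g (w' + u) - g (w + u)) has_derivative
       (%h'. g' (w' + (0 + \<zeta> *s h)) h' - g' (w + (0 + \<zeta> *s h)) h')) (at (0 + \<zeta> *s h))"
      using H by (intro has_derivative_diff has_derivative_compose[OF tr]) auto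
     show "g' (w' + (0 + \<zeta> *s h)) (c *s k) - g' (w + (0 + \<zeta> *s h)) (c *s k)
       = c * (g' (w' + (0 + \<zeta> *s h)) k - g' (w + (0 + \<zeta> *s h)) k)" for c k using H by (simp add: algebra_simps)
    qed
    moreover have "norm ((g (w' + (0 + circlepath 0 R t *s h)) - g (w + (0 + circlepath 0 R t *s h))) / circlepath 0 R t)
      <= e / 2 * r / R" if "t \<in> {0..1}" for t proof -
     have c: "cmod (circlepath 0 R t) = R" using R by (simp add: circlepath norm_mult)
     let ?u = "0 + circlepath 0 R t *s h"
     have "norm ?u <= r" using small c by simp
     from d(2)[OF mem[OF this]] w' show ?thesis unfolding norm_divide c using R by (intro divide_right_mono) (auto simp: dist_norm)
    qed
    ultimately have "norm (g' (w' + 0) h - g' (w + 0) h) <= e / 2 * r / R * measure lborel {0..1::real}"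
     using e r(1) R by (intro has_integral_bound_real) auto
    thus ?thesis using r(1) by (simp add: R_def)
   qed
   hence "norm (G w' - G w) <= e / 2" using U[of 0] e r(1) by (intro norm_blinfun_bound) (auto simp: G blinfun.diff_left)
   thus ?thesis using e by (simp add: dist_norm)
  qed
  thus "EX d>0. \<forall>w'\<in>U. dist w' w < d --> dist (G w') (G w) < e" using d(1) r(1) by (intro exI[of _ "min d r"]) auto
 qed
 obtain \<rho> where \<rho>: "\<rho> > 0" "cball x (2 * \<rho>) \<subseteq> U"
  using open_contains_cball[THEN iffD1, OF `open U`, rule_format, OF x] by (metis field_sum_of_halves half_gt_zero mult_2)
 define R where "R = \<rho> / (norm v + 1)"
 have R: "R > 0" using \<rho> by (simp add: R_def add_nonneg_pos)
 have U: "z + \<zeta> *s v \<in> U" if "z \<in> ball x \<rho>" "cmod \<zeta> <= R" for z \<zeta> proof -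
  have "cmod \<zeta> * norm v <= R * (norm v + 1)" using that R by (intro mult_mono) auto
  also have "... = \<rho>" by (simp add: R_def add_nonneg_eq_0_iff)
  finally have "dist x (z + \<zeta> *s v) <= 2 * \<rho>"
   using that(1) norm_triangle_ineq4[of "x - z" "\<zeta> *s v"] by (simp add: dist_norm norm_scale diff_diff_eq)
  thus ?thesis using \<rho>(2) by auto
 qed
 have cR: "cmod (circlepath 0 R t) = R" for t using R by (simp add: circlepath norm_mult)
 note Uc = U[OF _ eq_refl[OF cR]]
 let ?c = "circlepath 0 R"
 let ?f = "%z t. g (z + ?c t *s v) / ?c t" and ?F = "%z t. blinfun_mult_right (1 / ?c t) o\<^sub>L G (z + ?c t *s v)"
 have int: "((%t. ?f z t) has_integral g' z v) (cbox 0 1)" if "z \<in> ball x \<rho>" for z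
  unfolding cbox_interval using hol U[OF that] by (intro Cauchy_directional R) blast
 have contc: "continuous_on S ?c" for S unfolding circlepath by (intro continuous_intros)
 have c0: "?c t ~= 0" for t using cR[of t] R by auto
 have contv: "continuous_on (ball x \<rho> \<times> cbox 0 1) (%p. fst p + ?c (snd p) *s v)"
  unfolding vector_scalar_mult_def by (intro continuous_intros continuous_on_compose2[OF contc[of UNIV]]) auto
 have contF: "continuous_on (ball x \<rho> \<times> cbox 0 1) (%(z, t). ?F z t)" unfolding case_prod_beta
  by (intro bounded_bilinear.continuous_on[OF bounded_bilinear_blinfun_compose]
    bounded_linear.continuous_on[OF bounded_linear_blinfun_mult_right] continuous_intros
    continuous_on_compose2[OF contc[of UNIV]] continuous_on_compose2[OF contG contv])
   (use c0 Uc in auto)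
 have "((%z. integral (cbox 0 1) (?f z)) has_derivative integral (cbox 0 1) (?F x)) (at x within ball x \<rho>)"
 proof (rule leibniz_rule[OF _ _ contF])
  fix z t assume z: "z \<in> ball x \<rho>"
  have tr: "((%u. u + a) has_derivative (%h. h)) F" for a :: "complex^'n" and F by (auto intro!: derivative_eq_intros)
  have "((%z. ?f z t) has_derivative (%h. 1 / ?c t * g' (z + ?c t *s v) h)) (at z within ball x \<rho>)"
   using has_derivative_mult_right[OF has_derivative_compose[OF tr conjunct1[OF hol[OF Uc[OF z]]]], of "1 / ?c t"] by simp
  thus "((%z. ?f z t) has_derivative blinfun_apply (?F z t)) (at z within ball x \<rho>)"
   using G[OF Uc[OF z]] by (simp add: blinfun_compose.rep_eq comp_def)
 qed (use int \<rho> in "auto intro: has_integral_integrable")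
 hence "((%z. integral (cbox 0 1) (?f z)) has_derivative integral (cbox 0 1) (?F x)) (at x)"
  using \<rho>(1) by (simp add: at_within_open[of x "ball x \<rho>"])
 hence der: "((%z. g' z v) has_derivative integral (cbox 0 1) (?F x)) (at x)"
  by (rule has_derivative_transform_within_open[OF _ open_ball[of x \<rho>]]) (use \<rho>(1) int in "auto intro: integral_unique")
 have Fint: "?F x integrable_on cbox 0 1" using continuous_on_compose2[OF contF, of "cbox 0 1" "%t. (x, t)"] \<rho>(1)
  by (intro integrable_continuous) (auto simp: image_subset_iff continuous_on_Pair[OF continuous_on_const continuous_on_id])
 have xU: "x + ?c t *s v \<in> U" for t by (rule Uc) (simp add: \<rho>(1))
 have ap: "integral (cbox 0 1) (?F x) h = integral (cbox 0 1) (%t. g' (x + ?c t *s v) h / ?c t)" for h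
  unfolding blinfun_apply_integral[OF Fint] by (simp add: G[OF xU])
 have "g' (x + ?c t *s v) (c *s h) / ?c t = c * (g' (x + ?c t *s v) h / ?c t)" for c h t using hol[OF xU] by simp
 hence "integral (cbox 0 1) (?F x) (c *s h) = c * integral (cbox 0 1) (?F x) h" for c h unfolding ap by (simp only: integral_mult_right)
 with der show ?thesis by (rule cdiffI)
qed

section \<open>Polynomial functions\<close>

inductive polyfun :: "(complex^'n => complex) => bool" where
 polyfun_const: "polyfun (%x. c)"
| polyfun_coord: "polyfun (%x. x $ i)"
| polyfun_add: "polyfun f ==> polyfun g ==> polyfun (%x. f x + g x)"
| polyfun_mult: "polyfun f ==> polyfun g ==> polyfun (%x. f x * g x)"

lemma polyfun_sum: "(!!i. i \<in> A ==> polyfun (f i)) ==> polyfun (%x. \<Sum>i\<in>A. f i x)"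
 by (induction A rule: infinite_finite_induct) (auto intro: polyfun_const polyfun_add)

lemma polyfun_prod: "(!!i. i \<in> A ==> polyfun (f i)) ==> polyfun (%x. \<Prod>i\<in>A. f i x)"
 by (induction A rule: infinite_finite_induct) (auto intro: polyfun_const polyfun_mult)

lemma polyfun_minus: "polyfun f ==> polyfun (%x. - f x)" using polyfun_mult[OF polyfun_const[of "-1"], of f] by simp
lemma polyfun_diff: "polyfun f ==> polyfun g ==> polyfun (%x. f x - g x)" using polyfun_add[OF _ polyfun_minus[of g], of f] by simp
lemma polyfun_power: "polyfun f ==> polyfun (%x. f x ^ k)" by (induction k) (auto intro: polyfun_const polyfun_mult)

lemma polyfun_det: "(!!i j. polyfun (%x. M x $ i $ j)) ==> polyfun (%x. det (M x))"
 unfolding det_def by (intro polyfun_sum polyfun_mult polyfun_const polyfun_prod)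

lemma polyfun_compose:
 assumes "polyfun f" "!!i. polyfun (%x. g x $ i)" shows "polyfun (%x. f (g x))" using assms(1)
 by (induction) (auto intro: polyfun_const polyfun_add polyfun_mult assms(2))

lemma polyfun_clin: "clin f ==> polyfun (%x. f x $ i)" proof -
 assume f: "clin f"
 have "(%x. f x $ i) = (%x. \<Sum>j\<in>UNIV. x $ j * f (axis j 1) $ i)" by (rule ext) (rule linear_componentwise[OF f])
 moreover have "polyfun ..." by (intro polyfun_sum polyfun_mult polyfun_coord polyfun_const)
 ultimately show ?thesis by simp
qed

lemmas polyfun_intros = polyfun_const polyfun_coord polyfun_add polyfun_mult polyfun_sum polyfun_prod
 polyfun_minus polyfun_diff polyfun_power

lemma polyfun_cdiff: "polyfun f ==> cdiff f x" by (induction rule: polyfun.induct) (auto intro: cdiff_intros)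
lemma polyfun_continuous: "polyfun f ==> continuous_on S f" by (intro continuous_at_imp_continuous_on ballI cdiff_continuous polyfun_cdiff)

definition polycurve :: "(complex => complex) => bool" where
 "polycurve f \<longleftrightarrow> (EX p. f = poly p)"

lemma polycurve_const: "polycurve (%t. c)" and polycurve_id: "polycurve (%t. t)"
 and polycurve_add: "polycurve f ==> polycurve g ==> polycurve (%t. f t + g t)"
 and polycurve_mult: "polycurve f ==> polycurve g ==> polycurve (%t. f t * g t)" proof -
 show "polycurve (%t. c)" unfolding polycurve_def by (rule exI[of _ "[:c:]"]) auto
 show "polycurve (%t. t)" unfolding polycurve_def by (rule exI[of _ "[:0,1:]"]) auto
 assume "polycurve f" "polycurve g"
 then obtain p q where pq: "f = poly p" "g = poly q" by (auto simp: polycurve_def)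
 show "polycurve (%t. f t + g t)" unfolding polycurve_def pq by (rule exI[of _ "p + q"]) auto
 show "polycurve (%t. f t * g t)" unfolding polycurve_def pq by (rule exI[of _ "p * q"]) auto
qed

lemma polycurve_sum: "(!!i. i \<in> A ==> polycurve (f i)) ==> polycurve (%x. \<Sum>i\<in>A. f i x)"
 by (induction A rule: infinite_finite_induct) (auto intro: polycurve_const polycurve_add)

lemma polycurve_prod: "(!!i. i \<in> A ==> polycurve (f i)) ==> polycurve (%x. \<Prod>i\<in>A. f i x)"
 by (induction A rule: infinite_finite_induct) (auto intro: polycurve_const polycurve_mult)

lemma polycurve_det: "(!!i j. polycurve (%x. M x $ i $ j)) ==> polycurve (%x. det (M x))"
 unfolding det_def by (intro polycurve_sum polycurve_mult polycurve_const polycurve_prod)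

lemma polycurve_polyfun:
 assumes "polyfun f" "!!i. polycurve (%t. g t $ i)" shows "polycurve (%t. f (g t))" using assms(1)
 by induction (auto intro: polycurve_const polycurve_add polycurve_mult assms(2))

lemma polycurve_zeros_finite:
 assumes "polycurve f" "f t0 ~= 0" shows "finite {t. f t = 0}" proof -
 obtain p where p: "f = poly p" using assms by (auto simp: polycurve_def)
 hence "p ~= 0" using assms(2) by auto
 thus ?thesis using poly_roots_finite p by blast
qed

lemma polycurve_continuous: "polycurve f ==> continuous_on S f" unfolding polycurve_def by (auto intro!: continuous_intros)

lemma line_polycurve: "polycurve (%t. ((x::complex^'n) + t *s y) $ i)"
 by (auto intro!: polycurve_add polycurve_mult polycurve_const polycurve_id)

text \<open>A polynomial in one variable with infinitely many zeros is zero.\<close>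

lemma polyfun_zero_complexify:
 assumes f: "polyfun f" and z: "!!s::real. f (x + of_real s *s y) = 0" shows "f (x + t *s y) = 0" proof -
 have p: "polycurve (%t. f (x + t *s y))" by (rule polycurve_polyfun[OF f line_polycurve])
 have "infinite {t. f (x + t *s y) = 0}" proof
  assume "finite {t. f (x + t *s y) = 0}"
  hence "finite (range complex_of_real)" by (rule finite_subset[rotated]) (use z in auto)
  hence "finite (UNIV :: real set)" by (rule finite_imageD) (auto simp: inj_on_def)
  thus False using infinite_UNIV_char_0 by blast
 qed
 thus ?thesis using polycurve_zeros_finite[OF p, of t] by blast
qed

text \<open>The complement of a finite set of complex parameters is connected, so a continuous
  function with finitely many values is constant there.\<close>

lemma cofinite_constant:
 fixes f :: "complex => complex"
 assumes "finite F" "continuous_on (- F) f" "finite V" "!!t. t \<notin> F ==> f t \<in> V" "s \<notin> F" "t \<notin> F" shows "f s = f t"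
proof -
 have "connected (- F)" using path_connected_complement_countable[of F] assms(1)
  by (simp add: countable_finite path_connected_imp_connected)
 hence "f constant_on (- F)" using assms by (intro continuous_finite_range_constant) (auto intro: finite_subset[OF _ assms(3)])
 thus ?thesis using assms(5,6) unfolding constant_on_def by auto
qed

section \<open>Jordan triple identities and Peirce decompositions\<close>

locale jordan_triple =
 fixes T :: "('n::finite) triple"
 assumes hermitian: "hermitian_jordan_triple T"
begin

lemma T_clin1: "clin (%u. T u v w)" using hermitian by (simp add: hermitian_jordan_triple_def)
lemma T_commute: "T u v w = T w v u" using hermitian by (simp add: hermitian_jordan_triple_def)
lemma T_clin3: "clin (T u v)" proof -
 have "(%w. T w v u) = T u v" by (rule ext) (rule T_commute)
 thus ?thesis using T_clin1[of v u] by simp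
qed

lemma T_add: "T (u + u') v w = T u v w + T u' v w" "T u (v + v') w = T u v w + T u v' w"
 "T u v (w + w') = T u v w + T u v w'"
 using clin_add[OF T_clin1] clin_add[OF T_clin3] hermitian by (simp_all add: hermitian_jordan_triple_def)

lemma T_scale: "T (c *s u) v w = c *s T u v w" "T u (c *s v) w = cnj c *s T u v w"
 "T u v (c *s w) = c *s T u v w"
 using clin_scale[OF T_clin1] clin_scale[OF T_clin3] hermitian by (simp_all add: hermitian_jordan_triple_def)

lemma T_zero [simp]: "T 0 v w = 0" "T u 0 w = 0" "T u v 0 = 0"
 using T_scale(1)[of 0 0] T_scale(2)[of u 0 0] T_scale(3)[of _ _ 0 0] by simp_all

lemma T_minus: "T (- u) v w = - T u v w" "T u (- v) w = - T u v w" "T u v (- w) = - T u v w"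
 using T_scale(1)[of "-1"] T_scale(2)[of _ "-1"] T_scale(3)[of _ _ "-1"] by (simp_all add: vector_sneg_minus1[symmetric])

lemma T_diff: "T (u - u') v w = T u v w - T u' v w" "T u (v - v') w = T u v w - T u v' w"
 "T u v (w - w') = T u v w - T u v w'" using T_add T_minus by (simp_all only: diff_conv_add_uminus)

lemma T_sum: "T (\<Sum>i\<in>A. f i) v w = (\<Sum>i\<in>A. T (f i) v w)" "T u (\<Sum>i\<in>A. f i) w = (\<Sum>i\<in>A. T u (f i) w)"
 "T u v (\<Sum>i\<in>A. f i) = (\<Sum>i\<in>A. T u v (f i))" by (induction A rule: infinite_finite_induct) (auto simp: T_add)

lemmas T_simps = T_add T_scale T_minus T_diff

text \<open>The main identity says that \<open>D(x,y)\<close> is a derivation of the triple product up to a sign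
  and an interchange of its arguments in the middle slot.\<close>

lemma jordan_identity: "T x y (T u v w) = T u v (T x y w) + T (T x y u) v w - T u (T v x y) w" proof -
 have "T x y (T u v w) - T u v (T x y w) = T (T x y u) v w - T u (T v x y) w" using hermitian unfolding hermitian_jordan_triple_def by blast
 thus ?thesis by (simp add: algebra_simps)
qed

definition ip :: "complex^'n => complex^'n => complex" where
 "ip u v = trace (matrix (T u v))"

lemma ip_cnj: "ip v u = cnj (ip u v)" using hermitian unfolding hermitian_jordan_triple_def ip_def by blast
lemma ip_pos: "u ~= 0 ==> Re (ip u u) > 0" using hermitian unfolding hermitian_jordan_triple_def ip_def by blast

lemma ip_add: "ip (u + u') v = ip u v + ip u' v" "ip u (v + v') = ip u v + ip u v'" proof -
 have "T (u + u') v = (%w. T u v w + T u' v w)" "T u (v + v') = (%w. T u v w + T u v' w)" by (auto simp: T_add)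
 thus "ip (u + u') v = ip u v + ip u' v" "ip u (v + v') = ip u v + ip u v'" by (simp_all add: ip_def matrix_add_fun trace_add)
qed

lemma ip_scale: "ip (c *s u) v = c * ip u v" "ip u (c *s v) = cnj c * ip u v" proof -
 have "T (c *s u) v = (%w. c *s T u v w)" "T u (c *s v) = (%w. cnj c *s T u v w)" by (auto simp: T_scale)
 thus "ip (c *s u) v = c * ip u v" "ip u (c *s v) = cnj c * ip u v" by (simp_all add: ip_def trace_scale_fun)
qed

lemma ip_zero [simp]: "ip 0 v = 0" "ip u 0 = 0" using ip_scale(1)[of 0 0] ip_scale(2)[of u 0 0] by simp_all

lemma ip_minus: "ip (- u) v = - ip u v" "ip u (- v) = - ip u v"
 using ip_scale(1)[of "-1"] ip_scale(2)[of _ "-1"] by (simp_all add: vector_sneg_minus1[symmetric])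

lemma ip_diff: "ip (u - u') v = ip u v - ip u' v" "ip u (v - v') = ip u v - ip u v'"
 using ip_add ip_minus by (simp_all only: diff_conv_add_uminus)

lemma ip_sum: "ip (\<Sum>i\<in>A. f i) v = (\<Sum>i\<in>A. ip (f i) v)" "ip v (\<Sum>i\<in>A. f i) = (\<Sum>i\<in>A. ip v (f i))"
 by (induction A rule: infinite_finite_induct) (auto simp: ip_add)

lemmas ip_simps = ip_add ip_scale ip_minus ip_diff

lemma ip_self_real: "ip u u = of_real (Re (ip u u))" using ip_cnj[of u u] by (simp add: complex_eq_iff)
lemma ip_self_zero: "ip u u = 0 \<longleftrightarrow> u = 0" using ip_pos[of u] by (cases "u = 0") (auto simp: complex_eq_iff)
lemma ip_ext: "(!!v. ip u v = 0) ==> u = 0" using ip_self_zero by blast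

lemma trace_commutator: "clin f ==> clin g ==> trace (matrix (%x. f (g x) - g (f x))) = 0" for f g :: "complex^'n => complex^'n"
 using trace_comp_commute[of f g] by (simp add: matrix_diff_fun trace_sub)

text \<open>The trace of the main identity vanishes; hence \<open>D(y,x)\<close> is the adjoint of \<open>D(x,y)\<close>.\<close>

lemma ip_adjoint: "ip (T x y u) v = ip u (T y x v)" proof -
 have "(%w. T (T x y u) v w - T u (T v x y) w) = (%w. T x y (T u v w) - T u v (T x y w))"
  by (rule ext) (simp add: jordan_identity[of x y u v])
 hence "ip (T x y u) v - ip u (T v x y) = 0" unfolding ip_def using trace_commutator[OF T_clin3 T_clin3, of x y u v]
  by (metis (no_types) matrix_diff_fun trace_sub)
 thus ?thesis by (simp add: T_commute[of v x y])
qed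

lemma T_zero_adjoint: "(!!w. T x y w = 0) ==> T y x w = 0" using ip_adjoint[of y x w] by (intro ip_ext) simp

lemma T_basis: "T u v w = (\<Sum>i\<in>UNIV. u $ i *s T (axis i 1) v w)" "T u v w = (\<Sum>k\<in>UNIV. w $ k *s T u v (axis k 1))"
 using T_sum(1)[of "%i. u $ i *s axis i 1" UNIV v w] T_sum(3)[of u v "%i. w $ i *s axis i 1" UNIV]
 by (simp_all add: basis_expansion T_scale)

lemma T_expand:
 "T u v w = (\<Sum>i\<in>UNIV. \<Sum>j\<in>UNIV. \<Sum>k\<in>UNIV. (u $ i * cnj (v $ j) * w $ k) *s T (axis i 1) (axis j 1) (axis k 1))"
proof -
 have 2: "T u v w = (\<Sum>j\<in>UNIV. cnj (v $ j) *s T u (axis j 1) w)" for u v w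
  using T_sum(2)[of u "%i. v $ i *s axis i 1" UNIV w] by (simp add: basis_expansion T_scale)
 have "T u v w = (\<Sum>i\<in>UNIV. u $ i *s (\<Sum>j\<in>UNIV. cnj (v $ j) *s (\<Sum>k\<in>UNIV. w $ k *s T (axis i 1) (axis j 1) (axis k 1))))"
  by (subst T_basis(1), subst 2, subst T_basis(2)) (rule refl)
 thus ?thesis by (simp add: vec.scale_sum_right vec.scale_scale mult.assoc)
qed

lemma T_continuous [continuous_intros]:
 fixes f g h :: "'a::topological_space => complex^'n"
 assumes "continuous_on S f" "continuous_on S g" "continuous_on S h" shows "continuous_on S (%x. T (f x) (g x) (h x))" proof -
 have bl: "continuous_on X (%c. c *s (v :: complex^'n))" for X v unfolding vector_scalar_mult_def by (intro continuous_intros)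
 have "continuous_on S (%x. \<Sum>i\<in>UNIV. \<Sum>j\<in>UNIV. \<Sum>k\<in>UNIV.
    (f x $ i * cnj (g x $ j) * h x $ k) *s T (axis i 1) (axis j 1) (axis k 1))"
  by (intro continuous_on_sum continuous_on_compose2[OF bl[of UNIV]] continuous_intros assms subset_UNIV)
 thus ?thesis by (simp only: T_expand[symmetric])
qed

lemma ip_expand: "ip u v = (\<Sum>i\<in>UNIV. T u v (axis i 1) $ i)" by (simp add: ip_def trace_def matrix_def)

lemma ip_continuous [continuous_intros]:
 "continuous_on S f ==> continuous_on S g ==> continuous_on S (%x. ip (f x) (g x))" unfolding ip_expand by (intro continuous_intros)

text \<open>For \<open>{zzz} = \<mu>z\<close> with real \<open>\<mu>\<close> all operators built from \<open>z\<close> alone satisfy the relations that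
  are familiar for tripotents (\<open>\<mu> = 2\<close>).\<close>

lemma
 assumes z: "T z z z = of_real \<mu> *s z" shows cube_LQ: "T z z (T z v z) = of_real \<mu> *s T z v z"
  and cube_QQ: "T z (T z w z) z = 2 *s T z z (T z z w) - of_real \<mu> *s T z z w" and cube_L3: "(2::complex) *s T z z (T z z (T z z w)) =
   (3 * of_real \<mu>) *s T z z (T z z w) - (of_real \<mu>)\<^sup>2 *s T z z w" proof -
 have LQ: "T z z (T z v z) = of_real \<mu> *s T z v z" and QL: "T z (T z z v) z = of_real \<mu> *s T z v z" for v proof -
  have 1: "T z z (T z v z) = 2 *s (of_real \<mu> *s T z v z) - T z (T v z z) z"
   using jordan_identity[of z z z v z] by (simp add: z T_scale vec_eq_iff)
  have 2: "T z v (T z z z) = T z z (T z v z) + T (T z v z) z z - T z (T z z v) z" by (rule jordan_identity)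
  have c: "T v z z = T z z v" "T (T z v z) z z = T z z (T z v z)" by (rule T_commute)+
  have eqs: "T z z (T z v z) $ i = 2 * (of_real \<mu> * T z v z $ i) - T z (T z z v) z $ i"
   "of_real \<mu> * T z v z $ i = 2 * T z z (T z v z) $ i - T z (T z z v) z $ i" for i using 1 2 by (simp_all add: c z T_scale vec_eq_iff)
  have "3 * T z z (T z v z) $ i = 3 * (of_real \<mu> * T z v z $ i)" for i using eqs[of i] by algebra
  thus LQ: "T z z (T z v z) = of_real \<mu> *s T z v z" by (simp add: vec_eq_iff)
  show "T z (T z z v) z = of_real \<mu> *s T z v z" using 1 by (simp add: c LQ vec_eq_iff)
 qed
 show "T z z (T z v z) = of_real \<mu> *s T z v z" by (rule LQ)
 have QQ: "T z (T z w z) z = 2 *s T z z (T z z w) - of_real \<mu> *s T z z w" for w using jordan_identity[of w z z z z]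
  by (simp add: T_commute[of w z z] T_commute[of "T z z w" z z] z T_scale vec_eq_iff algebra_simps)
 thus "T z (T z w z) z = 2 *s T z z (T z z w) - of_real \<mu> *s T z z w" .
 have "of_real \<mu> *s T z (T z w z) z =
   2 *s T z z (T z z (T z z w)) - of_real \<mu> *s T z z (T z z w)" using QQ[of "T z z w"] by (simp add: QL T_scale)
 thus "(2::complex) *s T z z (T z z (T z z w)) =
   (3 * of_real \<mu>) *s T z z (T z z w) - (of_real \<mu>)\<^sup>2 *s T z z w" by (simp add: QQ vec_eq_iff algebra_simps power2_eq_square)
qed

lemma tripotent_iff: "tripotent T c \<longleftrightarrow> T c c c = 2 *s c"
 unfolding tripotent_def quad_op_def by (auto simp: vec_eq_iff field_simps)

lemma
 assumes "tripotent T c" shows tripotent_LQ: "T c c (T c v c) = 2 *s T c v c"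
  and tripotent_QQ: "T c (T c w c) c = 2 *s T c c (T c c w) - 2 *s T c c w"
  and tripotent_L3: "T c c (T c c (T c c w)) = 3 *s T c c (T c c w) - 2 *s T c c w" proof -
 have z: "T c c c = of_real 2 *s c" using assms by (simp add: tripotent_iff)
 show "T c c (T c v c) = 2 *s T c v c" using cube_LQ[OF z] by simp
 show "T c (T c w c) c = 2 *s T c c (T c c w) - 2 *s T c c w" using cube_QQ[OF z] by simp
 show "T c c (T c c (T c c w)) = 3 *s T c c (T c c w) - 2 *s T c c w" proof (subst vec_eq_iff, rule allI)
  fix i
  have "2 * T c c (T c c (T c c w)) $ i = 6 * T c c (T c c w) $ i - 4 * T c c w $ i" using cube_L3[OF z, of w] by (simp add: vec_eq_iff)
  hence "2 * T c c (T c c (T c c w)) $ i = 2 * (3 * T c c (T c c w) $ i - 2 * T c c w $ i)" by algebra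
  thus "T c c (T c c (T c c w)) $ i = (3 *s T c c (T c c w) - 2 *s T c c w) $ i" by (simp only: mult_cancel_left) simp
 qed
qed

definition pspace :: "complex^'n => nat => (complex^'n) set" where
 "pspace c k = {z. T c c z = of_nat k *s z}"

text \<open>Lagrange interpolation at the possible eigenvalues \<open>0, 1, 2\<close> of \<open>D(c,c)\<close>.\<close>

definition pproj :: "complex^'n => nat => complex^'n => complex^'n" where
 "pproj c k z =
   (if k = 2 then (1/2) *s (T c c (T c c z) - T c c z)
   else if k = 1 then 2 *s T c c z - T c c (T c c z)
   else z - (3/2) *s T c c z + (1/2) *s T c c (T c c z))"

lemma pspaceD: "z \<in> pspace c k ==> T c c z = of_nat k *s z" by (simp add: pspace_def)
lemma pproj_clin: "clin (pproj c k)" unfolding pproj_def by (rule clinI) (simp_all add: T_simps vec_eq_iff algebra_simps)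

lemma pproj_pspace: "z \<in> pspace c m ==> k <= 2 ==> m <= 2 ==> pproj c k z = (if k = m then z else 0)" proof -
 assume z: "z \<in> pspace c m" and km: "k <= 2" "m <= 2"
 have 1: "T c c z = of_nat m *s z" by (rule pspaceD[OF z])
 hence 2: "T c c (T c c z) = (of_nat m * of_nat m) *s z" by (simp add: T_scale)
 show ?thesis using km unfolding pproj_def 2 unfolding 1 by (auto simp: vec_eq_iff le_Suc_eq numeral_2_eq_2)
qed

lemma pproj_mem: "tripotent T c ==> k <= 2 ==> pproj c k z \<in> pspace c k"
 by (auto simp: pproj_def pspace_def T_simps tripotent_L3 vec_eq_iff le_Suc_eq numeral_2_eq_2 field_simps)

lemma pproj_sum: "pproj c 0 z + pproj c 1 z + pproj c 2 z = z" by (simp add: pproj_def vec_eq_iff algebra_simps)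

lemma peirce_cases:
 assumes "tripotent T c" "!!x y. P x ==> P y ==> P (x + y)" "!!k z. k <= 2 ==> z \<in> pspace c k ==> P z" shows "P z" proof -
 have "P (pproj c 0 z + pproj c 1 z + pproj c 2 z)" by (intro assms(2)) (rule assms(3)[OF _ pproj_mem[OF assms(1)]]; simp)+
 thus ?thesis by (simp only: pproj_sum)
qed

lemma pspace_subspace: "vec.subspace (pspace c k)" by (auto simp: vec.subspace_def pspace_def T_simps vec_eq_iff algebra_simps)

lemmas pspace_scale = vec.subspace_scale[OF pspace_subspace]

lemma pspace_eq_range: "tripotent T c ==> k <= 2 ==> pspace c k = range (pproj c k)"
 using pproj_mem pproj_pspace[of _ c k k] by (auto simp: image_iff) metis

lemma tripotent_pspace: "tripotent T c ==> c \<in> pspace c 2" by (simp add: tripotent_iff pspace_def)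

text \<open>\<open>D(c,c)\<close> acts on triple products as a derivation, so its eigenvalues add up like weights; since only
  \<open>0, 1, 2\<close> occur, this gives all the Peirce rules that follow.\<close>

lemma T_weight:
 assumes "T c c x = \<alpha> *s x" "T c c y = \<beta> *s y" "T c c w = \<gamma> *s w"
 shows "T c c (T x y w) = (\<alpha> - cnj \<beta> + \<gamma>) *s T x y w" using jordan_identity[of c c x y w]
 by (simp add: assms T_commute[of y c c] T_simps vec_eq_iff algebra_simps)

lemma tripotent_eigenvalue:
 assumes "tripotent T c" "T c c v = \<mu> *s v" "\<mu> \<notin> {0, 1, 2}" shows "v = 0" proof -
 have "(\<mu> * (\<mu> - 1) * (\<mu> - 2)) *s v = 0"
  using tripotent_L3[OF assms(1), of v] by (simp add: assms(2) T_simps vec_eq_iff algebra_simps)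
 thus ?thesis using assms(3) by auto
qed

lemma T_pspace_zero:
 assumes "tripotent T c" "x \<in> pspace c i" "y \<in> pspace c j" "w \<in> pspace c k"
  "int i - int j + int k \<notin> {0, 1, 2}" shows "T x y w = 0" proof (rule tripotent_eigenvalue[OF assms(1)])
 show "T c c (T x y w) = complex_of_int (int i - int j + int k) *s T x y w"
  using T_weight[OF pspaceD[OF assms(2)] pspaceD[OF assms(3)] pspaceD[OF assms(4)]] by simp
 have "complex_of_int (int i - int j + int k) ~= complex_of_int m" if "m \<in> {0,1,2}" for m
  using assms(5) that unfolding of_int_eq_iff by metis
 from this[of 0] this[of 1] this[of 2] show "complex_of_int (int i - int j + int k) \<notin> {0, 1, 2}" by simp
qed

lemma T_pspace:
 assumes "x \<in> pspace c i" "y \<in> pspace c j" "w \<in> pspace c k" "int i - int j + int k = int m" shows "T x y w \<in> pspace c m"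
proof -
 have "T c c (T x y w) = complex_of_int (int i - int j + int k) *s T x y w"
  using T_weight[OF pspaceD[OF assms(1)] pspaceD[OF assms(2)] pspaceD[OF assms(3)]] by simp
 thus ?thesis by (simp only: assms(4)) (simp add: pspace_def)
qed

lemma Q_pspace2: "tripotent T c ==> T c v c \<in> pspace c 2" using tripotent_LQ[of c v] by (simp add: pspace_def)

lemma Q_involution: assumes "tripotent T c" "v \<in> pspace c 2" shows "T c (T c v c) c = 4 *s v"
 using tripotent_QQ[OF assms(1), of v] pspaceD[OF assms(2)] by (simp add: T_simps vec_eq_iff)

text \<open>For \<open>u \<in> Z\<^sub>2(c)\<close> the operator \<open>D(u,c)\<close> preserves weights and so commutes with \<open>D(c,c)\<close>; then the
  main identity for \<open>D(u,c)\<close> and \<open>D(c,c)\<close> moves \<open>u\<close> to the second argument.\<close>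

lemma T_c_right:
 assumes c: "tripotent T c" and u: "u \<in> pspace c 2" shows "T u c v = T c ((1/2) *s T c u c) v" proof -
 have "T u c (T c c v) = T c c (T u c v)" proof (rule peirce_cases[OF c, where P = "%v. T u c (T c c v) = T c c (T u c v)"])
  fix v k assume v: "v \<in> pspace c k"
  have "T c c (T u c v) = of_nat k *s T u c v" using T_weight[OF pspaceD[OF u] pspaceD[OF tripotent_pspace[OF c]] pspaceD[OF v]] by simp
  thus "T u c (T c c v) = T c c (T u c v)" using pspaceD[OF v] by (simp add: T_scale)
 qed (simp add: T_add)
 hence "T (T u c c) c v = T c (T c u c) v" using jordan_identity[of u c c c v] by simp
 thus ?thesis using pspaceD[OF u] by (simp add: T_commute[of u c c] T_scale vec_eq_iff field_simps)
qed

text \<open>The Peirce spaces \<open>Z\<^sub>2(c)\<close> and \<open>Z\<^sub>0(c)\<close> are strongly orthogonal.\<close>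

lemma
 assumes c: "tripotent T c" and x: "x \<in> pspace c 2" and y: "y \<in> pspace c 0"
 shows T_pspace_02: "T y x w = 0" and T_pspace_20: "T x y w = 0" proof -
 have wt: "T y x w = 0" if "w \<in> pspace c k" "k <= 1" "x \<in> pspace c 2" for x w k
  using T_pspace_zero[OF c y that(3,1)] that(2) by auto
 have wt': "T x y w = 0" if "w \<in> pspace c k" "k = 1 \<or> k = 2" "x \<in> pspace c 2" for x w k
  using T_pspace_zero[OF c that(3) y that(1)] that(2) by auto
 have c2: "c \<in> pspace c 2" by (rule tripotent_pspace[OF c])
 \<comment> \<open>every element of \<open>Z\<^sub>2(c)\<close> is of the form \<open>{c v c}\<close>\<close>
 have rep: "\<exists>v'\<in>pspace c 2. v = T c v' c" if "v \<in> pspace c 2" for v proof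
  show "v = T c ((1/4) *s T c v c) c" using Q_involution[OF c that] by (simp add: T_scale vec_eq_iff)
  show "(1/4) *s T c v c \<in> pspace c 2" using Q_pspace2[OF c] by (rule pspace_scale)
 qed
 have expand: "T y x (T c v c) = 2 *s T (T y x c) v c" if "x \<in> pspace c 2" "v \<in> pspace c 2" for x v proof -
  have "T v y x = 0" using wt'[OF that(1) _ that(2)] by simp
  thus ?thesis using jordan_identity[of y x c v c] by (simp add: T_commute[of c v "T y x c"]) (simp add: vec_eq_iff)
 qed
 have yc: "T y c c = 0" using y by (simp add: T_commute[of y] pspace_def)
 have a: "T y c v = 0" for v proof -
  have "T y c v = 0" if "v \<in> pspace c 2" for v using rep[OF that] expand[OF c2] yc by (metis T_zero(1) vec.scale_zero_right)
  hence h: "T y c v = 0" if "k <= 2" "v \<in> pspace c k" for k v using that wt[of v k c] c2 by (cases "k = 2") auto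
  show ?thesis by (rule peirce_cases[where P = "%w. T y c w = 0", OF c _ h]) (simp_all add: T_add)
 qed
 have cc: "T y x c = 0" if "x \<in> pspace c 2" for x proof -
  have "T y x c = T c x y" by (rule T_commute)
  also obtain x' where x': "x' \<in> pspace c 2" "x = T c x' c" using rep[OF `x \<in> pspace c 2`] by blast
  have "T c x y = 2 *s T x' c y" using T_c_right[OF c x'(1), of y] by (simp add: x'(2) T_scale)
  also have "... = 0" using a[of x'] T_commute[of x' c y] by simp
  finally show ?thesis .
 qed
 have d: "T y x w = 0" for w proof -
  have "T y x v = 0" if "v \<in> pspace c 2" for v using rep[OF that] expand[OF x] cc[OF x] by (metis T_zero(1) vec.scale_zero_right)
  hence h: "T y x v = 0" if "k <= 2" "v \<in> pspace c k" for k v using that wt[of v k x] x by (cases "k = 2") auto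
  show ?thesis by (rule peirce_cases[where P = "%w. T y x w = 0", OF c _ h]) (simp_all add: T_add)
 qed
 thus "T y x w = 0" .
 show "T x y w = 0" by (rule T_zero_adjoint[OF d])
qed

end

lemma vscale_continuous [continuous_intros]:
 fixes g :: "'a::topological_space => complex^'n" shows "continuous_on S f ==> continuous_on S g ==> continuous_on S (%x. f x *s g x)"
 unfolding vector_scalar_mult_def by (intro continuous_intros)

context jordan_triple
begin

section \<open>The Jordan algebra of a tripotent\<close>

text \<open>\<open>star c\<close> and \<open>jp c\<close> are the involution and the product of the Jordan algebra \<open>Z\<^sub>2(c)\<close> with unit \<open>c\<close>.\<close>

definition star :: "complex^'n => complex^'n => complex^'n" where
 "star c x = (1/2) *s T c x c"

definition jp :: "complex^'n => complex^'n => complex^'n => complex^'n" where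
 "jp c x y = (1/2) *s T x c y"

lemma star_add: "star c (x + y) = star c x + star c y" and star_scale: "star c (s *s x) = cnj s *s star c x"
 and star_zero [simp]: "star c 0 = 0" and star_minus: "star c (- x) = - star c x" and star_diff: "star c (x - y) = star c x - star c y"
 by (simp_all add: star_def T_simps vec_eq_iff algebra_simps)

lemma star_sum: "star c (\<Sum>i\<in>A. f i) = (\<Sum>i\<in>A. star c (f i))"
 by (induction A rule: infinite_finite_induct) (auto simp: star_add)

lemma jp_add: "jp c (x + x') y = jp c x y + jp c x' y" "jp c x (y + y') = jp c x y + jp c x y'"
 and jp_scale: "jp c (s *s x) y = s *s jp c x y" "jp c x (s *s y) = s *s jp c x y"
 and jp_minus: "jp c (- x) y = - jp c x y" "jp c x (- y) = - jp c x y"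
 and jp_diff: "jp c (x - x') y = jp c x y - jp c x' y" "jp c x (y - y') = jp c x y - jp c x y'"
 and jp_zero [simp]: "jp c 0 y = 0" "jp c x 0 = 0" by (simp_all add: jp_def T_simps vec_eq_iff algebra_simps)

lemma jp_commute: "jp c x y = jp c y x" by (simp add: jp_def T_commute[of x c y])

lemma jp_sum: "jp c (\<Sum>i\<in>A. f i) y = (\<Sum>i\<in>A. jp c (f i) y)" "jp c x (\<Sum>i\<in>A. f i) = (\<Sum>i\<in>A. jp c x (f i))"
 by (induction A rule: infinite_finite_induct) (auto simp: jp_add)

lemma jp_clin: "clin (jp c x)" by (rule clinI) (auto simp: jp_add jp_scale)

lemmas jp_simps = jp_add jp_scale jp_minus jp_diff
lemmas star_simps = star_add star_scale star_minus star_diff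

lemma T_eq_jp: "T x c y = 2 *s jp c x y" by (simp add: jp_def vec_eq_iff)

lemma
 assumes c: "tripotent T c" and x: "x \<in> pspace c 2" shows star_pspace: "star c x \<in> pspace c 2"
  and star_star: "star c (star c x) = x" and T_move_left: "T c x w = 2 *s jp c (star c x) w" and jp_unit: "jp c c x = x" "jp c x c = x"
proof -
 show m: "star c x \<in> pspace c 2" unfolding star_def using Q_pspace2[OF c] by (rule pspace_scale)
 show s: "star c (star c x) = x" using Q_involution[OF c x] by (simp add: star_def T_scale vec_eq_iff)
 show "T c x w = 2 *s jp c (star c x) w" using T_c_right[OF c m, of w] s by (simp add: star_def T_eq_jp)
 show "jp c x c = x" using pspaceD[OF x] by (simp add: jp_def T_commute[of x c c] vec_eq_iff)
 thus "jp c c x = x" by (simp add: jp_commute)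
qed

lemma star_continuous [continuous_intros]:
 fixes f :: "'a::topological_space => complex^'n" shows "continuous_on S f ==> continuous_on S (%x. star c (f x))"
 unfolding star_def by (intro continuous_intros)

lemma jp_continuous [continuous_intros]:
 fixes f g :: "'a::topological_space => complex^'n"
 shows "continuous_on S f ==> continuous_on S g ==> continuous_on S (%x. jp c (f x) (g x))" unfolding jp_def by (intro continuous_intros)

lemma star_unit: "tripotent T c ==> star c c = c" by (simp add: star_def tripotent_iff vec_eq_iff)

lemma jp_pspace: "tripotent T c ==> x \<in> pspace c 2 ==> y \<in> pspace c 2 ==> jp c x y \<in> pspace c 2"
 unfolding jp_def by (rule pspace_scale) (rule T_pspace[OF _ tripotent_pspace], auto)

lemma ip_jp: assumes "tripotent T c" "x \<in> pspace c 2" shows "ip (jp c x y) w = ip y (jp c (star c x) w)"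
 using ip_adjoint[of x c y w] T_move_left[OF assms, of w] by (simp add: jp_def ip_scale)

text \<open>On \<open>Z\<^sub>2(c)\<close> the operator \<open>D(x,y)\<close> commutes with \<open>D(c,c)\<close>; this makes the involution
  multiplicative.\<close>

lemma star_jp:
 assumes c: "tripotent T c" and x: "x \<in> pspace c 2" and y: "y \<in> pspace c 2" shows "star c (jp c x y) = jp c (star c x) (star c y)"
proof -
 have gen: "star c (jp c (star c x) y) = jp c (star c y) x" if x: "x \<in> pspace c 2" and y: "y \<in> pspace c 2" for x y proof -
  have c2: "c \<in> pspace c 2" by (rule tripotent_pspace[OF c])
  have "T x y c \<in> pspace c 2" by (rule T_pspace[OF x y c2]) simp
  hence "T x y (T c c c) = T c c (T x y c)" using pspaceD[OF c2] pspaceD by (simp add: T_scale)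
  hence "T (T x y c) c c = T c (T c x y) c" using jordan_identity[of x y c c c] by simp
  moreover have "T x y c = 2 *s jp c (star c y) x" using T_move_left[OF c y, of x] by (simp add: T_commute[of x y c])
  moreover have "T c x y = 2 *s jp c (star c x) y" by (rule T_move_left[OF c x])
  moreover have "T (jp c (star c y) x) c c = 2 *s jp c (star c y) x"
   using jp_unit[OF c jp_pspace[OF c star_pspace[OF c y] x]] by (simp add: T_eq_jp[of _ c])
  moreover have "T c (jp c (star c x) y) c = 2 *s star c (jp c (star c x) y)" by (simp add: star_def vec_eq_iff)
  ultimately have "4 *s star c (jp c (star c x) y) = 4 *s jp c (star c y) x" by (simp add: T_scale vec_eq_iff)
  thus ?thesis by simp
 qed
 show ?thesis using gen[OF star_pspace[OF c x] y] by (simp add: star_star[OF c x] jp_commute)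
qed

text \<open>The triple product is determined by the Jordan algebra: write \<open>y\<close> as \<open>{c; y\<^sup>*; c}/2\<close> and apply the
  main identity to \<open>D(y\<^sup>*,c)\<close>.\<close>

lemma T_formula:
 assumes c: "tripotent T c" and y: "y \<in> pspace c 2"
 shows "T u y w = 2 *s (jp c (jp c (star c y) u) w + jp c u (jp c (star c y) w) - jp c (star c y) (jp c u w))" proof -
 let ?x = "star c y"
 have "T c ?x c = 2 *s y" using star_star[OF c y] by (simp add: star_def vec_eq_iff)
 hence "2 *s T u y w = T u (T c ?x c) w" by (simp add: T_scale)
 also have "... = T u c (T ?x c w) + T (T ?x c u) c w - T ?x c (T u c w)" using jordan_identity[of ?x c u c w] by (simp add: algebra_simps)
 finally have half: "T u y w $ i = (T u c (T ?x c w) $ i + T (T ?x c u) c w $ i - T ?x c (T u c w) $ i) / 2" for i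
  by (simp add: vec_eq_iff field_simps)
 have "2 * T u y w $ i = 2 * (2 * (jp c (jp c (star c y) u) w $ i + jp c u (jp c (star c y) w) $ i - jp c (star c y) (jp c u w) $ i))" for i
  using half[of i] by (simp add: T_eq_jp[of _ c] jp_scale mult.commute)
 hence "T u y w $ i = 2 * (jp c (jp c (star c y) u) w $ i + jp c u (jp c (star c y) w) $ i - jp c (star c y) (jp c u w) $ i)" for i
  by (simp only: mult_cancel_left) simp
 thus ?thesis by (simp add: vec_eq_iff)
qed

text \<open>By the previous formula \<open>D(d,d)\<close> is twice the multiplication by \<open>d\<close>.\<close>

lemma idempotent_tripotent:
 assumes c: "tripotent T c" and d: "d \<in> pspace c 2" "star c d = d" "jp c d d = d"
 shows "tripotent T d" and "T d d w = 2 *s jp c d w" and "T d (c - d) w = 0" and "T (c - d) d w = 0" and "tripotent T (c - d)" proof -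
 have Tdd: "T d d w = 2 *s jp c d w" for w using T_formula[OF c d(1), of d w] by (simp add: d)
 show "T d d w = 2 *s jp c d w" by (rule Tdd)
 thus td: "tripotent T d" using Tdd[of d] d by (simp add: tripotent_iff)
 have cd: "c - d \<in> pspace d 0" using Tdd[of "c - d"] jp_unit[OF c d(1)] d by (simp add: pspace_def jp_diff)
 note dd = tripotent_pspace[OF td]
 show z: "T d (c - d) w = 0" "T (c - d) d w = 0" for w using T_pspace_02[OF td dd cd] T_pspace_20[OF td dd cd] by auto
 have "T (c-d)(c-d)(c-d) = T c c (c - d)" proof -
  have "T (c-d)(c-d)(c-d) = T c (c-d) (c-d) - T d (c-d) (c-d)" by (simp add: T_diff(1))
  also have "... = T c (c-d) (c-d)" by (simp add: z)
  also have "... = T c c (c-d) - T c d (c-d)" by (simp add: T_diff(2))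
  also have "T c d (c-d) = T (c-d) d c" by (rule T_commute)
  also have "... = 0" by (rule z)
  finally show ?thesis by simp
 qed
 moreover have "T c c (c - d) = 2 *s (c - d)" using pspaceD[OF tripotent_pspace[OF c]] pspaceD[OF d(1)] by (simp add: T_diff vec_eq_iff)
 ultimately show "tripotent T (c - d)" by (simp add: tripotent_iff)
qed

section \<open>Existence of tripotents\<close>

lemma ip_norm_bound: obtains m where "m > 0" "!!z. m * (norm z)\<^sup>2 <= Re (ip z z)" proof -
 let ?S = "sphere (0::complex^'n) 1"
 have ne: "?S ~= {}" using vector_choose_size[of 1] by fastforce
 have "continuous_on ?S (%z. Re (ip z z))" by (intro continuous_intros)
 from continuous_attains_inf[OF compact_sphere ne this]
 obtain z0 where z0: "z0 \<in> ?S" "!!z. z \<in> ?S ==> Re (ip z0 z0) <= Re (ip z z)" by blast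
 have "z0 ~= 0" using z0(1) by auto
 hence "Re (ip z0 z0) > 0" by (rule ip_pos)
 moreover have "Re (ip z0 z0) * (norm z)\<^sup>2 <= Re (ip z z)" for z proof (cases "z = 0")
  case False
  let ?w = "(1 / norm z) *\<^sub>R z"
  have "?w \<in> ?S" using False by simp
  from z0(2)[OF this] have "Re (ip z0 z0) <= Re (ip z z) / (norm z)\<^sup>2"
   by (simp add: scaleR_eq_scale ip_scale power2_eq_square flip: of_real_mult of_real_divide)
  thus ?thesis using False by (simp add: field_simps)
 qed simp
 ultimately show ?thesis using that by blast
qed

lemma ip_sphere_compact: assumes "closed S" shows "compact {z \<in> S. Re (ip z z) = 1}" proof -
 obtain m where m: "m > 0" "!!z. m * (norm z)\<^sup>2 <= Re (ip z z)" using ip_norm_bound by blast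
 have bd: "bounded {z \<in> S. Re (ip z z) = 1}" unfolding bounded_iff proof (intro exI ballI)
  fix z assume "z \<in> {z \<in> S. Re (ip z z) = 1}"
  hence "m * (norm z)\<^sup>2 <= 1" using m(2)[of z] by simp
  hence "(norm z)\<^sup>2 <= 1 / m" using m(1) by (simp add: field_simps)
  thus "norm z <= sqrt (1 / m)" using real_le_rsqrt by blast
 qed
 have "closed {z. Re (ip z z) = 1}" by (intro closed_Collect_eq continuous_intros)
 moreover have "{z \<in> S. Re (ip z z) = 1} = S \<inter> {z. Re (ip z z) = 1}" by auto
 ultimately have "closed {z \<in> S. Re (ip z z) = 1}" using closed_Int[OF assms] by metis
 thus ?thesis using bd by (simp add: compact_eq_bounded_closed)
qed

lemma closed_vec_subspace: "vec.subspace S ==> closed (S :: (complex^'n) set)"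
 by (rule closed_subspace) (auto simp: vec.subspace_def subspace_def scaleR_eq_scale)

lemma ip_line: "ip (z + of_real t *s y) (z + of_real t *s y)
  = ip z z + of_real (2 * t * Re (ip z y)) + of_real (t\<^sup>2) * ip y y" using ip_cnj[of z y]
 by (simp add: ip_add ip_scale complex_eq_iff power2_eq_square algebra_simps)

text \<open>A homogeneous function that is maximal at \<open>z\<close> on the unit sphere of a real subspace is critical
  in all directions orthogonal to \<open>z\<close>.\<close>

lemma sphere_maximum:
 assumes cl: "closed V" and V: "!!x y s. x \<in> V ==> y \<in> V ==> x + of_real s *s y \<in> V" and ne: "z0 \<in> V" "z0 ~= 0"
  and F: "continuous_on UNIV F" "!!s y. F (of_real s *s y) = s ^ k * F y"
 obtains z where "z \<in> V" "ip z z = 1"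
  "!!y D. y \<in> V ==> Re (ip z y) = 0 ==> ((%t. F (z + of_real t *s y)) has_real_derivative D) (at 0) ==> D = 0" proof -
 let ?K = "{z \<in> V. Re (ip z z) = 1}"
 have V0: "of_real s *s y \<in> V" if "y \<in> V" for s y using V[OF V[OF that that, of "-1"] that, of s] by (simp add: vec_eq_iff)
 have normalize: "of_real (1 / sqrt (Re (ip z z))) *s z \<in> ?K" if "z \<in> V" "z ~= 0" for z
  using V0[OF that(1)] ip_pos[OF that(2)] by (simp add: ip_scale flip: of_real_mult of_real_divide)
 have "continuous_on ?K F" using F(1) by (rule continuous_on_subset) simp
 with continuous_attains_sup[OF ip_sphere_compact[OF cl], of F] normalize[OF ne]
 obtain z where z: "z \<in> ?K" "!!y. y \<in> ?K ==> F y <= F z" by blast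
 have zz: "ip z z = 1" using z(1) ip_self_real[of z] by simp
 have "D = 0" if y: "y \<in> V" "Re (ip z y) = 0" and D: "((%t. F (z + of_real t *s y)) has_real_derivative D) (at 0)" for y D proof -
  define q where "q = Re (ip y y)"
  have q: "q >= 0" using ip_pos[of y] by (cases "y = 0") (auto simp: q_def)
  have n: "Re (ip (z + of_real t *s y) (z + of_real t *s y)) = 1 + t\<^sup>2 * q" for t unfolding ip_line by (simp add: zz y(2) q_def)
  have "((%t. (1 / sqrt (1 + t\<^sup>2 * q)) ^ k * F (z + of_real t *s y)) has_real_derivative D) (at 0)"
   by (rule derivative_eq_intros D refl | simp)+
  moreover have "(1 / sqrt (1 + t\<^sup>2 * q)) ^ k * F (z + of_real t *s y) <= F z" for t proof -
   have "1 + t\<^sup>2 * q > 0" using q by (simp add: add_pos_nonneg)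
   hence "z + of_real t *s y ~= 0" using n[of t] by auto
   from z(2)[OF normalize[OF V[OF _ y(1)] this]] z(1) show ?thesis unfolding n F(2) by simp
  qed
  ultimately show ?thesis by (intro DERIV_local_max[of _ D 0 1]) auto
 qed
 thus ?thesis using z(1) zz by (intro that[of z]) auto
qed

text \<open>The cube operation has positive eigenvalues: otherwise \<open>D(z,z)\<close> would have only
  non-positive eigenvalues, against \<open>tr D(z,z) > 0\<close>.\<close>

lemma cube_eigenvalue_pos:
 assumes z: "T z z z = of_real \<mu> *s z" and nz: "z ~= 0" shows "\<mu> > 0" proof (rule ccontr)
 assume "\<not> \<mu> > 0"
 then consider "\<mu> = 0" | "\<mu> < 0" by linarith
 thus False proof cases
  case 1
  have L3: "T z z (T z z (T z z w)) = 0" for w using cube_L3[OF z, of w] by (simp add: 1)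
  have L2: "T z z (T z z w) = 0" for w using ip_adjoint[of z z "T z z w" "T z z (T z z w)"] L3 ip_self_zero by (metis ip_zero(2))
  have "T z z w = 0" for w using ip_adjoint[of z z w "T z z w"] L2 ip_self_zero by (metis ip_zero(2))
  hence "T z z = (%w. 0)" by auto
  hence "ip z z = 0" by (simp add: ip_def matrix_def trace_def)
  thus False using nz ip_self_zero by blast
 next
  case 2
  define s where "s = complex_of_real (sqrt (- 2 / \<mu>))"
  define y where "y = s *s z"
  have ss: "s * cnj s = complex_of_real (- 2 / \<mu>)" using 2 by (simp add: s_def divide_nonpos_neg flip: of_real_mult)
  have "T y y y = (s * cnj s * of_real \<mu>) *s y" by (simp add: y_def T_scale z vec_eq_iff)
  also have "s * cnj s * of_real \<mu> = complex_of_real (-2)" using 2 by (simp add: ss)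
  finally have y: "T y y y = of_real (-2) *s y" .
  have y0: "y ~= 0" using nz 2 by (auto simp: y_def s_def)
  have L3: "T y y (T y y (T y y w)) = - 3 *s T y y (T y y w) - 2 *s T y y w" for w proof -
   have "2 * T y y (T y y (T y y w)) $ i = 2 * (- 3 * T y y (T y y w) $ i - 2 * T y y w $ i)" for i
    using cube_L3[OF y, of w] by (simp add: vec_eq_iff)
   hence "T y y (T y y (T y y w)) $ i = - 3 * T y y (T y y w) $ i - 2 * T y y w $ i" for i by (simp only: mult_cancel_left) simp
   thus ?thesis by (simp add: vec_eq_iff)
  qed
  define P where "P w = (1/2) *s (T y y (T y y w) + T y y w)" for w
  define P' where "P' w = - 2 *s T y y w - T y y (T y y w)" for w
  have cl: "clin P" "clin P'" unfolding P_def P'_def by (auto intro!: clinI simp: T_simps vec_eq_iff algebra_simps)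
  have idem: "P (P w) = P w" "P' (P' w) = P' w" for w by (simp_all add: P_def P'_def T_simps L3 vec_eq_iff field_simps)
  have "T y y = (%w. (-2) *s P w + (-1) *s P' w)" by (rule ext) (simp add: P_def P'_def vec_eq_iff field_simps)
  hence "ip y y = (-2) * trace (matrix P) + (-1) * trace (matrix P')"
   unfolding ip_def by (simp only: matrix_add_fun trace_add trace_scale_fun)
  hence "Re (ip y y) <= 0" by (simp add: trace_idempotent[OF cl(1) idem(1)] trace_idempotent[OF cl(2) idem(2)])
  thus False using ip_pos[OF y0] by simp
 qed
qed

text \<open>A maximum of the quartic form \<open>\<langle>{zzz}, z\<rangle>\<close> on the unit sphere of a subspace closed under cubes
  is an eigenvector of the cube operation, hence proportional to a tripotent.\<close>

lemma exists_tripotent: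
 assumes S: "vec.subspace S" and cube: "!!x. x \<in> S ==> T x x x \<in> S" and ne: "z0 \<in> S" "z0 ~= 0"
 obtains c where "tripotent T c" "c ~= 0" "c \<in> S" proof -
 have Sadd: "x + of_real s *s y \<in> S" if "x \<in> S" "y \<in> S" for x y s
  using that by (intro vec.subspace_add[OF S] vec.subspace_scale[OF S])
 let ?F = "%z. Re (ip (T z z z) z)"
 have contF: "continuous_on UNIV ?F" by (intro continuous_intros)
 have homF: "?F (of_real s *s y) = s ^ 4 * ?F y" for s y by (simp add: T_scale ip_scale power4_eq_xxxx)
 obtain z where zS: "z \<in> S" and zz: "ip z z = 1" and max:
  "!!y D. y \<in> S ==> Re (ip z y) = 0 ==> ((%t. ?F (z + of_real t *s y)) has_real_derivative D) (at 0) ==> D = 0"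
  by (rule sphere_maximum[OF closed_vec_subspace[OF S] _ ne contF homF], erule (1) Sadd, rule that)
 define \<mu> where "\<mu> = Re (ip (T z z z) z)"
 have crit: "Re (ip (T z z z) y) = 0" if y: "y \<in> S" "Re (ip z y) = 0" for y proof -
  define a where "a = Re (ip (T y z z) z + ip (T z y z) z + ip (T z z y) z + ip (T z z z) y)"
  define b where "b = Re (ip (T y y z) z + ip (T y z y) z + ip (T y z z) y + ip (T z y y) z + ip (T z y z) y + ip (T z z y) y)"
  define c where "c = Re (ip (T y y y) z + ip (T y y z) y + ip (T y z y) y + ip (T z y y) y)"
  define d where "d = Re (ip (T y y y) y)"
  have "?F (z + of_real t *s y) = \<mu> + a * t + b * t^2 + c * t^3 + d * t^4" for t
   by (simp add: T_add T_scale ip_add ip_scale \<mu>_def a_def b_def c_def d_def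
     power2_eq_square power3_eq_cube power4_eq_xxxx algebra_simps)
  hence "((%t. ?F (z + of_real t *s y)) has_real_derivative a) (at 0)" by (auto intro!: derivative_eq_intros)
  hence "a = 0" by (rule max[OF y])
  moreover have "a = 4 * Re (ip (T z z z) y)" proof -
   have "ip (T y z z) z = cnj (ip (T z z z) y)" using ip_adjoint[of z z y z] ip_cnj[of y "T z z z"] by (simp add: T_commute[of y z z])
   moreover have "ip (T z y z) z = ip (T z z z) y" using ip_adjoint[of z y z z] ip_adjoint[of z z z y] by (simp add: T_commute[of y z z])
   moreover have "ip (T z z y) z = ip (T y z z) z" by (simp add: T_commute[of y z z])
   ultimately show ?thesis by (simp add: a_def)
  qed
  ultimately show ?thesis by simp
 qed
 have real: "ip (T z z z) z = of_real \<mu>" using ip_adjoint[of z z z z] ip_cnj[of z "T z z z"] by (simp add: \<mu>_def complex_eq_iff)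
 define y where "y = T z z z - of_real \<mu> *s z"
 have yS: "y \<in> S" unfolding y_def using cube[OF zS] zS by (intro vec.subspace_diff[OF S] vec.subspace_scale[OF S])
 have "ip y z = 0" by (simp add: y_def ip_diff ip_scale zz real)
 hence zy: "ip z y = 0" using ip_cnj[of y z] by simp
 have "Re (ip (T z z z) y) = 0" using crit[OF yS] zy by simp
 moreover have "ip y y = ip (T z z z) y" using zy by (subst (1) y_def) (simp add: ip_diff ip_scale)
 ultimately have "Re (ip y y) = 0" by simp
 hence "y = 0" using ip_pos[of y] by force
 hence eig: "T z z z = of_real \<mu> *s z" by (simp add: y_def)
 have z0: "z ~= 0" using zz by auto
 have \<mu>: "\<mu> > 0" by (rule cube_eigenvalue_pos[OF eig z0])
 define s where "s = complex_of_real (sqrt (2 / \<mu>))"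
 have "s * cnj s * of_real \<mu> = 2" using \<mu> by (simp add: s_def flip: of_real_mult)
 moreover have "T (s *s z) (s *s z) (s *s z) = (s * cnj s * of_real \<mu>) *s (s *s z)" by (simp add: T_scale eig vec_eq_iff)
 ultimately have "tripotent T (s *s z)" by (simp add: tripotent_iff)
 moreover have "s *s z ~= 0" using z0 \<mu> by (simp add: s_def)
 moreover have "s *s z \<in> S" using zS by (rule vec.subspace_scale[OF S])
 ultimately show ?thesis by (rule that)
qed

text \<open>By the trace form the dimensions of the Peirce spaces give a natural number that is additive on
  orthogonal sums of tripotents.\<close>

lemma ip_tripotent: assumes "tripotent T c" shows "ip c c = of_nat (2 * vec.dim (pspace c 2) + vec.dim (pspace c 1))" proof -
 have idem: "pproj c k (pproj c k w) = pproj c k w" if "k <= 2" for k w using pproj_pspace[OF pproj_mem[OF assms that]] that by simp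
 have "T c c = (%w. 2 *s pproj c 2 w + 1 *s pproj c 1 w)" by (rule ext) (simp add: pproj_def vec_eq_iff field_simps)
 hence "ip c c = 2 * trace (matrix (pproj c 2)) + trace (matrix (pproj c 1))"
  unfolding ip_def by (simp only: matrix_add_fun trace_add trace_scale_fun mult_1)
 thus ?thesis using trace_idempotent[OF pproj_clin[of c 2] idem] trace_idempotent[OF pproj_clin[of c 1] idem]
  by (simp add: pspace_eq_range[OF assms])
qed

text \<open>A nonzero tripotent of smallest trace among those in \<open>S\<close> is minimal, provided that \<open>S\<close> contains
  the summands of its tripotents.\<close>

lemma exists_minimal_tripotent:
 assumes S: "vec.subspace S" and cube: "!!x. x \<in> S ==> T x x x \<in> S" and ne: "z0 \<in> S" "z0 ~= 0"
  and her: "!!c c'. tripotent T c ==> c \<in> S ==> c' \<in> pspace c 2 ==> c' \<in> S"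
 obtains c where "minimal_tripotent T c" "c \<in> S" proof -
 let ?P = "%c. tripotent T c & c ~= 0 & c \<in> S"
 let ?m = "%c. 2 * vec.dim (pspace c 2) + vec.dim (pspace c 1)"
 obtain c0 where "?P c0" using exists_tripotent[OF S cube ne] by blast
 then obtain c where c: "?P c" "!!c'. ?P c' ==> ?m c <= ?m c'" using ex_has_least_nat[of ?P c0 ?m] by blast
 have "minimal_tripotent T c" unfolding minimal_tripotent_def proof (intro conjI notI; (elim exE conjE)?)
  fix c' c''
  assume t: "tripotent T c'" "tripotent T c''" "c' ~= 0" "c'' ~= 0" "jordan_orthogonal T c' c''" and s: "c = c' + c''"
  have o: "T c' c'' w = 0" for w using t(5) by (simp add: jordan_orthogonal_def)
  have o': "T c'' c' w = 0" for w by (rule T_zero_adjoint) (rule o)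
  have "T c c c' = T c' c' c'" using o o' by (simp add: s T_add) (metis T_commute o)
  hence "c' \<in> pspace c 2" using t(1) by (simp add: pspace_def tripotent_iff)
  hence "?P c'" using her c(1) t by blast
  hence "?m c <= ?m c'" by (rule c(2))
  moreover have "ip c c = ip c' c' + ip c'' c''" proof -
   have "T c' c'' = (%w. 0)" using o by auto
   hence "ip c' c'' = 0" by (simp add: ip_def matrix_def trace_def)
   thus ?thesis using ip_cnj[of c' c''] by (simp add: s ip_add)
  qed
  hence "of_nat (?m c) = (of_nat (?m c' + ?m c'') :: complex)" using ip_tripotent t c(1) by simp
  hence "?m c = ?m c' + ?m c''" by (simp only: of_nat_eq_iff)
  moreover have "?m c'' > 0" using ip_tripotent[OF t(2)] ip_self_zero[of c''] t(4) by (metis gr0I of_nat_0)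
  ultimately show False by linarith
 qed (use c in auto)
 thus ?thesis using that c(1) by blast
qed

text \<open>If \<open>Z\<^sub>2(e)\<close> contained a self-adjoint element outside \<open>\<real>e\<close>, then a maximum of the cubic form
  \<open>\<langle>x \<circ> x, x\<rangle>\<close> on the unit sphere of the self-adjoint elements orthogonal to \<open>e\<close> would satisfy a quadratic
  equation with two distinct real roots, and hence split \<open>e\<close> into two idempotents.\<close>

lemma minimal_tripotent_pspace2:
 assumes min: "minimal_tripotent T e" and z: "z \<in> pspace e 2" shows "EX s. z = s *s e" proof (rule ccontr)
 assume not: "\<nexists>s. z = s *s e"
 have e: "tripotent T e" and e0: "e ~= 0" using min by (auto simp: minimal_tripotent_def)
 have e2: "e \<in> pspace e 2" by (rule tripotent_pspace[OF e])
 note sub = pspace_subspace[of e 2]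
 let ?A = "{x \<in> pspace e 2. star e x = x}"
 have ee: "Re (ip e e) > 0" by (rule ip_pos[OF e0])
 have A_real: "ip x y = ip y x" if "x \<in> ?A" "y \<in> ?A" for x y proof -
  have "ip x y = ip (jp e x e) y" using that jp_unit[OF e] by simp
  also have "... = ip e (jp e x y)" using ip_jp[OF e] that by simp
  also have "... = ip e (jp e y x)" by (simp add: jp_commute)
  also have "... = ip (jp e y e) x" using ip_jp[OF e] that by simp
  also have "... = ip y x" using that jp_unit[OF e] by simp
  finally show ?thesis .
 qed
 have A_real': "ip x y = of_real (Re (ip x y))" if "x \<in> ?A" "y \<in> ?A" for x y
  using A_real[OF that] ip_cnj[of x y] by (simp add: complex_eq_iff)
 have A_add: "x + y \<in> ?A" if "x \<in> ?A" "y \<in> ?A" for x y using that by (auto simp: star_add intro: vec.subspace_add[OF sub])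
 have A_scale: "of_real s *s x \<in> ?A" if "x \<in> ?A" for x s using that by (auto simp: star_scale intro: vec.subspace_scale[OF sub])
 have A_jp: "jp e x y \<in> ?A" if "x \<in> ?A" "y \<in> ?A" for x y using that jp_pspace[OF e] star_jp[OF e] by auto
 have eA: "e \<in> ?A" using e2 star_unit[OF e] by simp
 let ?V = "{x \<in> ?A. ip x e = 0}"
 have V_scale: "of_real s *s x \<in> ?V" if "x \<in> ?V" for x s using that A_scale[of x s] by (auto simp: ip_scale)
 have V_add: "x + y \<in> ?V" if "x \<in> ?V" "y \<in> ?V" for x y using that A_add[of x y] by (auto simp: ip_add)
 have toV: "x - (ip x e / ip e e) *s e \<in> ?V" if "x \<in> ?A" for x proof -
  have "ip x e / ip e e = of_real (Re (ip x e) / Re (ip e e))" by (subst A_real'[OF that eA], subst A_real'[OF eA eA]) simp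
  hence eq: "x - (ip x e / ip e e) *s e = x + of_real (- (Re (ip x e) / Re (ip e e))) *s e" by (simp add: vec_eq_iff)
  have "x - (ip x e / ip e e) *s e \<in> ?A" unfolding eq by (rule A_add[OF that A_scale[OF eA]])
  moreover have "ip (x - (ip x e / ip e e) *s e) e = 0" using ip_self_zero[of e] e0 by (simp add: ip_diff ip_scale)
  ultimately show ?thesis by simp
 qed
 have "\<exists>x0\<in>?V. x0 ~= 0" proof (rule ccontr)
  assume "\<not> ?thesis"
  hence mult: "x = (ip x e / ip e e) *s e" if "x \<in> ?A" for x using toV[OF that] by auto
  let ?x = "(1/2) *s (z + star e z)" and ?y = "(- \<i>/2) *s (z - star e z)"
  have "?x \<in> ?A" "?y \<in> ?A" using z star_pspace[OF e z] star_star[OF e z]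
   by (auto simp: star_simps vec_eq_iff algebra_simps intro!: vec.subspace_scale[OF sub] vec.subspace_add[OF sub] vec.subspace_diff[OF sub])
  hence st: "?x = (ip ?x e / ip e e) *s e" "?y = (ip ?y e / ip e e) *s e" using mult by blast+
  have "z = ?x + \<i> *s ?y" by (simp add: vec_eq_iff field_simps)
  also have "... = (ip ?x e / ip e e + \<i> * (ip ?y e / ip e e)) *s e" by (subst st(1), subst st(2)) (simp add: vec_eq_iff algebra_simps)
  finally show False using not by blast
 qed
 then obtain x0 where x0: "x0 \<in> ?V" "x0 ~= 0" by blast
 have clV: "closed ?V" proof -
  have "?V = pspace e 2 \<inter> {x. star e x = x} \<inter> {x. ip x e = 0}" by auto
  moreover have "closed {x. star e x = x}" "closed {x. ip x e = 0}" by (intro closed_Collect_eq continuous_intros)+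
  ultimately show ?thesis using closed_vec_subspace[OF sub] by auto
 qed
 let ?F = "%x. Re (ip (jp e x x) x)"
 have contF: "continuous_on UNIV ?F" by (intro continuous_intros)
 have homF: "?F (of_real s *s y) = s ^ 3 * ?F y" for s y by (simp add: jp_scale ip_scale power3_eq_cube)
 obtain x where xV: "x \<in> ?V" and xx: "ip x x = 1" and max:
  "!!y D. y \<in> ?V ==> Re (ip x y) = 0 ==> ((%t. ?F (x + of_real t *s y)) has_real_derivative D) (at 0) ==> D = 0"
  by (rule sphere_maximum[OF clV _ x0 contF homF], erule V_add, erule V_scale, rule that)
 define \<alpha> where "\<alpha> = Re (ip (jp e x x) x)"
 have xA: "x \<in> ?A" using xV by simp
 have assoc: "ip (jp e u v) w = ip u (jp e v w)" if "u \<in> ?A" "v \<in> ?A" "w \<in> ?A" for u v w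
  using ip_jp[OF e, of v u w] that by (simp add: jp_commute)
 have crit: "Re (ip (jp e x x) y) = 0" if y: "y \<in> ?V" "ip x y = 0" for y proof -
  have yA: "y \<in> ?A" using y by simp
  have r: "ip (jp e x y) x = ip (jp e x x) y" "ip (jp e y y) x = ip (jp e x y) y"
   using assoc[OF xA yA xA] assoc[OF yA yA xA] assoc[OF xA xA yA] assoc[OF xA yA yA]
    A_real[OF xA A_jp[OF yA xA]] A_real[OF yA A_jp[OF yA xA]] by (simp_all add: jp_commute)
  have jexp: "jp e (x + of_real t *s y) (x + of_real t *s y) = jp e x x + of_real (2 * t) *s jp e x y + of_real (t^2) *s jp e y y" for t
   by (simp add: jp_add jp_scale jp_commute[of e y x] vec_eq_iff power2_eq_square algebra_simps)
  have "?F (x + of_real t *s y) = \<alpha> + (3 * Re (ip (jp e x x) y)) * t + (3 * Re (ip (jp e x y) y)) * t^2 + Re (ip (jp e y y) y) * t^3" for t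
   unfolding jexp by (simp add: ip_add ip_scale \<alpha>_def r power2_eq_square power3_eq_cube algebra_simps)
  hence "((%t. ?F (x + of_real t *s y)) has_real_derivative 3 * Re (ip (jp e x x) y)) (at 0)" by (auto intro!: derivative_eq_intros)
  from max[OF y(1) _ this] y(2) show ?thesis by simp
 qed
 define \<beta> where "\<beta> = 1 / Re (ip e e)"
 have \<beta>: "\<beta> > 0" using ee by (simp add: \<beta>_def)
 define y where "y = jp e x x - of_real \<alpha> *s x - of_real \<beta> *s e"
 have jxe: "ip (jp e x x) e = 1" using assoc[OF xA xA eA] jp_unit[OF e] xA xx by simp
 have yA: "y \<in> ?A" proof -
  have eq: "y = jp e x x + of_real (- \<alpha>) *s x + of_real (- \<beta>) *s e" by (simp add: y_def vec_eq_iff)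
  show ?thesis unfolding eq by (rule A_add[OF A_add[OF A_jp[OF xA xA] A_scale[OF xA]] A_scale[OF eA]])
 qed
 have xe: "ip x e = 0" "ip e x = 0" using xV ip_cnj[of x e] by auto
 have ye: "ip y e = 0" using ee by (simp add: y_def ip_diff ip_scale jxe xe \<beta>_def) (subst ip_self_real[of e], simp)
 have "ip (jp e x x) x = of_real \<alpha>" using A_real'[OF A_jp[OF xA xA] xA] by (simp add: \<alpha>_def)
 hence yx: "ip y x = 0" by (simp add: y_def ip_diff ip_scale xx xe)
 hence xy: "ip x y = 0" "ip e y = 0" using ip_cnj[of y x] ip_cnj[of y e] ye by auto
 have "Re (ip (jp e x x) y) = 0" using crit[of y] yA ye xy by simp
 moreover have "ip y y = ip (jp e x x) y" using xy by (subst (1) y_def) (simp add: ip_diff ip_scale)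
 ultimately have "y = 0" using ip_pos[of y] by force
 hence quad: "jp e x x = of_real \<alpha> *s x + of_real \<beta> *s e" by (simp add: y_def algebra_simps)
 define \<Delta> where "\<Delta> = sqrt (\<alpha>\<^sup>2 + 4 * \<beta>)"
 define t2 where "t2 = (\<alpha> - \<Delta>) / 2"
 have \<Delta>2: "\<Delta> * \<Delta> = \<alpha> * \<alpha> + 4 * \<beta>" and \<Delta>: "\<Delta> > 0"
  using \<beta> by (simp_all add: \<Delta>_def power2_eq_square add_nonneg_pos)
 define d where "d = of_real (1 / \<Delta>) *s (x + of_real (- t2) *s e)"
 have dA: "d \<in> ?A" unfolding d_def by (rule A_scale[OF A_add[OF xA A_scale[OF eA]]])
 have dd: "jp e d d = d" proof -
  have ex: "jp e x e = x" "jp e e x = x" "jp e e e = e" using jp_unit[OF e] xA e2 by auto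
  have "\<alpha> - 2 * t2 = \<Delta>" "\<beta> + t2 * t2 = - t2 * \<Delta>" using \<Delta>2 by (auto simp: t2_def field_simps)
  hence "complex_of_real (\<alpha> - 2 * t2) = of_real \<Delta>" "complex_of_real (\<beta> + t2 * t2) = of_real (- t2 * \<Delta>)"
   by simp_all
  hence c1: "complex_of_real \<alpha> - 2 * complex_of_real t2 = complex_of_real \<Delta>"
   "complex_of_real \<beta> + complex_of_real t2 * complex_of_real t2 = - complex_of_real t2 * complex_of_real \<Delta>" by simp_all
  have "jp e (x + of_real (- t2) *s e) (x + of_real (- t2) *s e)
   = (of_real \<alpha> - 2 * of_real t2) *s x + (of_real \<beta> + of_real t2 * of_real t2) *s e"
   by (simp add: jp_simps ex quad vec_eq_iff algebra_simps)
  also have "... = of_real \<Delta> *s (x + of_real (- t2) *s e)" unfolding c1 by (simp add: vec_eq_iff algebra_simps)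
  finally have sq: "jp e (x + of_real (- t2) *s e) (x + of_real (- t2) *s e) = of_real \<Delta> *s (x + of_real (- t2) *s e)" .
  show ?thesis unfolding d_def jp_scale sq vector_smult_assoc using \<Delta> by simp
 qed
 note idem = idempotent_tripotent[OF e, of d]
 have d0: "d ~= 0" proof
  assume "d = 0"
  hence "x = of_real t2 *s e" using \<Delta> by (simp add: d_def vec_eq_iff add_eq_0_iff2)
  hence "ip x x = of_real t2 * ip e x" by (metis ip_scale(1))
  thus False using xx xe by simp
 qed
 have ed0: "e - d ~= 0" proof
  assume "e - d = 0"
  hence "e = d" by simp
  moreover have "of_real \<Delta> *s d = x + of_real (- t2) *s e" unfolding d_def vector_smult_assoc using \<Delta> by simp
  ultimately have "of_real \<Delta> *s e = x + of_real (- t2) *s e" by simp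
  hence "x = of_real (\<Delta> + t2) *s e" by (simp add: vec_eq_iff algebra_simps)
  hence "ip x x = of_real (\<Delta> + t2) * ip e x" by (metis ip_scale(1))
  thus False using xx xe by simp
 qed
 have "jordan_orthogonal T d (e - d)" unfolding jordan_orthogonal_def using idem(3) dA dd by simp
 moreover have "tripotent T d" "tripotent T (e - d)" using idem(1,5) dA dd by auto
 ultimately show False using min d0 ed0 unfolding minimal_tripotent_def by (metis add.commute diff_add_cancel)
qed

end

section \<open>Frames of tube type\<close>

locale tube_frame = jordan_triple T for T :: "('n::finite) triple" +
 fixes r a :: nat and e :: "nat => complex^'n"
 assumes frm: "frame T r e" and mult: "characteristic_multiplicities T r e a 0"
begin

declare One_nat_def [simp del]

lemma e_minimal: "k \<in> {1..r} ==> minimal_tripotent T (e k)" using frm by (auto simp: frame_def)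
lemma e_tripotent: "k \<in> {1..r} ==> tripotent T (e k)" using e_minimal by (auto simp: minimal_tripotent_def)
lemma e_nonzero: "k \<in> {1..r} ==> e k ~= 0" using e_minimal by (auto simp: minimal_tripotent_def)

lemma e_orth: "i \<in> {1..r} ==> j \<in> {1..r} ==> i ~= j ==> T (e i) (e j) z = 0"
 using frm by (auto simp: frame_def jordan_orthogonal_def)

abbreviation L :: "nat => complex^'n => complex^'n" where "L k \<equiv> T (e k) (e k)"

lemma T_diagonal:
 assumes "J \<subseteq> {1..r}"
 shows "T (\<Sum>k\<in>J. s k *s e k) (\<Sum>k\<in>J. t k *s e k) z = (\<Sum>k\<in>J. (s k * cnj (t k)) *s L k z)" proof -
 have fin: "finite J" using assms finite_subset by auto
 have "T (\<Sum>k\<in>J. s k *s e k) (\<Sum>k\<in>J. t k *s e k) z = (\<Sum>k\<in>J. \<Sum>m\<in>J. (s k * cnj (t m)) *s T (e k) (e m) z)"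
  by (subst T_sum(1)) (simp add: T_sum(2) T_scale vec.scale_sum_right vec.scale_scale mult.commute)
 also have "... = (\<Sum>k\<in>J. \<Sum>m\<in>J. if m = k then (s k * cnj (t k)) *s L k z else 0)" proof (intro sum.cong refl)
  fix k m assume "k \<in> J" "m \<in> J"
  hence "k ~= m ==> T (e k) (e m) z = 0" using assms by (intro e_orth) auto
  thus "(s k * cnj (t m)) *s T (e k) (e m) z = (if m = k then (s k * cnj (t k)) *s L k z else 0)" by auto
 qed
 also have "... = (\<Sum>k\<in>J. (s k * cnj (t k)) *s L k z)" using fin by (intro sum.cong refl) (simp add: sum.delta)
 finally show ?thesis .
qed

definition esum :: "nat set => complex^'n" where "esum J = (\<Sum>k\<in>J. e k)"

lemma T_esum: "J \<subseteq> {1..r} ==> T (esum J) (esum J) z = (\<Sum>k\<in>J. L k z)"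
 using T_diagonal[of J "%_. 1" "%_. 1"] by (simp add: esum_def)

lemma L_e: "i \<in> {1..r} ==> k \<in> {1..r} ==> L k (e i) = (if i = k then 2 *s e i else 0)"
 using e_tripotent[of k] e_orth[of i k "e k"] by (auto simp: tripotent_iff T_commute[of "e k" "e k" "e i"])

lemma esum_tripotent: assumes "J \<subseteq> {1..r}" shows "tripotent T (esum J)" proof -
 have fin: "finite J" using assms finite_subset by auto
 have "T (esum J) (esum J) (esum J) = (\<Sum>k\<in>J. \<Sum>i\<in>J. L k (e i))" by (simp only: T_esum[OF assms]) (simp add: esum_def T_sum)
 also have "... = (\<Sum>k\<in>J. \<Sum>i\<in>J. if i = k then 2 *s e i else 0)" using assms by (intro sum.cong refl L_e) auto
 also have "... = 2 *s esum J" using fin by (simp add: sum.delta esum_def vec.scale_sum_right)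
 finally show ?thesis by (simp add: tripotent_iff)
qed

lemma L_commute: assumes "j \<in> {1..r}" "k \<in> {1..r}" shows "L j (L k z) = L k (L j z)"
 using jordan_identity[of "e j" "e j" "e k" "e k" z] assms by (simp add: L_e T_commute[of "e k" "e j" "e j"] T_scale)

text \<open>A nonzero element annihilated by all \<open>D(e\<^sub>k,e\<^sub>k)\<close> would give a minimal tripotent
  orthogonal to the frame.\<close>

lemma L_all_zero: assumes "!!k. k \<in> {1..r} ==> L k z = 0" shows "z = 0" proof (rule ccontr)
 assume z: "z ~= 0"
 define S where "S = {z. \<forall>k\<in>{1..r}. L k z = 0}"
 have S0: "S = (\<Inter>k\<in>{1..r}. pspace (e k) 0)" by (auto simp: S_def pspace_def)
 have S: "vec.subspace S" unfolding S0 by (rule vec.subspace_Inter) (auto simp: pspace_subspace)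
 have cube: "T x x x \<in> S" if "x \<in> S" for x using that T_pspace[of x _ 0 x 0 x 0 0] by (auto simp: S0)
 have o1: "T c (e k) w = 0" "T (e k) c w = 0" if "c \<in> S" "k \<in> {1..r}" for c k w
  using T_pspace_02[OF e_tripotent tripotent_pspace[OF e_tripotent], of k c]
   T_pspace_20[OF e_tripotent tripotent_pspace[OF e_tripotent], of k c] that by (auto simp: S0)
 have her: "c' \<in> S" if "tripotent T c" "c \<in> S" "c' \<in> pspace c 2" for c c' proof -
  have "L k c' = 0" if k: "k \<in> {1..r}" for k proof -
   have "e k \<in> pspace c 0" using o1[OF `c \<in> S` k] by (simp add: pspace_def T_commute[of c c "e k"])
   hence "T c' (e k) (e k) = 0" using T_pspace_20[OF `tripotent T c` `c' \<in> pspace c 2`] by blast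
   thus ?thesis by (simp add: T_commute[of "e k" "e k" c'])
  qed
  thus ?thesis by (simp add: S_def)
 qed
 have zS: "z \<in> S" using assms by (simp add: S_def)
 obtain c where "minimal_tripotent T c" "c \<in> S" by (rule exists_minimal_tripotent[OF S cube zS z her])
 hence "EX c. minimal_tripotent T c & (\<forall>i\<in>{1..r}. jordan_orthogonal T c (e i))"
  using o1(1) by (auto simp: jordan_orthogonal_def)
 thus False using frm by (simp add: frame_def)
qed

abbreviation un :: "complex^'n" where "un \<equiv> esum {1..r}"

abbreviation Z :: "nat => nat => (complex^'n) set" where "Z i j \<equiv> peirce T r e i j"

lemma Z_iff: "z \<in> Z i j \<longleftrightarrow> (\<forall>k\<in>{1..r}. L k z = (of_bool (i = k) + of_bool (j = k)) *s z)"
 by (simp add: peirce_def)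

lemma ZD: "z \<in> Z i j ==> k \<in> {1..r} ==> L k z = (of_bool (i = k) + of_bool (j = k)) *s z" by (simp add: Z_iff)
lemma Z_sym: "Z i j = Z j i" by (auto simp: Z_iff add.commute)

lemma Z_pspace: "z \<in> Z i j ==> k \<in> {1..r} ==> z \<in> pspace (e k) (of_bool (i = k) + of_bool (j = k))"
 by (auto simp: Z_iff pspace_def)

lemma Z_subspace: "vec.subspace (Z i j)" by (auto simp: vec.subspace_def Z_iff T_simps vec_eq_iff algebra_simps)
lemma vec_dim_zeroD: "vec.dim S = 0 ==> x \<in> S ==> x = (0::complex^'m)" using vec.dim_eq_0 by blast

lemma Z0_zero: assumes "j \<in> {1..r}" "z \<in> Z 0 j" shows "z = 0"
 by (rule vec_dim_zeroD[OF _ assms(2)]) (use mult assms(1) in "auto simp: characteristic_multiplicities_def")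

lemma un_tripotent: "tripotent T un" by (rule esum_tripotent) simp

lemma L_pspace2: assumes "i \<in> {1..r}" "k \<in> {1..r}" "k ~= i" "x \<in> pspace (e i) 2" shows "L k x = 0" proof -
 have "e k \<in> pspace (e i) 0" using L_e[OF assms(2,1)] assms(3) by (simp add: pspace_def)
 hence "T x (e k) (e k) = 0" by (rule T_pspace_20[OF e_tripotent[OF assms(1)] assms(4)])
 thus ?thesis by (simp add: T_commute[of x])
qed

lemma unit_pspace2: assumes z: "z \<in> pspace (e k) 2" and k: "k \<in> J" "J \<subseteq> {1..r}" shows "z \<in> pspace (esum J) 2" proof -
 have kr: "k \<in> {1..r}" using k by auto
 have "L j z = (if j = k then 2 *s z else 0)" if "j \<in> J" for j using L_pspace2[OF kr _ _ z, of j] pspaceD[OF z] that k by auto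
 hence "T (esum J) (esum J) z = (\<Sum>j\<in>J. if j = k then 2 *s z else 0)" unfolding T_esum[OF k(2)] by (intro sum.cong refl) auto
 also have "... = 2 *s z" using k finite_subset[OF k(2)] by (simp add: sum.delta')
 finally show ?thesis by (simp add: pspace_def)
qed

definition pidx :: "(nat \<times> nat) set" where "pidx = {(i, j). 1 <= i & i <= j & j <= r}"

definition PP :: "nat \<times> nat => complex^'n => complex^'n" where
 "PP = (%(i, j) z. if i = j then pproj (e i) 2 z else pproj (e i) 1 (pproj (e j) 1 z))"

lemma pidx_finite: "finite pidx" by (rule finite_subset[of _ "{1..r} \<times> {1..r}"]) (auto simp: pidx_def)
lemma PP_clin: "clin (PP t)" by (cases t) (auto simp: PP_def intro!: clinI simp: clin_add[OF pproj_clin] clin_scale[OF pproj_clin])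

lemma pproj_L_commute: assumes "j \<in> {1..r}" "k \<in> {1..r}" shows "pproj (e j) m (L k z) = L k (pproj (e j) m z)"
 using L_commute[OF assms] by (simp add: pproj_def T_simps)

text \<open>A further \<open>D(e\<^sub>k,e\<^sub>k)\<close> annihilates this space: \<open>e\<^sub>i + e\<^sub>j + e\<^sub>k\<close> is a tripotent, hence the total weight
  is at most \<open>2\<close>.\<close>

lemma Z_pproj: assumes "i \<in> {1..r}" "j \<in> {1..r}" "i ~= j" shows "pproj (e i) 1 (pproj (e j) 1 z) \<in> Z i j" proof -
 let ?y = "pproj (e i) 1 (pproj (e j) 1 z)"
 have i: "L i ?y = ?y" using pspaceD[OF pproj_mem[OF e_tripotent[OF assms(1)], of 1]] by simp
 have "L j (pproj (e j) 1 z) = pproj (e j) 1 z" using pspaceD[OF pproj_mem[OF e_tripotent[OF assms(2)], of 1]] by simp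
 hence j: "L j ?y = ?y" using pproj_L_commute[OF assms(1,2), of 1 "pproj (e j) 1 z"] by simp
 have "L k ?y = 0" if k: "k \<in> {1..r}" "k ~= i" "k ~= j" for k proof -
  let ?g = "esum {i, j, k}"
  have g: "tripotent T ?g" by (rule esum_tripotent) (use assms k in auto)
  have Tg: "T ?g ?g w = L i w + L j w + L k w" for w using T_esum[of "{i, j, k}" w] assms k by (simp add: add.assoc)
  have eig: "L i (pproj (e k) m ?y) = pproj (e k) m ?y" "L j (pproj (e k) m ?y) = pproj (e k) m ?y" for m
   using pproj_L_commute[OF k(1) assms(1), of m ?y] pproj_L_commute[OF k(1) assms(2), of m ?y] i j by simp_all
  have "pproj (e k) m ?y = 0" if "m \<in> {1, 2}" for m proof (rule tripotent_eigenvalue[OF g])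
   have "L k (pproj (e k) m ?y) = of_nat m *s pproj (e k) m ?y" by (rule pspaceD[OF pproj_mem[OF e_tripotent[OF k(1)]]]) (use that in auto)
   thus "T ?g ?g (pproj (e k) m ?y) = of_nat (2 + m) *s pproj (e k) m ?y" by (simp add: Tg eig vec_eq_iff algebra_simps)
   have "of_nat (2 + m) ~= (of_nat q :: complex)" if "q <= 2" for q using that `m \<in> {1, 2}` by (subst of_nat_eq_iff) auto
   from this[of 0] this[of 1] this[of 2] show "(of_nat (2 + m) :: complex) \<notin> {0, 1, 2}" by simp
  qed
  hence "pproj (e k) 1 ?y = 0" "pproj (e k) 2 ?y = 0" by auto
  hence "?y = pproj (e k) 0 ?y" using pproj_sum[of "e k" ?y] by (metis add.right_neutral)
  hence "L k ?y = L k (pproj (e k) 0 ?y)" by simp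
  also have "... = 0" using pspaceD[OF pproj_mem[OF e_tripotent[OF k(1)], of 0]] by simp
  finally show ?thesis .
 qed
 thus ?thesis using i j assms by (auto simp: Z_iff)
qed

lemma PP_Z: assumes "(i, j) \<in> pidx" shows "PP (i, j) z \<in> Z i j" proof (cases "i = j")
 case False
 thus ?thesis using Z_pproj[of i j z] assms by (auto simp: PP_def pidx_def)
next
 case True
 have i: "i \<in> {1..r}" using assms by (auto simp: pidx_def)
 let ?y = "pproj (e i) 2 z"
 have y: "?y \<in> pspace (e i) 2" by (rule pproj_mem[OF e_tripotent[OF i]]) simp
 have "L k ?y = 0" if "k \<in> {1..r}" "k ~= i" for k by (rule L_pspace2[OF i that y])
 thus ?thesis using pspaceD[OF y] True by (auto simp: Z_iff PP_def)
qed

lemma PP_on_Z: assumes "(i, j) \<in> pidx" "(k, m) \<in> pidx" "z \<in> Z i j" shows "PP (k, m) z = (if (k, m) = (i, j) then z else 0)"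
proof -
 have r: "k \<in> {1..r}" "m \<in> {1..r}" "i <= j" "k <= m" using assms by (auto simp: pidx_def)
 have wk: "pproj (e k) q z = (if q = of_bool (i = k) + of_bool (j = k) then z else 0)" if "q <= 2" for q
  using pproj_pspace[OF Z_pspace[OF assms(3) r(1)] that] by (auto split: if_splits)
 have wm: "pproj (e m) q z = (if q = of_bool (i = m) + of_bool (j = m) then z else 0)" if "q <= 2" for q
  using pproj_pspace[OF Z_pspace[OF assms(3) r(2)] that] by (auto split: if_splits)
 show ?thesis proof (cases "k = m")
  case True
  thus ?thesis using wk[of 2] r by (auto simp: PP_def)
 next
  case False
  thus ?thesis using wk[of 1] wm[of 1] r clin_zero[OF pproj_clin, of "e k" 1] by (auto simp: PP_def split: if_splits)
 qed
qed

text \<open>For \<open>i \<noteq> j\<close> the product of \<open>D(e\<^sub>i,e\<^sub>i)\<close> and \<open>D(e\<^sub>j,e\<^sub>j)\<close> is the projection to \<open>Z i j\<close>.  So on the part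
  \<open>w\<close> not covered by the \<open>Z i j\<close> with \<open>i, j \<ge> 1\<close> these operators are mutually orthogonal
  projections onto the \<open>Z\<^sub>0\<^sub>j\<close>, which vanish for tube type.\<close>

lemma PP_sum: "(\<Sum>t\<in>pidx. PP t z) = z" proof -
 define w where "w = z - (\<Sum>t\<in>pidx. PP t z)"
 have PPw: "PP t w = 0" if "t \<in> pidx" for t proof -
  have "PP t (PP u z) = (if u = t then PP t z else 0)" if u: "u \<in> pidx" for u
   using PP_on_Z[of "fst u" "snd u" "fst t" "snd t" "PP u z"] PP_Z[of "fst u" "snd u" z] u `t \<in> pidx` by auto
  hence "(\<Sum>u\<in>pidx. PP t (PP u z)) = (\<Sum>u\<in>pidx. if u = t then PP t z else 0)" by (intro sum.cong refl)
  thus ?thesis using that pidx_finite by (simp add: w_def clin_diff[OF PP_clin] clin_sum[OF PP_clin] sum.delta)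
 qed
 have dec: "L i x = 2 *s pproj (e i) 2 x + pproj (e i) 1 x" for i x by (simp add: pproj_def vec_eq_iff field_simps)
 have p2: "pproj (e i) 2 w = 0" if "i \<in> {1..r}" for i using PPw[of "(i, i)"] that by (simp add: PP_def pidx_def)
 have L1: "L i w = pproj (e i) 1 w" if "i \<in> {1..r}" for i using dec[of i w] p2[OF that] by simp
 have LL: "L i (L i w) = L i w" if "i \<in> {1..r}" for i
  using pspaceD[OF pproj_mem[OF e_tripotent[OF that], of 1]] by (simp add: L1[OF that])
 have "L i (L j w) = 0" if ij: "(i, j) \<in> pidx" "i ~= j" for i j proof -
  have m: "i \<in> {1..r}" "j \<in> {1..r}" using ij by (auto simp: pidx_def)
  have "pproj (e i) 2 (L j w) = 0" using pproj_L_commute[OF m, of 2 w] by (simp add: p2[OF m(1)])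
  hence "L i (L j w) = PP (i, j) w" using dec[of i "L j w"] ij(2) by (simp add: PP_def L1[OF m(2)])
  thus ?thesis using PPw[OF ij(1)] by simp
 qed
 hence lt: "L i (L j w) = 0" if "i < j" "i \<in> {1..r}" "j \<in> {1..r}" for i j using that by (simp add: pidx_def)
 have "L i (L j w) = 0" if ij: "i \<in> {1..r}" "j \<in> {1..r}" "i ~= j" for i j
  using lt[OF _ ij(1,2)] lt[OF _ ij(2,1)] ij(3) unfolding L_commute[OF ij(1,2)] by (meson linorder_neqE_nat)
 hence "L k w \<in> Z 0 k" if "k \<in> {1..r}" for k using LL that by (auto simp: Z_iff)
 hence "L k w = 0" if "k \<in> {1..r}" for k using Z0_zero[OF that] that by simp
 hence "w = 0" by (rule L_all_zero)
 thus ?thesis by (simp add: w_def)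
qed

lemma sum_L: "(\<Sum>k\<in>{1..r}. L k z) = 2 *s z" proof -
 have "(\<Sum>k\<in>{1..r}. L k x) = 2 *s x" if "(i, j) \<in> pidx" "x \<in> Z i j" for i j x proof -
  have "(\<Sum>k\<in>{1..r}. L k x) = (\<Sum>k\<in>{1..r}. (if k = i then x else 0) + (if k = j then x else 0))"
   using ZD[OF that(2)] by (intro sum.cong refl) (auto simp: vec_eq_iff)
  also have "... = 2 *s x" using that(1) by (simp add: sum.distrib pidx_def vec_eq_iff)
  finally show ?thesis .
 qed
 from this[OF _ PP_Z] have "(\<Sum>k\<in>{1..r}. L k (PP t z)) = 2 *s PP t z" if "t \<in> pidx" for t using that by (cases t) auto
 hence "(\<Sum>t\<in>pidx. \<Sum>k\<in>{1..r}. L k (PP t z)) = 2 *s (\<Sum>t\<in>pidx. PP t z)" by (simp add: vec.scale_sum_right)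
 thus ?thesis by (subst (asm) sum.swap) (simp only: T_sum(3)[symmetric] PP_sum)
qed

lemma pspace_unit: "z \<in> pspace un 2" using T_esum[OF order_refl, of z] sum_L[of z] by (simp add: pspace_def)

lemma PP_resolution: "resolution pidx PP" unfolding resolution_def proof (intro conjI ballI allI)
 fix k m x assume km: "k \<in> pidx" "m \<in> pidx"
 obtain i j where m: "m = (i, j)" by (cases m)
 obtain i' j' where k: "k = (i', j')" by (cases k)
 show "PP k (PP m x) = (if k = m then PP k x else 0)" using PP_on_Z[of i j i' j' "PP m x"] PP_Z[of i j x] km by (auto simp: k m)
qed (auto simp: pidx_finite PP_clin PP_sum)

lemma range_PP: "(i, j) \<in> pidx ==> range (PP (i, j)) = Z i j" using PP_Z[of i j] PP_on_Z[of i j i j] by (auto simp: image_iff) metis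

lemma Z_diag: assumes "i \<in> {1..r}" "z \<in> Z i i" shows "EX s. z = s *s e i"
 using minimal_tripotent_pspace2[OF e_minimal[OF assms(1)], of z] Z_pspace[OF assms(2,1)] by (simp add: numeral_2_eq_2)

lemma e_Z: "i \<in> {1..r} ==> e i \<in> Z i i" using L_e[of i] by (auto simp: Z_iff)

lemma dim_Z: "(i, j) \<in> pidx ==> vec.dim (Z i j) = (if i = j then 1 else a)" proof (cases "i = j")
 case True
 assume t: "(i, j) \<in> pidx"
 hence i: "i \<in> {1..r}" by (auto simp: pidx_def)
 have "Z i i = vec.span {e i}" using Z_diag[OF i] vec.span_minimal[OF _ Z_subspace[of i i], of "{e i}"] e_Z[OF i]
  by (auto simp: vec.span_singleton)
 hence "vec.dim (Z i i) = card {e i}" using e_nonzero[OF i] vec.dim_span_eq_card_independent[of "{e i}"] by simp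
 thus ?thesis using True by simp
next
 case False
 assume "(i, j) \<in> pidx"
 thus ?thesis using False mult by (auto simp: pidx_def characteristic_multiplicities_def)
qed

text \<open>A basis adapted to the joint Peirce decomposition of the frame; \<open>ty\<close> is the type of its members.\<close>

definition frame_basis :: "('n => nat \<times> nat) => ('n => complex^'n) => bool" where
 "frame_basis ty b \<longleftrightarrow>
  (ALL x. ty x \<in> pidx) & (ALL x. b x \<in> Z (fst (ty x)) (snd (ty x))) & invertible (\<chi> i j. b j $ i) &
  (ALL i j. (i, j) \<in> pidx --> card {x. ty x = (i, j)} = (if i = j then 1 else a))"

lemma frame_basisD: assumes "frame_basis ty b"
 shows "ALL x. ty x \<in> pidx" "ALL x. b x \<in> Z (fst (ty x)) (snd (ty x))" "invertible (\<chi> i j. b j $ i)"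
  "ALL i j. (i, j) \<in> pidx --> card {x. ty x = (i, j)} = (if i = j then 1 else a)" using assms unfolding frame_basis_def by blast+

lemma frame_basis_exists: obtains ty b where "frame_basis ty b" proof -
 obtain ty :: "'n => nat \<times> nat" and b :: "'n => complex^'n" where
  b: "ALL x. ty x \<in> pidx" "ALL x. PP (ty x) (b x) = b x" "invertible (\<chi> i j. b j $ i)"
  "\<forall>k\<in>pidx. card {x. ty x = k} = vec.dim (range (PP k))" by (rule adapted_basis[OF PP_resolution], rule that)
 have "b x \<in> Z (fst (ty x)) (snd (ty x))" for x using PP_Z[of "fst (ty x)" "snd (ty x)" "b x"] b(1,2) by simp
 moreover have "card {x. ty x = (i, j)} = (if i = j then 1 else a)" if "(i, j) \<in> pidx" for i j
  using b(4) that dim_Z[OF that] range_PP[OF that] by simp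
 ultimately show ?thesis using b(1,3) by (intro that[of ty b]) (auto simp: frame_basis_def)
qed

end

context tube_frame
begin

declare One_nat_def [simp del]

section \<open>Multiplication rules\<close>

abbreviation st :: "complex^'n => complex^'n" where "st \<equiv> star un"
abbreviation jo :: "complex^'n => complex^'n => complex^'n" where "jo \<equiv> jp un"

lemma st_st [simp]: "st (st x) = x" by (rule star_star[OF un_tripotent pspace_unit])
lemma jo_unit [simp]: "jo un x = x" "jo x un = x" by (rule jp_unit[OF un_tripotent pspace_unit])+
lemma st_jo: "st (jo x y) = jo (st x) (st y)" by (rule star_jp[OF un_tripotent pspace_unit pspace_unit])
lemma ip_jo: "ip (jo x y) w = ip y (jo (st x) w)" by (rule ip_jp[OF un_tripotent pspace_unit])
lemma T_jo: "T u y w = 2 *s (jo (jo (st y) u) w + jo u (jo (st y) w) - jo (st y) (jo u w))" by (rule T_formula[OF un_tripotent pspace_unit])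
lemma st_un [simp]: "st un = un" by (rule star_unit[OF un_tripotent])
lemma st_T: "st (T u y w) = T (st u) (st y) (st w)" by (simp add: T_jo star_simps st_jo)
lemma T_un: "T x un y = 2 *s jo x y" by (rule T_eq_jp)
lemma ip_eq_un: "ip x y = ip un (jo (st x) y)" using ip_jo[of x un y] by simp
lemma ip_st: "ip (st x) (st y) = ip y x" by (simp add: ip_eq_un[of "st x"] ip_eq_un[of y] jp_commute)
lemma jo_sum_T: "jo x y = (1/2) *s (\<Sum>m\<in>{1..r}. T x (e m) y)" by (simp add: jp_def esum_def T_sum)

lemma L_jo: "k \<in> {1..r} ==> L k z = 2 *s jo (e k) z" proof -
 assume k: "k \<in> {1..r}"
 have "(\<Sum>m\<in>{1..r}. T (e k) (e m) z) = (\<Sum>m\<in>{1..r}. if m = k then L k z else 0)"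
  using e_orth[OF k] by (intro sum.cong refl) auto
 thus ?thesis using k by (simp add: jo_sum_T sum.delta)
qed

lemma st_e: assumes k: "k \<in> {1..r}" shows "st (e k) = e k" proof -
 have "T un (e k) un = (\<Sum>i\<in>{1..r}. T (e i) (e k) un)" by (simp add: esum_def T_sum(1))
 also have "... = (\<Sum>i\<in>{1..r}. if i = k then L k un else 0)" using e_orth[OF _ k] by (intro sum.cong refl) auto
 also have "... = L k un" using k by (simp add: sum.delta)
 also have "... = 2 *s e k" using L_jo[OF k, of un] by simp
 finally show ?thesis by (simp add: star_def)
qed

lemma jo_e: "z \<in> Z i j ==> k \<in> {1..r} ==> jo (e k) z = ((of_bool (i = k) + of_bool (j = k)) / 2) *s z" proof -
 assume z: "z \<in> Z i j" and k: "k \<in> {1..r}"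
 have "jo (e k) z = (1/2) *s L k z" using L_jo[OF k, of z] by (simp add: vec_eq_iff)
 thus ?thesis unfolding ZD[OF z k] vector_smult_assoc by (simp only: times_divide_eq_left mult_1_left)
qed

lemma st_Z: "x \<in> Z i j ==> st x \<in> Z i j" proof -
 assume x: "x \<in> Z i j"
 have "L k (st x) = st (L k x)" if "k \<in> {1..r}" for k using L_jo[OF that] st_jo[of "e k" x] st_e[OF that] by (simp add: star_simps)
 thus ?thesis using ZD[OF x] by (auto simp: Z_iff star_simps)
qed

lemma T_Z_weight:
 assumes "x \<in> Z i j" "y \<in> Z k l" "w \<in> Z m n" "q \<in> {1..r}"
 shows "L q (T x y w) = ((of_bool (i = q) + of_bool (j = q)) - (of_bool (k = q) + of_bool (l = q))
   + (of_bool (m = q) + of_bool (n = q))) *s T x y w" using T_weight[OF ZD[OF assms(1,4)] ZD[OF assms(2,4)] ZD[OF assms(3,4)]] by simp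

lemma T_e_zero:
 assumes "x \<in> Z i j" "y \<in> Z k l" "m \<in> {1..r}"
  "(of_bool (i = m) + of_bool (j = m)) + (of_bool (k = m) + of_bool (l = m)) < (2::nat)" shows "T x (e m) y = 0"
 by (rule T_pspace_zero[OF e_tripotent[OF assms(3)] Z_pspace[OF assms(1,3)]
    tripotent_pspace[OF e_tripotent[OF assms(3)]] Z_pspace[OF assms(2,3)]])
   (use assms(4) in "auto split: if_splits simp: of_bool_def")

lemma jo_disjoint:
 assumes "x \<in> Z i j" "y \<in> Z k l" "{i, j} \<inter> {k, l} = {}" shows "jo x y = 0" proof -
 have "T x (e m) y = 0" if "m \<in> {1..r}" for m proof (cases "m \<in> {i, j}")
  case False
  hence "x \<in> pspace (e m) 0" using Z_pspace[OF assms(1) that] by auto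
  thus ?thesis by (rule T_pspace_02[OF e_tripotent[OF that] tripotent_pspace[OF e_tripotent[OF that]]])
 next
  case True
  hence "y \<in> pspace (e m) 0" using assms(3) Z_pspace[OF assms(2) that] by auto
  hence "T y (e m) x = 0" by (rule T_pspace_02[OF e_tripotent[OF that] tripotent_pspace[OF e_tripotent[OF that]]])
  thus ?thesis by (simp add: T_commute[of x])
 qed
 thus ?thesis by (simp add: jo_sum_T)
qed

text \<open>By weights, only the summand \<open>e j\<close> of the unit contributes to \<open>{x; un; y}\<close>.\<close>

lemma jo_chain:
 assumes "x \<in> Z i j" "y \<in> Z j k" "i ~= j" "j ~= k" "i ~= k" "j \<in> {1..r}" shows "jo x y \<in> Z i k" proof -
 have "T x (e m) y = 0" if "m \<in> {1..r}" "m ~= j" for m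
  by (rule T_e_zero[OF assms(1,2) that(1)]) (use that assms in "auto simp: of_bool_def")
 hence "(\<Sum>m\<in>{1..r}. T x (e m) y) = (\<Sum>m\<in>{1..r}. if m = j then T x (e j) y else 0)" by (intro sum.cong refl) auto
 hence jo: "jo x y = (1/2) *s T x (e j) y" using assms(6) by (simp add: jo_sum_T sum.delta)
 have "T x (e j) y \<in> Z i k" unfolding Z_iff using T_Z_weight[OF assms(1) e_Z[OF assms(6)] assms(2)] by auto
 thus ?thesis unfolding jo by (rule vec.subspace_scale[OF Z_subspace])
qed

text \<open>The genus for \<open>b = 0\<close>.\<close>

definition pnum :: nat where "pnum = 2 + a * (r - 1)"

lemma sum_by_type:
 fixes ty :: "'n => nat \<times> nat" and f :: "nat \<times> nat => 'b::comm_ring_1"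
 assumes "ALL x. ty x \<in> pidx"
  "ALL i j. (i, j) \<in> pidx --> card {x. ty x = (i, j)} = (if i = j then 1 else a)"
 shows "(\<Sum>x\<in>UNIV. f (ty x)) = (\<Sum>(i, j)\<in>pidx. of_nat (if i = j then 1 else a) * f (i, j))" proof -
 have "(\<Sum>x\<in>UNIV. f (ty x)) = (\<Sum>t\<in>pidx. \<Sum>x\<in>{x\<in>UNIV. ty x = t}. f (ty x))"
  by (rule sum.group[symmetric]) (use assms(1) pidx_finite in auto)
 also have "... = (\<Sum>(i, j)\<in>pidx. of_nat (if i = j then 1 else a) * f (i, j))" proof (intro sum.cong refl)
  fix t assume t: "t \<in> pidx"
  obtain i j where ij: "t = (i, j)" by (cases t)
  have "(\<Sum>x\<in>{x\<in>UNIV. ty x = t}. f (ty x)) = of_nat (card {x. ty x = (i, j)}) * f (i, j)" by (simp add: ij)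
  thus "(\<Sum>x\<in>{x\<in>UNIV. ty x = t}. f (ty x)) = (case t of (i, j) => of_nat (if i = j then 1 else a) * f (i, j))"
   using assms(2) t ij by simp
 qed
 finally show ?thesis .
qed

lemma prod_by_type:
 fixes ty :: "'n => nat \<times> nat" and f :: "nat \<times> nat => 'b::comm_ring_1"
 assumes "ALL x. ty x \<in> pidx"
  "ALL i j. (i, j) \<in> pidx --> card {x. ty x = (i, j)} = (if i = j then 1 else a)"
 shows "(\<Prod>x\<in>UNIV. f (ty x)) = (\<Prod>(i, j)\<in>pidx. f (i, j) ^ (if i = j then 1 else a))" proof -
 have "(\<Prod>x\<in>UNIV. f (ty x)) = (\<Prod>t\<in>pidx. \<Prod>x\<in>{x\<in>UNIV. ty x = t}. f (ty x))"
  by (rule prod.group[symmetric]) (use assms(1) pidx_finite in auto)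
 also have "... = (\<Prod>(i, j)\<in>pidx. f (i, j) ^ (if i = j then 1 else a))" proof (intro prod.cong refl)
  fix t assume t: "t \<in> pidx"
  obtain i j where ij: "t = (i, j)" by (cases t)
  have "(\<Prod>x\<in>{x\<in>UNIV. ty x = t}. f (ty x)) = f (i, j) ^ card {x. ty x = (i, j)}" by (simp add: ij)
  thus "(\<Prod>x\<in>{x\<in>UNIV. ty x = t}. f (ty x)) = (case t of (i, j) => f (i, j) ^ (if i = j then 1 else a))"
   using assms(2) t ij by simp
 qed
 finally show ?thesis .
qed

lemma pidx_Sigma: "pidx = Sigma {1..r} (%i. {i..r})" by (auto simp: pidx_def)

text \<open>The trace of \<open>D(e\<^sub>k,e\<^sub>k)\<close>: each \<open>Z i j\<close> contributes its dimension times the weight of \<open>e\<^sub>k\<close> on it.\<close>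

lemma ip_e: assumes k: "k \<in> {1..r}" shows "ip (e k) (e k) = of_nat pnum" proof -
 obtain ty b where "frame_basis ty b" by (rule frame_basis_exists)
 note b = frame_basisD[OF this]
 let ?f = "%t::nat \<times> nat. (of_bool (fst t = k) + of_bool (snd t = k) :: complex)"
 have "ip (e k) (e k) = (\<Sum>x\<in>UNIV. ?f (ty x))" unfolding ip_def by (rule trace_eigenbasis[OF T_clin3 b(3)]) (use b(2) ZD k in blast)
 also have "... = (\<Sum>(i, j)\<in>pidx. of_nat (if i = j then 1 else a) * ?f (i, j))" by (rule sum_by_type[OF b(1,4)])
 also have "... = (\<Sum>i\<in>{1..r}. \<Sum>j\<in>{i..r}. of_nat (if i = j then 1 else a) * ?f (i, j))"
  unfolding pidx_Sigma by (rule sum.Sigma[symmetric]) auto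
 also have "... = (\<Sum>i\<in>{1..r}. if i = k then of_nat (2 + a * (r - k)) else if i < k then of_nat a else 0)"
 proof (intro sum.cong refl)
  fix i assume i: "i \<in> {1..r}"
  consider "i = k" | "i < k" | "i > k" by linarith
  thus "(\<Sum>j\<in>{i..r}. of_nat (if i = j then 1 else a) * ?f (i, j)) = (if i = k then of_nat (2 + a * (r - k)) else if i < k then of_nat a else 0)"
  proof cases
   case 1
   have "{i..r} = insert i {i<..r}" using i by auto
   hence "(\<Sum>j\<in>{i..r}. of_nat (if i = j then 1 else a) * ?f (i, j)) = 2 + (\<Sum>j\<in>{i<..r}. of_nat (if i = j then 1 else a) * ?f (i, j))"
    using 1 by simp
   also have "(\<Sum>j\<in>{i<..r}. of_nat (if i = j then 1 else a) * ?f (i, j)) = (\<Sum>j\<in>{i<..r}. of_nat a)"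
    using 1 by (intro sum.cong refl) auto
   finally show ?thesis using 1 by simp
  next
   case 2
   have "(\<Sum>j\<in>{i..r}. of_nat (if i = j then 1 else a) * ?f (i, j)) = (\<Sum>j\<in>{i..r}. if j = k then of_nat a else 0)"
    using 2 by (intro sum.cong refl) auto
   thus ?thesis using 2 k by (simp add: sum.delta)
  next
   case 3
   thus ?thesis by (auto intro!: sum.neutral)
  qed
 qed
 also have "{1..r} = insert k ({1..<k} \<union> {k<..r})" using k by auto
 also have "(\<Sum>i\<in>insert k ({1..<k} \<union> {k<..r}). if i = k then of_nat (2 + a * (r - k)) else if i < k then of_nat a else (0::complex))
   = of_nat (2 + a * (r - k)) + (\<Sum>i\<in>{1..<k} \<union> {k<..r}. if i < k then of_nat a else 0)"
  by (subst sum.insert) (auto intro!: sum.cong)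
 also have "(\<Sum>i\<in>{1..<k} \<union> {k<..r}. if i < k then of_nat a else (0::complex)) = (\<Sum>i\<in>{1..<k}. of_nat a)"
  by (rule sum.mono_neutral_cong_right) auto
 also have "of_nat (2 + a * (r - k)) + (\<Sum>i\<in>{1..<k}. of_nat a) = (of_nat (2 + a * (r - k) + (k - 1) * a) :: complex)" by simp
 also have "2 + a * (r - k) + (k - 1) * a = pnum" proof -
  have "r - 1 = (r - k) + (k - 1)" using k by auto
  thus ?thesis by (simp add: pnum_def algebra_simps)
 qed
 finally show ?thesis .
qed

lemma pnum_pos: "pnum > 0" by (simp add: pnum_def)

lemma ip_Z_orth:
 assumes "x \<in> Z i j" "y \<in> Z k l" "q \<in> {1..r}"
  "of_bool (i = q) + of_bool (j = q) ~= (of_bool (k = q) + of_bool (l = q) :: nat)" shows "ip x y = 0" proof -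
 have "(of_bool (i = q) + of_bool (j = q)) * ip x y = cnj (of_bool (k = q) + of_bool (l = q)) * ip x y"
  using ip_adjoint[of "e q" "e q" x y] unfolding ZD[OF assms(1,3)] ZD[OF assms(2,3)] ip_scale .
 thus ?thesis using assms(4) by (cases "i = q"; cases "j = q"; cases "k = q"; cases "l = q") simp_all
qed

definition bq :: "complex^'n => complex^'n => complex" where
 "bq x y = ip x (st y) / (2 * of_nat pnum)"

lemma bq_commute: "bq x y = bq y x" using ip_st[of "st y" x] by (simp add: bq_def)

text \<open>The off-diagonal Peirce spaces carry the quadratic form of a spin factor.\<close>

lemma jo_spin:
 assumes x: "x \<in> Z i j" and y: "y \<in> Z i j" and ij: "i \<in> {1..r}" "j \<in> {1..r}" "i ~= j" shows "jo x y = bq x y *s (e i + e j)"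
proof -
 have "T x (e m) y = 0" if "m \<in> {1..r}" "m ~= i" "m ~= j" for m by (rule T_e_zero[OF x y that(1)]) (use that in auto)
 hence "(\<Sum>m\<in>{1..r}. T x (e m) y) = (\<Sum>m\<in>{1..r}. (if m = i then T x (e i) y else 0) + (if m = j then T x (e j) y else 0))"
  using ij by (intro sum.cong refl) auto
 hence jo: "jo x y = (1/2) *s (T x (e i) y + T x (e j) y)" using ij by (simp add: jo_sum_T sum.distrib sum.delta)
 have "T x (e i) y \<in> Z j j" unfolding Z_iff using T_Z_weight[OF x e_Z[OF ij(1)] y] ij by auto
 then obtain s where s: "T x (e i) y = s *s e j" using Z_diag[OF ij(2)] by blast
 have "T x (e j) y \<in> Z i i" unfolding Z_iff using T_Z_weight[OF x e_Z[OF ij(2)] y] ij by auto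
 then obtain t where t: "T x (e j) y = t *s e i" using Z_diag[OF ij(1)] by blast
 have jj: "jo x y = (t/2) *s e i + (s/2) *s e j" unfolding jo s t by (simp add: vec_eq_iff field_simps)
 have c: "ip (jo x y) (e k) = ip x (st y) / 2" if "k = i \<or> k = j" for k proof -
  have k: "k \<in> {1..r}" using that ij by auto
  have "ip (jo x y) (e k) = ip (jo y x) (e k)" by (simp add: jp_commute)
  also have "... = ip x (jo (st y) (e k))" by (rule ip_jo)
  also have "... = ip x (jo (e k) (st y))" by (simp only: jp_commute)
  also have "jo (e k) (st y) = (1/2) *s st y" using jo_e[OF st_Z[OF y] k] that ij by auto
  finally show ?thesis by (simp add: ip_scale)
 qed
 have eij: "ip (e i) (e j) = 0" "ip (e j) (e i) = 0"
  using ip_Z_orth[OF e_Z[OF ij(1)] e_Z[OF ij(2)] ij(1)] ip_Z_orth[OF e_Z[OF ij(2)] e_Z[OF ij(1)] ij(1)] ij by auto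
 have "t / 2 * of_nat pnum = ip x (st y) / 2" "s / 2 * of_nat pnum = ip x (st y) / 2"
  using c[of i] c[of j] ij by (simp_all add: jj ip_add ip_scale eij ip_e)
 hence "t / 2 = bq x y" "s / 2 = bq x y" using pnum_pos by (auto simp: bq_def field_simps)
 thus ?thesis by (simp add: jj vec_eq_iff algebra_simps)
qed

text \<open>Unit vectors in the real form of \<open>Z i j\<close>.\<close>

definition unit_vec :: "nat => nat => complex^'n => bool" where
 "unit_vec i j v \<longleftrightarrow> v \<in> Z i j & st v = v & jo v v = e i + e j"

lemma real_multiple_unit_vec:
 assumes x: "x \<in> Z i j" "st x = x" and ij: "i \<in> {1..r}" "j \<in> {1..r}" "i ~= j" and nz: "x ~= 0"
 obtains v t where "unit_vec i j v" "x = of_real t *s v" "t ~= 0" proof -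
 define t where "t = sqrt (Re (ip x x) / (2 * real pnum))"
 have pos: "Re (ip x x) / (2 * real pnum) > 0" using ip_pos[OF nz] pnum_pos by simp
 have t: "t > 0" "t * t = Re (ip x x) / (2 * real pnum)"
  using pos unfolding t_def by (simp only: real_sqrt_gt_zero, simp only: real_sqrt_mult_self abs_of_pos)
 have "bq x x = of_real (t * t)" using ip_self_real[of x] by (simp add: bq_def x t)
 hence jx: "jo x x = of_real (t * t) *s (e i + e j)" using jo_spin[OF x(1) x(1) ij] by simp
 let ?v = "of_real (1/t) *s x"
 have "jo ?v ?v = of_real ((1/t) * (1/t) * (t * t)) *s (e i + e j)" by (simp add: jp_scale jx vec_eq_iff)
 moreover have "(1/t) * (1/t) * (t * t) = 1" using t(1) by simp
 ultimately have "jo ?v ?v = e i + e j" by (simp only: of_real_1 vector_smult_lid)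
 hence "unit_vec i j ?v" using x vec.subspace_scale[OF Z_subspace x(1)] by (simp add: unit_vec_def star_scale)
 moreover have "x = of_real t *s ?v" using t by simp
 ultimately show ?thesis using that t by (metis less_irrefl)
qed

lemma Z_real_decomp:
 assumes "x \<in> Z i j"
 obtains y z where "y \<in> Z i j" "st y = y" "z \<in> Z i j" "st z = z" "x = y + \<i> *s z" proof (rule that)
 show "(1/2) *s (x + st x) \<in> Z i j" "(- \<i>/2) *s (x - st x) \<in> Z i j"
  by (intro vec.subspace_scale[OF Z_subspace] vec.subspace_add[OF Z_subspace] vec.subspace_diff[OF Z_subspace] assms st_Z)+
 show "st ((1/2) *s (x + st x)) = (1/2) *s (x + st x)" "st ((- \<i>/2) *s (x - st x)) = (- \<i>/2) *s (x - st x)"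
  by (simp_all add: star_simps vec_eq_iff algebra_simps)
 show "x = (1/2) *s (x + st x) + \<i> *s ((- \<i>/2) *s (x - st x))" by (simp add: vec_eq_iff field_simps)
qed

lemma unit_vec_exists:
 assumes "i \<in> {1..r}" "j \<in> {1..r}" "i ~= j" "a ~= 0"
 obtains v where "unit_vec i j v" proof -
 have "vec.dim (Z i j) ~= 0" using dim_Z[of i j] dim_Z[of j i] assms Z_sym[of i j] by (cases "i < j") (auto simp: pidx_def)
 then obtain x where x: "x \<in> Z i j" "x ~= 0" using vec.dim_eq_0[of "Z i j"] by auto
 obtain y z where yz: "y \<in> Z i j" "st y = y" "z \<in> Z i j" "st z = z" "x = y + \<i> *s z" by (rule Z_real_decomp[OF x(1)], rule that)
 hence "y ~= 0 \<or> z ~= 0" using x(2) by force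
 then consider "y ~= 0" | "z ~= 0" by blast
 thus ?thesis proof cases
  case 1
  show ?thesis by (rule real_multiple_unit_vec[OF yz(1,2) assms(1-3) 1]) (rule that)
 next
  case 2
  show ?thesis by (rule real_multiple_unit_vec[OF yz(3,4) assms(1-3) 2]) (rule that)
 qed
qed

lemma ip_unit_vec_zero:
 assumes ij: "i \<in> {1..r}" "j \<in> {1..r}" "i ~= j" and z: "!!v. unit_vec i j v ==> ip w v = 0" and x: "x \<in> Z i j"
 shows "ip w x = 0" proof -
 have real: "ip w y = 0" if y: "y \<in> Z i j" "st y = y" for y proof (cases "y = 0")
  case False
  obtain v t where "unit_vec i j v" "y = of_real t *s v" "t ~= 0" by (rule real_multiple_unit_vec[OF y ij False], rule that)
  thus ?thesis using z by (simp add: ip_scale)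
 qed simp
 obtain y y' where "y \<in> Z i j" "st y = y" "y' \<in> Z i j" "st y' = y'" "x = y + \<i> *s y'" by (rule Z_real_decomp[OF x], rule that)
 thus ?thesis using real by (simp add: ip_add ip_scale)
qed

section \<open>Scalings along tripotents and reflections\<close>

text \<open>The operators \<open>B((1-s)c, c)\<close>, which scale the Peirce spaces of \<open>c\<close> by the powers of \<open>s\<close>; for
  \<open>s = -1\<close> this is the reflection of the tripotent.\<close>

definition rho :: "complex^'n => complex => complex^'n => complex^'n" where
 "rho c s z = s\<^sup>2 *s pproj c 2 z + s *s pproj c 1 z + pproj c 0 z"

lemma rho_clin: "clin (rho c s)" unfolding rho_def
 by (rule clinI) (simp_all add: clin_add[OF pproj_clin] clin_scale[OF pproj_clin] vec_eq_iff algebra_simps)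

lemma rho_pspace: "z \<in> pspace c k ==> k <= 2 ==> rho c s z = s ^ k *s z"
 using pproj_pspace[of z c k 2] pproj_pspace[of z c k 1] pproj_pspace[of z c k 0]
 by (auto simp: rho_def le_Suc_eq numeral_2_eq_2 One_nat_def power2_eq_square)

lemma rho_mult: assumes "tripotent T c" shows "rho c s (rho c t z) = rho c (s * t) z"
proof (rule peirce_cases[OF assms, of "%z. rho c s (rho c t z) = rho c (s * t) z"])
 show "rho c s (rho c t z) = rho c (s * t) z" if "k <= 2" "z \<in> pspace c k" for k z
  using that by (simp add: rho_pspace[OF that(2,1)] clin_scale[OF rho_clin] power_mult_distrib mult.commute)
qed (simp add: clin_add[OF rho_clin])

lemma rho_1 [simp]: "rho c 1 z = z" using pproj_sum[of c z] by (simp add: rho_def add.commute add.left_commute)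

lemma rho_inverse: "tripotent T c ==> s ~= 0 ==> rho c s (rho c (1/s) z) = z"
 "tripotent T c ==> s ~= 0 ==> rho c (1/s) (rho c s z) = z" by (simp_all add: rho_mult)

lemma rho_bij: "tripotent T c ==> s ~= 0 ==> bij (rho c s)" by (rule bijI') (metis rho_inverse)+

lemma peirce_cases3:
 assumes c: "tripotent T c" and add: "!!x x' y w. P x y w ==> P x' y w ==> P (x + x') y w"
   "!!x y y' w. P x y w ==> P x y' w ==> P x (y + y') w"
   "!!x y w w'. P x y w ==> P x y w' ==> P x y (w + w')"
  and hom: "!!i j k x y w. i <= 2 ==> j <= 2 ==> k <= 2 ==> x \<in> pspace c i ==> y \<in> pspace c j ==> w \<in> pspace c k ==> P x y w"
 shows "P x y w" proof -
 have 1: "P x y w" if "i <= 2" "j <= 2" "x \<in> pspace c i" "y \<in> pspace c j" for i j x y w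
  by (rule peirce_cases[OF c, where P = "P x y"]) (erule (1) add, erule (1) hom[OF that(1,2) _ that(3,4)])
 have 2: "P x y w" if "i <= 2" "x \<in> pspace c i" for i x y w
  by (rule peirce_cases[OF c, where P = "%y. P x y w"]) (erule (1) add, erule (1) 1[OF that(1) _ that(2)])
 show ?thesis by (rule peirce_cases[OF c, where P = "%x. P x y w"]) (erule (1) add, erule (1) 2)
qed

lemma rho_T:
 assumes c: "tripotent T c" shows "T (rho c s x) y (rho c s w) = rho c s (T x (rho c (cnj s) y) w)"
proof (rule peirce_cases3[OF c, where P = "%x y w. T (rho c s x) y (rho c s w) = rho c s (T x (rho c (cnj s) y) w)"])
 fix i j k x y w
 assume that: "i <= 2" "j <= 2" "k <= 2" "x \<in> pspace c i" "y \<in> pspace c j" "w \<in> pspace c k"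
 show "T (rho c s x) y (rho c s w) = rho c s (T x (rho c (cnj s) y) w)" proof (cases "int i - int j + int k \<in> {0, 1, 2}")
  case True
  define m where "m = nat (int i - int j + int k)"
  have m: "int i - int j + int k = int m" "m <= 2" using True by (auto simp: m_def)
  hence mj: "m + j = i + k" by linarith
  have Tm: "T x y w \<in> pspace c m" by (rule T_pspace[OF that(4-6) m(1)])
  have "rho c s (T x (rho c (cnj s) y) w) = (s ^ (m + j)) *s T x y w"
   unfolding rho_pspace[OF that(5,2)] T_scale clin_scale[OF rho_clin] rho_pspace[OF Tm m(2)] by (simp add: power_add mult.commute)
  moreover have "T (rho c s x) y (rho c s w) = (s ^ (i + k)) *s T x y w"
   unfolding rho_pspace[OF that(4,1)] rho_pspace[OF that(6,3)] T_scale by (simp add: power_add)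
  ultimately show ?thesis by (simp add: mj)
 next
  case False
  have z: "T x y w = 0" by (rule T_pspace_zero[OF c that(4-6) False])
  show ?thesis unfolding rho_pspace[OF that(4,1)] rho_pspace[OF that(5,2)] rho_pspace[OF that(6,3)] T_scale z
   by (simp add: clin_zero[OF rho_clin])
 qed
qed (simp_all add: clin_add[OF rho_clin] T_add)

lemma bergman_rho: assumes "tripotent T c" shows "bergman_op T (t *s c) c = rho c (1 - t)" proof
 fix z
 have QQ: "T c (T c z c) c = 4 *s pproj c 2 z" using tripotent_QQ[OF assms, of z] by (simp add: pproj_def vec_eq_iff)
 have L: "T c c z = 2 *s pproj c 2 z + 1 *s pproj c 1 z" by (simp add: pproj_def vec_eq_iff field_simps)
 have z: "z = pproj c 0 z + pproj c 1 z + pproj c 2 z" by (simp only: pproj_sum)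
 have "bergman_op T (t *s c) c z = z - t *s T c c z + (t * t) *s pproj c 2 z"
  by (simp add: bergman_op_def quad_op_def T_scale QQ vec_eq_iff)
 also have "... = (pproj c 0 z + pproj c 1 z + pproj c 2 z) - t *s T c c z + (t * t) *s pproj c 2 z" by (simp only: pproj_sum)
 also have "... = rho c (1 - t) z" unfolding L rho_def by (simp add: vec_eq_iff power2_eq_square algebra_simps)
 finally show "bergman_op T (t *s c) c z = rho c (1 - t) z" .
qed

lemma reflection_formula:
 assumes c: "tripotent T un" and d: "st d = d" "jo d d = d" shows "tripotent T d" "rho d (-1) z = z - 8 *s jo d z + 8 *s jo d (jo d z)"
proof -
 note i = idempotent_tripotent[OF un_tripotent pspace_unit d]
 show "tripotent T d" by (rule i(1))
 show "rho d (-1) z = z - 8 *s jo d z + 8 *s jo d (jo d z)" by (simp add: rho_def pproj_def i(2) jp_scale vec_eq_iff field_simps)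
qed

text \<open>The idempotents \<open>C\<^sup>2 e\<^sub>i + S C v + S\<^sup>2 e\<^sub>j\<close> are the rank one projections of a two by two matrix
  algebra; reflection in one of them rotates \<open>e\<^sub>i\<close> and \<open>e\<^sub>j\<close> by the double angle.\<close>

definition rot_idem :: "nat => nat => complex^'n => real => complex^'n" where
 "rot_idem i j v t = of_real ((cos t)\<^sup>2) *s e i + of_real (sin t * cos t) *s v + of_real ((sin t)\<^sup>2) *s e j"

lemma
 assumes ij: "i \<in> {1..r}" "j \<in> {1..r}" "i ~= j" and v: "unit_vec i j v"
 shows rot_idem_star: "st (rot_idem i j v t) = rot_idem i j v t"
  and rot_idem_idem: "jo (rot_idem i j v t) (rot_idem i j v t) = rot_idem i j v t"
  and rot_idem_reflect_i: "rho (rot_idem i j v (t/2)) (-1) (e i) = rot_idem i j v t"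
  and rot_idem_reflect_j: "rho (rot_idem i j v (t/2)) (-1) (e j) =
    of_real ((sin t)\<^sup>2) *s e i - of_real (sin t * cos t) *s v + of_real ((cos t)\<^sup>2) *s e j"
  and rot_idem_reflect_other: "k \<in> {1..r} ==> k ~= i ==> k ~= j ==> rho (rot_idem i j v t) (-1) (e k) = e k" proof -
 have vZ: "v \<in> Z i j" and stv: "st v = v" and vv: "jo v v = e i + e j" using v by (auto simp: unit_vec_def)
 \<comment> \<open>the constant \<open>1/2\<close> is abstracted so that the identities below are polynomial\<close>
 define h :: complex where "h = 1/2"
 have h: "2 * h = 1" by (simp add: h_def)
 have ev: "jo (e i) v = h *s v" "jo (e j) v = h *s v" "jo v (e i) = h *s v" "jo v (e j) = h *s v"
  using jo_e[OF vZ ij(1)] jo_e[OF vZ ij(2)] ij by (simp_all add: jp_commute h_def)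
 have ee: "jo (e i) (e i) = e i" "jo (e j) (e j) = e j" "jo (e i) (e j) = 0" "jo (e j) (e i) = 0"
  using jo_e[OF e_Z[OF ij(1)] ij(1)] jo_e[OF e_Z[OF ij(2)] ij(2)] jo_e[OF e_Z[OF ij(1)] ij(2)] jo_e[OF e_Z[OF ij(2)] ij(1)] ij by auto
 define C S where "C t = complex_of_real (cos t)" and "S t = complex_of_real (sin t)" for t
 have CS: "C t * C t + S t * S t = 1" for t
  unfolding C_def S_def by (metis of_real_1 of_real_add of_real_mult power2_eq_square sin_cos_squared_add2)
 have d: "rot_idem i j v t = (C t * C t) *s e i + (S t * C t) *s v + (S t * S t) *s e j" for t
  by (simp add: rot_idem_def C_def S_def power2_eq_square)
 show std: "st (rot_idem i j v t) = rot_idem i j v t" for t using ij by (simp add: rot_idem_def star_simps st_e stv)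
 have dei: "jo (rot_idem i j v t) (e i) = (C t * C t) *s e i + (S t * C t * h) *s v" for t by (simp add: d jp_simps ev ee vec_eq_iff)
 have dej: "jo (rot_idem i j v t) (e j) = (S t * S t) *s e j + (S t * C t * h) *s v" for t by (simp add: d jp_simps ev ee vec_eq_iff)
 have dv: "jo (rot_idem i j v t) v = (S t * C t) *s e i + (S t * C t) *s e j + h *s v" for t proof -
  have "jo (rot_idem i j v t) v = (S t * C t) *s e i + (S t * C t) *s e j + ((C t * C t + S t * S t) * h) *s v"
   by (simp add: d jp_simps ev vv vec_eq_iff field_simps)
  thus ?thesis by (simp add: CS)
 qed
 show dd: "jo (rot_idem i j v t) (rot_idem i j v t) = rot_idem i j v t" for t proof -
  have "jo (rot_idem i j v t) (rot_idem i j v t) = (C t * C t) *s e i + (S t * C t) *s v + (S t * S t) *s e j"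
   by (subst (2) d) (unfold jp_simps dei dej dv vec_eq_iff,
     use CS[of t] h in "simp only: vector_add_component vector_minus_component vector_smult_component, intro allI, algebra")
  thus ?thesis by (simp add: d)
 qed
 note R = reflection_formula(2)[OF un_tripotent std dd]
 define c s where "c = C (t/2)" and "s = S (t/2)"
 have cs: "c * c + s * s = 1" by (simp add: c_def s_def CS)
 have dbl: "C t = c * c - s * s" "S t = 2 * s * c"
  using cos_double[of "t/2"] sin_double[of "t/2"] by (simp_all add: C_def S_def c_def s_def power2_eq_square)
 note dei' = dei[of "t/2", folded c_def s_def] and dej' = dej[of "t/2", folded c_def s_def] and dv' = dv[of "t/2", folded c_def s_def]
 have l: "rho (rot_idem i j v (t/2)) (-1) (e i) = (C t * C t) *s e i + (S t * C t) *s v + (S t * S t) *s e j"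
  unfolding R jp_simps dei' dej' dv' vec_eq_iff dbl
  using cs h by (simp only: vector_add_component vector_minus_component vector_smult_component, intro allI) algebra
 thus "rho (rot_idem i j v (t/2)) (-1) (e i) = rot_idem i j v t" by (simp add: d)
 have "rho (rot_idem i j v (t/2)) (-1) (e j) = (S t * S t) *s e i - (S t * C t) *s v + (C t * C t) *s e j"
  unfolding R jp_simps dei' dej' dv' vec_eq_iff dbl
  using cs h by (simp only: vector_add_component vector_minus_component vector_smult_component, intro allI) algebra
 thus "rho (rot_idem i j v (t/2)) (-1) (e j) =
    of_real ((sin t)\<^sup>2) *s e i - of_real (sin t * cos t) *s v + of_real ((cos t)\<^sup>2) *s e j"
  by (simp add: C_def S_def power2_eq_square)
 show "rho (rot_idem i j v t) (-1) (e k) = e k" if k: "k \<in> {1..r}" "k ~= i" "k ~= j" proof -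
  have "jo v (e k) = 0" using jo_e[OF vZ k(1)] k by (simp add: jp_commute)
  moreover have "jo (e i) (e k) = 0" "jo (e j) (e k) = 0" using jo_e[OF e_Z[OF k(1)] ij(1)] jo_e[OF e_Z[OF k(1)] ij(2)] k by auto
  ultimately have "jo (rot_idem i j v t) (e k) = 0" by (simp add: d jp_simps)
  thus ?thesis by (simp add: R)
 qed
qed

end

section \<open>Automorphisms and the spectral theorem\<close>

lemma mv_continuous [continuous_intros]:
 fixes f :: "'a::topological_space => complex^'n^'m" shows "continuous_on S f ==> continuous_on S g ==> continuous_on S (%x. f x *v g x)"
 unfolding matrix_vector_mult_def by (intro continuous_intros)

lemma mm_continuous [continuous_intros]:
 fixes f :: "'a::topological_space => complex^'n^'m" shows "continuous_on S f ==> continuous_on S g ==> continuous_on S (%x. f x ** g x)"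
 unfolding matrix_matrix_mult_def by (intro continuous_intros)

lemma matrix_continuous [continuous_intros]:
 fixes f :: "'a::topological_space => complex^'n => complex^'m"
 assumes "!!z. continuous_on S (%x. f x z)" shows "continuous_on S (%x. matrix (f x))"
 unfolding matrix_def by (intro continuous_intros assms)

lemma norm_vec_le_sum: "norm (x::'a::real_normed_vector^'n) <= (\<Sum>i\<in>UNIV. norm (x $ i))"
 unfolding norm_vec_def by (rule L2_set_le_sum) auto

lemma inv_mv [simp]: "invertible A ==> A *v (matrix_inv A *v x) = x" "invertible A ==> matrix_inv A *v (A *v x) = x"
 for A :: "complex^'n^'n" proof -
 assume "invertible A"
 hence "A ** matrix_inv A = mat 1 & matrix_inv A ** A = mat 1" unfolding invertible_def matrix_inv_def by (rule someI_ex)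
 thus "A *v (matrix_inv A *v x) = x" "matrix_inv A *v (A *v x) = x" by (simp_all add: matrix_vector_mul_assoc)
qed

text \<open>The function \<open>A sin\<^sup>2 t + \<gamma> sin t cos t\<close> is what a linear functional traces on an orbit of plane rotations.\<close>

lemma double_angle_critical:
 fixes A \<gamma> :: real
 assumes "!!t. (sin t)\<^sup>2 * A + sin t * cos t * \<gamma> <= 0" shows "\<gamma> = 0" "A <= 0" proof -
 have "((%t. (sin t)\<^sup>2 * A + sin t * cos t * \<gamma>) has_real_derivative \<gamma>) (at 0)" by (auto intro!: derivative_eq_intros)
 thus "\<gamma> = 0" by (rule DERIV_local_max[of _ _ _ 1]) (use assms in auto)
 show "A <= 0" using assms[of "pi/2"] by simp
qed

context jordan_triple
begin

abbreviation Aut :: "(complex^'n^'n) set" where "Aut \<equiv> triple_automorphisms T"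

lemma AutD: "A \<in> Aut ==> invertible A" "A \<in> Aut ==> A *v T u v w = T (A *v u) (A *v v) (A *v w)"
 by (auto simp: triple_automorphisms_def)

lemma Aut_ip: assumes "A \<in> Aut" shows "ip (A *v x) (A *v y) = ip x y" proof -
 note inv = AutD(1)[OF assms]
 have "T (A *v x) (A *v y) = (%z. A *v (T x y (matrix_inv A *v z)))" using inv by (auto simp: AutD(2)[OF assms])
 hence "ip (A *v x) (A *v y) = trace (matrix (%z. A *v (T x y (matrix_inv A *v z))))" by (simp add: ip_def)
 also have "... = trace (matrix (%z. T x y (matrix_inv A *v (A *v z))))"
  by (rule trace_comp_commute[of "(*v) A" "%z. T x y (matrix_inv A *v z)"])
    (auto intro: clin_comp[OF T_clin3])
 finally show ?thesis using inv by (simp add: ip_def)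
qed

lemma Aut_iff: "A \<in> Aut \<longleftrightarrow> (ALL u v w. A *v T u v w = T (A *v u) (A *v v) (A *v w)) & (ALL x y. ip (A *v x) (A *v y) = ip x y)"
proof
 assume A: "(ALL u v w. A *v T u v w = T (A *v u) (A *v v) (A *v w)) & (ALL x y. ip (A *v x) (A *v y) = ip x y)"
 have "x = 0" if "A *v x = 0" for x using A that ip_self_zero[of x] by (metis ip_zero(1))
 hence "invertible A" using clin_bij_iff_inj[of "(*v) A"] by (simp add: invertible_eq_bij)
 thus "A \<in> Aut" using A by (auto simp: triple_automorphisms_def)
qed (auto simp: Aut_ip AutD)

lemma Aut_one: "mat 1 \<in> Aut" by (simp add: Aut_iff)
lemma Aut_mult: "A \<in> Aut ==> B \<in> Aut ==> A ** B \<in> Aut" by (simp add: Aut_iff mv_mult)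

text \<open>Automorphisms are isometries of the trace form.\<close>

lemma Aut_compact: "compact Aut" proof -
 have "Aut = {A. ALL u v w. A *v T u v w = T (A *v u) (A *v v) (A *v w)} \<inter> {A. ALL x y. ip (A *v x) (A *v y) = ip x y}"
  by (auto simp: Aut_iff)
 moreover have "closed {A. ALL u v w. A *v T u v w = T (A *v u) (A *v v) (A *v w)}"
  by (intro closed_Collect_all closed_Collect_eq continuous_intros)
 moreover have "closed {A. ALL x y. ip (A *v x) (A *v y) = ip x y}" by (intro closed_Collect_all closed_Collect_eq continuous_intros)
 ultimately have "closed Aut" by auto
 moreover have "bounded Aut" proof -
  obtain m where m: "m > 0" "!!z. m * (norm z)\<^sup>2 <= Re (ip z z)" using ip_norm_bound by blast
  define M where "M j = sqrt (Re (ip (axis j 1) (axis j 1)) / m)" for j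
  have ent: "norm (A $ i $ j) <= M j" if A: "A \<in> Aut" for A i j proof -
   have "m * (norm (A *v axis j 1))\<^sup>2 <= Re (ip (axis j 1) (axis j 1))" using m(2)[of "A *v axis j 1"] by (simp add: Aut_ip[OF A])
   hence "(norm (A *v axis j 1))\<^sup>2 <= Re (ip (axis j 1) (axis j 1)) / m" using m(1) by (simp add: field_simps)
   hence "norm (A *v axis j 1) <= M j" unfolding M_def using real_le_rsqrt by blast
   moreover have "norm ((A *v axis j 1) $ i) <= norm (A *v axis j 1)" by (rule Finite_Cartesian_Product.norm_nth_le)
   moreover have "(A *v axis j 1) $ i = A $ i $ j" by (simp add: matrix_vector_mul_component matrix_vector_mult_def axis_def if_distrib cong: if_cong)
   ultimately show ?thesis by simp
  qed
  have "norm A <= (\<Sum>i\<in>(UNIV::'n set). \<Sum>j\<in>UNIV. M j)" if "A \<in> Aut" for A proof -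
   have "norm A <= (\<Sum>i\<in>UNIV. norm (A $ i))" by (rule norm_vec_le_sum)
   also have "... <= (\<Sum>i\<in>UNIV. \<Sum>j\<in>UNIV. norm (A $ i $ j))" by (intro sum_mono norm_vec_le_sum)
   also have "... <= (\<Sum>i\<in>(UNIV::'n set). \<Sum>j\<in>UNIV. M j)" by (intro sum_mono ent that)
   finally show ?thesis .
  qed
  thus ?thesis unfolding bounded_iff by blast
 qed
 ultimately show ?thesis by (simp add: compact_eq_bounded_closed)
qed

lemma K_Aut: "K_group T \<subseteq> Aut" unfolding K_group_def by (rule connected_component_subset)
lemma K_one: "mat 1 \<in> K_group T" by (simp add: K_group_def Aut_one)

lemma K_compact: "compact (K_group T)"
 using compact_Int_closed[OF Aut_compact closed_connected_component[OF compact_imp_closed[OF Aut_compact]], of "mat 1"]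
 unfolding K_group_def by (simp add: Int_absorb1 connected_component_subset)

lemma K_mult: assumes "A \<in> K_group T" "B \<in> K_group T" shows "A ** B \<in> K_group T" proof -
 have AA: "A \<in> Aut" using assms(1) K_Aut by blast
 let ?C = "(%X. A ** X) ` K_group T"
 have "connected ?C" unfolding K_group_def by (intro connected_continuous_image continuous_intros connected_connected_component)
 moreover have "?C \<subseteq> Aut" using K_Aut Aut_mult[OF AA] by auto
 moreover have "A \<in> ?C" using K_one by (auto simp: image_iff intro!: bexI[of _ "mat 1"])
 moreover have "A ** B \<in> ?C" using assms(2) by auto
 ultimately have "connected_component Aut A (A ** B)" unfolding connected_component_def by blast
 moreover have "connected_component Aut (mat 1) A" using assms(1) by (simp add: K_group_def)
 ultimately show ?thesis unfolding K_group_def by (auto intro: connected_component_trans)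
qed

text \<open>Maximising \<open>Re \<langle>z, km\<rangle>\<close> over a compact group of automorphisms.\<close>

lemma spectral_max:
 assumes H: "compact H" "H \<subseteq> Aut" "mat 1 \<in> H" "\<forall>A\<in>H. \<forall>B\<in>H. A ** B \<in> H"
 obtains k w where "k \<in> H" "z = k *v w" "\<forall>k'\<in>H. Re (ip w (k' *v m)) <= Re (ip w m)" proof -
 have ne: "H ~= {}" using H(3) by blast
 have "continuous_on H (%k. Re (ip z (k *v m)))" by (intro continuous_intros)
 from continuous_attains_sup[OF H(1) ne this]
 obtain k where k: "k \<in> H" "!!k'. k' \<in> H ==> Re (ip z (k' *v m)) <= Re (ip z (k *v m))" by blast
 have kA: "k \<in> Aut" using k(1) H(2) by blast
 let ?w = "matrix_inv k *v z"
 have z: "z = k *v ?w" using AutD(1)[OF kA] by simp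
 have "ip z (k *v y) = ip ?w y" for y using Aut_ip[OF kA, of ?w y] AutD(1)[OF kA] by simp
 thus ?thesis using that[OF k(1) z] k(2)[OF H(4)[rule_format, OF k(1)]] by (simp add: mv_mult)
qed

lemma Aut_pspace: assumes "A \<in> Aut" shows "A *v pproj c k z = pproj (A *v c) k (A *v z)" using AutD(2)[OF assms]
 by (simp add: pproj_def clin_add[OF clin_matrix] clin_diff[OF clin_matrix] clin_scale[OF clin_matrix])

lemma ip_pspace_orth: assumes "x \<in> pspace c i" "y \<in> pspace c j" "i ~= j" shows "ip x y = 0" proof -
 have "of_nat i * ip x y = of_nat j * ip x y"
  using ip_adjoint[of c c x y] unfolding pspaceD[OF assms(1)] pspaceD[OF assms(2)] ip_scale by simp
 thus ?thesis using assms(3) by simp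
qed

end

context tube_frame
begin

declare One_nat_def [simp del]

text \<open>For \<open>|s| = 1\<close> the scaling identity \<open>rho_T\<close> becomes invariance.\<close>

lemma rho_Aut: assumes c: "tripotent T c" and s: "cmod s = 1" shows "matrix (rho c s) \<in> Aut" proof -
 have s0: "s ~= 0" using s by auto
 have "cnj s * s = 1" using s by (metis complex_norm_square mult.commute of_real_1 power_one)
 hence "rho c s (T u v w) = T (rho c s u) (rho c s v) (rho c s w)" for u v w
  using rho_T[OF c, of s u "rho c s v" w] by (simp add: rho_mult[OF c])
 thus ?thesis using rho_bij[OF c s0] by (simp add: triple_automorphisms_def matrix_works[OF rho_clin] invertible_iff_bij[OF rho_clin])
qed

lemma rho_K: assumes c: "tripotent T c" and s: "cmod s = 1" shows "matrix (rho c s) \<in> K_group T" proof -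
 let ?C = "(%t. matrix (rho c (cis t))) ` UNIV"
 have "connected ?C" by (intro connected_continuous_image connected_UNIV)
    (auto simp: rho_def cis_conv_exp intro!: continuous_intros)
 moreover have "?C \<subseteq> Aut" using rho_Aut[OF c] by auto
 moreover have "mat 1 \<in> ?C" proof
  have "rho c (cis 0) = id" by auto
  thus "mat 1 = matrix (rho c (cis 0))" by (simp only: matrix_id_mat_1)
 qed simp
 moreover have "matrix (rho c s) \<in> ?C" proof -
  have "s ~= 0" using s by auto
  hence "cis (Arg s) = s" using s cis_Arg[of s] by (simp add: sgn_eq)
  thus ?thesis by (intro image_eqI[of _ _ "Arg s"]) auto
 qed
 ultimately show ?thesis unfolding K_group_def connected_component_def by blast
qed

lemma ip_Z_ext: assumes "!!i j x. (i, j) \<in> pidx ==> x \<in> Z i j ==> ip y x = 0" shows "y = 0" proof -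
 have "ip y y = ip y (\<Sum>t\<in>pidx. PP t y)" by (simp only: PP_sum)
 also have "... = (\<Sum>t\<in>pidx. ip y (PP t y))" by (rule ip_sum)
 also have "... = 0" using assms PP_Z by (intro sum.neutral) auto
 finally show ?thesis by (simp add: ip_self_zero)
qed

lemma ip_e_e: "i \<in> {1..r} ==> j \<in> {1..r} ==> ip (e i) (e j) = (if i = j then of_nat pnum else 0)"
 using ip_e ip_Z_orth[OF e_Z e_Z, of i j i] by auto

lemma diagonal_if_orth:
 assumes "!!i j x. (i, j) \<in> pidx ==> i ~= j ==> x \<in> Z i j ==> ip w x = 0"
 shows "w = (\<Sum>i=1..r. (ip w (e i) / of_nat pnum) *s e i)" proof -
 let ?d = "\<Sum>i=1..r. (ip w (e i) / of_nat pnum) *s e i"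
 have "w - ?d = 0" proof (rule ip_Z_ext)
  fix i j x assume ij: "(i, j) \<in> pidx" and x: "x \<in> Z i j"
  have ir: "i \<in> {1..r}" "j \<in> {1..r}" using ij by (auto simp: pidx_def)
  show "ip (w - ?d) x = 0" proof (cases "i = j")
   case False
   have "ip ?d x = 0" unfolding ip_sum ip_scale proof (intro sum.neutral ballI)
    fix k assume k: "k \<in> {1..r}"
    have "ip (e k) x = 0" using ip_Z_orth[OF e_Z[OF k] x k] False by (auto split: if_splits)
    thus "ip w (e k) / of_nat pnum * ip (e k) x = 0" by simp
   qed
   thus ?thesis using assms[OF ij False x] by (simp add: ip_diff)
  next
   case True
   obtain s where s: "x = s *s e i" using Z_diag[OF ir(1)] x True by blast
   have "ip ?d (e i) = (\<Sum>k=1..r. if k = i then ip w (e i) else 0)"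
    unfolding ip_sum ip_scale using pnum_pos ir by (intro sum.cong refl) (auto simp: ip_e_e)
   hence "ip ?d (e i) = ip w (e i)" using ir by (simp add: sum.delta)
   thus ?thesis by (simp add: s ip_scale ip_diff)
  qed
 qed
 thus ?thesis by simp
qed

text \<open>The reflection in \<open>rot_idem i j v (t/2)\<close> rotates the frame elements \<open>e i, e j\<close> by the angle \<open>t\<close>; these reflections
  are the curves in the group along which the spectral theorem is derived.\<close>

abbreviation refl :: "nat => nat => complex^'n => real => complex^'n => complex^'n" where
 "refl i j v t \<equiv> rho (rot_idem i j v (t/2)) (-1)"

lemma rot_idem_tripotent:
 "i \<in> {1..r} ==> j \<in> {1..r} ==> i ~= j ==> unit_vec i j v ==> tripotent T (rot_idem i j v t)"
 using reflection_formula(1)[OF un_tripotent rot_idem_star rot_idem_idem] by blast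

lemma refl_diag:
 assumes ij: "i \<in> {1..r}" "j \<in> {1..r}" "i ~= j" and v: "unit_vec i j v" and J: "J \<subseteq> {1..r}" "i \<in> J" "j \<in> J"
 shows "refl i j v t (\<Sum>k\<in>J. m k *s e k) = (\<Sum>k\<in>J. m k *s e k) +
   (m j - m i) *s (of_real ((sin t)\<^sup>2) *s (e i - e j) - of_real (sin t * cos t) *s v)" proof -
 have fin: "finite J" using J finite_subset by auto
 have split: "(\<Sum>k\<in>J. f k) = f i + f j + (\<Sum>k\<in>J - {i, j}. f k)" for f :: "nat => complex^'n"
  using sum.remove[OF fin J(2), of f] sum.remove[of "J - {i}" j f] fin J ij by (simp add: Diff_insert2[symmetric] insert_commute add.assoc)
 have rest: "(\<Sum>k\<in>J - {i, j}. m k *s refl i j v t (e k)) = (\<Sum>k\<in>J - {i, j}. m k *s e k)"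
  by (intro sum.cong refl) (use rot_idem_reflect_other[OF ij v] J in auto)
 have cs: "complex_of_real ((cos t)\<^sup>2) = 1 - of_real ((sin t)\<^sup>2)" by (simp add: cos_squared_eq)
 have "refl i j v t (\<Sum>k\<in>J. m k *s e k) = (\<Sum>k\<in>J. m k *s refl i j v t (e k))"
  by (simp only: clin_sum[OF rho_clin] clin_scale[OF rho_clin])
 also have "... = m i *s refl i j v t (e i) + m j *s refl i j v t (e j) + (\<Sum>k\<in>J - {i, j}. m k *s e k)"
  unfolding rest[symmetric] by (rule split)
 also have "... = (m i *s e i + m j *s e j + (\<Sum>k\<in>J - {i, j}. m k *s e k)) +
   (m j - m i) *s (of_real ((sin t)\<^sup>2) *s (e i - e j) - of_real (sin t * cos t) *s v)"
  unfolding rot_idem_reflect_i[OF ij v] rot_idem_reflect_j[OF ij v] unfolding rot_idem_def cs by (simp add: vec_eq_iff algebra_simps)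
 also have "m i *s e i + m j *s e j + (\<Sum>k\<in>J - {i, j}. m k *s e k) = (\<Sum>k\<in>J. m k *s e k)" by (rule split[symmetric])
 finally show ?thesis .
qed

text \<open>The criticality conditions obtained from the rotations in the plane of \<open>e i\<close> and \<open>e j\<close>.\<close>

lemma rotation_critical:
 assumes ij: "i \<in> {1..r}" "j \<in> {1..r}" "i ~= j" and v: "unit_vec i j v" and mu: "\<mu> j < (\<mu> i :: real)"
  and crit: "!!t. Re (ip w (refl i j v t (\<Sum>k=1..r. of_real (\<mu> k) *s e k))) <= Re (ip w (\<Sum>k=1..r. of_real (\<mu> k) *s e k))"
 shows "Re (ip w v) = 0" "Re (ip w (e j)) <= Re (ip w (e i))" proof -
 have "(sin t)\<^sup>2 * (Re (ip w (e j)) - Re (ip w (e i))) + sin t * cos t * Re (ip w v) <= 0" for t proof -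
  have "(\<mu> i - \<mu> j) * ((sin t)\<^sup>2 * (Re (ip w (e j)) - Re (ip w (e i))) + sin t * cos t * Re (ip w v)) <= 0"
   using crit[of t] refl_diag[OF ij v order_refl ij(1,2), of t "%k. of_real (\<mu> k)"] by (simp add: ip_simps algebra_simps)
  thus ?thesis using mu by (simp add: mult_le_0_iff)
 qed
 from double_angle_critical[OF this] show "Re (ip w v) = 0" "Re (ip w (e j)) <= Re (ip w (e i))" by auto
qed

lemma rho_e: assumes "i \<in> {1..r}" "x \<in> Z k m" shows "rho (e i) s x = s ^ (of_bool (k = i) + of_bool (m = i)) *s x"
 by (rule rho_pspace[OF Z_pspace[OF assms(2,1)]]) (auto simp: of_bool_def)

lemma rho_e_e: "i \<in> {1..r} ==> k \<in> {1..r} ==> rho (e i) s (e k) = (if k = i then s\<^sup>2 *s e i else e k)"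
 using rho_e[OF _ e_Z, of i k s] by (auto simp: numeral_2_eq_2 One_nat_def)

lemma rho_e_diag:
 assumes "i \<in> {1..r}" shows "rho (e i) s (\<Sum>k=1..r. m k *s e k) = (\<Sum>k=1..r. (if k = i then s\<^sup>2 * m k else m k) *s e k)"
 unfolding clin_sum[OF rho_clin] clin_scale[OF rho_clin] using assms by (intro sum.cong refl) (auto simp: rho_e_e mult.commute)

text \<open>Spectral theorem: a critical point of \<open>Re \<langle>z, k(\<Sum>\<mu>\<^sub>i e\<^sub>i)\<rangle>\<close> with strictly decreasing \<open>\<mu>\<close> is diagonal
  with non-negative decreasing entries.\<close>

lemma spectral_theorem:
 assumes a: "a ~= 0"
 obtains k s where "k \<in> K_group T" "z = k *v (\<Sum>i=1..r. of_real (s i :: real) *s e i)"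
  "!!i j. 1 <= i ==> i <= j ==> j <= r ==> s j <= s i" "!!i. i \<in> {1..r} ==> 0 <= s i" proof -
 define \<mu> where "\<mu> i = real (r + 1 - i)" for i
 define m where "m = (\<Sum>i=1..r. of_real (\<mu> i) *s e i)"
 obtain k w where k: "k \<in> K_group T" "z = k *v w" and mx0: "\<forall>k'\<in>K_group T. Re (ip w (k' *v m)) <= Re (ip w m)"
  by (rule spectral_max[OF K_compact K_Aut K_one, of z m]) (use K_mult in blast, rule that)
 note mx = mx0[rule_format]
 have mxr: "Re (ip w (rho c s m)) <= Re (ip w m)" if "tripotent T c" "cmod s = 1" for c s
  using mx[OF rho_K[OF that]] by (simp add: matrix_works[OF rho_clin])
 have \<mu>_pos: "\<mu> i > 0" if "i \<in> {1..r}" for i using that by (auto simp: \<mu>_def)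
 have \<mu>_less: "\<mu> j < \<mu> i" if "i < j" "i \<in> {1..r}" "j \<in> {1..r}" for i j using that by (auto simp: \<mu>_def)
 have diag: "ip w (e i) = of_real (Re (ip w (e i))) & Re (ip w (e i)) >= 0" if i: "i \<in> {1..r}" for i proof -
  let ?\<alpha> = "ip w (e i)"
  have u: "Re (cnj (s\<^sup>2) * ?\<alpha>) <= Re ?\<alpha>" if s: "cmod s = 1" for s proof -
   have eq1: "rho (e i) s m = m + ((s\<^sup>2 - 1) * of_real (\<mu> i)) *s e i" proof -
    have "rho (e i) s m - m = (\<Sum>k=1..r. (if k = i then ((s\<^sup>2 - 1) * of_real (\<mu> i)) *s e i else 0))"
     unfolding m_def rho_e_diag[OF i] sum_subtractf[symmetric] by (intro sum.cong refl) (auto simp: vec_eq_iff algebra_simps)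
    thus ?thesis using i by (simp add: sum.delta algebra_simps)
   qed
   have "Re (ip w (m + ((s\<^sup>2 - 1) * of_real (\<mu> i)) *s e i)) <= Re (ip w m)" using mxr[OF e_tripotent[OF i] s] unfolding eq1 .
   hence "\<mu> i * (Re (cnj (s\<^sup>2) * ?\<alpha>) - Re ?\<alpha>) <= 0" by (simp add: ip_simps algebra_simps)
   thus ?thesis using \<mu>_pos[OF i] by (simp add: mult_le_0_iff)
  qed
  show ?thesis proof (cases "?\<alpha> = 0")
   case False
   let ?s = "csqrt (?\<alpha> / cmod ?\<alpha>)"
   have "cmod ?s = 1" using False by (simp add: norm_divide)
   from u[OF this] have "Re (cnj (?\<alpha> / cmod ?\<alpha>) * ?\<alpha>) <= Re ?\<alpha>" by simp
   moreover have "cnj (?\<alpha> / cmod ?\<alpha>) * ?\<alpha> = of_real (cmod ?\<alpha>)"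
    using False complex_norm_square[of ?\<alpha>] by (simp add: field_simps power2_eq_square)
   ultimately have "cmod ?\<alpha> <= Re ?\<alpha>" by (simp only: Re_complex_of_real)
   hence "Re ?\<alpha> = cmod ?\<alpha>" using complex_Re_le_cmod[of ?\<alpha>] by linarith
   moreover have "Im ?\<alpha> = 0" using `Re ?\<alpha> = cmod ?\<alpha>` cmod_power2[of ?\<alpha>] by simp
   moreover have "Re ?\<alpha> >= 0" unfolding `Re ?\<alpha> = cmod ?\<alpha>` by simp
   ultimately show ?thesis by (simp add: complex_eq_iff)
  qed simp
 qed
 have off: "ip w v = 0 & Re (ip w (e j)) <= Re (ip w (e i))"
  if ij: "i < j" "i \<in> {1..r}" "j \<in> {1..r}" and v: "unit_vec i j v" for i j v proof -
  have ne: "i ~= j" using ij by auto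
  have trip: "tripotent T (rot_idem i j v t)" for t using rot_idem_tripotent[OF ij(2,3) ne v] .
  have c: "Re (ip w v) = 0" "Re (ip w (e j)) <= Re (ip w (e i))"
   by (rule rotation_critical[OF ij(2,3) ne v \<mu>_less[OF ij]]; use mxr[OF trip] in "simp add: m_def")+
  \<comment> \<open>for the imaginary part the rotation is conjugated by phases on \<open>e i\<close> and \<open>e j\<close>\<close>
  obtain u :: complex where u1: "u\<^sup>2 = \<i>" using power2_csqrt by blast
  have "(cmod u)\<^sup>2 = 1" using u1 by (simp flip: norm_power)
  hence "cmod u = 1" using norm_ge_zero[of u] by (auto simp: power2_eq_1_iff)
  have u: "u\<^sup>2 = \<i>" "(cnj u)\<^sup>2 = - \<i>" "u * cnj u = 1" "cmod u = 1"
   using u1 `cmod u = 1` complex_norm_square[of u] by (simp_all flip: complex_cnj_power)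
  define \<tau> where "\<tau> = (%x. rho (e i) u (rho (e j) (cnj u) x))"
  define \<tau>' where "\<tau>' = (%x. rho (e i) (cnj u) (rho (e j) u x))"
  define m' where "m' = (%k. if k = i then - \<i> * of_real (\<mu> i) else if k = j then \<i> * of_real (\<mu> j) else of_real (\<mu> k))"
  have vZ: "v \<in> Z i j" using v by (simp add: unit_vec_def)
  have \<tau>_lin: "clin \<tau>" unfolding \<tau>_def by (intro clin_comp[OF rho_clin rho_clin])
  have \<tau>v: "\<tau> v = v" unfolding \<tau>_def using ne u
   by (simp add: rho_e[OF ij(3) vZ] rho_e[OF ij(2) vZ] clin_scale[OF rho_clin] One_nat_def[symmetric] mult.commute)
  have \<tau>e: "\<tau> (e i) = \<i> *s e i" "\<tau> (e j) = - \<i> *s e j" "k \<in> {1..r} ==> k ~= i ==> k ~= j ==> \<tau> (e k) = e k" for k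
   unfolding \<tau>_def using ne u ij by (simp_all add: rho_e_e clin_scale[OF rho_clin] clin_minus[OF rho_clin])
  have \<tau>'m: "\<tau>' m = (\<Sum>k=1..r. m' k *s e k)" unfolding \<tau>'_def m_def rho_e_diag[OF ij(3)] rho_e_diag[OF ij(2)] u m'_def
   using ne by (intro sum.cong refl) auto
  have \<tau>m': "\<tau> (\<Sum>k=1..r. m' k *s e k) = m" unfolding clin_sum[OF \<tau>_lin] clin_scale[OF \<tau>_lin] m_def
  proof (intro sum.cong refl)
   fix k assume k: "k \<in> {1..r}"
   have ii: "- \<i> * c * \<i> = c" "\<i> * c * (- \<i>) = c" for c by (simp_all add: complex_eq_iff)
   consider "k = i" | "k = j" | "k ~= i" "k ~= j" by blast
   thus "m' k *s \<tau> (e k) = of_real (\<mu> k) *s e k" proof cases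
    case 1 thus ?thesis by (simp only: m'_def \<tau>e vector_smult_assoc ii if_True simp_thms)
   next
    case 2
    hence "m' k = \<i> * of_real (\<mu> j)" using ne by (simp add: m'_def)
    thus ?thesis by (simp only: 2 \<tau>e vector_smult_assoc ii)
   next
    case 3 thus ?thesis using k by (simp add: m'_def \<tau>e)
   qed
  qed
  have "(sin t)\<^sup>2 * (- Re (ip w (e i) + ip w (e j))) + sin t * cos t * (- Im (ip w v)) <= 0" for t proof -
   let ?K = "matrix (rho (e i) u) ** (matrix (rho (e j) (cnj u)) ** (matrix (refl i j v t) ** (matrix (rho (e i) (cnj u)) ** matrix (rho (e j) u))))"
   have "?K \<in> K_group T" using u by (intro K_mult rho_K e_tripotent ij trip) auto
   from mx[OF this] have le: "Re (ip w (\<tau> (refl i j v t (\<tau>' m)))) <= Re (ip w m)"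
    by (simp add: mv_mult matrix_works[OF rho_clin] \<tau>_def \<tau>'_def)
   have "refl i j v t (\<tau>' m) = (\<Sum>k=1..r. m' k *s e k) +
     (\<i> * of_real (\<mu> i + \<mu> j)) *s (of_real ((sin t)\<^sup>2) *s (e i - e j) - of_real (sin t * cos t) *s v)"
    unfolding \<tau>'m refl_diag[OF ij(2,3) ne v order_refl ij(2,3)] using ne by (simp add: m'_def algebra_simps)
   hence "\<tau> (refl i j v t (\<tau>' m)) = m + (\<i> * of_real (\<mu> i + \<mu> j)) *s
     (of_real ((sin t)\<^sup>2) *s (\<i> *s e i + \<i> *s e j) - of_real (sin t * cos t) *s v)"
    by (simp add: clin_add[OF \<tau>_lin] clin_scale[OF \<tau>_lin] clin_diff[OF \<tau>_lin] \<tau>m' \<tau>e \<tau>v mult.assoc)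
   with le have "(\<mu> i + \<mu> j) * ((sin t)\<^sup>2 * (- Re (ip w (e i) + ip w (e j))) + sin t * cos t * (- Im (ip w v))) <= 0"
    by (simp add: ip_simps algebra_simps)
   thus ?thesis using \<mu>_pos[OF ij(2)] \<mu>_pos[OF ij(3)] by (simp add: mult_le_0_iff)
  qed
  from double_angle_critical(1)[OF this] have "Im (ip w v) = 0" by simp
  thus ?thesis using c by (simp add: complex_eq_iff)
 qed
 define s where "s i = Re (ip w (e i)) / real pnum" for i
 have w: "w = (\<Sum>i=1..r. of_real (s i) *s e i)" proof -
  have "w = (\<Sum>i=1..r. (ip w (e i) / of_nat pnum) *s e i)" proof (rule diagonal_if_orth)
   fix i j x assume p: "(i, j) \<in> pidx" "i ~= j" "x \<in> Z i j"
   hence ij: "i < j" "i \<in> {1..r}" "j \<in> {1..r}" by (auto simp: pidx_def)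
   show "ip w x = 0" by (rule ip_unit_vec_zero[OF ij(2,3) p(2) _ p(3)]) (use off[OF ij] in blast)
  qed
  also have "... = (\<Sum>i=1..r. of_real (s i) *s e i)" proof (intro sum.cong refl)
   fix i assume "i \<in> {1..r}"
   hence "ip w (e i) = of_real (Re (ip w (e i)))" using diag by blast
   hence "ip w (e i) / of_nat pnum = of_real (s i)" by (simp add: s_def)
   thus "(ip w (e i) / of_nat pnum) *s e i = of_real (s i) *s e i" by simp
  qed
  finally show ?thesis .
 qed
 have "s j <= s i" if "1 <= i" "i <= j" "j <= r" for i j proof (cases "i = j")
  case False
  hence ij: "i < j" "i \<in> {1..r}" "j \<in> {1..r}" using that by auto
  obtain v where "unit_vec i j v" using unit_vec_exists[OF ij(2,3) False a] by blast
  thus ?thesis using off[OF ij] by (simp add: s_def divide_right_mono)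
 qed simp
 moreover have "s i >= 0" if "i \<in> {1..r}" for i using diag[OF that] by (simp add: s_def)
 ultimately show ?thesis using that[OF k(1)] k(2) w by blast
qed

text \<open>The real version, for the group of automorphisms fixing two complementary idempotents.\<close>

definition Haut :: "nat => (complex^'n^'n) set" where
 "Haut l = {A \<in> Aut. A *v esum {1..l} = esum {1..l} & A *v un = un}"

lemma HautD: "A \<in> Haut l ==> A \<in> Aut" "A \<in> Haut l ==> A *v esum {1..l} = esum {1..l}" "A \<in> Haut l ==> A *v un = un"
 by (auto simp: Haut_def)

lemma Haut_st: "A \<in> Haut l ==> A *v st x = st (A *v x)"
 using AutD(2)[OF HautD(1)] by (simp add: star_def clin_scale[OF clin_matrix] HautD)

lemma Haut_jo: "A \<in> Haut l ==> A *v jo x y = jo (A *v x) (A *v y)"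
 using AutD(2)[OF HautD(1)] by (simp add: jp_def clin_scale[OF clin_matrix] HautD)

lemma real_spectral_theorem:
 assumes l: "l <= r" and x: "st x = x" "pproj (esum {1..l}) 1 x = 0"
 obtains k s where "k \<in> Haut l" "x = k *v (\<Sum>i=1..r. of_real (s i :: real) *s e i)" proof -
 define \<mu> where "\<mu> i = real (r + 1 - i)" for i
 define m where "m = (\<Sum>i=1..r. of_real (\<mu> i) *s e i)"
 let ?c = "esum {1..l}"
 have H: "compact (Haut l)" "Haut l \<subseteq> Aut" "mat 1 \<in> Haut l" "\<forall>A\<in>Haut l. \<forall>B\<in>Haut l. A ** B \<in> Haut l"
 proof -
  have "closed {A. A *v ?c = ?c & A *v un = un}" by (intro closed_Collect_conj closed_Collect_eq continuous_intros)
  hence "compact (Aut \<inter> {A. A *v ?c = ?c & A *v un = un})" by (rule compact_Int_closed[OF Aut_compact])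
  thus "compact (Haut l)" by (simp add: Haut_def Int_def)
 qed (auto simp: Haut_def Aut_one Aut_mult mv_mult)
 obtain k w where k: "k \<in> Haut l" "x = k *v w" and mx0: "\<forall>k'\<in>Haut l. Re (ip w (k' *v m)) <= Re (ip w m)"
  by (rule spectral_max[OF H, of x m], rule that)
 note mx = mx0[rule_format]
 have kinj: "y = y'" if "k *v y = k *v y'" for y y' using that AutD(1)[OF HautD(1)[OF k(1)]] by (metis inv_mv(2))
 have stw: "st w = w" proof (rule kinj)
  show "k *v st w = k *v w" unfolding Haut_st[OF k(1)] k(2)[symmetric] by (rule x(1))
 qed
 have pw: "pproj ?c 1 w = 0" proof (rule kinj)
  show "k *v pproj ?c 1 w = k *v 0" unfolding Aut_pspace[OF HautD(1)[OF k(1)]] HautD(2)[OF k(1)] k(2)[symmetric] x(2) by simp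
 qed
 have real: "ip w y = of_real (Re (ip w y))" if "st y = y" for y using ip_st[of w y] ip_cnj[of w y] by (simp add: stw that complex_eq_iff)
 have \<mu>_less: "\<mu> j < \<mu> i" if "i < j" "i \<in> {1..r}" "j \<in> {1..r}" for i j using that by (auto simp: \<mu>_def)
 have tc: "tripotent T ?c" by (rule esum_tripotent) (use l in auto)
 have off: "ip w v = 0" if ij: "i < j" "i \<in> {1..r}" "j \<in> {1..r}" and v: "unit_vec i j v" for i j v proof -
  have ne: "i ~= j" using ij by auto
  have vZ: "v \<in> Z i j" "st v = v" using v by (auto simp: unit_vec_def)
  show ?thesis proof (cases "i <= l & l < j")
   case True
   have "T ?c ?c v = (\<Sum>k\<in>{1..l}. if k = i then v else 0)"
    unfolding T_esum[OF atLeastatMost_subset_iff[THEN iffD2, of 1 l 1 r, OF disjI2[OF conjI[OF order_refl l]]]]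
    using ZD[OF vZ(1)] True l ij by (intro sum.cong refl) auto
   also have "... = v" using True ij by (simp add: sum.delta)
   finally have v1: "v \<in> pspace ?c 1" by (simp add: pspace_def)
   have "w = pproj ?c 0 w + pproj ?c 1 w + pproj ?c 2 w" by (simp only: pproj_sum)
   hence "ip w v = ip (pproj ?c 0 w) v + ip (pproj ?c 2 w) v" by (simp add: pw ip_add flip: ip_add(1))
   also have "... = 0" using ip_pspace_orth[OF pproj_mem[OF tc] v1, of 0] ip_pspace_orth[OF pproj_mem[OF tc] v1, of 2] by simp
   finally show ?thesis .
  next
   case False
   have trip: "tripotent T (rot_idem i j v t)" for t using rot_idem_tripotent[OF ij(2,3) ne v] .
   have "matrix (refl i j v t) \<in> Haut l" for t proof -
    have inv: "refl i j v t (esum J) = esum J" if "J \<subseteq> {1..r}" "i \<in> J \<longleftrightarrow> j \<in> J" for J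
    proof (cases "i \<in> J")
     case True
     thus ?thesis using refl_diag[OF ij(2,3) ne v that(1), of t "%_. 1"] that(2) by (simp add: esum_def)
    next
     case False
     thus ?thesis unfolding esum_def clin_sum[OF rho_clin] using that by (intro sum.cong refl rot_idem_reflect_other[OF ij(2,3) ne v]) auto
    qed
    have "{1..l} \<subseteq> {1..r}" "i \<in> {1..l} \<longleftrightarrow> j \<in> {1..l}" using False ij l by auto
    from inv[OF this] inv[of "{1..r}"] show ?thesis using rho_Aut[OF trip, of "-1"] ij by (simp add: Haut_def matrix_works[OF rho_clin])
   qed
   hence "Re (ip w (refl i j v t m)) <= Re (ip w m)" for t using mx[of "matrix (refl i j v t)"] by (simp add: matrix_works[OF rho_clin])
   hence "Re (ip w v) = 0" using rotation_critical(1)[OF ij(2,3) ne v \<mu>_less[OF ij]] by (simp add: m_def)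
   thus ?thesis using real[OF vZ(2)] by simp
  qed
 qed
 have "w = (\<Sum>i=1..r. (ip w (e i) / of_nat pnum) *s e i)" proof (rule diagonal_if_orth)
  fix i j x assume p: "(i, j) \<in> pidx" "i ~= j" "x \<in> Z i j"
  hence ij: "i < j" "i \<in> {1..r}" "j \<in> {1..r}" by (auto simp: pidx_def)
  show "ip w x = 0" by (rule ip_unit_vec_zero[OF ij(2,3) p(2) _ p(3)]) (use off[OF ij] in blast)
 qed
 also have "... = (\<Sum>i=1..r. of_real (Re (ip w (e i)) / real pnum) *s e i)" proof (intro sum.cong refl)
  fix i assume "i \<in> {1..r}"
  hence "ip w (e i) = of_real (Re (ip w (e i)))" using real st_e by blast
  hence "ip w (e i) / of_nat pnum = of_real (Re (ip w (e i)) / real pnum)" by simp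
  thus "(ip w (e i) / of_nat pnum) *s e i = of_real (Re (ip w (e i)) / real pnum) *s e i" by simp
 qed
 finally show ?thesis using that[OF k(1)] k(2) by metis
qed

text \<open>If all \<open>Z i j\<close> with \<open>i \<noteq> j\<close> vanish, the triple is a direct sum of copies of \<open>\<complex>\<close>.\<close>

lemma irreducible_a_nonzero:
 assumes irr: "irreducible_triple T" and r: "2 <= r" shows "a ~= 0" proof
 assume a: "a = 0"
 have 1: "1 \<in> {1..r}" and 2: "2 \<in> {1..r}" using r by auto
 let ?I = "pspace (e 1) 2" and ?J = "pspace (e 1) 0"
 note t1 = e_tripotent[OF 1]
 have dec: "\<exists>x\<in>?I. \<exists>y\<in>?J. z = x + y" for z proof -
  have z: "z = (\<Sum>i=1..r. (ip z (e i) / of_nat pnum) *s e i)" proof (intro diagonal_if_orth)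
   fix i j x assume "(i, j) \<in> pidx" "i ~= j" "x \<in> Z i j"
   hence "x = 0" using dim_Z a by (intro vec_dim_zeroD[of "Z i j"]) auto
   thus "ip z x = 0" by simp
  qed
  let ?f = "%i. (ip z (e i) / of_nat pnum) *s e i"
  have "?f 1 \<in> ?I" by (intro pspace_scale tripotent_pspace t1)
  moreover have "(\<Sum>i\<in>{1..r} - {1}. ?f i) \<in> ?J" using L_e[OF _ 1] by (intro vec.subspace_sum[OF pspace_subspace] pspace_scale)
    (auto simp: pspace_def)
  moreover have "z = ?f 1 + (\<Sum>i\<in>{1..r} - {1}. ?f i)" by (subst z) (rule sum.remove[OF _ 1], simp)
  ultimately show ?thesis by blast
 qed
 have ideal: "triple_ideal T P"
  if kl: "P = pspace (e 1) k" "Q = pspace (e 1) m" and orth: "!!x y w. x \<in> P ==> y \<in> Q ==> T x y w = 0 & T y x w = 0"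
   and dec: "!!z. \<exists>x\<in>P. \<exists>y\<in>Q. z = x + y" for P Q k m unfolding triple_ideal_def proof (intro conjI ballI allI)
  show "vec.subspace P" unfolding kl by (rule pspace_subspace)
  fix x u v assume x: "x \<in> P"
  obtain u1 u2 v1 v2 where uv: "u = u1 + u2" "v = v1 + v2" and m: "u1 \<in> P" "u2 \<in> Q" "v1 \<in> P" "v2 \<in> Q" using dec by metis
  have "T w v2 x = 0" "T u2 x w = 0" "T u2 v1 w = 0" "T w x v2 = 0" for w
   using orth[OF x m(4), of w] orth[OF x m(2), of w] orth[OF m(3,2), of w] by (simp_all add: T_commute[of w])
  moreover have "T u1 v1 x \<in> P" "T u1 x v1 \<in> P" using T_pspace[of _ "e 1" k _ k _ k k] m(1,3) x unfolding kl by auto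
  ultimately show "T u v x \<in> P" "T u x v \<in> P" by (simp_all add: uv T_add)
 qed
 have orth: "T x y w = 0 & T y x w = 0" if "x \<in> ?I" "y \<in> ?J" for x y w using T_pspace_20[OF t1 that] T_pspace_02[OF t1 that] by simp
 have dec': "\<exists>x\<in>?J. \<exists>y\<in>?I. z = x + y" for z proof -
  obtain x y where "x \<in> ?I" "y \<in> ?J" "z = x + y" using dec by blast
  thus ?thesis by (intro bexI[of _ y] bexI[of _ x]) (simp_all add: add.commute)
 qed
 have "triple_ideal T ?I" by (rule ideal[OF refl refl orth dec])
 moreover have "triple_ideal T ?J" by (rule ideal[OF refl refl _ dec']) (use orth in blast)
 moreover have "e 1 \<in> ?I" "e 2 \<in> ?J" using tripotent_pspace[OF t1] L_e[OF 2 1] by (auto simp: pspace_def)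
 hence "?I ~= {0}" "?J ~= {0}" using e_nonzero[OF 1] e_nonzero[OF 2] by auto
 moreover have "?I \<inter> ?J = {0}" by (auto simp: pspace_def T_zero)
 moreover have "{x + y |x y. x \<in> ?I & y \<in> ?J} = UNIV" using dec by blast
 ultimately show False using irr unfolding irreducible_triple_def by blast
qed

end

section \<open>The structure group\<close>

lemma matrix_inv_mult: "invertible A ==> A ** matrix_inv A = mat 1" "invertible A ==> matrix_inv A ** A = mat 1"
 for A :: "complex^'n^'n" by (rule matrix_eqI; simp add: mv_mult)+

lemma matrix_inv_unique:
 fixes A :: "complex^'n^'n"
 assumes "A ** B = mat 1" shows "matrix_inv A = B" proof -
 have inv: "invertible A" using assms by (auto simp: invertible_right_inverse)
 have "matrix_inv A = matrix_inv A ** (A ** B)" by (simp add: assms)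
 also have "... = B" by (simp only: matrix_mul_assoc matrix_inv_mult[OF inv] matrix_mul_lid)
 finally show ?thesis .
qed

lemma matrix_inv_conj:
 fixes A S :: "complex^'n^'n"
 assumes iS: "invertible S" and iA: "invertible A" shows "matrix_inv (S ** A ** matrix_inv S) = S ** matrix_inv A ** matrix_inv S"
proof (rule matrix_inv_unique)
 show "(S ** A ** matrix_inv S) ** (S ** matrix_inv A ** matrix_inv S) = mat 1" by (rule matrix_eqI) (use assms in "simp add: mv_mult")
qed

context jordan_triple
begin

declare One_nat_def [simp del]

text \<open>Pairs \<open>(g, g')\<close> of linear maps with \<open>{gx; y; gz} = g{x; g'y; z}\<close>; for bijective \<open>g\<close> the map \<open>g'\<close> is
  the adjoint of \<open>g\<close> for the trace form.\<close>

definition str_pair :: "(complex^'n => complex^'n) => (complex^'n => complex^'n) => bool" where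
 "str_pair g g' \<longleftrightarrow> clin g & clin g' & (ALL x y z. T (g x) y (g z) = g (T x (g' y) z))"

lemma str_pairD: assumes "str_pair g g'" shows "clin g" "clin g'" "T (g x) y (g z) = g (T x (g' y) z)"
 using assms by (auto simp: str_pair_def)

lemma str_pair_id: "str_pair (%x. x) (%x. x)" by (simp add: str_pair_def clin_id)
lemma str_pair_comp: "str_pair g g' ==> str_pair h h' ==> str_pair (%x. g (h x)) (%x. h' (g' x))" by (simp add: str_pair_def clin_comp)

text \<open>Conjugating \<open>D(x, g'y)\<close> by \<open>g\<close> gives \<open>D(gx, y)\<close>, and the trace is invariant.\<close>

lemma str_pair_adjoint:
 assumes "str_pair g g'" "bij g" shows "ip (g x) y = ip x (g' y)" proof -
 note s = str_pairD[OF assms(1)]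
 have gi: "g (inv g z) = z" "inv g (g z) = z" for z using assms(2) by (simp_all add: bij_is_surj surj_f_inv_f bij_is_inj)
 have ci: "clin (inv g)" by (rule clin_inv_bij[OF s(1) assms(2)])
 have "T (g x) y = (%z. g (T x (g' y) (inv g z)))" using s(3)[of x y "inv g _"] by (auto simp: gi)
 hence "ip (g x) y = trace (matrix (%z. g (T x (g' y) (inv g z))))" by (simp add: ip_def)
 also have "... = trace (matrix (%z. T x (g' y) (inv g (g z))))"
  by (rule trace_comp_commute[OF s(1), of "%z. T x (g' y) (inv g z)"]) (rule clin_comp[OF T_clin3 ci])
 finally show ?thesis by (simp add: gi ip_def)
qed

lemma ip_ext2: "(!!x. ip x y = ip x z) ==> y = z" using ip_self_zero[of "y - z"] by (simp add: ip_diff)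

lemma str_pair_bij: assumes "str_pair g g'" "bij g" shows "bij g'" proof -
 note s = str_pairD[OF assms(1)]
 have "y = 0" if "g' y = 0" for y proof -
  have "ip (g x) y = 0" for x using str_pair_adjoint[OF assms, of x y] that by simp
  hence "ip y y = 0" using assms(2) by (metis bij_pointE)
  thus ?thesis by (simp add: ip_self_zero)
 qed
 thus ?thesis using clin_bij_iff_inj[OF s(2)] by blast
qed

lemma str_pair_flip: assumes "str_pair g g'" "bij g" shows "str_pair g' g" proof -
 note s = str_pairD[OF assms(1)]
 note adj = str_pair_adjoint[OF assms]
 have "g' (T y (g x) w) = T (g' y) x (g' w)" for x y w proof (rule ip_ext2)
  fix z
  have "ip z (g' (T y (g x) w)) = ip (T (g x) y (g z)) w" by (simp add: adj[symmetric] ip_adjoint)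
  also have "... = ip (T x (g' y) z) (g' w)" by (simp add: s adj)
  also have "... = ip z (T (g' y) x (g' w))" by (rule ip_adjoint)
  finally show "ip z (g' (T y (g x) w)) = ip z (T (g' y) x (g' w))" .
 qed
 thus ?thesis using s by (simp add: str_pair_def)
qed

lemma str_pair_inv: assumes "str_pair g g'" "bij g" shows "str_pair (inv g) (inv g')" proof -
 note s = str_pairD[OF assms(1)]
 have b': "bij g'" by (rule str_pair_bij[OF assms])
 have gi: "g (inv g z) = z" "inv g (g z) = z" "g' (inv g' z) = z" for z
  using assms(2) b' by (simp_all add: bij_is_surj surj_f_inv_f bij_is_inj)
 have "T (inv g x) y (inv g z) = inv g (T x (inv g' y) z)" for x y z using s(3)[of "inv g x" "inv g' y" "inv g z"] by (simp add: gi)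
 thus ?thesis using clin_inv_bij[OF s(1) assms(2)] clin_inv_bij[OF s(2) b'] by (simp add: str_pair_def)
qed

lemma str_pair_quad: "str_pair g g' ==> quad_op T (g x) y = g (quad_op T x (g' y))"
 using str_pairD[of g g'] by (simp add: quad_op_def clin_scale)

lemma bergman_clin: "clin (bergman_op T u v)" unfolding bergman_op_def quad_op_def
 by (rule clinI) (simp_all add: T_simps vec_eq_iff algebra_simps)

lemma str_pair_bergman_conj:
 assumes "str_pair g g'" "bij g" shows "bergman_op T (g x) v (g z) = g (bergman_op T x (g' v) z)"
 using str_pairD[OF assms(1)] str_pair_quad[OF assms(1)] str_pair_quad[OF str_pair_flip[OF assms]]
 by (simp add: bergman_op_def clin_add clin_diff)

lemma ip_quad: "ip (quad_op T x y) z = ip (quad_op T x z) y" proof -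
 have "ip (T x y x) z = ip x (T y x z)" by (rule ip_adjoint)
 also have "T y x z = T z x y" by (rule T_commute)
 also have "ip x (T z x y) = ip (T x z x) y" by (rule ip_adjoint[symmetric])
 finally show ?thesis by (simp add: quad_op_def ip_scale)
qed

lemma ip_bergman: "ip (bergman_op T x v a) b = ip a (bergman_op T v x b)" proof -
 have "ip (quad_op T x (quad_op T v a)) b = ip (quad_op T x b) (quad_op T v a)" by (rule ip_quad)
 also have "... = cnj (ip (quad_op T v a) (quad_op T x b))" by (rule ip_cnj)
 also have "... = cnj (ip (quad_op T v (quad_op T x b)) a)" by (simp only: ip_quad[of v a])
 also have "... = ip a (quad_op T v (quad_op T x b))" by (rule ip_cnj[symmetric])
 finally show ?thesis by (simp add: bergman_op_def ip_simps ip_adjoint)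
qed

definition Str :: "(complex^'n^'n) set" where
 "Str = {A. invertible A & (EX g'. str_pair ((*v) A) g')}"

lemma StrI: "str_pair g g' ==> bij g ==> matrix g \<in> Str" proof -
 assume a: "str_pair g g'" "bij g"
 have "(*v) (matrix g) = g" using matrix_works[OF str_pairD(1)[OF a(1)]] by auto
 thus ?thesis using a invertible_iff_bij[OF str_pairD(1)[OF a(1)]] by (auto simp: Str_def)
qed

lemma StrE:
 assumes "A \<in> Str" obtains g' where "str_pair ((*v) A) g'" "bij ((*v) A)" using assms invertible_eq_bij by (auto simp: Str_def)

lemma Str_group: "matrix_group Str" unfolding matrix_group_def proof (intro conjI ballI)
 have "(*v) (mat 1) = (%x::complex^'n. x)" by auto
 thus "mat 1 \<in> Str" using str_pair_id by (auto simp: Str_def invertible_eq_bij bij_def)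
 fix A assume A: "A \<in> Str"
 show inv: "invertible A" using A by (simp add: Str_def)
 obtain g' where g: "str_pair ((*v) A) g'" "bij ((*v) A)" by (rule StrE[OF A])
 have "(*v) (matrix_inv A) = inv ((*v) A)" using inv by (intro ext inv_equality[symmetric]) auto
 thus "matrix_inv A \<in> Str" using str_pair_inv[OF g] bij_imp_bij_inv[OF g(2)] by (auto simp: Str_def invertible_eq_bij)
 fix B assume B: "B \<in> Str"
 obtain h' where h: "str_pair ((*v) B) h'" "bij ((*v) B)" by (rule StrE[OF B])
 have "(*v) (A ** B) = (%x. A *v (B *v x))" by (auto simp: matrix_vector_mul_assoc)
 thus "A ** B \<in> Str" using str_pair_comp[OF g(1) h(1)] g(2) h(2) bij_comp[OF h(2) g(2)] by (auto simp: Str_def invertible_eq_bij o_def)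
qed

lemma Aut_Str: "A \<in> Aut ==> A \<in> Str" proof -
 assume A: "A \<in> Aut"
 have "str_pair ((*v) A) ((*v) (matrix_inv A))" unfolding str_pair_def using AutD[OF A] by simp
 thus ?thesis using AutD(1)[OF A] by (auto simp: Str_def)
qed

text \<open>The rank of the quadratic operator takes different values on the \<open>e\<^sub>1 + \<dots> + e\<^sub>m\<close> and is invariant under the
  structure group; so it detects the rank of an element.\<close>

definition rk :: "complex^'n => nat" where "rk z = vec.dim (range (quad_op T z))"

lemma rk_Str: assumes "A \<in> Str" shows "rk (A *v z) = rk z" proof -
 obtain g' where g: "str_pair ((*v) A) g'" "bij ((*v) A)" by (rule StrE[OF assms])
 have "range (quad_op T (A *v z)) = (*v) A ` quad_op T z ` range g'" using str_pair_quad[OF g(1), of z] by (auto simp: image_image)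
 also have "range g' = UNIV" using str_pair_bij[OF g] by (simp add: bij_is_surj)
 finally show ?thesis unfolding rk_def using vec.dim_image_eq[OF clin_matrix, of A "range (quad_op T z)"] bij_is_inj[OF g(2)]
  by (metis inj_on_subset subset_UNIV)
qed

end

context tube_frame
begin

lemma rho_str_pair: "tripotent T c ==> str_pair (rho c s) (rho c (cnj s))" by (simp add: str_pair_def rho_clin rho_T)

text \<open>Compose the scalings along the members of the frame.\<close>

lemma diag_str:
 assumes "J \<subseteq> {1..r}" "!!k. k \<in> J ==> t k ~= 0"
 shows "EX h h'. str_pair h h' & bij h & (\<forall>k\<in>J. h (e k) = (t k)\<^sup>2 *s e k) & (\<forall>k\<in>{1..r} - J. h (e k) = e k)"
proof -
 have "finite J" using assms(1) finite_subset by auto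
 thus ?thesis using assms proof induction
  case empty
  show ?case by (intro exI[of _ "%x. x"]) (auto simp: str_pair_id bij_def)
 next
  case (insert i J)
  then obtain h h' where h: "str_pair h h'" "bij h" "!!k. k \<in> J ==> h (e k) = (t k)\<^sup>2 *s e k" "!!k. k \<in> {1..r} - J ==> h (e k) = e k"
   by auto
  have i: "i \<in> {1..r}" "i \<notin> J" "t i ~= 0" using insert by auto
  let ?g = "%x. h (rho (e i) (t i) x)"
  have "str_pair ?g (%x. rho (e i) (cnj (t i)) (h' x))" by (rule str_pair_comp[OF h(1) rho_str_pair[OF e_tripotent[OF i(1)]]])
  moreover have "bij ?g" using bij_comp[OF rho_bij[OF e_tripotent[OF i(1)] i(3)] h(2)] by (simp add: o_def)
  moreover have "?g (e k) = (t k)\<^sup>2 *s e k" if "k \<in> insert i J" for k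
   using that insert.prems(1) i h rho_e_e[OF i(1), of k] clin_scale[OF str_pairD(1)[OF h(1)]] by auto
  moreover have "?g (e k) = e k" if "k \<in> {1..r} - insert i J" for k using that h rho_e_e[OF i(1), of k] by auto
  ultimately show ?case by blast
 qed
qed

lemma quad_un: "quad_op T un = st" by (rule ext) (simp add: quad_op_def star_def)
lemma T_un_left: "T un x w = 2 *s jo (st x) w" by (rule T_move_left[OF un_tripotent pspace_unit])

text \<open>For the unit, \<open>B(un,v)\<close> is a quadratic operator up to the involution.\<close>

lemma bergman_un: "bergman_op T un v z = st (quad_op T (un - v) z)" proof -
 have "st (T un z v) = T un v z" proof -
  have "st (T un z v) = T un (st z) (st v)" by (simp add: st_T)
  also have "... = 2 *s jo (st v) z" by (simp add: T_un_left jp_commute)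
  finally show ?thesis by (simp add: T_un_left)
 qed
 hence s: "T un v z = st (T un z v)" by simp
 have q: "quad_op T (un - v) z = st z - T un z v + quad_op T v z"
  by (simp add: quad_op_def T_diff T_commute[of v z un] star_def vec_eq_iff field_simps)
 show ?thesis unfolding q bergman_op_def quad_un star_simps by (simp add: s)
qed

lemma str_pair_st: "str_pair g g' ==> str_pair (%x. st (g (st x))) (%x. st (g' (st x)))" proof -
 assume s: "str_pair g g'"
 note sp = str_pairD[OF s]
 have "T (st (g (st x))) y (st (g (st z))) = st (g (st (T x (st (g' (st y))) z)))" for x y z proof -
  have "T (st (g (st x))) y (st (g (st z))) = st (T (g (st x)) (st y) (g (st z)))" by (simp add: st_T)
  also have "... = st (g (T (st x) (g' (st y)) (st z)))" by (simp add: sp)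
  finally show ?thesis by (simp add: st_T)
 qed
 moreover have "clin (%x. st (g (st x)))" "clin (%x. st (g' (st x)))" using sp by (auto intro!: clinI simp: clin_add clin_scale star_simps)
 ultimately show ?thesis by (simp add: str_pair_def)
qed

lemma diag_esum:
 assumes J: "J \<subseteq> {1..r}" and s: "!!i. i \<in> J ==> (s i :: real) > 0"
 obtains h h' where "str_pair h h'" "bij h" "h (esum J) = (\<Sum>i\<in>J. of_real (s i) *s e i)" proof -
 have "EX h h'. str_pair h h' & bij h & (\<forall>k\<in>J. h (e k) = (of_real (sqrt (s k)))\<^sup>2 *s e k)
   & (\<forall>k\<in>{1..r} - J. h (e k) = e k)" by (rule diag_str[OF J]) (use s in force)
 then obtain h h' where h: "str_pair h h'" "bij h" "\<forall>k\<in>J. h (e k) = (of_real (sqrt (s k)))\<^sup>2 *s e k" by blast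
 have "h (esum J) = (\<Sum>i\<in>J. of_real (s i) *s e i)" unfolding esum_def clin_sum[OF str_pairD(1)[OF h(1)]] proof (intro sum.cong refl)
  fix k assume k: "k \<in> J"
  have "(complex_of_real (sqrt (s k)))\<^sup>2 = of_real (s k)" using s[OF k] by (simp flip: of_real_power)
  thus "h (e k) = of_real (s k) *s e k" using h(3) k by simp
 qed
 thus ?thesis using that h by blast
qed

end

locale kepler_frame = tube_frame T r a e for T :: "('n::finite) triple" and r a and e +
 fixes l :: nat
 assumes irr: "irreducible_triple T" and l_pos: "0 < l" and l_less: "l < r"
begin

lemma a_nonzero: "a ~= 0" by (rule irreducible_a_nonzero[OF irr]) (use l_pos l_less in auto)

lemmas spectral = spectral_theorem[OF a_nonzero]

text \<open>An element with injective quadratic operator has only nonzero spectral values, so scalings and an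
  automorphism carry the unit to it.\<close>

lemma inj_quad_orbit:
 assumes inj: "!!z. quad_op T y z = 0 ==> z = 0"
 obtains g g' where "str_pair g g'" "bij g" "y = g un" proof -
 obtain k s where k: "k \<in> K_group T" "y = k *v (\<Sum>i=1..r. of_real (s i :: real) *s e i)"
  "!!i. i \<in> {1..r} ==> 0 <= s i" by (rule spectral[of y]) blast
 have kA: "k \<in> Aut" using k(1) K_Aut by blast
 obtain k' where k': "str_pair ((*v) k) k'" "bij ((*v) k)" by (rule StrE[OF Aut_Str[OF kA]])
 have "s i > 0" if i: "i \<in> {1..r}" for i proof (rule ccontr)
  assume "\<not> s i > 0"
  hence si: "s i = 0" using k(3)[OF i] by simp
  let ?d = "\<Sum>i=1..r. of_real (s i) *s e i"
  have "T ?d (e i) ?d = (\<Sum>j=1..r. of_real (s j) *s T (e j) (e i) ?d)" by (subst (1) T_sum(1)) (simp add: T_scale)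
  also have "... = 0" proof (intro sum.neutral ballI)
   fix j assume "j \<in> {1..r}"
   thus "of_real (s j) *s T (e j) (e i) ?d = 0" using e_orth[of j i ?d] i si by (cases "j = i") auto
  qed
  finally have "quad_op T ?d (e i) = 0" by (simp add: quad_op_def)
  moreover have "quad_op T y (k *v e i) = k *v quad_op T ?d (e i)" unfolding k(2) quad_op_def clin_scale[OF clin_matrix] AutD(2)[OF kA] ..
  ultimately have "k *v e i = 0" using inj[of "k *v e i"] by simp
  hence "e i = 0" using AutD(1)[OF kA] by (metis inv_mv(2) matrix_vector_mult_0_right)
  thus False using e_nonzero[OF i] by simp
 qed
 then obtain h h' where h: "str_pair h h'" "bij h" "h un = (\<Sum>i=1..r. of_real (s i) *s e i)"
  using diag_esum[OF order_refl, of s] by blast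
 have "str_pair (%x. k *v h x) (%x. h' (k' x))" by (rule str_pair_comp[OF k'(1) h(1)])
 moreover have "bij (%x. k *v h x)" using bij_comp[OF h(2) k'(2)] by (simp add: o_def)
 ultimately show ?thesis using that k(2) h(3) by metis
qed

text \<open>After transport by \<open>g\<close> it is enough to treat \<open>B(un,v)\<close>, which is given by the quadratic operator of
  \<open>un - v\<close>; injectivity makes \<open>un - v\<close> the image of the unit under the structure group, and the assertion reduces to that for the
  unit.\<close>

lemma bergman_str_generic:
 assumes g: "str_pair g g'" "bij g" and b: "bij (bergman_op T (g un) v)" shows "str_pair (bergman_op T (g un) v) (bergman_op T v (g un))"
proof -
 have conj: "bergman_op T (g un) v (g z) = g (bergman_op T un (g' v) z)" for z by (rule str_pair_bergman_conj[OF g])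
 have "quad_op T (un - g' v) z = 0 ==> z = 0" for z proof -
  assume "quad_op T (un - g' v) z = 0"
  hence "bergman_op T (g un) v (g z) = 0" unfolding conj bergman_un by (simp add: clin_zero[OF str_pairD(1)[OF g(1)]])
  hence "g z = 0" using b clin_bij_iff_inj[OF bergman_clin] by blast
  thus "z = 0" using g clin_bij_iff_inj[OF str_pairD(1)[OF g(1)]] by blast
 qed
 then obtain h h' where h: "str_pair h h'" "bij h" "un - g' v = h un" using inj_quad_orbit by blast
 define B where "B = (%z. st (h (st (h' z))))"
 have Bz: "bergman_op T un (g' v) z = B z" for z unfolding bergman_un h(3) str_pair_quad[OF h(1)] quad_un B_def ..
 have sB: "str_pair B (%x. h (st (h' (st x))))"
  unfolding B_def using str_pair_comp[OF str_pair_st[OF h(1)] str_pair_flip[OF h(1,2)]] by simp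
 have gi: "g (inv g z) = z" for z using g(2) by (simp add: bij_is_surj surj_f_inv_f)
 have eq: "bergman_op T (g un) v = (%z. g (B (inv g z)))" using conj[of "inv g _"] by (auto simp: gi Bz)
 have "str_pair (%z. g (B (inv g z))) (%z. inv g' (h (st (h' (st (g' z))))))"
  using str_pair_comp[OF g(1) str_pair_comp[OF sB str_pair_inv[OF g]]] by simp
 then obtain B' where B': "str_pair (bergman_op T (g un) v) B'" unfolding eq by blast
 have "B' y = bergman_op T v (g un) y" for y by (rule ip_ext2) (simp only: str_pair_adjoint[OF B' b, symmetric] ip_bergman)
 hence "B' = bergman_op T v (g un)" by auto
 thus ?thesis using B' by simp
qed

text \<open>Every \<open>B(u,v)\<close> is a limit of operators to which the previous lemma applies.\<close>

lemma bergman_str: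
 assumes b: "bij (bergman_op T u v)" shows "str_pair (bergman_op T u v) (bergman_op T v u)" proof -
 obtain k s where k: "k \<in> K_group T" "u = k *v (\<Sum>i=1..r. of_real (s i :: real) *s e i)"
  "!!i. i \<in> {1..r} ==> 0 <= s i" by (rule spectral[of u]) blast
 have kA: "k \<in> Aut" using k(1) K_Aut by blast
 obtain k' where k': "str_pair ((*v) k) k'" "bij ((*v) k)" by (rule StrE[OF Aut_Str[OF kA]])
 define x where "x \<epsilon> = k *v (\<Sum>i=1..r. of_real (s i + \<epsilon>) *s e i)" for \<epsilon> :: real
 have x0: "x 0 = u" by (simp add: x_def k(2))
 have cx: "continuous_on UNIV x" unfolding x_def by (intro continuous_intros)
 have cont: "continuous_on UNIV (%\<epsilon>. bergman_op T (x \<epsilon>) v z)" "continuous_on UNIV (%\<epsilon>. bergman_op T v (x \<epsilon>) z)" for z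
  unfolding bergman_op_def quad_op_def by (intro continuous_intros cx)+
 have "continuous_on UNIV (%\<epsilon>. Det (bergman_op T (x \<epsilon>) v))"
  unfolding det_def by (intro continuous_intros cont[THEN continuous_on_compose2] continuous_on_component matrix_continuous cont)
 hence "((%\<epsilon>. Det (bergman_op T (x \<epsilon>) v)) \<longlongrightarrow> Det (bergman_op T u v)) (at_right 0)"
  unfolding x0[symmetric] by (simp add: continuous_on_def) (meson filterlim_at_within_If tendsto_within_subset subset_UNIV UNIV_I)
 moreover have "Det (bergman_op T u v) ~= 0" using b Det_nz_iff[OF bergman_clin] by blast
 ultimately have ev: "\<forall>\<^sub>F \<epsilon> in at_right 0. Det (bergman_op T (x \<epsilon>) v) ~= 0" by (rule tendsto_imp_eventually_ne)
 have "T (bergman_op T u v a) y (bergman_op T u v z) = bergman_op T u v (T a (bergman_op T v u y) z)" for a y z proof -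
  let ?F = "%\<epsilon>. T (bergman_op T (x \<epsilon>) v a) y (bergman_op T (x \<epsilon>) v z) - bergman_op T (x \<epsilon>) v (T a (bergman_op T v (x \<epsilon>) y) z)"
  have cF: "continuous_on UNIV ?F" unfolding bergman_op_def quad_op_def by (intro continuous_intros cx)
  hence lim: "(?F \<longlongrightarrow> ?F 0) (at_right 0)"
   by (simp add: continuous_on_def) (meson tendsto_within_subset subset_UNIV UNIV_I)
  have "\<forall>\<^sub>F \<epsilon> in at_right 0. ?F \<epsilon> = 0" using ev eventually_at_right_less[of 0] proof eventually_elim
   case (elim \<epsilon>)
   have "s i + \<epsilon> > 0" if "i \<in> {1..r}" for i using k(3)[OF that] elim(2) by simp
   then obtain h h' where h: "str_pair h h'" "bij h" "h un = (\<Sum>i=1..r. of_real (s i + \<epsilon>) *s e i)"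
    using diag_esum[OF order_refl, of "%i. s i + \<epsilon>"] by blast
   have g: "str_pair (%x. k *v h x) (%x. h' (k' x))" "bij (%x. k *v h x)"
    using str_pair_comp[OF k'(1) h(1)] bij_comp[OF h(2) k'(2)] by (simp_all add: o_def)
   have xe: "x \<epsilon> = k *v h un" by (simp only: x_def h(3))
   have "bij (bergman_op T (x \<epsilon>) v)" using elim(1) Det_nz_iff[OF bergman_clin] by blast
   hence "str_pair (bergman_op T (x \<epsilon>) v) (bergman_op T v (x \<epsilon>))" unfolding xe by (rule bergman_str_generic[OF g])
   thus ?case by (simp add: str_pair_def)
  qed
  hence "(?F \<longlongrightarrow> 0) (at_right 0)" by (rule tendsto_eventually)
  hence "?F 0 = 0" by (rule tendsto_unique[OF trivial_limit_at_right_real lim])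
  thus ?thesis by (simp add: x0)
 qed
 thus ?thesis by (simp add: str_pair_def bergman_clin)
qed

section \<open>The Kepler manifold as an orbit\<close>

abbreviation cc :: "nat => complex^'n" where "cc m \<equiv> esum {1..m}"

lemma cc_tripotent: "m <= r ==> tripotent T (cc m)" by (rule esum_tripotent) auto

lemma down_closed_segment:
 fixes J :: "nat set"
 assumes "J \<subseteq> {1..r}" "!!i j. j \<in> J ==> 1 <= i ==> i <= j ==> i \<in> J" shows "J = {1..card J}" proof (cases "J = {}")
 case False
 have fin: "finite J" using assms(1) finite_subset by auto
 have "J = {1..Max J}" using assms Max_in[OF fin False] Max_ge[OF fin] by (auto intro: assms(2)[OF Max_in[OF fin False]])
 thus ?thesis by (metis card_atLeastAtMost diff_Suc_1 Suc_eq_plus1 add_diff_cancel_right')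
qed simp

lemma has_rank_orbit:
 assumes "has_rank T r e z m" shows "m <= r & (\<exists>A\<in>Str. z = A *v cc m)" proof -
 obtain k s where k: "k \<in> K_group T" "z = k *v (\<Sum>i=1..r. of_real (s i) *s e i)"
  and s: "!!i j. 1 <= i ==> i <= j ==> j <= r ==> s j <= s i" "!!i. i \<in> {1..r} ==> 0 <= s i" and m: "m = card {i\<in>{1..r}. s i ~= 0}"
  using assms unfolding has_rank_def by blast
 let ?J = "{i\<in>{1..r}. s i ~= 0}"
 have "i \<in> ?J" if "j \<in> ?J" "1 <= i" "i <= j" for i j proof -
  have "s j > 0" using that s(2)[of j] by (auto simp: order.strict_iff_order)
  hence "s i > 0" using s(1)[of i j] that by auto
  thus ?thesis using that by auto
 qed
 hence J: "?J = {1..m}" unfolding m by (intro down_closed_segment) auto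
 have "card ?J <= card {1..r}" by (rule card_mono) auto
 hence mr: "m <= r" unfolding m[symmetric] by simp
 have pos: "s i > 0" if "i \<in> {1..m}" for i using that s(2)[of i] unfolding J[symmetric] by (auto simp: order.strict_iff_order)
 obtain h h' where h: "str_pair h h'" "bij h" "h (cc m) = (\<Sum>i\<in>{1..m}. of_real (s i) *s e i)"
  using diag_esum[of "{1..m}" s] pos mr by auto
 note h(3)
 also have "... = (\<Sum>i=1..r. of_real (s i) *s e i)" proof (rule sum.mono_neutral_left)
  have "s i = 0" if "i \<in> {1..r} - {1..m}" for i using that unfolding J[symmetric] by simp
  thus "\<forall>i\<in>{1..r} - {1..m}. of_real (s i) *s e i = 0" by simp
 qed (use mr in auto)
 finally have hc: "h (cc m) = (\<Sum>i=1..r. of_real (s i) *s e i)" .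
 have "k ** matrix h \<in> Str" using Str_group Aut_Str[of k] K_Aut k(1) StrI[OF h(1,2)] by (auto simp: matrix_group_def)
 moreover have "z = (k ** matrix h) *v cc m" by (simp add: mv_mult matrix_works[OF str_pairD(1)[OF h(1)]] hc k(2))
 ultimately show ?thesis using mr by blast
qed

lemma has_rank_exists: "EX m. has_rank T r e z m" proof -
 obtain k s where "k \<in> K_group T" "z = k *v (\<Sum>i=1..r. of_real (s i :: real) *s e i)"
  "!!i j. 1 <= i ==> i <= j ==> j <= r ==> s j <= s i" "!!i. i \<in> {1..r} ==> 0 <= s i" by (rule spectral[of z]) blast
 thus ?thesis unfolding has_rank_def by blast
qed

lemma rk_cc: "m <= r ==> rk (cc m) = vec.dim (pspace (cc m) 2)" proof -
 assume m: "m <= r"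
 note t = cc_tripotent[OF m]
 have "range (quad_op T (cc m)) = pspace (cc m) 2" proof
  show "range (quad_op T (cc m)) \<subseteq> pspace (cc m) 2" using star_def[of "cc m"] Q_pspace2[OF t] pspace_scale
   by (auto simp: quad_op_def)
  show "pspace (cc m) 2 \<subseteq> range (quad_op T (cc m))" proof
   fix x assume "x \<in> pspace (cc m) 2"
   hence "x = quad_op T (cc m) (star (cc m) x)" using star_star[OF t] by (simp add: quad_op_def star_def)
   thus "x \<in> range (quad_op T (cc m))" by blast
  qed
 qed
 thus ?thesis by (simp add: rk_def)
qed

lemma T_cc: "m <= r ==> T (cc m) (cc m) z = (\<Sum>k=1..m. L k z)" by (rule T_esum) auto

lemma cc_mono: "m <= r ==> z \<in> pspace (cc m) 2 ==> k \<in> {1..r} - {1..m} ==> L k z = 0" proof -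
 assume m: "m <= r" and z: "z \<in> pspace (cc m) 2" and k: "k \<in> {1..r} - {1..m}"
 have "e k \<in> pspace (cc m) 0" unfolding pspace_def using T_cc[OF m, of "e k"] L_e[of k] k m by (auto intro!: sum.neutral)
 hence "T z (e k) (e k) = 0" by (rule T_pspace_20[OF cc_tripotent[OF m] z])
 thus ?thesis by (simp add: T_commute[of z])
qed

lemma rk_cc_strict: assumes "m < m'" "m' <= r" shows "rk (cc m) < rk (cc m')" proof -
 have m: "m <= r" using assms by simp
 have sub: "pspace (cc m) 2 \<subseteq> pspace (cc m') 2" proof
  fix z assume z: "z \<in> pspace (cc m) 2"
  have "(\<Sum>k=1..m'. L k z) = (\<Sum>k=1..m. L k z)" by (rule sum.mono_neutral_right) (use assms cc_mono[OF m z] in auto)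
  thus "z \<in> pspace (cc m') 2" using pspaceD[OF z] by (simp add: pspace_def T_cc m assms)
 qed
 have "e m' \<in> pspace (cc m') 2" by (rule unit_pspace2[OF tripotent_pspace[OF e_tripotent], of m']) (use assms in auto)
 moreover have "e m' \<notin> pspace (cc m) 2" proof
  assume "e m' \<in> pspace (cc m) 2"
  hence "L m' (e m') = 0" by (rule cc_mono[OF m]) (use assms in auto)
  thus False using L_e[of m' m'] e_nonzero[of m'] assms by auto
 qed
 ultimately have "pspace (cc m) 2 \<subset> pspace (cc m') 2" using sub by blast
 hence "vec.span (pspace (cc m) 2) \<subset> vec.span (pspace (cc m') 2)" by (simp add: vec.span_eq_iff[THEN iffD2, OF pspace_subspace])
 thus ?thesis using vec.dim_psubset rk_cc m assms(2) by simp
qed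

abbreviation M :: "(complex^'n) set" where "M \<equiv> kepler T r e l"

lemma l_le: "l <= r" using l_less by simp

text \<open>The manifold is one orbit of the structure group, cut out by the rank of the quadratic operator.\<close>

lemma M_iff_rk: "z \<in> M \<longleftrightarrow> rk z = rk (cc l)" proof
 assume "z \<in> M"
 thus "rk z = rk (cc l)" using has_rank_orbit[of z l] rk_Str by (auto simp: kepler_def)
next
 assume z: "rk z = rk (cc l)"
 obtain m where m: "has_rank T r e z m" using has_rank_exists by blast
 have "m <= r" "rk z = rk (cc m)" using has_rank_orbit[OF m] rk_Str by auto
 hence "m = l" using rk_cc_strict[of m l] rk_cc_strict[of l m] z l_le by (metis less_irrefl linorder_neqE_nat)
 thus "z \<in> M" using m by (simp add: kepler_def)
qed

lemma M_orbit: "z \<in> M ==> \<exists>A\<in>Str. z = A *v cc l" using has_rank_orbit[of z l] by (simp add: kepler_def)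
lemma M_Str: "A \<in> Str ==> A *v z \<in> M \<longleftrightarrow> z \<in> M" by (simp add: M_iff_rk rk_Str)
lemma cc_M: "cc l \<in> M" by (simp add: M_iff_rk)

section \<open>The group generated by the Bergman operators\<close>

abbreviation KR :: "(complex^'n^'n) set" where "KR \<equiv> K_ring T"

abbreviation mB :: "complex^'n => complex^'n => complex^'n^'n" where "mB u v \<equiv> matrix (bergman_op T u v)"

lemma KR_gen: "invertible (mB u v) ==> mB u v \<in> KR" unfolding K_ring_def by (rule hull_inc) blast

lemma KR_induct:
 assumes "matrix_group H" "!!u v. invertible (mB u v) ==> mB u v \<in> H" shows "KR \<subseteq> H"
 unfolding K_ring_def by (rule hull_minimal) (use assms in auto)

lemma matrix_group_Inter:
 assumes "\<F> ~= {}" "!!H. H \<in> \<F> ==> matrix_group H" shows "matrix_group (\<Inter>\<F>)"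
 using assms unfolding matrix_group_def by blast

lemma mB_Str: "invertible (mB u v) ==> mB u v \<in> Str"
 using bergman_str[of u v] StrI[of "bergman_op T u v"] invertible_iff_bij[OF bergman_clin] by blast

lemma KR_group: "matrix_group KR" unfolding K_ring_def hull_def by (rule matrix_group_Inter) (use mB_Str Str_group in auto)
lemma KR_Str: "KR \<subseteq> Str" by (rule KR_induct[OF Str_group mB_Str])

lemma matrix_group_mult: "matrix_group H ==> A \<in> H ==> B \<in> H ==> A ** B \<in> H"
 and matrix_group_inv: "matrix_group H ==> A \<in> H ==> matrix_inv A \<in> H" and matrix_group_one: "matrix_group H ==> mat 1 \<in> H"
 and matrix_group_invertible: "matrix_group H ==> A \<in> H ==> invertible A" by (auto simp: matrix_group_def)

lemma KR_mult: "A \<in> KR ==> B \<in> KR ==> A ** B \<in> KR" by (rule matrix_group_mult[OF KR_group])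
lemma KR_inv: "A \<in> KR ==> matrix_inv A \<in> KR" by (rule matrix_group_inv[OF KR_group])
lemma KR_invertible: "A \<in> KR ==> invertible A" by (rule matrix_group_invertible[OF KR_group])
lemma KR_one: "mat 1 \<in> KR" by (rule matrix_group_one[OF KR_group])

text \<open>Conjugation by an element of the structure group maps generators to generators.\<close>

lemma KR_conj: assumes S: "S \<in> Str" and A: "A \<in> KR" shows "S ** A ** matrix_inv S \<in> KR" proof -
 have inv: "invertible S" using S by (simp add: Str_def)
 let ?H = "{A. invertible A & S ** A ** matrix_inv S \<in> KR}"
 have cancel: "matrix_inv S ** (S ** X) = X" "S ** (matrix_inv S ** X) = X" for X :: "complex^'n^'n"
  by (simp_all add: matrix_mul_assoc matrix_inv_mult[OF inv])
 have "matrix_group ?H" unfolding matrix_group_def proof (intro conjI ballI)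
  show "mat 1 \<in> ?H" using KR_one by (simp add: matrix_inv_mult[OF inv] invertible_det_nz)
  fix A assume A: "A \<in> ?H"
  hence iA: "invertible A" by simp
  show "invertible A" by (rule iA)
  note matrix_inv_conj[OF inv iA]
  hence "S ** matrix_inv A ** matrix_inv S \<in> KR" using A KR_inv by fastforce
  moreover have "invertible (matrix_inv A)" using matrix_inv_mult[OF iA] by (auto simp: invertible_def)
  ultimately show "matrix_inv A \<in> ?H" by simp
  fix B assume B: "B \<in> ?H"
  have "(S ** A ** matrix_inv S) ** (S ** B ** matrix_inv S) \<in> KR" using A B KR_mult by auto
  moreover have "(S ** A ** matrix_inv S) ** (S ** B ** matrix_inv S) = S ** (A ** B) ** matrix_inv S"
   by (simp add: matrix_mul_assoc[symmetric] cancel)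
  ultimately show "A ** B \<in> ?H" using A B by (simp add: invertible_mult)
 qed
 moreover have "mB u v \<in> ?H" if B: "invertible (mB u v)" for u v proof -
  obtain g' where g: "str_pair ((*v) S) g'" "bij ((*v) S)" by (rule StrE[OF S])
  let ?v = "inv g' v"
  have gi: "g' ?v = v" using str_pair_bij[OF g] by (simp add: bij_is_surj surj_f_inv_f)
  have "bergman_op T (S *v u) ?v (S *v z) = S *v bergman_op T u v z" for z using str_pair_bergman_conj[OF g, of u ?v z] by (simp add: gi)
  from this[of "matrix_inv S *v _"] have eq: "mB (S *v u) ?v = S ** mB u v ** matrix_inv S"
   using inv by (intro matrix_eqI) (simp add: mv_mult matrix_works[OF bergman_clin])
  have "invertible (S ** mB u v ** matrix_inv S)" using inv B matrix_inv_mult[OF inv] by (intro invertible_mult) (auto simp: invertible_def)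
  hence "S ** mB u v ** matrix_inv S \<in> KR" using KR_gen[of "S *v u" ?v] by (simp add: eq)
  thus ?thesis using B by simp
 qed
 ultimately have "KR \<subseteq> ?H" by (rule KR_induct)
 thus ?thesis using A by blast
qed

lemma rho_KR: assumes "tripotent T c" "s ~= 0" shows "matrix (rho c s) \<in> KR" proof -
 have "mB ((1 - s) *s c) c = matrix (rho c s)" using bergman_rho[OF assms(1), of "1 - s"] by simp
 thus ?thesis using KR_gen[of "(1 - s) *s c" c] invertible_iff_bij[OF rho_clin] rho_bij[OF assms] by simp
qed

lemma scalar_KR: assumes "s ~= 0" shows "matrix (%z. s *s z) \<in> KR" proof -
 have "rho un (csqrt s) = (%z. s *s z)" using rho_pspace[OF pspace_unit, of "csqrt s"] by (auto simp: fun_eq_iff)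
 thus ?thesis using rho_KR[OF un_tripotent, of "csqrt s"] assms by simp
qed

end

section \<open>Tangent spaces of complex submanifolds\<close>

lemma holomorphic_wrtD:
 assumes "holomorphic_wrt (*s) f S" "open S" "x \<in> S"
 obtains f' where "(f has_derivative f') (at x)" "clin (f' :: complex^'n => complex^'n)" proof -
 obtain f' where f': "(f has_derivative f') (at x within S)" "!!c v. f' (c *s v) = c *s f' v"
  using assms unfolding holomorphic_wrt_def by blast
 have "(f has_derivative f') (at x)" using f'(1) at_within_open[OF assms(3,2)] by simp
 thus ?thesis using that clin_derivative f'(2) by blast
qed

lemma slice_chartD:
 assumes "slice_chart d M W f g V" shows "open W" "open (f ` W)" "holomorphic_wrt (*s) f W" "holomorphic_wrt (*s) g (f ` W)"
  "!!x. x \<in> W ==> g (f x) = x" "vec.subspace V" "vec.dim V = d" "f ` (W \<inter> M) = f ` W \<inter> V"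
 using assms unfolding slice_chart_def by auto

lemma slice_chart_derivatives:
 fixes f :: "complex^'n => complex^'n"
 assumes ch: "slice_chart d M W f g V" and z: "z \<in> W"
 obtains f' g' where "(f has_derivative f') (at z)" "(g has_derivative g') (at (f z))" "clin f'" "clin g'"
  "!!v. g' (f' v) = v" "!!v. f' (g' v) = v" proof -
 note D = slice_chartD[OF ch]
 obtain f' where f': "(f has_derivative f') (at z)" "clin f'" by (rule holomorphic_wrtD[OF D(3,1) z])
 obtain g' where g': "(g has_derivative g') (at (f z))" "clin g'" by (rule holomorphic_wrtD[OF D(4,2), of "f z"]) (use z in auto)
 have "((%x. g (f x)) has_derivative (%v. g' (f' v))) (at z)" by (rule has_derivative_compose[OF f'(1) g'(1)])
 moreover have "((%x. g (f x)) has_derivative (%v. v)) (at z)"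
  by (rule has_derivative_transform_within_open[OF has_derivative_ident D(1) z]) (simp add: D(5))
 ultimately have gf: "(%v. g' (f' v)) = (%v. v)" by (rule has_derivative_unique)
 hence gf': "g' (f' v) = v" for v by metis
 have "inj f'" by (rule injI) (metis gf')
 hence "bij f'" using clin_bij_iff_inj[OF f'(2)] gf' clin_zero[OF g'(2)] by metis
 hence "surj f'" by (rule bij_is_surj)
 hence "f' (g' v) = v" for v using gf' by (metis surjD)
 thus ?thesis using that f' g' gf' by blast
qed

lemma slice_chart_inverse_derivative:
 fixes f :: "complex^'n => complex^'n"
 assumes "slice_chart d M W f g V" "z \<in> W" shows "EX g'. (g has_derivative g') (at (f z))"
 by (rule slice_chart_derivatives[OF assms]) (rule exI)

text \<open>A chart maps curves in the manifold to curves in the subspace, whose velocities stay in it because subspaces are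
  closed; conversely lines in the subspace pull back to curves.\<close>

lemma tangent_space_slice:
 fixes f :: "complex^'n => complex^'n"
 assumes ch: "slice_chart d M W f g V" and z: "z \<in> W" "z \<in> M" and g': "(g has_derivative g') (at (f z))"
 shows "tangent_space M z = g' ` V" "vec.dim (tangent_space M z) = d" "vec.subspace (tangent_space M z)" proof -
 note D = slice_chartD[OF ch]
 obtain f' g'' where d: "(f has_derivative f') (at z)" "(g has_derivative g'') (at (f z))" "clin f'" "clin g''"
  "!!v. g'' (f' v) = v" "!!v. f' (g'' v) = v" using slice_chart_derivatives[OF ch z(1)] by metis
 have gg: "g'' = g'" by (rule has_derivative_unique[OF d(2) g'])
 have fz: "f z \<in> V" "f z \<in> f ` W" using D(8) z by auto
 show eq: "tangent_space M z = g' ` V" proof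
  show "tangent_space M z \<subseteq> g' ` V" proof
   fix v assume "v \<in> tangent_space M z"
   then obtain \<gamma> :: "real => complex^'n" where \<gamma>: "\<gamma> 0 = z" "\<forall>\<^sub>F t in nhds 0. \<gamma> t \<in> M" "(\<gamma> has_vector_derivative v) (at 0)"
    unfolding tangent_space_def by blast
   have "(\<gamma> \<longlongrightarrow> z) (at 0)"
    using has_vector_derivative_continuous[OF \<gamma>(3)] \<gamma>(1) by (simp add: continuous_within)
   hence "\<forall>\<^sub>F t in at 0. \<gamma> t \<in> W" using D(1) z(1) by (rule topological_tendstoD)
   moreover have "\<forall>\<^sub>F t in at 0. \<gamma> t \<in> M" using \<gamma>(2) by (simp add: eventually_nhds_conv_at)
   ultimately have ev: "\<forall>\<^sub>F t in at 0. (f (\<gamma> t) - f z) /\<^sub>R t \<in> V" proof eventually_elim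
    case (elim t)
    hence "f (\<gamma> t) \<in> V" using D(8) by blast
    thus ?case using fz(1) unfolding scaleR_eq_scale by (intro vec.subspace_scale[OF D(6)] vec.subspace_diff[OF D(6)])
   qed
   have "((%t. f (\<gamma> t)) has_derivative (%t. f' (t *\<^sub>R v))) (at 0)"
    using has_derivative_compose[OF \<gamma>(3)[unfolded has_vector_derivative_def], of f f'] d(1) by (simp add: \<gamma>(1))
   moreover have "f' (t *\<^sub>R v) = t *\<^sub>R f' v" for t by (simp add: scaleR_eq_scale clin_scale[OF d(3)])
   ultimately have "((%t. f (\<gamma> t)) has_vector_derivative f' v) (at 0)" by (simp add: has_vector_derivative_def)
   hence lim: "((%y. norm (f (\<gamma> y) - f (\<gamma> 0) - (y - 0) *\<^sub>R f' v) / norm (y - 0)) \<longlongrightarrow> 0) (at 0)"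
    unfolding has_vector_derivative_def has_derivative_iff_norm by blast
   have "norm (f (\<gamma> y) - f (\<gamma> 0) - (y - 0) *\<^sub>R f' v) / norm (y - 0) = norm ((f (\<gamma> y) - f z) /\<^sub>R y - f' v)" if "y ~= 0" for y
   proof -
    have "f (\<gamma> y) - f z - y *\<^sub>R f' v = y *\<^sub>R ((f (\<gamma> y) - f z) /\<^sub>R y - f' v)" using that by (simp add: algebra_simps)
    thus ?thesis using that by (simp add: \<gamma>(1))
   qed
   with lim have "((%y. norm ((f (\<gamma> y) - f z) /\<^sub>R y - f' v)) \<longlongrightarrow> 0) (at 0)"
    by (elim Lim_transform_eventually) (auto simp: eventually_at_filter)
   hence "((%t. (f (\<gamma> t) - f z) /\<^sub>R t) \<longlongrightarrow> f' v) (at 0)" by (simp only: tendsto_norm_zero_iff LIM_zero_iff)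
   hence "f' v \<in> V"
    by (intro Lim_in_closed_set[OF _ ev]) (use D(6) in "auto intro!: closed_subspace simp: vec.subspace_def subspace_def scaleR_eq_scale")
   thus "v \<in> g' ` V" using d(5)[of v] gg by (metis image_eqI)
  qed
  show "g' ` V \<subseteq> tangent_space M z" proof
   fix v assume "v \<in> g' ` V"
   then obtain w where w: "w \<in> V" "v = g' w" by blast
   define \<gamma> where "\<gamma> t = g (f z + t *\<^sub>R w)" for t :: real
   have line: "((%t. f z + t *\<^sub>R w) has_derivative (%t. t *\<^sub>R w)) (at 0)" by (auto intro!: derivative_eq_intros)
   have "(\<gamma> has_derivative (%t. g' (t *\<^sub>R w))) (at 0)"
    unfolding \<gamma>_def using has_derivative_compose[OF line, of g g'] g' by simp
   moreover have "g' (t *\<^sub>R w) = t *\<^sub>R v" for t using d(4) w(2) gg by (simp add: scaleR_eq_scale clin_scale)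
   ultimately have der: "(\<gamma> has_vector_derivative v) (at 0)" by (simp add: has_vector_derivative_def)
   have "((%t. f z + t *\<^sub>R w) \<longlongrightarrow> f z) (nhds 0)" by (rule tendsto_eq_intros | simp)+ (auto simp: filterlim_ident)
   hence "\<forall>\<^sub>F t in nhds 0. f z + t *\<^sub>R w \<in> f ` W" by (rule topological_tendstoD[OF _ D(2) fz(2)])
   hence "\<forall>\<^sub>F t in nhds 0. \<gamma> t \<in> M" proof eventually_elim
    case (elim t)
    have "f z + t *\<^sub>R w \<in> V" using fz(1) w(1) unfolding scaleR_eq_scale
     by (intro vec.subspace_add[OF D(6)] vec.subspace_scale[OF D(6)])
    then obtain x where "x \<in> W" "x \<in> M" "f z + t *\<^sub>R w = f x" using elim D(8) by blast
    thus ?case by (simp add: \<gamma>_def D(5))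
   qed
   moreover have "\<gamma> 0 = z" by (simp add: \<gamma>_def D(5) z)
   ultimately show "v \<in> tangent_space M z" using der unfolding tangent_space_def by blast
  qed
 qed
 have lin: "clin g'" using d(4) gg by simp
 have "inj g'" using d(6) gg by (metis injI)
 thus "vec.dim (tangent_space M z) = d" unfolding eq using vec.dim_image_eq[OF lin, of V] D(7) inj_on_subset by blast
 show "vec.subspace (tangent_space M z)" unfolding eq by (rule vec.linear_subspace_image[OF lin D(6)])
qed

lemma complex_dim_eq:
 assumes "complex_submanifold d M" "z \<in> M" shows "complex_dim M = d" unfolding complex_dim_def proof (rule the_equality)
 show "complex_submanifold d M" by (rule assms(1))
 have dim: "vec.dim (tangent_space M z) = d'" if "complex_submanifold d' M" for d' proof -
  have "EX W f g V. z \<in> W & slice_chart d' M W f g V" using that assms(2) unfolding complex_submanifold_def by (rule bspec)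
  then obtain W f g V where ch: "z \<in> W" "slice_chart d' M W f g V" by (elim exE conjE)
  obtain g' where "(g has_derivative g') (at (f z))" using slice_chart_inverse_derivative[OF ch(2,1)] by blast
  thus ?thesis by (rule tangent_space_slice(2)[OF ch(2,1) assms(2)])
 qed
 show "d' = d" if "complex_submanifold d' M" for d' using dim[OF that] dim[OF assms(1)] by simp
qed

lemma tangent_space_linear:
 assumes A: "invertible (A::complex^'n^'n)" and M: "!!z. A *v z \<in> M \<longleftrightarrow> z \<in> M"
 shows "tangent_space M (A *v z) = (*v) A ` tangent_space M z" proof -
 have bl: "bounded_linear ((*v) B)" for B :: "complex^'n^'n" by (rule clin_bounded_linear) simp
 have sub: "B *v v \<in> tangent_space M (B *v z)"
  if v: "v \<in> tangent_space M z" and B: "!!z. z \<in> M ==> B *v z \<in> M" for B :: "complex^'n^'n" and v z proof -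
  obtain \<gamma> :: "real => complex^'n" where \<gamma>: "\<gamma> 0 = z" "\<forall>\<^sub>F t in nhds 0. \<gamma> t \<in> M" "(\<gamma> has_vector_derivative v) (at 0)"
   using v unfolding tangent_space_def by blast
  have "((%t. B *v \<gamma> t) has_vector_derivative B *v v) (at 0)" by (rule bounded_linear.has_vector_derivative[OF bl \<gamma>(3)])
  moreover have "\<forall>\<^sub>F t in nhds 0. B *v \<gamma> t \<in> M" using \<gamma>(2) by eventually_elim (rule B)
  ultimately show ?thesis unfolding tangent_space_def using \<gamma>(1) by (auto intro!: exI[of _ "%t. B *v \<gamma> t"])
 qed
 have Ai: "matrix_inv A *v z \<in> M" if "z \<in> M" for z using M[of "matrix_inv A *v z"] that A by simp
 show ?thesis proof
  show "(*v) A ` tangent_space M z \<subseteq> tangent_space M (A *v z)" using sub M by blast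
  show "tangent_space M (A *v z) \<subseteq> (*v) A ` tangent_space M z" proof
   fix v assume "v \<in> tangent_space M (A *v z)"
   hence "matrix_inv A *v v \<in> tangent_space M z" using sub[of v "A *v z" "matrix_inv A"] Ai A by simp
   thus "v \<in> (*v) A ` tangent_space M z" using A by (intro image_eqI[of _ _ "matrix_inv A *v v"]) auto
  qed
 qed
qed

lemma open_linear_image: "invertible (A::complex^'n^'n) ==> open U ==> open ((*v) A ` U)" proof -
 assume A: "invertible A" and U: "open U"
 have "(*v) A ` U = (*v) (matrix_inv A) -` U" proof (intro set_eqI iffI)
  show "x \<in> (*v) (matrix_inv A) -` U" if "x \<in> (*v) A ` U" for x using that A by auto
  show "x \<in> (*v) A ` U" if "x \<in> (*v) (matrix_inv A) -` U" for x using that A by (intro image_eqI[of _ _ "matrix_inv A *v x"]) auto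
 qed
 thus ?thesis using U by (simp add: open_vimage clin_continuous)
qed

lemma slice_chart_linear:
 assumes ch: "slice_chart d M W f g V" and A: "invertible (A::complex^'n^'n)" and M: "!!z. A *v z \<in> M \<longleftrightarrow> z \<in> M"
 shows "slice_chart d M ((*v) A ` W) (%x. f (matrix_inv A *v x)) (%y. A *v g y) V" proof -
 note D = slice_chartD[OF ch]
 have img: "(%x. f (matrix_inv A *v x)) ` ((*v) A ` S) = f ` S" for S using A by (force simp: image_image)
 have bl: "bounded_linear ((*v) B)" for B :: "complex^'n^'n" by (rule clin_bounded_linear) simp
 have Wi: "(*v) A ` W = (*v) (matrix_inv A) -` W" using A by (auto simp: image_iff) (metis inv_mv(1))
 have oW: "open ((*v) A ` W)" by (rule open_linear_image[OF A D(1)])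
 show ?thesis unfolding slice_chart_def img proof (intro conjI ballI)
  show "holomorphic_wrt (*s) (%x. f (matrix_inv A *v x)) ((*v) A ` W)" unfolding holomorphic_wrt_def proof
   fix x assume x: "x \<in> (*v) A ` W"
   hence "matrix_inv A *v x \<in> W" using Wi by auto
   then obtain f' where f': "(f has_derivative f') (at (matrix_inv A *v x))" "clin f'" by (rule holomorphic_wrtD[OF D(3,1)])
   have "((%x. f (matrix_inv A *v x)) has_derivative (%v. f' (matrix_inv A *v v))) (at x within (*v) A ` W)"
    by (rule has_derivative_compose[OF bounded_linear_imp_has_derivative[OF bl] f'(1)])
   thus "EX f'. ((%x. f (matrix_inv A *v x)) has_derivative f') (at x within (*v) A ` W) & (ALL c v. f' (c *s v) = c *s f' v)"
    by (intro exI[of _ "%v. f' (matrix_inv A *v v)"] conjI allI) (auto simp: clin_scale[OF f'(2)] clin_scale[OF clin_matrix])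
  qed
  show "holomorphic_wrt (*s) (%y. A *v g y) (f ` W)" unfolding holomorphic_wrt_def proof
   fix y assume y: "y \<in> f ` W"
   obtain g' where g': "(g has_derivative g') (at y)" "clin g'" by (rule holomorphic_wrtD[OF D(4,2) y])
   have "((%y. A *v g y) has_derivative (%v. A *v g' v)) (at y within f ` W)"
    by (rule bounded_linear.has_derivative[OF bl has_derivative_at_withinI[OF g'(1)]])
   thus "EX f'. ((%y. A *v g y) has_derivative f') (at y within f ` W) & (ALL c v. f' (c *s v) = c *s f' v)"
    by (intro exI[of _ "%v. A *v g' v"] conjI allI) (auto simp: clin_scale[OF g'(2)] clin_scale[OF clin_matrix])
  qed
  show "A *v g (f (matrix_inv A *v x)) = x" if "x \<in> (*v) A ` W" for x using that A by (auto simp: D(5))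
  have "(*v) A ` W \<inter> M = (*v) A ` (W \<inter> M)" using M by auto
  thus "(%x. f (matrix_inv A *v x)) ` ((*v) A ` W \<inter> M) = f ` W \<inter> V" using img[of "W \<inter> M"] D(8) by simp
 qed (use D oW in auto)
qed

section \<open>The chart at the base point\<close>

context kepler_frame
begin

abbreviation c :: "complex^'n" where "c \<equiv> cc l"
abbreviation c0 :: "complex^'n" where "c0 \<equiv> esum {l+1..r}"

lemma c_tripotent: "tripotent T c" by (rule cc_tripotent[OF l_le])

lemma un_split: "un = c + c0" proof -
 have "{1..r} = {1..l} \<union> {l+1..r}" using l_less by auto
 thus ?thesis unfolding esum_def by (simp add: sum.union_disjoint[symmetric])
qed

lemma c_pspace: "c \<in> pspace c 2" by (rule tripotent_pspace[OF c_tripotent])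

lemma c0_pspace: "c0 \<in> pspace c 0" proof -
 have "L k (e i) = 0" if "k \<in> {1..l}" "i \<in> {l+1..r}" for k i using L_e[of i k] that l_less by auto
 hence "T c c c0 = 0" unfolding T_cc[OF l_le] esum_def[of "{l+1..r}"] T_sum by (intro sum.neutral ballI) auto
 thus ?thesis by (simp add: pspace_def)
qed

lemma st_esum: "J \<subseteq> {1..r} ==> st (esum J) = esum J" unfolding esum_def[of J] star_sum by (intro sum.cong refl st_e) auto

lemma jo_c: "jo c z = (1/2) *s T c c z" proof -
 have "T c c0 z = 0" by (rule T_pspace_20[OF c_tripotent c_pspace c0_pspace])
 thus ?thesis by (simp add: jp_def T_add un_split)
qed

lemma st_pspace: assumes "x \<in> pspace c k" shows "st x \<in> pspace c k" proof -
 have "T c c (st x) = st (T c c x)" using jo_c[of "st x"] jo_c[of x] st_jo[of c x] st_esum[of "{1..l}"] l_less by (simp add: star_simps)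
 thus ?thesis using assms by (simp add: pspace_def star_simps)
qed

text \<open>The quadratic representation of the Jordan algebra, \<open>P(x)z = 2x(xz) - x\<^sup>2z\<close>; unlike \<open>quad_op\<close> it is complex
  linear in \<open>z\<close>.\<close>

definition Px :: "complex^'n => complex^'n => complex^'n" where
 "Px x z = quad_op T x (st z)"

lemma Px_clin: "clin (Px x)" unfolding Px_def quad_op_def by (rule clinI) (simp_all add: star_simps T_simps vec_eq_iff algebra_simps)

text \<open>\<open>{u; y\<^sup>*; w}\<close> is complex trilinear.\<close>

definition T_coeff :: "'n => 'n => 'n => complex^'n" where
 "T_coeff i j k = T (axis i 1) (st (axis j 1)) (axis k 1)"

lemma Tst_expand:
 "T u (st y) w = (\<Sum>i\<in>UNIV. \<Sum>j\<in>UNIV. \<Sum>k\<in>UNIV. (u $ i * y $ j * w $ k) *s T_coeff i j k)" proof -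
 have 2: "T u (st y) w = (\<Sum>j\<in>UNIV. y $ j *s T u (st (axis j 1)) w)" for u y w proof -
  have "st y = st (\<Sum>j\<in>UNIV. y $ j *s axis j 1)" by (simp add: basis_expansion)
  also have "... = (\<Sum>j\<in>UNIV. cnj (y $ j) *s st (axis j 1))" by (simp add: star_sum star_scale)
  finally show ?thesis by (simp add: T_sum T_scale)
 qed
 have "T u (st y) w = (\<Sum>i\<in>UNIV. u $ i *s (\<Sum>j\<in>UNIV. y $ j *s (\<Sum>k\<in>UNIV. w $ k *s T (axis i 1) (st (axis j 1)) (axis k 1))))"
  by (subst T_basis(1), subst 2, subst T_basis(2)) (rule refl)
 thus ?thesis by (simp only: vec.scale_sum_right vec.scale_scale mult.assoc T_coeff_def)
qed

lemma cdiff_Tst: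
 assumes "!!i. cdiff (%x. f x $ i) x" "!!i. cdiff (%x. g x $ i) x" "!!i. cdiff (%x. h x $ i) x"
 shows "cdiff (%x. T (f x) (st (g x)) (h x) $ i) x" unfolding Tst_expand sum_component vector_smult_component by (intro cdiff_intros assms)

lemma polyfun_Tst:
 assumes "!!i. polyfun (%x. f x $ i)" "!!i. polyfun (%x. g x $ i)" "!!i. polyfun (%x. h x $ i)"
 shows "polyfun (%x. T (f x) (st (g x)) (h x) $ i)" unfolding Tst_expand sum_component vector_smult_component
 by (intro polyfun_intros assms)

lemma polyfun_Px: "(!!i. polyfun (%x. f x $ i)) ==> polyfun (%x. Px (f x) z $ i)"
 unfolding Px_def quad_op_def vector_smult_component by (intro polyfun_intros polyfun_Tst)

lemma polyfun_DetPx: "(!!i. polyfun (%x. f x $ i)) ==> polyfun (%x. Det (Px (f x)))" by (rule polyfun_det) (simp add: matrix_def polyfun_Px)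

lemma Px_block:
 assumes u: "u \<in> pspace c 2" and w: "w \<in> pspace c 0"
 shows "x \<in> pspace c 2 ==> Px (u + w) x = Px u x" "x \<in> pspace c 2 ==> Px u x \<in> pspace c 2"
  and "x \<in> pspace c 0 ==> Px (u + w) x = Px w x" "x \<in> pspace c 0 ==> Px w x \<in> pspace c 0"
  and "x \<in> pspace c 1 ==> Px (u + w) x = T u (st x) w" "x \<in> pspace c 1 ==> T u (st x) w \<in> pspace c 1" proof -
 note t = c_tripotent
 have ex: "Px (u + w) x = Px u x + T u (st x) w + Px w x" for x
  by (simp add: Px_def quad_op_def T_add T_commute[of w "st x" u] vec_eq_iff field_simps)
 { assume x: "x \<in> pspace c 2"
  note sx = st_pspace[OF x]
  have "T u (st x) w = 0" using T_pspace_02[OF t sx w] by (simp add: T_commute[of u])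
  moreover have "Px w x = 0" unfolding Px_def quad_op_def using T_pspace_02[OF t sx w] by simp
  ultimately show "Px (u + w) x = Px u x" by (simp add: ex)
  have "T u (st x) u \<in> pspace c 2" by (rule T_pspace[OF u sx u]) simp
  thus "Px u x \<in> pspace c 2" unfolding Px_def quad_op_def by (rule pspace_scale) }
 { assume x: "x \<in> pspace c 0"
  note sx = st_pspace[OF x]
  have "T u (st x) w = 0" by (rule T_pspace_20[OF t u sx])
  moreover have "Px u x = 0" unfolding Px_def quad_op_def using T_pspace_20[OF t u sx] by simp
  ultimately show "Px (u + w) x = Px w x" by (simp add: ex)
  have "T w (st x) w \<in> pspace c 0" by (rule T_pspace[OF w sx w]) simp
  thus "Px w x \<in> pspace c 0" unfolding Px_def quad_op_def by (rule pspace_scale) }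
 { assume x: "x \<in> pspace c 1"
  note sx = st_pspace[OF x]
  have "Px u x = 0" unfolding Px_def quad_op_def using T_pspace_zero[OF t u sx u] by simp
  moreover have "Px w x = 0" unfolding Px_def quad_op_def using T_pspace_zero[OF t w sx w] by simp
  ultimately show "Px (u + w) x = T u (st x) w" by (simp add: ex)
  show "T u (st x) w \<in> pspace c 1" by (rule T_pspace[OF u sx w]) simp }
qed

abbreviation p2 :: "complex^'n => complex^'n" where "p2 \<equiv> pproj c 2"
abbreviation p1 :: "complex^'n => complex^'n" where "p1 \<equiv> pproj c 1"
abbreviation p0 :: "complex^'n => complex^'n" where "p0 \<equiv> pproj c 0"

lemma p_mem: "p2 z \<in> pspace c 2" "p1 z \<in> pspace c 1" "p0 z \<in> pspace c 0" by (rule pproj_mem[OF c_tripotent]; simp)+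

lemma p_on:
 "x \<in> pspace c 2 ==> p2 x = x" "x \<in> pspace c 2 ==> p1 x = 0" "x \<in> pspace c 2 ==> p0 x = 0"
 "x \<in> pspace c 1 ==> p2 x = 0" "x \<in> pspace c 1 ==> p1 x = x" "x \<in> pspace c 1 ==> p0 x = 0"
 "x \<in> pspace c 0 ==> p2 x = 0" "x \<in> pspace c 0 ==> p1 x = 0" "x \<in> pspace c 0 ==> p0 x = x"
 using pproj_pspace[of x c 2] pproj_pspace[of x c 1] pproj_pspace[of x c 0] by simp_all

lemmas p_add = clin_add[OF pproj_clin, of c]
lemmas p_scale = clin_scale[OF pproj_clin, of c]
lemmas p_diff = clin_diff[OF pproj_clin, of c]

lemma p_sum: "z = p2 z + p1 z + p0 z" using pproj_sum[of c z] by (simp add: add.commute add.left_commute)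

text \<open>The neighbourhood of \<open>c\<close> on which the component in \<open>Z\<^sub>2(c)\<close> is invertible.\<close>

definition W0 :: "(complex^'n) set" where "W0 = {z. Det (Px (p2 z + c0)) ~= 0}"

lemma polyfun_W0: "polyfun (%z. Det (Px (p2 z + c0)))"
 unfolding vector_add_component by (rule polyfun_DetPx) (auto intro!: polyfun_intros polyfun_clin pproj_clin)

lemma W0_open: "open W0" proof -
 have "continuous_on UNIV (%z. Det (Px (p2 z + c0)))" by (rule polyfun_continuous[OF polyfun_W0])
 thus ?thesis unfolding W0_def by (intro open_Collect_neq continuous_on_const)
qed

lemma Px_un: "Px un z = z" by (simp add: Px_def quad_un)

lemma c_W0: "c \<in> W0" proof -
 have "p2 c + c0 = un" using p_on(1)[OF c_pspace] by (simp add: un_split)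
 moreover have "Px un = (%z. z)" by (auto simp: Px_un)
 ultimately show ?thesis by (simp add: W0_def Det_id)
qed

text \<open>Cramer's rule, so that solutions depend holomorphically on the data.\<close>

definition cramer_Px :: "complex^'n => complex^'n => complex^'n" where
 "cramer_Px u v = (\<chi> k. det (\<chi> i j. if j = k then v $ i else matrix (Px (u + c0)) $ i $ j) / Det (Px (u + c0)))"

text \<open>The parameter in \<open>Z\<^sub>1(c)\<close> of the unipotent operator that removes the component of \<open>z\<close> in \<open>Z\<^sub>1(c)\<close>.\<close>

definition vp :: "complex^'n => complex^'n" where
 "vp z = cramer_Px (p2 z) (p1 z)"

lemma vp_solves: assumes "z \<in> W0" shows "Px (p2 z + c0) (vp z) = p1 z" proof -
 have d: "Det (Px (p2 z + c0)) ~= 0" using assms by (simp add: W0_def)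
 have "matrix (Px (p2 z + c0)) *v vp z = p1 z" by (subst cramer[OF d]) (simp add: vp_def cramer_Px_def)
 thus ?thesis by (simp add: matrix_works[OF Px_clin])
qed

lemma W0_inj: "z \<in> W0 ==> Px (p2 z + c0) x = 0 ==> x = 0"
 using Det_nz_iff[OF Px_clin] clin_bij_iff_inj[OF Px_clin] by (auto simp: W0_def)

lemma vp_pspace: assumes z: "z \<in> W0" shows "vp z \<in> pspace c 1" proof -
 let ?P = "Px (p2 z + c0)"
 note B = Px_block[OF p_mem(1)[of z] c0_pspace]
 have "?P (vp z) = ?P (p2 (vp z)) + ?P (p1 (vp z)) + ?P (p0 (vp z))" by (subst p_sum[of "vp z"]) (simp add: clin_add[OF Px_clin])
 hence s: "p1 z = ?P (p2 (vp z)) + ?P (p1 (vp z)) + ?P (p0 (vp z))" by (simp add: vp_solves[OF z])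
 have m: "?P (p2 (vp z)) \<in> pspace c 2" "?P (p1 (vp z)) \<in> pspace c 1" "?P (p0 (vp z)) \<in> pspace c 0"
  using B p_mem[of "vp z"] by simp_all
 have "p2 (p1 z) = ?P (p2 (vp z))" "p0 (p1 z) = ?P (p0 (vp z))" by (subst s; simp add: p_add p_on m)+
 hence "?P (p2 (vp z)) = 0" "?P (p0 (vp z)) = 0" using p_mem(2)[of z] by (simp_all add: p_on)
 hence "p2 (vp z) = 0" "p0 (vp z) = 0" using W0_inj[OF z] by auto
 thus ?thesis using p_sum[of "vp z"] p_mem(2)[of "vp z"] by simp
qed

lemma vp_unique: assumes z: "z \<in> W0" and y: "Px (p2 z + c0) y = p1 z" shows "vp z = y" proof -
 have "Px (p2 z + c0) (vp z - y) = 0" using vp_solves[OF z] y by (simp add: clin_diff[OF Px_clin])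
 hence "vp z - y = 0" by (rule W0_inj[OF z])
 thus ?thesis by simp
qed

lemma cdiff_vp: assumes "z \<in> W0" shows "cdiff (%z. vp z $ k) z" proof -
 have "polyfun (%z. det (\<chi> i j. if j = k then p1 z $ i else matrix (Px (p2 z + c0)) $ i $ j))" proof (rule polyfun_det)
  fix i j
  show "polyfun (%z. (\<chi> i j. if j = k then p1 z $ i else matrix (Px (p2 z + c0)) $ i $ j) $ i $ j)" proof (cases "j = k")
   case True thus ?thesis by (simp add: polyfun_clin[OF pproj_clin])
  next
   case False
   have "polyfun (%z. (p2 z + c0) $ i)" for i by (auto intro!: polyfun_intros polyfun_clin pproj_clin)
   thus ?thesis using False by (simp add: matrix_def polyfun_Px)
  qed
 qed
 thus ?thesis unfolding vp_def cramer_Px_def vec_lambda_beta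
  by (intro cdiff_divide polyfun_cdiff polyfun_W0) (use assms in "auto simp: W0_def")
qed

lemma T_c_Px: assumes u: "u \<in> pspace c 2" and v: "v \<in> pspace c 1" shows "T v c u = Px (u + c0) v" proof -
 have uv: "jo u v \<in> pspace c 1" unfolding jp_def un_split T_add
  using T_pspace[OF u c_pspace v, of 1] T_pspace_20[OF c_tripotent u c0_pspace, of v] by (auto intro!: pspace_scale)
 have cx: "jo c x = (of_nat k / 2) *s x" if "x \<in> pspace c k" for x k using pspaceD[OF that] by (simp add: jo_c)
 have c0x: "jo c0 x = x - jo c x" for x proof -
  have "jo un x = jo c x + jo c0 x" by (simp only: un_split jp_add)
  thus ?thesis by (simp add: algebra_simps)
 qed
 have a: "jo c0 u = 0" "jo c0 v = (1/2) *s v" "jo c0 (jo u v) = (1/2) *s jo u v"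
  using cx[OF u] cx[OF v] cx[OF uv] by (simp_all add: c0x vec_eq_iff)
 have "T u (st v) c0 = 2 *s jo u v" proof -
  have "jo u c0 = 0" "jo v c0 = (1/2) *s v" "jo v u = jo u v" "jo (jo u v) c0 = (1/2) *s jo u v"
   by (rule trans[OF jp_commute a(1)] trans[OF jp_commute a(2)] jp_commute trans[OF jp_commute a(3)])+
  hence "T u (st v) c0 = 2 *s ((1/2) *s jo u v + (1/2) *s jo u v - jo v 0)" using a by (simp only: T_jo st_st clin_scale[OF jp_clin])
  thus ?thesis by (simp add: clin_zero[OF jp_clin] vec_eq_iff)
 qed
 moreover have "T v c u = 2 *s jo u v" proof -
  have "T u c v = T u un v" unfolding un_split T_add using T_pspace_20[OF c_tripotent u c0_pspace] by simp
  thus ?thesis by (simp add: T_un T_commute[of v])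
 qed
 ultimately show ?thesis using Px_block(5)[OF u c0_pspace v] by simp
qed

lemma star_c_st: assumes "u \<in> pspace c 2" shows "quad_op T c u = st u" proof -
 have "T c0 u x = 0" for x by (rule T_pspace_02[OF c_tripotent assms c0_pspace])
 hence "T un u un = T c u c" unfolding un_split by (simp add: T_add T_commute[of c u c0])
 thus ?thesis by (simp add: quad_op_def star_def)
qed

text \<open>For \<open>v \<in> Z\<^sub>1(c)\<close> the operator \<open>B(v,c)\<close> is the unipotent \<open>exp(- D(v,c))\<close>.\<close>

lemma frobenius:
 assumes v: "v \<in> pspace c 1" shows "w \<in> pspace c 0 ==> bergman_op T v c w = w"
  and "y \<in> pspace c 1 ==> bergman_op T v c y = y - T v c y" and "y \<in> pspace c 1 ==> T v c y \<in> pspace c 0"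
  and "u \<in> pspace c 2 ==> bergman_op T v c u = u - Px (u + c0) v + quad_op T v (st u)"
  and "u \<in> pspace c 2 ==> quad_op T v (st u) \<in> pspace c 0" and "bergman_op T v c (bergman_op T (- v) c z) = z" proof -
 note t = c_tripotent
 have Qc: "quad_op T c y = 0" if "y \<in> pspace c k" "k = 0 \<or> k = 1" for y k
  unfolding quad_op_def using T_pspace_zero[OF t c_pspace that(1) c_pspace] that(2) by auto
 have w0: "bergman_op T x c w = w" if "w \<in> pspace c 0" "x \<in> pspace c 1" for w x proof -
  have "T x c w = 0" using T_pspace_02[OF t c_pspace that(1)] by (simp add: T_commute[of x])
  thus ?thesis using Qc[OF that(1)] by (simp add: bergman_op_def quad_op_def)
 qed
 have y1: "bergman_op T x c y = y - T x c y" if "y \<in> pspace c 1" for x y using Qc[OF that] by (simp add: bergman_op_def quad_op_def)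
 have y0: "T x c y \<in> pspace c 0" if "x \<in> pspace c 1" "y \<in> pspace c 1" for x y
  by (rule T_pspace[OF that(1) c_pspace that(2)]) simp
 show "w \<in> pspace c 0 ==> bergman_op T v c w = w" using w0 v by blast
 show "y \<in> pspace c 1 ==> bergman_op T v c y = y - T v c y" by (rule y1)
 show "y \<in> pspace c 1 ==> T v c y \<in> pspace c 0" using y0 v by blast
 have b2: "bergman_op T x c u = u - T x c u + quad_op T x (st u)" if "u \<in> pspace c 2" for x u
  using star_c_st[OF that] by (simp add: bergman_op_def)
 show "u \<in> pspace c 2 ==> bergman_op T v c u = u - Px (u + c0) v + quad_op T v (st u)" using b2 T_c_Px v by simp
 have q0: "quad_op T x (st u) \<in> pspace c 0" if "u \<in> pspace c 2" "x \<in> pspace c 1" for x u unfolding quad_op_def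
  using T_pspace[OF that(2) st_pspace[OF that(1)] that(2), of 0] by (auto intro: pspace_scale)
 show "u \<in> pspace c 2 ==> quad_op T v (st u) \<in> pspace c 0" using q0 v by blast
 have mv: "- v \<in> pspace c 1" using v by (rule vec.subspace_neg[OF pspace_subspace])
 \<comment> \<open>\<open>D(v,c)\<^sup>2 = 2 Q\<^sub>v Q\<^sub>c\<close> on \<open>Z\<^sub>2(c)\<close>\<close>
 have sq: "T v c (T v c u) = T v (st u) v" if u: "u \<in> pspace c 2" for u proof -
  let ?u = "st u"
  have su: "?u \<in> pspace c 2" by (rule st_pspace[OF u])
  have uc: "u = (1/2) *s T c ?u c" using star_c_st[OF su] by (simp add: quad_op_def)
  have z1: "T c v ?u = 0" by (rule T_pspace_zero[OF t c_pspace v su]) simp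
  have vcc: "T v c c = v" using pspaceD[OF v] by (simp add: T_commute[of v])
  have "T v c (T c ?u c) = 2 *s T v ?u c"
   using jordan_identity[of v c c ?u c] by (simp add: vcc T_commute[of ?u v c] z1 T_commute[of c ?u v] vec_eq_iff)
  hence 1: "T v c u = T v ?u c" by (subst uc) (simp add: T_scale vec_eq_iff)
  have vcv: "T v c v \<in> pspace c 0" by (rule y0[OF v v])
  have z2: "T (T v c v) ?u c = 0" by (rule T_pspace_02[OF t su vcv])
  have "T v c (T v ?u c) = T v ?u v" using jordan_identity[of v c v ?u c] by (simp add: vcc T_commute[of ?u v c] z1 z2)
  thus ?thesis by (simp add: 1)
 qed
 show "bergman_op T v c (bergman_op T (- v) c z) = z"
 proof (rule peirce_cases[OF t, where P = "%z. bergman_op T v c (bergman_op T (- v) c z) = z"])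
  fix k z assume k: "k <= (2::nat)" and z: "z \<in> pspace c k"
  consider "k = 0" | "k = 1" | "k = 2" using k by linarith
  thus "bergman_op T v c (bergman_op T (- v) c z) = z" proof cases
   case 1 thus ?thesis using w0[of z] v mv z by simp
  next
   case 2
   hence z1: "z \<in> pspace c 1" using z by simp
   have "bergman_op T (- v) c z = z + T v c z" using y1[OF z1] by (simp add: T_minus(1))
   thus ?thesis using y1[OF z1] w0[OF y0[OF v z1] v] by (simp add: clin_add[OF bergman_clin] T_minus(1))
  next
   case 3
   hence z2: "z \<in> pspace c 2" using z by simp
   have vz: "T v c z \<in> pspace c 1" by (rule T_pspace[OF v c_pspace z2]) simp
   have "bergman_op T (- v) c z = z + T v c z + quad_op T v (st z)" using b2[OF z2, of "- v"] by (simp add: T_minus quad_op_def)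
   hence "bergman_op T v c (bergman_op T (- v) c z) =
     (z - T v c z + quad_op T v (st z)) + (T v c z - T v c (T v c z)) + quad_op T v (st z)"
    by (simp only: clin_add[OF bergman_clin] b2[OF z2, of v] y1[OF vz] w0[OF q0[OF z2 v] v])
   also have "... = z" unfolding sq[OF z2] quad_op_def by (simp add: vec_eq_iff)
   finally show ?thesis .
  qed
 qed (simp add: clin_add[OF bergman_clin])
qed

lemma frobenius_inverse: "v \<in> pspace c 1 ==> bergman_op T (- v) c (bergman_op T v c z) = z"
 using frobenius(6)[of "- v" z] vec.subspace_neg[OF pspace_subspace] by auto

lemma frobenius_KR: assumes "v \<in> pspace c 1" shows "mB v c \<in> KR" proof -
 have "bij (bergman_op T v c)" by (rule bijI') (metis frobenius(6) frobenius_inverse assms)+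
 thus ?thesis using KR_gen invertible_iff_bij[OF bergman_clin] by blast
qed

text \<open>The component in \<open>Z\<^sub>0(c)\<close> that a point of the manifold must have: near \<open>c\<close> the manifold is the graph of this
  function on \<open>Z\<^sub>2(c) \<oplus> Z\<^sub>1(c)\<close>.\<close>

definition Ez :: "complex^'n => complex^'n" where "Ez z = quad_op T (vp z) (st (p2 z))"

lemma Ez_pspace: "z \<in> W0 ==> Ez z \<in> pspace c 0" unfolding Ez_def by (rule frobenius(5)[OF vp_pspace p_mem(1)])
lemma W0_cong: "p2 z = p2 z' ==> z \<in> W0 \<longleftrightarrow> z' \<in> W0" by (simp add: W0_def)
lemma vp_cong: "p2 z = p2 z' ==> p1 z = p1 z' ==> vp z = vp z'" by (simp add: vp_def cramer_Px_def)
lemma Ez_cong: "p2 z = p2 z' ==> p1 z = p1 z' ==> Ez z = Ez z'" using vp_cong[of z z'] by (simp add: Ez_def)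

text \<open>Frobenius transformations bring a point of \<open>W0\<close> into \<open>Z\<^sub>2(c) \<oplus> Z\<^sub>0(c)\<close>.\<close>

lemma frobenius_normal_form:
 assumes z: "z \<in> W0" shows "bergman_op T (vp z) c z = p2 z + (p0 z - Ez z)" proof -
 note v = vp_pspace[OF z]
 have mv: "- vp z \<in> pspace c 1" using v by (rule vec.subspace_neg[OF pspace_subspace])
 have "p0 z - Ez z \<in> pspace c 0" by (rule vec.subspace_diff[OF pspace_subspace p_mem(3) Ez_pspace[OF z]])
 hence "bergman_op T (- vp z) c (p2 z + (p0 z - Ez z)) = p2 z - Px (p2 z + c0) (- vp z) + quad_op T (- vp z) (st (p2 z)) + (p0 z - Ez z)"
  by (simp add: clin_add[OF bergman_clin] frobenius(1)[OF mv] frobenius(4)[OF mv p_mem(1)])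
 also have "... = p2 z + p1 z + Ez z + (p0 z - Ez z)" by (simp add: clin_minus[OF Px_clin] vp_solves[OF z] Ez_def quad_op_def T_minus)
 also have "... = p2 z + p1 z + p0 z" by simp
 also have "... = z" by (rule p_sum[symmetric])
 finally show ?thesis using frobenius(6)[OF v, of "p2 z + (p0 z - Ez z)"] by simp
qed

lemma cube_nonzero: "T w w w = 0 ==> w = 0" using cube_eigenvalue_pos[of w 0] by auto

text \<open>In the normal form \<open>u + w\<close> with invertible \<open>u \<in> Z\<^sub>2(c)\<close> the range of the quadratic operator contains
  \<open>Z\<^sub>2(c)\<close> and is strictly larger unless \<open>w = 0\<close>.\<close>

lemma M_W0_iff: assumes z: "z \<in> W0" shows "z \<in> M \<longleftrightarrow> p0 z = Ez z" proof -
 let ?w = "p0 z - Ez z" and ?u = "p2 z"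
 have w: "?w \<in> pspace c 0" by (rule vec.subspace_diff[OF pspace_subspace p_mem(3) Ez_pspace[OF z]])
 have u: "?u \<in> pspace c 2" by (rule p_mem)
 have "mB (vp z) c \<in> Str" using frobenius_KR[OF vp_pspace[OF z]] KR_Str by blast
 hence zM: "z \<in> M \<longleftrightarrow> ?u + ?w \<in> M"
  using M_Str[of "mB (vp z) c" z] frobenius_normal_form[OF z] by (simp add: matrix_works[OF bergman_clin])
 have surj2: "\<exists>y\<in>pspace c 2. Px ?u y = x" if x: "x \<in> pspace c 2" for x proof -
  have "bij (Px (?u + c0))" using z Det_nz_iff[OF Px_clin] by (simp add: W0_def)
  then obtain y where y: "Px (?u + c0) y = x" by (metis bij_pointE)
  note B = Px_block[OF u c0_pspace]
  let ?P = "Px (?u + c0)"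
  have s: "x = ?P (p2 y) + ?P (p1 y) + ?P (p0 y)" unfolding y[symmetric] by (subst p_sum[of y]) (simp add: clin_add[OF Px_clin])
  have m: "?P (p2 y) \<in> pspace c 2" "?P (p1 y) \<in> pspace c 1" "?P (p0 y) \<in> pspace c 0" using B p_mem[of y] by simp_all
  have "p2 x = ?P (p2 y)" by (subst s) (simp add: p_add p_on m)
  hence "Px ?u (p2 y) = x" using B(1)[OF p_mem(1)] p_on(1)[OF x] by simp
  thus ?thesis using p_mem(1) by blast
 qed
 have sub: "pspace c 2 \<subseteq> range (quad_op T (?u + ?w))" proof
  fix x assume "x \<in> pspace c 2"
  then obtain y where y: "y \<in> pspace c 2" "Px ?u y = x" using surj2 by blast
  hence "x = quad_op T (?u + ?w) (st y)" using Px_block(1)[OF u w y(1)] by (simp add: Px_def)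
  thus "x \<in> range (quad_op T (?u + ?w))" by blast
 qed
 have rkc: "rk c = vec.dim (pspace c 2)" by (rule rk_cc[OF l_le])
 show ?thesis proof
  assume "z \<in> M"
  hence rk: "rk (?u + ?w) = rk c" using zM M_iff_rk by simp
  have "?w = 0" proof (rule ccontr)
   assume "?w ~= 0"
   hence "T ?w ?w ?w ~= 0" by (rule contrapos_nn) (rule cube_nonzero)
   hence nz: "quad_op T ?w ?w ~= 0" unfolding quad_op_def vec.scale_eq_0_iff by simp
   have "Px (?u + ?w) (st ?w) = Px ?w (st ?w)" by (rule Px_block(3)[OF u w st_pspace[OF w]])
   hence "quad_op T (?u + ?w) ?w = quad_op T ?w ?w" unfolding Px_def st_st .
   hence in_r: "quad_op T ?w ?w \<in> range (quad_op T (?u + ?w))" by (rule range_eqI[OF sym])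
   have "quad_op T ?w ?w \<in> pspace c 0" using Px_block(4)[OF u w st_pspace[OF w]] unfolding Px_def st_st .
   hence q0: "quad_op T ?w ?w \<notin> pspace c 2" using nz p_on(1)[of "quad_op T ?w ?w"] p_on(7)[of "quad_op T ?w ?w"] by argo
   have sp: "vec.span (pspace c 2) = pspace c 2" using pspace_subspace vec.span_eq_iff by blast
   have in_s: "quad_op T ?w ?w \<in> vec.span (range (quad_op T (?u + ?w)))" by (rule vec.span_base[OF in_r])
   have "vec.span (pspace c 2) \<subset> vec.span (range (quad_op T (?u + ?w)))" using vec.span_mono[OF sub] in_s q0 sp by blast
   hence "vec.dim (pspace c 2) < rk (?u + ?w)" unfolding rk_def by (rule vec.dim_psubset)
   thus False using rk rkc by simp
  qed
  thus "p0 z = Ez z" by simp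
 next
  assume "p0 z = Ez z"
  hence w0: "?w = 0" by simp
  have "range (quad_op T ?u) \<subseteq> pspace c 2" proof
   fix x assume "x \<in> range (quad_op T ?u)"
   then obtain y where x: "x = quad_op T ?u y" by blast
   have "x = Px ?u (st y)" by (simp add: Px_def x)
   also have "... = Px ?u (p2 (st y)) + Px ?u (p1 (st y)) + Px ?u (p0 (st y))" by (subst p_sum[of "st y"]) (simp add: clin_add[OF Px_clin])
   also have "Px ?u (p1 (st y)) = 0" using Px_block(5)[OF u vec.subspace_0[OF pspace_subspace] p_mem(2)] by simp
   also have "Px ?u (p0 (st y)) = 0" proof -
    have "Px ?u (p0 (st y)) = Px 0 (p0 (st y))" using Px_block(3)[OF u vec.subspace_0[OF pspace_subspace] p_mem(3)] by simp
    thus ?thesis by (simp add: Px_def quad_op_def)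
   qed
   finally show "x \<in> pspace c 2" using Px_block(2)[OF u w p_mem(1)] by simp
  qed
  hence "range (quad_op T ?u) = pspace c 2" using sub w0 by auto
  hence "rk ?u = rk c" by (simp add: rk_def rkc[unfolded rk_def])
  thus "z \<in> M" using zM w0 M_iff_rk by simp
 qed
qed

text \<open>The tangent space at \<open>c\<close>, which is \<open>Z\<^sub>2(c) \<oplus> Z\<^sub>1(c)\<close>.\<close>

definition VV :: "(complex^'n) set" where "VV = {z. p0 z = 0}"

definition dd :: nat where "dd = vec.dim VV"

lemma VV_subspace: "vec.subspace VV" by (auto simp: VV_def vec.subspace_def p_add p_scale clin_zero[OF pproj_clin])

definition fch :: "complex^'n => complex^'n" where "fch z = z - Ez z"
definition gch :: "complex^'n => complex^'n" where "gch z = z + Ez z"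

lemma gch_p: assumes "z \<in> W0" shows "p2 (gch z) = p2 z" "p1 (gch z) = p1 z" "gch z \<in> W0" "Ez (gch z) = Ez z" proof -
 show 1: "p2 (gch z) = p2 z" "p1 (gch z) = p1 z" using Ez_pspace[OF assms] by (simp_all add: gch_def p_add p_on)
 show "gch z \<in> W0" using W0_cong[OF 1(1)] assms by simp
 show "Ez (gch z) = Ez z" by (rule Ez_cong[OF 1])
qed

lemma fch_p: assumes "z \<in> W0" shows "p2 (fch z) = p2 z" "p1 (fch z) = p1 z" "fch z \<in> W0" "Ez (fch z) = Ez z" proof -
 show 1: "p2 (fch z) = p2 z" "p1 (fch z) = p1 z" using Ez_pspace[OF assms] by (simp_all add: fch_def p_diff p_on)
 show "fch z \<in> W0" using W0_cong[OF 1(1)] assms by simp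
 show "Ez (fch z) = Ez z" by (rule Ez_cong[OF 1])
qed

lemma cdiff_Ez: "z \<in> W0 ==> cdiff (%z. Ez z $ i) z" unfolding Ez_def quad_op_def vector_smult_component
 by (intro cdiff_mult cdiff_const cdiff_Tst cdiff_vp cdiff_clin[OF pproj_clin])

lemma holomorphic_wrt_of_cdiff:
 assumes "!!z i. z \<in> S ==> cdiff (%z. f z $ i) z" shows "holomorphic_wrt (*s) f S" unfolding holomorphic_wrt_def proof
 fix x assume "x \<in> S"
 then obtain f' where "(f has_derivative f') (at x)" "!!c v. f' (c *s v) = c *s f' v" using cdiff_vec[of f x] assms by blast
 thus "EX f'. (f has_derivative f') (at x within S) & (ALL c v. f' (c *s v) = c *s f' v)" using has_derivative_at_withinI by blast
qed

lemma base_chart: "slice_chart dd M W0 fch gch VV" proof -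
 have gf: "gch (fch z) = z" if "z \<in> W0" for z using fch_p(4)[OF that] by (simp add: gch_def fch_def)
 have fg: "fch (gch z) = z" if "z \<in> W0" for z using gch_p(4)[OF that] by (simp add: gch_def fch_def)
 have img: "fch ` W0 = W0" using fch_p(3) gch_p(3) fg by force
 show ?thesis unfolding slice_chart_def img proof (intro conjI ballI)
  show "holomorphic_wrt (*s) fch W0" "holomorphic_wrt (*s) gch W0" unfolding fch_def gch_def
   by (rule holomorphic_wrt_of_cdiff, simp, intro cdiff_intros cdiff_Ez, assumption)+
  show "fch ` (W0 \<inter> M) = W0 \<inter> VV" proof
   show "fch ` (W0 \<inter> M) \<subseteq> W0 \<inter> VV" using fch_p(3) M_W0_iff Ez_pspace by (auto simp: VV_def fch_def p_diff p_on)
   show "W0 \<inter> VV \<subseteq> fch ` (W0 \<inter> M)" proof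
    fix z assume z: "z \<in> W0 \<inter> VV"
    hence "gch z \<in> W0" "p0 (gch z) = Ez (gch z)" using gch_p[of z] Ez_pspace[of z] by (auto simp: VV_def gch_def p_add p_on)
    hence "gch z \<in> W0 \<inter> M" using M_W0_iff by blast
    thus "z \<in> fch ` (W0 \<inter> M)" using fg z by force
   qed
  qed
 qed (auto simp: W0_open gf VV_subspace dd_def)
qed

lemma M_submanifold: "complex_submanifold dd M" unfolding complex_submanifold_def proof
 fix z assume "z \<in> M"
 then obtain A where A: "A \<in> Str" "z = A *v c" using M_orbit by blast
 have "slice_chart dd M ((*v) A ` W0) (%x. fch (matrix_inv A *v x)) (%y. A *v gch y) VV"
  by (rule slice_chart_linear[OF base_chart]) (use A(1) M_Str in "auto simp: Str_def")
 thus "EX W f g V. z \<in> W & slice_chart dd M W f g V" using A(2) c_W0 by blast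
qed

lemma complex_dim_M: "complex_dim M = dd" by (rule complex_dim_eq[OF M_submanifold cc_M])

text \<open>At a point \<open>u \<in> Z\<^sub>2(c)\<close> the manifold is tangent to \<open>Z\<^sub>2(c) \<oplus> Z\<^sub>1(c)\<close>, since \<open>Ez\<close> is of second order.\<close>

lemma tangent_space_u:
 assumes u: "u \<in> pspace c 2" "u \<in> W0" shows "u \<in> M" "tangent_space M u = VV" proof -
 have pu: "p2 u = u" "p1 u = 0" "p0 u = 0" using p_on[of u] u by auto
 have vpu: "vp u = 0" by (rule vp_unique[OF u(2)]) (simp add: pu clin_zero[OF Px_clin])
 have Eu: "Ez u = 0" by (simp add: Ez_def vpu quad_op_def)
 show uM: "u \<in> M" using M_W0_iff[OF u(2)] pu Eu by simp
 have sub: "VV \<subseteq> tangent_space M u" proof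
  fix x assume x: "x \<in> VV"
  \<comment> \<open>a curve in the slice; \<open>F t\<close> is \<open>Ez\<close> along it divided by \<open>t\<^sup>2\<close>\<close>
  define a where "a t = u + t *\<^sub>R x" for t :: real
  define b where "b t = u + t *\<^sub>R p2 x + p1 x" for t :: real
  have pa: "p2 (a t) = u + t *\<^sub>R p2 x" "p1 (a t) = t *\<^sub>R p1 x" "p2 (b t) = u + t *\<^sub>R p2 x" "p1 (b t) = p1 x" for t
   using pu p_mem[of x] by (simp_all add: a_def b_def scaleR_eq_scale p_add p_scale p_on)
  have ab: "a t \<in> W0 \<longleftrightarrow> b t \<in> W0" for t by (rule W0_cong) (simp add: pa)
  have vab: "vp (a t) = t *\<^sub>R vp (b t)" if "b t \<in> W0" for t proof (rule vp_unique)
   show "a t \<in> W0" using that ab by simp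
   show "Px (p2 (a t) + c0) (t *\<^sub>R vp (b t)) = p1 (a t)"
    using vp_solves[OF that] by (simp add: pa scaleR_eq_scale clin_scale[OF Px_clin])
  qed
  define F where "F t = (1/2::complex) *s T (vp (b t)) (st (p2 (b t))) (vp (b t))" for t
  have Eab: "Ez (a t) = t\<^sup>2 *\<^sub>R F t" if "b t \<in> W0" for t unfolding Ez_def quad_op_def vab[OF that] F_def pa
   by (simp add: scaleR_eq_scale T_scale power2_eq_square vec_eq_iff)
  have b0: "b 0 \<in> W0" using ab[of 0] u(2) by (simp add: a_def)
  have contb: "isCont b 0" unfolding b_def by (intro continuous_intros)
  have "cdiff (%z. ((1/2::complex) *s T (vp z) (st (p2 z)) (vp z)) $ i) (b 0)" for i
   unfolding vector_smult_component by (intro cdiff_mult cdiff_const cdiff_Tst cdiff_vp[OF b0] cdiff_clin[OF pproj_clin])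
  then obtain f' where f': "((%z. (1/2::complex) *s T (vp z) (st (p2 z)) (vp z)) has_derivative f') (at (b 0))" by (rule cdiff_vec)
  have "(b has_derivative (%t. t *\<^sub>R p2 x)) (at 0)" unfolding b_def by (auto intro!: derivative_eq_intros)
  from has_derivative_compose[OF this f'] have F': "(F has_derivative (%t. f' (t *\<^sub>R p2 x))) (at 0)" unfolding F_def .
  have "((%t::real. t\<^sup>2) has_derivative (%h. 0)) (at 0)" by (auto intro!: derivative_eq_intros)
  from has_derivative_scaleR[OF this F'] have sq: "((%t. t\<^sup>2 *\<^sub>R F t) has_vector_derivative 0) (at 0)"
   by (simp add: has_vector_derivative_def)
  have ev: "\<forall>\<^sub>F t in nhds 0. b t \<in> W0"
   using contb[unfolded continuous_at tendsto_at_iff_tendsto_nhds] W0_open b0 by (rule topological_tendstoD)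
  define \<gamma> where "\<gamma> t = a t + t\<^sup>2 *\<^sub>R F t" for t
  have "(a has_vector_derivative x) (at 0)" unfolding a_def by (auto intro!: derivative_eq_intros)
  hence der: "(\<gamma> has_vector_derivative x) (at 0)" unfolding \<gamma>_def using has_vector_derivative_add[OF _ sq] by fastforce
  have "\<forall>\<^sub>F t in nhds 0. \<gamma> t \<in> M" using ev proof eventually_elim
   case (elim t)
   have aW: "a t \<in> W0" using ab elim by simp
   have g: "\<gamma> t = gch (a t)" by (simp add: \<gamma>_def gch_def Eab[OF elim])
   have "p0 (a t) = 0" using x pu by (simp add: a_def scaleR_eq_scale p_add p_scale VV_def)
   hence "p0 (gch (a t)) = Ez (gch (a t))" using gch_p(4)[OF aW] Ez_pspace[OF aW] by (simp add: gch_def p_add p_on)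
   thus ?case unfolding g using M_W0_iff[OF gch_p(3)[OF aW]] by simp
  qed
  moreover have "\<gamma> 0 = u" by (simp add: \<gamma>_def a_def)
  ultimately show "x \<in> tangent_space M u" unfolding tangent_space_def using der by blast
 qed
 obtain g' where g': "(gch has_derivative g') (at (fch u))" using slice_chart_inverse_derivative[OF base_chart u(2)] by blast
 note t = tangent_space_slice[OF base_chart u(2) uM g']
 have "VV = tangent_space M u" using vec.subspace_dim_equal[OF VV_subspace t(3) sub] t(2) by (simp add: dd_def)
 thus "tangent_space M u = VV" by simp
qed

lemma tangent_space_orbit: assumes "A \<in> Str" shows "tangent_space M (A *v c) = (*v) A ` VV" proof -
 have "tangent_space M (A *v c) = (*v) A ` tangent_space M c" by (rule tangent_space_linear) (use assms M_Str in "auto simp: Str_def")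
 thus ?thesis by (simp add: tangent_space_u(2)[OF c_pspace c_W0])
qed

end

section \<open>The norm polynomial\<close>

text \<open>Newton's recursion computes elementary symmetric functions from power sums.\<close>

fun elem_sym :: "(nat => complex) => nat => complex" where
 "elem_sym p 0 = 1"
| "elem_sym p (Suc k) = (\<Sum>j\<in>{..k}. elem_sym p j * ((-1) ^ (k - j) * p (Suc (k - j)))) / of_nat (Suc k)"

text \<open>Differentiate \<open>\<Prod>(1 + s\<^sub>i X)\<close> logarithmically.\<close>

lemma fps_log_derivative:
 fixes s :: "'i => complex"
 assumes "finite I"
 defines "E \<equiv> %I. \<Prod>i\<in>I. 1 + fps_const (s i) * fps_X"
 shows "fps_deriv (E I) = E I * Abs_fps (%n. (-1) ^ n * (\<Sum>i\<in>I. s i ^ Suc n))" using assms(1) proof induction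
 case empty
 thus ?case by (simp add: E_def fps_eq_iff)
next
 case (insert i I)
 let ?G = "Abs_fps (%n. (-1) ^ n * s i ^ Suc n)"
 let ?S = "%I. Abs_fps (%n. (-1) ^ n * (\<Sum>i\<in>I. s i ^ Suc n))"
 let ?l = "1 + fps_const (s i) * fps_X"
 have E: "E (insert i I) = ?l * E I" using insert by (simp add: E_def)
 have S: "?S (insert i I) = ?G + ?S I" using insert by (simp add: fps_eq_iff distrib_left)
 have "?l * ?G = fps_const (s i)" proof (rule fps_ext)
  fix n
  show "fps_nth (?l * ?G) n = fps_nth (fps_const (s i)) n" by (cases n) (simp_all add: distrib_right mult.assoc)
 qed
 hence "fps_deriv ?l = ?l * ?G" by simp
 hence "fps_deriv (E (insert i I)) = ?l * (E I * ?S I) + (?l * ?G) * E I" by (simp only: E fps_deriv_mult insert.IH)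
 also have "... = ?l * E I * (?G + ?S I)" by (simp only: distrib_left distrib_right mult.assoc mult.commute mult.left_commute add.commute)
 finally have "fps_deriv (E (insert i I)) = ?l * E I * (?G + ?S I)" .
 thus ?case by (simp only: E S)
qed

text \<open>Compare coefficients in the logarithmic derivative.\<close>

lemma elem_sym_power_sums:
 fixes s :: "'i => complex"
 assumes I: "finite I" shows "elem_sym (%k. \<Sum>i\<in>I. s i ^ k) n = fps_nth (\<Prod>i\<in>I. 1 + fps_const (s i) * fps_X) n"
proof (induction n rule: less_induct)
 case (less n)
 let ?E = "\<Prod>i\<in>I. 1 + fps_const (s i) * fps_X"
 show ?case proof (cases n)
  case 0
  have "fps_nth (\<Prod>i\<in>I. f i) 0 = (\<Prod>i\<in>I. fps_nth (f i) 0)" for f :: "'i => complex fps"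
   by (induction I rule: infinite_finite_induct) auto
  with 0 show ?thesis by simp
 next
  case (Suc k)
  have "of_nat (Suc k) * fps_nth ?E (Suc k) = fps_nth (fps_deriv ?E) k" by simp
  also have "... = (\<Sum>j=0..k. fps_nth ?E j * ((-1) ^ (k - j) * (\<Sum>i\<in>I. s i ^ Suc (k - j))))"
   by (simp add: fps_log_derivative[OF I] fps_mult_nth)
  also have "... = (\<Sum>j\<in>{..k}. elem_sym (%k. \<Sum>i\<in>I. s i ^ k) j * ((-1) ^ (k - j) * (\<Sum>i\<in>I. s i ^ Suc (k - j))))"
   using less Suc by (intro sum.cong) auto
  also have "... = of_nat (Suc k) * elem_sym (%k. \<Sum>i\<in>I. s i ^ k) (Suc k)" by (simp del: of_nat_Suc)
  finally show ?thesis using Suc by (metis of_nat_neq_0 mult_left_cancel)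
 qed
qed

lemma elem_sym_top:
 fixes s :: "'i => complex"
 assumes "finite I" shows "elem_sym (%k. \<Sum>i\<in>I. s i ^ k) (card I) = (\<Prod>i\<in>I. s i)" proof -
 have "fps_nth (\<Prod>i\<in>I. 1 + fps_const (s i) * fps_X) (card I) = (\<Prod>i\<in>I. s i) &
  (ALL n>card I. fps_nth (\<Prod>i\<in>I. 1 + fps_const (s i) * fps_X) n = 0)" using assms proof induction
  case (insert i I)
  let ?E = "\<Prod>i\<in>I. 1 + fps_const (s i) * fps_X"
  have step: "fps_nth ((1 + fps_const (s i) * fps_X) * ?E) (Suc n) = fps_nth ?E (Suc n) + s i * fps_nth ?E n" for n
   by (simp add: distrib_right mult.assoc)
  have "fps_nth ((1 + fps_const (s i) * fps_X) * ?E) n = 0" if "n > Suc (card I)" for n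
   using that step[of "n - 1"] insert.IH by (cases n) auto
  thus ?case using insert step[of "card I"] by auto
 qed simp
 thus ?thesis by (simp add: elem_sym_power_sums[OF assms])
qed

lemma polyfun_elem_sym:
 assumes "!!k. polyfun (%x. p x k)" shows "polyfun (%x. elem_sym (p x) n)" proof (induction n rule: less_induct)
 case (less n)
 show ?case proof (cases n)
  case 0 thus ?thesis by (simp add: polyfun_const)
 next
  case (Suc k)
  have "polyfun (%x. (\<Sum>j\<in>{..k}. elem_sym (p x) j * ((-1) ^ (k - j) * p x (Suc (k - j)))) * inverse (of_nat (Suc k)))"
   using less Suc by (intro polyfun_intros assms) auto
  thus ?thesis by (simp add: Suc divide_inverse del: of_nat_Suc)
 qed
qed

lemma polycurve_agree:
 assumes p: "polycurve p" and q: "polycurve q" and F: "finite F" and eq: "!!t. t \<notin> F ==> p t = q t" shows "p t = q t"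
proof (rule ccontr)
 assume "p t ~= q t"
 hence n: "p t + (-1) * q t ~= 0" by simp
 have "finite {t. p t + (-1) * q t = 0}" by (rule polycurve_zeros_finite[where f = "%t. p t + (-1) * q t", OF _ n])
    (intro polycurve_add polycurve_mult polycurve_const p q)
 moreover have "- F \<subseteq> {t. p t + (-1) * q t = 0}" using eq by auto
 ultimately have "finite (- F)" using finite_subset by blast
 hence "finite (UNIV :: complex set)" using F by (metis Compl_partition finite_UnI)
 thus False using infinite_UNIV_char_0 by blast
qed

lemma polycurve_at_0: "polycurve p ==> (!!t. t ~= 0 ==> p t = k) ==> p 0 = k"
 by (rule polycurve_agree[where F = "{0}", OF _ polycurve_const]) auto

text \<open>Each \<open>s\<^sub>k\<close> occurs twice in the diagonal term and \<open>a\<close> times for each of the other indices.\<close>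

lemma prod_pairs:
 fixes s :: "nat => complex"
 assumes "m < r"
 shows "(\<Prod>i\<in>{Suc m..r}. \<Prod>j\<in>{i..r}. (s i * s j) ^ (if i = j then 1 else a)) = (\<Prod>i\<in>{Suc m..r}. s i) ^ (2 + a * (r - Suc m))"
 using assms proof (induction "r - Suc m" arbitrary: m)
 case 0
 hence "Suc m = r" by simp
 hence "{Suc m..r} = {r}" by auto
 thus ?case using 0 by (simp add: power2_eq_square)
next
 case (Suc d)
 hence m: "Suc m < r" "d = r - Suc (Suc m)" by auto
 have I: "{Suc m..r} = insert (Suc m) {Suc (Suc m)..r}" using m by auto
 let ?A = "\<Prod>i\<in>{Suc (Suc m)..r}. s i" and ?x = "s (Suc m)"
 have "(\<Prod>j\<in>{Suc m..r}. (?x * s j) ^ (if Suc m = j then 1 else a))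
   = ?x\<^sup>2 * (\<Prod>j\<in>{Suc (Suc m)..r}. (?x * s j) ^ a)"
  unfolding I by (subst prod.insert) (auto simp: power2_eq_square intro!: prod.cong)
 also have "(\<Prod>j\<in>{Suc (Suc m)..r}. (?x * s j) ^ a) = (?x ^ (r - Suc m) * ?A) ^ a"
  by (simp add: prod_power_distrib[symmetric] prod.distrib)
 finally have row: "(\<Prod>j\<in>{Suc m..r}. (?x * s j) ^ (if Suc m = j then 1 else a)) = ?x\<^sup>2 * (?x ^ (r - Suc m) * ?A) ^ a" .
 have "(\<Prod>i\<in>{Suc m..r}. \<Prod>j\<in>{i..r}. (s i * s j) ^ (if i = j then 1 else a))
   = (\<Prod>j\<in>{Suc m..r}. (?x * s j) ^ (if Suc m = j then 1 else a)) *
    (\<Prod>i\<in>{Suc (Suc m)..r}. \<Prod>j\<in>{i..r}. (s i * s j) ^ (if i = j then 1 else a))" by (subst I, subst prod.insert) auto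
 also have "... = ?x\<^sup>2 * (?x ^ (r - Suc m) * ?A) ^ a * ?A ^ (2 + a * (r - Suc (Suc m)))" using Suc.hyps(1)[OF m(2)] m(1) row by simp
 also have "... = (?x * ?A) ^ (2 + a * (r - Suc m))" proof -
  have r: "r - Suc m = Suc (r - Suc (Suc m))" using m by simp
  show ?thesis unfolding r by (simp add: power_mult_distrib power_add power_mult[symmetric] power2_eq_square algebra_simps)
 qed
 also have "?x * ?A = (\<Prod>i\<in>{Suc m..r}. s i)" unfolding I by simp
 finally show ?case .
qed

context kepler_frame
begin

text \<open>Every element is \<open>x + \<i>y\<close> with \<open>x, y\<close> fixed by the involution.\<close>

lemma vanishes_on_real_form:
 assumes f: "polyfun f" and real: "!!x. st x = x ==> f x = 0" shows "f z = 0" proof -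
 let ?x = "(1/2) *s (z + st z)" and ?y = "(- \<i> / 2) *s (z - st z)"
 have "st (?x + of_real s *s ?y) = ?x + of_real s *s ?y" for s :: real by (simp add: star_simps vec_eq_iff field_simps)
 hence "f (?x + of_real s *s ?y) = 0" for s :: real by (rule real)
 hence "f (?x + \<i> *s ?y) = 0" by (rule polyfun_zero_complexify[OF f])
 moreover have "?x + \<i> *s ?y = z" by (simp add: vec_eq_iff field_simps)
 ultimately show ?thesis by simp
qed

fun jo_power :: "complex^'n => nat => complex^'n" where
 "jo_power x 0 = un"
| "jo_power x (Suc k) = jo x (jo_power x k)"

text \<open>The power sums of the spectral values are the traces of the Jordan powers, so Newton's recursion expresses the product of the
  spectral values as a polynomial.\<close>

definition Nm :: "complex^'n => complex" where
 "Nm x = elem_sym (%k. ip (jo_power x k) un / of_nat pnum) r"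

lemma polyfun_ip: "(!!i. polyfun (%x. f x $ i)) ==> polyfun (%x. ip (f x) v)" proof -
 assume f: "!!i. polyfun (%x. f x $ i)"
 have "ip (f x) v = (\<Sum>i\<in>UNIV. f x $ i * ip (axis i 1) v)" for x
  using ip_sum(1)[of "%i. f x $ i *s axis i 1" UNIV v] by (simp add: basis_expansion ip_scale)
 thus ?thesis by (simp only:) (intro polyfun_intros f)
qed

lemma polyfun_jo:
 assumes "!!i. polyfun (%x. f x $ i)" "!!i. polyfun (%x. g x $ i)" shows "polyfun (%x. jo (f x) (g x) $ i)" proof -
 have "polyfun (%x. (1/2) * T (f x) (st un) (g x) $ i)" by (intro polyfun_intros polyfun_Tst assms)
 thus ?thesis by (simp add: jp_def)
qed

lemma polyfun_Nm: "polyfun Nm" proof -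
 have p: "polyfun (%x. jo_power x k $ i)" for k i by (induction k arbitrary: i) (auto intro: polyfun_intros polyfun_jo)
 have "polyfun (%x. ip (jo_power x k) un * inverse (of_nat pnum))" for k by (intro polyfun_intros polyfun_ip p)
 hence "polyfun (%x. ip (jo_power x k) un / of_nat pnum)" for k by (simp add: divide_inverse)
 thus ?thesis unfolding Nm_def by (rule polyfun_elem_sym)
qed

lemma Nm_Haut: assumes "k \<in> Haut m" shows "Nm (k *v x) = Nm x" proof -
 have "jo_power (k *v x) n = k *v jo_power x n" for n by (induction n) (simp_all add: HautD(3)[OF assms] Haut_jo[OF assms])
 hence "ip (jo_power (k *v x) n) un = ip (jo_power x n) un" for n
  using Aut_ip[OF HautD(1)[OF assms], of _ un] by (simp add: HautD(3)[OF assms])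
 thus ?thesis by (simp add: Nm_def)
qed

lemma jo_e_e: "i \<in> {1..r} ==> k \<in> {1..r} ==> jo (e i) (e k) = (if i = k then e k else 0)" using jo_e[OF e_Z, of k i] by auto

lemma jo_diag: "jo (\<Sum>i=1..r. s i *s e i) (\<Sum>i=1..r. t i *s e i) = (\<Sum>i=1..r. (s i * t i) *s e i)" proof -
 have "jo (\<Sum>i=1..r. s i *s e i) (\<Sum>i=1..r. t i *s e i) = (\<Sum>i=1..r. \<Sum>k=1..r. (s i * t k) *s jo (e i) (e k))"
  unfolding jp_sum jp_scale by (subst sum.swap) (simp add: clin_scale[OF jp_clin] vec.scale_sum_right vec.scale_scale mult.commute)
 also have "... = (\<Sum>i=1..r. \<Sum>k=1..r. if i = k then (s i * t i) *s e i else 0)" by (intro sum.cong refl) (simp add: jo_e_e)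
 finally show ?thesis by simp
qed

lemma Nm_diag: "Nm (\<Sum>i=1..r. s i *s e i) = (\<Prod>i=1..r. s i)" proof -
 have p: "jo_power (\<Sum>i=1..r. s i *s e i) k = (\<Sum>i=1..r. s i ^ k *s e i)" for k
  by (induction k) (simp add: esum_def, simp add: jo_diag)
 have u: "ip (e i) un = of_nat pnum" if "i \<in> {1..r}" for i using that by (simp add: esum_def ip_sum ip_e_e)
 have pn: "pnum ~= 0" by (simp add: pnum_def)
 have "ip (jo_power (\<Sum>i=1..r. s i *s e i) k) un / of_nat pnum = (\<Sum>i=1..r. s i ^ k)" for k
  unfolding p ip_sum ip_scale using pn by (simp add: u sum_distrib_right[symmetric])
 thus ?thesis using elem_sym_top[of "{1..r}" s] by (simp add: Nm_def)
qed

lemma Nm_un: "Nm un = 1" using Nm_diag[of "%_. 1"] by (simp add: esum_def)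

lemma Px_jo: "Px x z = 2 *s jo x (jo x z) - jo (jo x x) z" proof -
 have c: "jo (jo z x) x = jo x (jo x z)" "jo x (jo z x) = jo x (jo x z)" "jo z (jo x x) = jo (jo x x) z" by (metis jp_commute)+
 have "T x (st z) x = 2 *s (jo (jo z x) x + jo x (jo z x) - jo z (jo x x))" by (simp only: T_jo st_st)
 thus ?thesis unfolding Px_def quad_op_def c by (simp add: vec_eq_iff)
qed

lemma jo_diag_Z:
 assumes z: "z \<in> Z i j" and ij: "i \<in> {1..r}" "j \<in> {1..r}" shows "jo (\<Sum>k=1..r. s k *s e k) z = ((s i + s j) / 2) *s z"
proof -
 have "jo (\<Sum>k=1..r. s k *s e k) z = (\<Sum>k=1..r. (s k * ((of_bool (i = k) + of_bool (j = k)) / 2)) *s z)"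
  unfolding jp_sum jp_scale using jo_e[OF z] by (intro sum.cong refl) (simp add: vec.scale_scale)
 also have "... = (\<Sum>k=1..r. s k * ((of_bool (i = k) + of_bool (j = k)) / 2)) *s z" by (simp add: vec.scale_sum_left)
 also have "(\<Sum>k=1..r. s k * ((of_bool (i = k) + of_bool (j = k)) / 2))
   = (\<Sum>k=1..r. (if k = i then s k / 2 else 0) + (if k = j then s k / 2 else 0))" by (intro sum.cong refl) (auto simp: of_bool_def)
 also have "... = (s i + s j) / 2" using ij by (simp add: sum.distrib add_divide_distrib)
 finally show ?thesis .
qed

lemma Px_diag:
 assumes z: "z \<in> Z i j" and ij: "i \<in> {1..r}" "j \<in> {1..r}" shows "Px (\<Sum>k=1..r. s k *s e k) z = (s i * s j) *s z"
 unfolding Px_jo jo_diag jo_diag_Z[OF z ij] clin_scale[OF jp_clin] by (simp add: vec_eq_iff field_simps)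

lemma Z_pspace_cc:
 assumes z: "z \<in> Z i j" and m: "m <= r" "i \<in> {1..r}" "j \<in> {1..r}"
 shows "z \<in> pspace (cc m) (of_bool (i <= m) + of_bool (j <= m))" proof -
 have "T (cc m) (cc m) z = (\<Sum>k=1..m. (of_bool (i = k) + of_bool (j = k)) *s z)"
  unfolding T_cc[OF m(1)] using ZD[OF z] m by (intro sum.cong refl) auto
 also have "... = (\<Sum>k=1..m. of_bool (i = k) + of_bool (j = k)) *s z" by (simp add: vec.scale_sum_left)
 also have "(\<Sum>k=1..m. of_bool (i = k) + of_bool (j = k) :: complex) = of_nat (of_bool (i <= m) + of_bool (j <= m))"
  using m by (auto simp: sum.distrib of_bool_def)
 finally show ?thesis by (simp add: pspace_def)
qed

lemma Haut_pproj: assumes "k \<in> Haut m" shows "k *v pproj (cc m) j x = pproj (cc m) j (k *v x)"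
 using Aut_pspace[OF HautD(1)[OF assms], of "cc m"] HautD(2)[OF assms] by simp

lemma st_pproj_cc: assumes "m <= r" shows "st (pproj (cc m) j x) = pproj (cc m) j (st x)" proof -
 have "T (cc m) (cc m) (st x) = st (T (cc m) (cc m) x)" for x unfolding T_cc[OF assms] star_sum proof (intro sum.cong refl)
  fix k assume "k \<in> {1..m}"
  hence k: "k \<in> {1..r}" using assms by simp
  show "L k (st x) = st (L k x)" unfolding L_jo[OF k] star_scale st_jo st_e[OF k] by simp
 qed
 thus ?thesis by (simp add: pproj_def star_simps)
qed

text \<open>Compression to \<open>Z\<^sub>0(e\<^sub>1 + \<dots> + e\<^sub>m)\<close>, extended by the identity so that its determinant is that of the block.\<close>

definition block0 :: "nat => (complex^'n => complex^'n) => complex^'n => complex^'n" where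
 "block0 m f z = pproj (cc m) 0 (f (pproj (cc m) 0 z)) + (z - pproj (cc m) 0 z)"

lemma block0_clin: "clin f ==> clin (block0 m f)" unfolding block0_def
 by (rule clinI) (simp_all add: clin_add[OF pproj_clin] clin_scale[OF pproj_clin] clin_add clin_scale vec_eq_iff algebra_simps)

lemma Det_block0_diag:
 assumes m: "m < r" shows "Det (block0 m (Px (\<Sum>k=1..r. s k *s e k))) = (\<Prod>i\<in>{Suc m..r}. s i) ^ (2 + a * (r - Suc m))" proof -
 obtain ty b where "frame_basis ty b" by (rule frame_basis_exists)
 note b = frame_basisD[OF this]
 let ?f = "%(i, j). if m < i then s i * s j else 1"
 have "block0 m (Px (\<Sum>k=1..r. s k *s e k)) (b x) = ?f (ty x) *s b x" for x proof -
  obtain i j where t: "ty x = (i, j)" by (cases "ty x")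
  have ij: "1 <= i" "i <= j" "j <= r" using b(1)[rule_format, of x] t by (auto simp: pidx_def)
  have z: "b x \<in> Z i j" using b(2)[rule_format, of x] t by simp
  have "b x \<in> pspace (cc m) (of_bool (i <= m) + of_bool (j <= m))" by (rule Z_pspace_cc[OF z]) (use ij m in auto)
  hence q: "pproj (cc m) 0 (b x) = (if m < i then b x else 0)"
   using pproj_pspace[of "b x" "cc m" "of_bool (i <= m) + of_bool (j <= m)" 0] ij by (auto simp: of_bool_def split: if_splits)
  show ?thesis proof (cases "m < i")
   case True
   have "Px (\<Sum>k=1..r. s k *s e k) (b x) = (s i * s j) *s b x" by (rule Px_diag[OF z]) (use ij in auto)
   thus ?thesis using True q by (simp add: block0_def t clin_scale[OF pproj_clin])
  next
   case False
   thus ?thesis using q by (simp add: block0_def t clin_zero[OF Px_clin] clin_zero[OF pproj_clin])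
  qed
 qed
 hence "Det (block0 m (Px (\<Sum>k=1..r. s k *s e k))) = (\<Prod>x\<in>UNIV. ?f (ty x))"
  by (rule Det_eigenbasis[OF block0_clin[OF Px_clin] b(3)])
 also have "... = (\<Prod>(i, j)\<in>pidx. ?f (i, j) ^ (if i = j then 1 else a))" by (rule prod_by_type[OF b(1,4)])
 also have "... = (\<Prod>i\<in>{1..r}. \<Prod>j\<in>{i..r}. ?f (i, j) ^ (if i = j then 1 else a))"
  unfolding pidx_Sigma by (rule prod.Sigma[symmetric]) auto
 also have "... = (\<Prod>i\<in>{Suc m..r}. \<Prod>j\<in>{i..r}. ?f (i, j) ^ (if i = j then 1 else a))"
  by (rule prod.mono_neutral_right) (auto intro!: prod.neutral)
 also have "... = (\<Prod>i\<in>{Suc m..r}. \<Prod>j\<in>{i..r}. (s i * s j) ^ (if i = j then 1 else a))" by (intro prod.cong refl) auto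
 also have "... = (\<Prod>i\<in>{Suc m..r}. s i) ^ (2 + a * (r - Suc m))" by (rule prod_pairs[OF m])
 finally show ?thesis .
qed

lemma Det_matrix_mult: "Det (%x. A *v f x) = det A * Det f" "Det (%x. f (A *v x)) = Det f * det A" if "clin f"
 using Det_comp[OF clin_matrix that, of A] Det_comp[OF that clin_matrix, of A] by (simp_all add: matrix_of_matrix_vector_mul)

lemma Px_Haut: assumes "k \<in> Haut m" shows "k *v Px x z = Px (k *v x) (k *v z)" using AutD(2)[OF HautD(1)[OF assms]] Haut_st[OF assms]
 by (simp add: Px_def quad_op_def clin_scale[OF clin_matrix])

lemma Det_block0_Haut: assumes k: "k \<in> Haut m" shows "Det (block0 m (Px (k *v x))) = Det (block0 m (Px x))" proof -
 have "(%z. k *v block0 m (Px x) z) = (%z. block0 m (Px (k *v x)) (k *v z))" using Px_Haut[OF k] Haut_pproj[OF k]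
  by (auto simp: block0_def clin_add[OF clin_matrix] clin_diff[OF clin_matrix])
 hence "det k * Det (block0 m (Px x)) = Det (block0 m (Px (k *v x))) * det k" using Det_matrix_mult[OF block0_clin[OF Px_clin]] by metis
 moreover have "det k ~= 0" using AutD(1)[OF HautD(1)[OF k]] by (simp add: invertible_det_nz)
 ultimately show ?thesis by simp
qed

lemma polyfun_p: "polyfun (%x. pproj u k x $ i)" by (rule polyfun_clin[OF pproj_clin])

text \<open>Both sides are polynomials, hence it suffices to compare them on the real form; there the real spectral theorem,
  applied to \<open>c\<^sub>m + x\<^sub>0\<close> with an automorphism that respects the decomposition, reduces to diagonal elements.\<close>

lemma Det_block0:
 assumes m: "m < r" shows "Det (block0 m (Px (cc m + pproj (cc m) 0 x))) = Nm (cc m + pproj (cc m) 0 x) ^ (2 + a * (r - Suc m))" proof -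
 let ?q = "%x. cc m + pproj (cc m) 0 x"
 let ?f = "%x. Det (block0 m (Px (?q x))) - Nm (?q x) ^ (2 + a * (r - Suc m))"
 have mr: "m <= r" and t: "tripotent T (cc m)" using m cc_tripotent[of m] by auto
 have q: "polyfun (%x. ?q x $ i)" for i unfolding vector_add_component by (intro polyfun_intros polyfun_p)
 have "polyfun (%x. Det (block0 m (Px (?q x))))" proof (rule polyfun_det)
  fix i j
  have "polyfun (%x. pproj (cc m) 0 (Px (?q x) (pproj (cc m) 0 (axis j 1))) $ i)"
   by (rule polyfun_compose[OF polyfun_p]) (rule polyfun_Px[OF q])
  hence "polyfun (%x. pproj (cc m) 0 (Px (?q x) (pproj (cc m) 0 (axis j 1))) $ i + (axis j 1 - pproj (cc m) 0 (axis j 1)) $ i)"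
   by (intro polyfun_add polyfun_const)
  thus "polyfun (%x. matrix (block0 m (Px (?q x))) $ i $ j)" by (simp add: matrix_def block0_def)
 qed
 hence "polyfun ?f" by (intro polyfun_diff polyfun_power polyfun_compose[OF polyfun_Nm q])
 moreover have "?f x = 0" if "st x = x" for x proof -
  have st: "st (?q x) = ?q x" using that m by (simp add: star_simps st_pproj_cc[OF mr] st_esum)
  have q1: "pproj (cc m) 1 (?q x) = 0" using pproj_pspace[OF tripotent_pspace[OF t], of 1] pproj_pspace[OF pproj_mem[OF t], of 0 1 x]
   by (simp add: clin_add[OF pproj_clin])
  obtain k s where k: "k \<in> Haut m" "?q x = k *v (\<Sum>i=1..r. of_real (s i :: real) *s e i)"
   by (rule real_spectral_theorem[OF mr st q1], rule that)
  let ?d = "\<Sum>i=1..r. of_real (s i) *s e i"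
  have "k *v pproj (cc m) 2 ?d = cc m" using pproj_pspace[OF tripotent_pspace[OF t], of 2] pproj_pspace[OF pproj_mem[OF t], of 0 2 x]
   by (simp add: Haut_pproj[OF k(1)] k(2)[symmetric] clin_add[OF pproj_clin])
  hence d2: "pproj (cc m) 2 ?d = cc m" using AutD(1)[OF HautD(1)[OF k(1)]] HautD(2)[OF k(1)] by (metis inv_mv(2))
  have s1: "s i = 1" if i: "i \<in> {1..m}" for i proof -
   have ir: "i \<in> {1..r}" using i mr by auto
   have e2: "pproj (cc m) 2 (e j) = (if j <= m then e j else 0)" if "j \<in> {1..r}" for j
    using pproj_pspace[OF Z_pspace_cc[OF e_Z[OF that] mr that that], of 2] by auto
   have "jo (e i) (pproj (cc m) 2 ?d) = of_real (s i) *s e i" proof -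
    have "jo (e i) (pproj (cc m) 2 ?d) = (\<Sum>j=1..r. if j = i then of_real (s i) *s e i else 0)"
     unfolding clin_sum[OF pproj_clin] clin_scale[OF pproj_clin] jp_sum jp_scale
     by (intro sum.cong refl) (use i ir in "auto simp: e2 jo_e_e clin_zero[OF jp_clin]")
    thus ?thesis using ir by simp
   qed
   moreover have "jo (e i) (cc m) = e i" proof -
    have "jo (e i) (cc m) = (\<Sum>j=1..m. if j = i then e i else 0)"
     unfolding esum_def[of "{1..m}"] jp_sum by (intro sum.cong refl) (use i ir mr in "auto simp: jo_e_e")
    thus ?thesis using i by simp
   qed
   ultimately have "of_real (s i) *s e i = 1 *s e i" using d2 by simp
   thus ?thesis using e_nonzero[OF ir] by (simp only: vec.scale_right_imp_eq of_real_eq_1_iff vec.scale_cancel_right) simp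
  qed
  have "Det (block0 m (Px (?q x))) = (\<Prod>i\<in>{Suc m..r}. of_real (s i)) ^ (2 + a * (r - Suc m))"
   unfolding k(2) by (simp only: Det_block0_Haut[OF k(1)] Det_block0_diag[OF m])
  moreover have "Nm (?q x) = (\<Prod>i\<in>{Suc m..r}. of_real (s i))" proof -
   have "Nm (?q x) = (\<Prod>i=1..r. of_real (s i))" unfolding k(2) by (simp only: Nm_Haut[OF k(1)] Nm_diag)
   also have "... = (\<Prod>i\<in>{Suc m..r}. of_real (s i))" by (rule prod.mono_neutral_right) (use s1 in auto)
   finally show ?thesis .
  qed
  ultimately show ?thesis by simp
 qed
 ultimately have "?f x = 0" by (rule vanishes_on_real_form)
 thus ?thesis by simp
qed

lemma Det_Px: "Det (Px x) = Nm x ^ pnum" proof -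
 have c0: "cc 0 = 0" by (simp add: esum_def)
 have p: "pproj (cc 0) 0 z = z" for z unfolding c0 by (simp add: pproj_def)
 have "block0 0 (Px x) = Px x" by (rule ext) (unfold block0_def p, simp)
 moreover have "cc 0 + pproj (cc 0) 0 x = x" by (simp only: p) (simp only: c0 add_0)
 ultimately have "Det (Px x) = Nm x ^ (2 + a * (r - Suc 0))" using Det_block0[of 0 x] l_less by simp
 thus ?thesis by (simp add: pnum_def One_nat_def)
qed

lemma Det_block0_Px: assumes "w \<in> pspace c 0" shows "Det (block0 l (Px w)) = Nm (c + w) ^ (2 + a * (r - Suc l))" proof -
 have "block0 l (Px w) = block0 l (Px (c + w))" using Px_block(3)[OF c_pspace assms p_mem(3)] by (auto simp: block0_def)
 thus ?thesis using Det_block0[OF l_less, of w] p_on(9)[OF assms] by simp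
qed

text \<open>The same reduction to the real form and to diagonal elements, where the norm is a product over the indices up to
  \<open>l\<close> and the remaining ones.\<close>

lemma Nm_split: "Nm (p2 x + p0 x) = Nm (p2 x + c0) * Nm (c + p0 x)" proof -
 let ?f = "%x. Nm (p2 x + p0 x) - Nm (p2 x + c0) * Nm (c + p0 x)"
 have "polyfun ?f" by (intro polyfun_diff polyfun_mult polyfun_compose[OF polyfun_Nm])
    (auto intro!: polyfun_intros polyfun_p)
 moreover have "?f x = 0" if "st x = x" for x proof -
  let ?y = "p2 x + p0 x"
  have st: "st ?y = ?y" using that by (simp add: star_simps st_pproj_cc[OF l_le])
  have y1: "p1 ?y = 0" using p_mem[of x] by (simp add: p_add p_on)
  obtain k s where k: "k \<in> Haut l" "?y = k *v (\<Sum>i=1..r. of_real (s i :: real) *s e i)"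
   by (rule real_spectral_theorem[OF l_le st y1], rule that)
  let ?d = "\<Sum>i=1..r. of_real (s i) *s e i"
  have pe: "p2 (e j) = (if j <= l then e j else 0)" "p0 (e j) = (if j <= l then 0 else e j)" if "j \<in> {1..r}" for j
   using pproj_pspace[OF Z_pspace_cc[OF e_Z[OF that] l_le that that], of 2]
    pproj_pspace[OF Z_pspace_cc[OF e_Z[OF that] l_le that that], of 0] by auto
  have kc0: "k *v c0 = c0" using HautD(2,3)[OF k(1)] by (simp add: un_split clin_add[OF clin_matrix])
  have ce: "c = (\<Sum>i=1..r. (if i <= l then 1 else 0) *s e i)" "c0 = (\<Sum>i=1..r. (if i <= l then 0 else 1) *s e i)"
   unfolding esum_def by (rule sum.mono_neutral_cong_left; use l_less in auto)+
  have "p2 x = p2 ?y" "p0 x = p0 ?y" using p_mem[of x] by (simp_all add: p_add p_on)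
  hence px: "p2 x = k *v p2 ?d" "p0 x = k *v p0 ?d" unfolding k(2) by (simp_all add: Haut_pproj[OF k(1)])
  have dd: "p2 ?d = (\<Sum>i=1..r. (if i <= l then of_real (s i) else 0) *s e i)"
   "p0 ?d = (\<Sum>i=1..r. (if i <= l then 0 else of_real (s i)) *s e i)"
   unfolding clin_sum[OF pproj_clin] p_scale by (intro sum.cong refl; simp add: pe)+
  have "p2 x + c0 = k *v (\<Sum>i=1..r. (if i <= l then of_real (s i) else 1) *s e i)" proof -
   have "p2 ?d + c0 = (\<Sum>i=1..r. (if i <= l then of_real (s i) else 1) *s e i)"
    unfolding dd ce(2) sum.distrib[symmetric] by (intro sum.cong refl) auto
   thus ?thesis by (metis px(1) kc0 clin_add[OF clin_matrix])
  qed
  hence 1: "Nm (p2 x + c0) = (\<Prod>i=1..r. if i <= l then of_real (s i) else 1)" by (simp only: Nm_Haut[OF k(1)] Nm_diag)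
  have "c + p0 x = k *v (\<Sum>i=1..r. (if i <= l then 1 else of_real (s i)) *s e i)" proof -
   have "c + p0 ?d = (\<Sum>i=1..r. (if i <= l then 1 else of_real (s i)) *s e i)"
    unfolding arg_cong2[where f = "(+)", OF ce(1) dd(2)] sum.distrib[symmetric] by (intro sum.cong refl) auto
   thus ?thesis by (metis px(2) HautD(2)[OF k(1)] clin_add[OF clin_matrix])
  qed
  hence 2: "Nm (c + p0 x) = (\<Prod>i=1..r. if i <= l then 1 else of_real (s i))" by (simp only: Nm_Haut[OF k(1)] Nm_diag)
  have "Nm ?y = (\<Prod>i=1..r. of_real (s i))" unfolding k(2) by (simp only: Nm_Haut[OF k(1)] Nm_diag)
  also have "... = Nm (p2 x + c0) * Nm (c + p0 x)" unfolding 1 2 prod.distrib[symmetric] by (intro prod.cong refl) auto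
  finally show ?thesis by simp
 qed
 ultimately have "?f x = 0" by (rule vanishes_on_real_form)
 thus ?thesis by simp
qed

section \<open>The character of the structure group\<close>

lemma Px_str: "str_pair g g' ==> Px (g x) z = g (Px x (st (g' (st z))))" by (simp add: Px_def str_pair_quad)

definition chi :: "complex^'n^'n => complex" where "chi A = Nm (A *v un)"

text \<open>Since \<open>P(Ax) = A P(x) A'\<close>, the determinants show that \<open>Nm(Az)/Nm(z)\<close> has constant power \<open>pnum\<close>.  On a complex line
  through the unit without finitely many points it is continuous with values in a finite set, hence constant.\<close>

lemma Nm_Str: assumes A: "A \<in> Str" shows "Nm (A *v z) = chi A * Nm z" proof -
 obtain g' where g: "str_pair ((*v) A) g'" "bij ((*v) A)" by (rule StrE[OF A])
 have cg: "clin (%x. st (g' (st x)))" using str_pairD(2)[OF g(1)] by (intro clinI) (simp_all add: clin_add clin_scale star_simps)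
 define K where "K = det A * Det (%x. st (g' (st x)))"
 have pw: "Nm (A *v x) ^ pnum = K * Nm x ^ pnum" for x proof -
  have "Px (A *v x) = (%z. A *v (Px x (st (g' (st z)))))" using Px_str[OF g(1)] by auto
  hence "Det (Px (A *v x)) = det A * (Det (Px x) * Det (%x. st (g' (st x))))"
   using Det_matrix_mult(1)[OF clin_comp[OF Px_clin cg], of A x] Det_comp[OF Px_clin[of x] cg] by simp
  thus ?thesis unfolding Det_Px K_def by simp
 qed
 have pn: "pnum > 0" by (simp add: pnum_def)
 have "Nm (A *v (matrix_inv A *v un)) = 1" using A by (simp add: Str_def Nm_un)
 hence "K ~= 0" using pw[of "matrix_inv A *v un"] by auto
 moreover have chiK: "chi A ^ pnum = K" using pw[of un] by (simp add: chi_def Nm_un)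
 ultimately have chi0: "chi A ~= 0" using pn by auto
 define \<zeta> where "\<zeta> t = un + t *s (z - un)" for t
 define p q where "p t = Nm (A *v \<zeta> t)" and "q t = chi A * Nm (\<zeta> t)" for t
 have line: "polycurve (%t. \<zeta> t $ i)" for i unfolding \<zeta>_def by (rule line_polycurve)
 have "polyfun (%x. Nm (A *v x))" by (rule polyfun_compose[OF polyfun_Nm polyfun_clin[OF clin_matrix]])
 hence pp: "polycurve p" unfolding p_def by (rule polycurve_polyfun[OF _ line])
 have pq: "polycurve q" unfolding q_def by (intro polycurve_mult polycurve_const polycurve_polyfun[OF polyfun_Nm line])
 have z0: "\<zeta> 0 = un" "\<zeta> 1 = z" by (simp_all add: \<zeta>_def)
 have q0: "q 0 ~= 0" and pq0: "p 0 = q 0" using chi0 by (simp_all add: p_def q_def z0 Nm_un chi_def)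
 let ?F = "{t. q t = 0}"
 have fin: "finite ?F" by (rule polycurve_zeros_finite[OF pq q0])
 have eq: "p t = q t" if t: "t \<notin> ?F" for t proof -
  have "p t / q t = p 0 / q 0" proof (rule cofinite_constant[OF fin, where f = "%t. p t / q t" and V = "{w. w ^ pnum = 1}"])
   show "continuous_on (- ?F) (%t. p t / q t)" by (intro continuous_on_divide polycurve_continuous pp pq) auto
   show "finite {w :: complex. w ^ pnum = 1}" using pn by (intro finite_roots_unity) simp
   show "p t / q t \<in> {w. w ^ pnum = 1}" if "t \<notin> ?F" for t proof -
    have "p t ^ pnum = q t ^ pnum" using pw[of "\<zeta> t"] chiK by (simp add: p_def q_def power_mult_distrib)
    thus ?thesis using that by (simp add: power_divide)
   qed
  qed (use t q0 in auto)
  thus ?thesis using pq0 q0 t by simp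
 qed
 have "p 1 = q 1" by (rule polycurve_agree[OF pp pq fin eq])
 thus ?thesis by (simp add: p_def q_def z0)
qed

lemma chi_mult: "A \<in> Str ==> B \<in> Str ==> chi (A ** B) = chi A * chi B"
 using Nm_Str[of A "B *v un"] by (simp add: chi_def matrix_vector_mul_assoc)

lemma chi_one: "chi (mat 1) = 1" by (simp add: chi_def Nm_un)

lemma chi_nonzero: assumes "A \<in> Str" shows "chi A ~= 0" proof -
 have "chi (A ** matrix_inv A) = 1" using assms chi_one by (simp add: matrix_inv_mult Str_def)
 thus ?thesis using chi_mult[OF assms matrix_group_inv[OF Str_group assms]] by auto
qed

lemma chi_continuous: "continuous_on S chi" unfolding chi_def
 by (rule continuous_on_compose2[OF polyfun_continuous[OF polyfun_Nm, of UNIV]]) (auto intro!: continuous_intros)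

end

section \<open>Polynomial paths in the group\<close>

definition adjugate :: "complex^'n^'n => complex^'n^'n::finite" where
 "adjugate A = (\<chi> k j. det (\<chi> i m. if m = k then (axis j 1 :: complex^'n) $ i else A $ i $ m))"

lemma adjugate_inverse:
 assumes "det A ~= 0" shows "adjugate A *v x = det A *s (matrix_inv A *v x)" proof -
 have inv: "invertible A" using assms by (simp add: invertible_det_nz)
 have col: "(\<chi> k. adjugate A $ k $ j) = det A *s (matrix_inv A *v axis j 1)" for j proof -
  have "A *v (matrix_inv A *v axis j 1) = axis j 1" using inv by simp
  hence "matrix_inv A *v axis j 1 = (\<chi> k. det (\<chi> i m. if m = k then axis j 1 $ i else A $ i $ m) / det A)"
   using cramer[OF assms] by blast
  thus ?thesis using assms by (simp add: adjugate_def vec_eq_iff)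
 qed
 have "adjugate A $ k $ j = det A * matrix_inv A $ k $ j" for k j proof -
  have "adjugate A $ k $ j = (\<chi> k. adjugate A $ k $ j) $ k" by simp
  also have "... = det A * (matrix_inv A *v axis j 1) $ k" by (simp only: col vector_smult_component)
  also have "(matrix_inv A *v axis j 1) $ k = matrix_inv A $ k $ j"
   unfolding matrix_vector_mult_def axis_def by (simp add: if_distrib[of "%x. _ * x"] cong: if_cong)
  finally show ?thesis .
 qed
 thus ?thesis by (simp add: vec_eq_iff matrix_vector_mult_def sum_distrib_left mult.assoc)
qed

lemma polycurve_adjugate:
 assumes "!!i j. polycurve (%t. A t $ i $ j)" shows "polycurve (%t. adjugate (A t) $ i $ j)" proof -
 have "polycurve (%t. if P then x else A t $ i $ j)" for P x i j by (cases P) (simp_all add: polycurve_const assms)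
 thus ?thesis unfolding adjugate_def vec_lambda_beta by (intro polycurve_det) simp
qed

lemma polycurve_mv:
 assumes "!!i j. polycurve (%t. A t $ i $ j)" "!!j. polycurve (%t. x t $ j)" shows "polycurve (%t. (A t *v x t) $ i)"
 unfolding matrix_vector_mult_def vec_lambda_beta by (intro polycurve_sum polycurve_mult assms)

context kepler_frame
begin

text \<open>A polynomial curve from \<open>1\<close> to \<open>A\<close> that lies in the group wherever it is invertible, that is for all but finitely many
  parameters.  Such curves replace connectedness of the group.\<close>

definition poly_path :: "complex^'n^'n => (complex => complex^'n^'n) => bool" where
 "poly_path A \<Gamma> \<longleftrightarrow> (ALL i j. polycurve (%t. \<Gamma> t $ i $ j)) & \<Gamma> 0 = mat 1 & \<Gamma> 1 = A &
   (ALL t. det (\<Gamma> t) ~= 0 --> \<Gamma> t \<in> KR)"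

text \<open>For a generator scale \<open>u\<close> in \<open>B(u,v)\<close>; products are clear, and inverses are replaced by multiples of the adjugate.\<close>

lemma KR_poly_path: assumes "A \<in> KR" shows "\<exists>\<Gamma>. poly_path A \<Gamma>" proof -
 let ?H = "{A \<in> KR. \<exists>\<Gamma>. poly_path A \<Gamma>}"
 have "matrix_group ?H" unfolding matrix_group_def proof (intro conjI ballI)
  have "poly_path (mat 1) (%_. mat 1)" by (auto simp: poly_path_def intro: polycurve_const KR_one)
  thus "mat 1 \<in> ?H" using KR_one by blast
  fix A assume A: "A \<in> ?H"
  then obtain \<Gamma> where g: "poly_path A \<Gamma>" by blast
  show iA: "invertible A" using A KR_invertible by blast
  hence dA: "det A ~= 0" by (simp add: invertible_det_nz)
  \<comment> \<open>the adjugate, rescaled so that the end point is the inverse\<close>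
  define s where "s t = (1 + t * (1 / (det A * det A) - 1)) * det (\<Gamma> t)" for t
  define \<Gamma>' where "\<Gamma>' t = (\<chi> i j. s t * adjugate (\<Gamma> t) $ i $ j)" for t
  have pc: "polycurve (%t. \<Gamma> t $ i $ j)" and g01: "\<Gamma> 0 = mat 1" "\<Gamma> 1 = A" for i j
   using g by (simp_all add: poly_path_def)
  have "\<Gamma>' t *v x = s t *s (adjugate (\<Gamma> t) *v x)" for t x
   by (simp add: \<Gamma>'_def vec_eq_iff matrix_vector_mult_def sum_distrib_left mult.assoc)
  hence app: "\<Gamma>' t *v x = (s t * det (\<Gamma> t)) *s (matrix_inv (\<Gamma> t) *v x)" if "det (\<Gamma> t) ~= 0" for t x
   using adjugate_inverse[OF that] by (simp add: vec.scale_scale)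
  have "poly_path (matrix_inv A) \<Gamma>'" unfolding poly_path_def proof (intro conjI allI impI)
   show "polycurve (%t. \<Gamma>' t $ i $ j)" for i j unfolding \<Gamma>'_def s_def vec_lambda_beta
    by (intro polycurve_mult polycurve_add polycurve_const polycurve_id polycurve_det polycurve_adjugate pc)
   show "\<Gamma>' 0 = mat 1"
    by (rule matrix_eqI) (use app[of 0] in \<open>simp add: g01 s_def matrix_inv_unique[of "mat 1" "mat 1"]\<close>)
   show "\<Gamma>' 1 = matrix_inv A" by (rule matrix_eqI) (use app[of 1] dA in "simp add: g01 s_def")
   fix t assume t: "det (\<Gamma>' t) ~= 0"
   have nz: "s t * det (\<Gamma> t) ~= 0" proof
    assume "s t * det (\<Gamma> t) = 0"
    hence "s t = 0" by (auto simp: s_def)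
    hence "\<Gamma>' t = 0" by (simp add: \<Gamma>'_def vec_eq_iff)
    hence "row i (\<Gamma>' t) = 0" for i by (simp add: row_def vec_eq_iff)
    thus False using t det_zero_row(1) by blast
   qed
   hence G: "\<Gamma> t \<in> KR" using g by (auto simp: poly_path_def)
   have "\<Gamma>' t = matrix (%z. (s t * det (\<Gamma> t)) *s z) ** matrix_inv (\<Gamma> t)" by (rule matrix_eqI)
      (use app nz in "simp add: mv_mult matrix_works clin_cmul[OF clin_id]")
   thus "\<Gamma>' t \<in> KR" using scalar_KR[OF nz] KR_inv[OF G] KR_mult by simp
  qed
  thus "matrix_inv A \<in> ?H" using A KR_inv by blast
  fix B assume B: "B \<in> ?H"
  then obtain \<Delta> where d: "poly_path B \<Delta>" by blast
  have "poly_path (A ** B) (%t. \<Gamma> t ** \<Delta> t)" unfolding poly_path_def proof (intro conjI allI impI)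
   show "polycurve (%t. (\<Gamma> t ** \<Delta> t) $ i $ j)" for i j unfolding matrix_matrix_mult_def vec_lambda_beta
    by (intro polycurve_sum polycurve_mult) (use g d in "simp_all add: poly_path_def")
  qed (use g d in "auto simp: poly_path_def det_mul intro!: KR_mult")
  thus "A ** B \<in> ?H" using A B KR_mult by blast
 qed
 moreover have "mB u v \<in> ?H" if B: "invertible (mB u v)" for u v proof -
  have "poly_path (mB u v) (%t. mB (t *s u) v)" unfolding poly_path_def proof (intro conjI allI impI)
   fix i j
   have e: "bergman_op T (t *s u) v z = z - t *s T u v z + (t * t) *s quad_op T u (quad_op T v z)" for t z
    by (simp add: bergman_op_def quad_op_def T_scale vec_eq_iff)
   have "polycurve (%t. (axis j 1 :: complex^'n) $ i + t * (- (T u v (axis j 1) $ i)) + (t * t) * quad_op T u (quad_op T v (axis j 1)) $ i)"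
    by (intro polycurve_add polycurve_mult polycurve_const polycurve_id)
   thus "polycurve (%t. mB (t *s u) v $ i $ j)" by (simp add: matrix_def e)
  next
   show "mB (0 *s u) v = mat 1" by (rule matrix_eqI) (simp add: matrix_works[OF bergman_clin] bergman_op_def quad_op_def)
  qed (auto intro: KR_gen simp: invertible_det_nz)
  thus ?thesis using KR_gen[OF B] by blast
 qed
 ultimately have "KR \<subseteq> ?H" by (rule KR_induct)
 thus ?thesis using assms by blast
qed

section \<open>Transposition\<close>

text \<open>\<open>ip x (st y)\<close> is a nondegenerate complex bilinear form, and \<open>g\<close> is the transpose of \<open>f\<close> for it.\<close>

lemma Det_transpose:
 assumes f: "clin f" and g: "clin g" and adj: "!!x y. ip (f x) (st y) = ip x (st (g y))" shows "Det f = Det g" proof -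
 let ?J = "(\<chi> i j. ip (axis i 1) (st (axis j 1))) :: complex^'n^'n"
 have b: "ip x (st y) = (\<Sum>i\<in>UNIV. x $ i * ip (axis i 1) (st y))" "ip x (st y) = (\<Sum>j\<in>UNIV. y $ j * ip x (st (axis j 1)))" for x y
 proof -
  show "ip x (st y) = (\<Sum>i\<in>UNIV. x $ i * ip (axis i 1) (st y))"
   using ip_sum(1)[of "%i. x $ i *s axis i 1" UNIV "st y"] by (simp add: basis_expansion ip_scale)
  have "st y = (\<Sum>j\<in>UNIV. cnj (y $ j) *s st (axis j 1))"
   using star_sum[of un "%j. y $ j *s axis j 1" UNIV] by (simp add: basis_expansion star_scale)
  thus "ip x (st y) = (\<Sum>j\<in>UNIV. y $ j * ip x (st (axis j 1)))" by (simp add: ip_sum ip_scale)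
 qed
 have "transpose (matrix f) ** ?J = ?J ** matrix g" proof -
  have "(transpose (matrix f) ** ?J) $ i $ j = ip (f (axis i 1)) (st (axis j 1))" for i j
   by (subst b(1)) (simp add: matrix_matrix_mult_def transpose_def matrix_def)
  moreover have "(?J ** matrix g) $ i $ j = ip (axis i 1) (st (g (axis j 1)))" for i j
   by (subst b(2)) (simp add: matrix_matrix_mult_def matrix_def mult.commute)
  ultimately show ?thesis by (simp add: vec_eq_iff adj)
 qed
 hence "det (transpose (matrix f)) * det ?J = det ?J * Det g" by (metis det_mul)
 moreover have "det ?J ~= 0" proof -
  have "y = 0" if y: "?J *v y = 0" for y proof -
   have "ip (axis i 1) (st y) = (?J *v y) $ i" for i by (subst b(2)) (simp add: matrix_vector_mult_def mult.commute)
   hence "ip x (st y) = 0" for x by (subst b(1)) (simp add: y)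
   hence "ip (st y) (st y) = 0" .
   hence "st y = 0" by (simp add: ip_self_zero)
   thus "y = 0" by (metis st_st star_zero)
  qed
  hence "bij ((*v) ?J)" using clin_bij_iff_inj[OF clin_matrix] by blast
  thus ?thesis by (simp add: invertible_eq_bij[symmetric] invertible_det_nz)
 qed
 ultimately show ?thesis by (simp add: det_transpose)
qed

lemma ip_pproj: "ip (pproj u k x) y = ip x (pproj u k y)" by (simp add: pproj_def ip_simps ip_adjoint)

section \<open>Block decomposition of normalised group elements\<close>

lemma c0_cpl: "z \<in> pspace c k ==> k <= 2 ==> z \<in> pspace c0 (2 - k)" proof -
 assume z: "z \<in> pspace c k" and k: "k <= 2"
 have "T c0 c0 z = (\<Sum>i\<in>{l+1..r}. L i z)" by (rule T_esum) auto
 moreover have "(\<Sum>i\<in>{1..r}. L i z) = (\<Sum>i\<in>{1..l}. L i z) + (\<Sum>i\<in>{l+1..r}. L i z)" proof -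
  have "{1..r} = {1..l} \<union> {l+1..r}" using l_less by auto
  thus ?thesis by (simp add: sum.union_disjoint[symmetric])
 qed
 ultimately have "T c0 c0 z = 2 *s z - T c c z" using T_cc[OF l_le, of z] sum_L[of z] by (simp add: algebra_simps)
 also have "... = of_nat (2 - k) *s z" using pspaceD[OF z] k by (simp add: vec_eq_iff of_nat_diff algebra_simps)
 finally show ?thesis by (simp add: pspace_def)
qed

lemma c0_tripotent: "tripotent T c0" by (rule esum_tripotent) auto

abbreviation Rs :: "complex => complex^'n => complex^'n" where "Rs \<equiv> rho c0"

lemma Rs_p: "z \<in> pspace c k ==> k <= 2 ==> Rs s z = s ^ (2 - k) *s z" using rho_pspace[OF c0_cpl] by simp
lemma Rs_c: "Rs s c = c" using Rs_p[OF c_pspace] by simp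
lemma Rs_KR: "s ~= 0 ==> matrix (Rs s) \<in> KR" by (rule rho_KR[OF c0_tripotent])

text \<open>Contracting with \<open>rho c0 s\<close> as \<open>s\<close> tends to \<open>0\<close> shows that the unipotent \<open>B(v,c)\<close> has trivial characters.\<close>

lemma frobenius_unimodular:
 assumes v: "v \<in> pspace c 1" shows "det (mB v c) = 1" "chi (mB v c) = 1" proof -
 have sv: "s *s v \<in> pspace c 1" for s using v by (rule pspace_scale)
 have conj: "bergman_op T (s *s v) c (Rs s z) = Rs s (bergman_op T v c z)" if "s ~= 0" for s z
  using str_pair_bergman_conj[OF rho_str_pair[OF c0_tripotent] rho_bij[OF c0_tripotent that], of v c z]
   Rs_p[OF v, of s] by (simp add: Rs_c)
 have mconj: "mB (s *s v) c ** matrix (Rs s) = matrix (Rs s) ** mB v c" if "s ~= 0" for s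
  by (rule matrix_eqI) (simp add: mv_mult matrix_works[OF bergman_clin] matrix_works[OF rho_clin] conj[OF that])
 have e: "bergman_op T (s *s v) c z = z - s *s T v c z + (s * s) *s quad_op T v (quad_op T c z)" for s z
  by (simp add: bergman_op_def quad_op_def T_scale vec_eq_iff)
 have pc: "polycurve (%s. bergman_op T (s *s v) c z $ i)" for z i proof -
  have "polycurve (%s. z $ i + s * (- (T v c z $ i)) + (s * s) * quad_op T v (quad_op T c z) $ i)"
   by (intro polycurve_add polycurve_mult polycurve_const polycurve_id)
  thus ?thesis by (simp add: e)
 qed
 have b0: "bergman_op T (0 *s v) c = (%z. z)" by (rule ext) (simp only: e, simp)
 have S: "mB (s *s v) c \<in> Str" "matrix (Rs s) \<in> Str" if "s ~= 0" for s using frobenius_KR[OF sv] Rs_KR[OF that] KR_Str by auto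
 have d: "det (mB (s *s v) c) = det (mB v c)" if "s ~= 0" for s proof -
  have "det (mB (s *s v) c) * det (matrix (Rs s)) = det (matrix (Rs s)) * det (mB v c)" using mconj[OF that] by (metis det_mul)
  moreover have "det (matrix (Rs s)) ~= 0" using S[OF that] by (simp add: Str_def invertible_det_nz)
  ultimately show ?thesis by simp
 qed
 have "polycurve (%s. det (mB (s *s v) c))" by (rule polycurve_det) (simp add: matrix_def pc)
 hence "det (mB (0 *s v) c) = det (mB v c)" by (rule polycurve_at_0[OF _ d])
 thus "det (mB v c) = 1" unfolding b0 by (simp add: Det_id)
 have "chi (mB (s *s v) c) = chi (mB v c)" if "s ~= 0" for s proof -
  have "chi (mB (s *s v) c) * chi (matrix (Rs s)) = chi (matrix (Rs s)) * chi (mB v c)"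
   using mconj[OF that] chi_mult S[OF that] frobenius_KR[OF v] KR_Str by (metis subsetD)
  thus ?thesis using chi_nonzero[OF S(2)[OF that]] by simp
 qed
 moreover have ch: "chi (mB (s *s v) c) = Nm (bergman_op T (s *s v) c un)" for s by (simp add: chi_def matrix_works[OF bergman_clin])
 ultimately have d': "Nm (bergman_op T (s *s v) c un) = chi (mB v c)" if "s ~= 0" for s using that by simp
 have "polycurve (%s. Nm (bergman_op T (s *s v) c un))" by (rule polycurve_polyfun[OF polyfun_Nm pc])
 hence "Nm (bergman_op T (0 *s v) c un) = chi (mB v c)" by (rule polycurve_at_0[OF _ d'])
 thus "chi (mB v c) = 1" unfolding b0 by (simp add: Nm_un)
qed

text \<open>Elements of the structure group that move \<open>c\<close> inside \<open>Z\<^sub>2(c)\<close>.\<close>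

definition normalised :: "complex^'n^'n => bool" where
 "normalised G \<longleftrightarrow> G \<in> Str & G *v c \<in> pspace c 2 & G *v c \<in> W0"

lemma normalised_VV: assumes G: "normalised G" and v: "v \<in> VV" shows "G *v v \<in> VV" proof -
 have "(*v) G ` VV = VV" using tangent_space_orbit[of G] tangent_space_u(2)[of "G *v c"] G by (simp add: normalised_def)
 thus ?thesis using v by blast
qed

lemma quad_p0: "y \<in> pspace c 0 ==> p0 (quad_op T x y) = quad_op T (p0 x) y" proof -
 assume y: "y \<in> pspace c 0"
 note t = c_tripotent
 have z2: "T (p2 x) y w = 0" "T w y (p2 x) = 0" for w using T_pspace_20[OF t p_mem(1) y] T_commute[of w y "p2 x"] by simp_all
 have m: "T (p1 x) y (p1 x) \<in> pspace c 2" "T (p1 x) y (p0 x) \<in> pspace c 1" "T (p0 x) y (p1 x) \<in> pspace c 1"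
   "T (p0 x) y (p0 x) \<in> pspace c 0"
  by (rule T_pspace[OF p_mem(2) y p_mem(2)] T_pspace[OF p_mem(2) y p_mem(3)] T_pspace[OF p_mem(3) y p_mem(2)]
    T_pspace[OF p_mem(3) y p_mem(3)]; simp)+
 have "T x y x = T (p2 x + p1 x + p0 x) y (p2 x + p1 x + p0 x)" by (simp only: p_sum[of x, symmetric])
 also have "... = T (p1 x) y (p1 x) + T (p1 x) y (p0 x) + T (p0 x) y (p1 x) + T (p0 x) y (p0 x)" by (simp add: T_add z2)
 finally have "p0 (T x y x) = T (p0 x) y (p0 x)" using m by (simp add: p_add p_on)
 thus ?thesis by (simp add: quad_op_def p_scale)
qed

lemma quad_0: "x \<in> pspace c 0 ==> quad_op T x y = quad_op T x (p0 y)" proof -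
 assume x: "x \<in> pspace c 0"
 note t = c_tripotent
 have "T x (p2 y) x = 0" by (rule T_pspace_02[OF t p_mem(1) x])
 moreover have "T x (p1 y) x = 0" by (rule T_pspace_zero[OF t x p_mem(2) x]) simp
 moreover have "T x y x = T x (p2 y) x + T x (p1 y) x + T x (p0 y) x" by (subst p_sum[of y]) (simp add: T_add)
 ultimately show ?thesis by (simp add: quad_op_def)
qed

abbreviation hb :: "complex^'n^'n => complex^'n => complex^'n" where "hb G \<equiv> block0 l ((*v) G)"

lemma p_idem: "p0 (p0 z) = p0 z" using p_on(9)[OF p_mem(3)] .

text \<open>The compression \<open>h\<close> of \<open>G\<close> to \<open>Z\<^sub>0(c)\<close> satisfies \<open>P(w) = h h'\<close> on \<open>Z\<^sub>0(c)\<close> for the image \<open>w\<close>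
  of the unit \<open>c0\<close>, where \<open>h'\<close> is the transpose of \<open>h\<close>; so the square of its determinant is the determinant of \<open>P(w)\<close>.\<close>

lemma Det_hb_square:
 assumes G: "G \<in> Str" shows "(Det (hb G))\<^sup>2 = Nm (c + p0 (G *v c0)) ^ (2 + a * (r - Suc l))" proof -
 obtain g' where g: "str_pair ((*v) G) g'" "bij ((*v) G)" by (rule StrE[OF G])
 let ?t = "%x. st (g' (st x))" and ?w = "p0 (G *v c0)"
 have ct: "clin ?t" using str_pairD(2)[OF g(1)] by (intro clinI) (simp_all add: clin_add clin_scale star_simps)
 have stp: "st (p0 x) = p0 (st x)" for x by (rule st_pproj_cc[OF l_le])
 have st0: "quad_op T c0 y = st y" if "y \<in> pspace c 0" for y proof -
  have "Px (c + c0) (st y) = Px c0 (st y)" by (rule Px_block(3)[OF c_pspace c0_pspace st_pspace[OF that]])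
  thus ?thesis using Px_un[of "st y"] by (simp add: un_split[symmetric]) (simp add: Px_def)
 qed
 have "Px ?w (p0 z) = p0 (G *v p0 (?t (p0 z)))" for z proof -
  have sz: "st (p0 z) \<in> pspace c 0" by (rule st_pspace[OF p_mem(3)])
  have "Px ?w (p0 z) = p0 (quad_op T (G *v c0) (st (p0 z)))" unfolding Px_def quad_p0[OF sz] ..
  also have "quad_op T (G *v c0) (st (p0 z)) = G *v quad_op T c0 (g' (st (p0 z)))" by (rule str_pair_quad[OF g(1)])
  also have "quad_op T c0 (g' (st (p0 z))) = st (p0 (g' (st (p0 z))))"
   unfolding quad_0[OF c0_pspace, of "g' (st (p0 z))"] by (rule st0[OF p_mem(3)])
  finally show ?thesis by (simp add: stp)
 qed
 hence "block0 l (Px ?w) = (%z. hb G (block0 l ?t z))" by (intro ext) (simp add: block0_def p_add p_diff p_idem)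
 hence "Nm (c + ?w) ^ (2 + a * (r - Suc l)) = Det (hb G) * Det (block0 l ?t)"
  using Det_comp[OF block0_clin[OF clin_matrix] block0_clin[OF ct]] Det_block0_Px[OF p_mem(3)] by metis
 also have "Det (hb G) = Det (block0 l ?t)" proof (rule Det_transpose[OF block0_clin[OF clin_matrix] block0_clin[OF ct]])
  show "ip (hb G x) (st y) = ip x (st (block0 l ?t y))" for x y
   by (simp add: block0_def ip_add ip_diff star_simps ip_pproj str_pair_adjoint[OF g] stp)
 qed
 finally show ?thesis using `Det (hb G) = Det (block0 l ?t)` by (simp add: power2_eq_square)
qed

text \<open>Conjugation with \<open>rho c0 s\<close> makes \<open>G\<close> block diagonal in the limit.\<close>

lemma chi_normalised:
 assumes G: "normalised G" shows "chi G = Nm (G *v c + c0) * Nm (c + p0 (G *v c0))" proof -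
 have GS: "G \<in> Str" and u: "G *v c \<in> pspace c 2" using G by (auto simp: normalised_def)
 define y where "y = G *v c0"
 define \<gamma> where "\<gamma> s = G *v c + (s * s) *s p2 y + s *s p1 y + p0 y" for s
 have const: "Nm (\<gamma> s) = chi G" if s: "s ~= 0" for s proof -
  let ?R = "matrix (Rs s)" and ?R' = "matrix (Rs (1/s))"
  have RS: "?R \<in> Str" "?R' \<in> Str" using Rs_KR[of s] Rs_KR[of "1/s"] s KR_Str by auto
  have "?R' ** ?R = mat 1" by (rule matrix_eqI) (simp add: mv_mult matrix_works[OF rho_clin] rho_inverse[OF c0_tripotent s])
  hence "chi ?R' * chi ?R = 1" using chi_mult[OF RS(2,1)] chi_one by simp
  hence "chi (?R' ** (G ** ?R)) = chi G" using chi_mult[OF RS(2) matrix_group_mult[OF Str_group GS RS(1)]] chi_mult[OF GS RS(1)] by simp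
  moreover have "(?R' ** (G ** ?R)) *v un = \<gamma> s" proof -
   have "(?R' ** (G ** ?R)) *v un = Rs (1/s) (G *v (c + (s * s) *s c0))"
    using Rs_p[OF c0_pspace, of s] by (simp add: mv_mult matrix_works[OF rho_clin] un_split clin_add[OF rho_clin] Rs_c power2_eq_square)
   also have "... = G *v c + (s * s) *s Rs (1/s) (p2 y + p1 y + p0 y)" using Rs_p[OF u, of "1/s"] unfolding p_sum[of y, symmetric]
    by (simp add: clin_add[OF clin_matrix] clin_scale[OF clin_matrix] clin_add[OF rho_clin] clin_scale[OF rho_clin] y_def)
   also have "... = \<gamma> s" using Rs_p[OF p_mem(1), of "1/s" y] Rs_p[OF p_mem(2), of "1/s" y] Rs_p[OF p_mem(3), of "1/s" y] s
    by (simp add: \<gamma>_def clin_add[OF rho_clin] vec_eq_iff power2_eq_square field_simps)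
   finally show ?thesis .
  qed
  ultimately show ?thesis by (simp add: chi_def)
 qed
 have "polycurve (%s. Nm (\<gamma> s))" unfolding \<gamma>_def by (rule polycurve_polyfun[OF polyfun_Nm])
    (auto intro!: polycurve_add polycurve_mult polycurve_const polycurve_id)
 hence "Nm (\<gamma> 0) = chi G" by (rule polycurve_at_0[OF _ const])
 hence "chi G = Nm (G *v c + p0 y)" by (simp add: \<gamma>_def)
 also have "... = Nm (G *v c + c0) * Nm (c + p0 y)"
  using Nm_split[of "G *v c + p0 y"] p_on[of "G *v c"] u p_idem[of y] p_mem[of y] by (simp add: p_add p_on)
 finally show ?thesis by (simp add: y_def)
qed

text \<open>\<open>G\<close> on the tangent space \<open>VV\<close>, extended by the identity of \<open>Z\<^sub>0(c)\<close>.\<close>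

definition F1 :: "complex^'n^'n => complex^'n => complex^'n" where
 "F1 G z = G *v (z - p0 z) + p0 z"

lemma F1_clin: "clin (F1 G)" unfolding F1_def by (intro clin_plus clin_comp[OF clin_matrix] clin_sub clin_id pproj_clin)

text \<open>\<open>G\<close> preserves \<open>VV\<close>, so it is block triangular; the unipotent factor \<open>U 1\<close> has determinant \<open>1\<close> because it is conjugate to
  all \<open>U s\<close> with \<open>s \<noteq> 0\<close>.\<close>

lemma det_normalised:
 assumes G: "normalised G" shows "det G = Det (F1 G) * Det (hb G)" proof -
 define U where "U s z = z + s *s (G *v p0 z - p0 (G *v p0 z))" for s z
 have GS: "G \<in> Str" using G by (auto simp: normalised_def)
 have cU: "clin (U s)" for s
  unfolding U_def by (rule clinI) (simp_all add: p_add p_scale clin_add[OF clin_matrix] clin_scale[OF clin_matrix] vec_eq_iff algebra_simps)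
 have "G *v z = hb G (U 1 (F1 G z))" for z proof -
  have "G *v (z - p0 z) \<in> VV" by (rule normalised_VV[OF G]) (simp add: VV_def p_diff p_idem)
  hence p: "p0 (F1 G z) = p0 z" by (simp add: F1_def p_add p_idem VV_def)
  have pu: "p0 (U 1 y) = p0 y" for y by (simp add: U_def p_add p_scale p_diff p_idem)
  have "hb G (U 1 (F1 G z)) = p0 (G *v p0 z) + (F1 G z + (G *v p0 z - p0 (G *v p0 z)) - p0 z)"
   unfolding block0_def pu p by (simp add: U_def p)
  also have "... = G *v z" by (simp add: F1_def clin_diff[OF clin_matrix])
  finally show ?thesis by simp
 qed
 hence "(*v) G = (%z. hb G (U 1 (F1 G z)))" by auto
 hence "det G = Det (hb G) * (Det (U 1) * Det (F1 G))"
  using Det_comp[OF block0_clin[OF clin_matrix] clin_comp[OF cU F1_clin]] Det_comp[OF cU F1_clin] by (metis matrix_of_matrix_vector_mul)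
 moreover have "Det (U 1) = 1" proof -
  have const: "Det (U s) = Det (U 1)" if s: "s ~= 0" for s proof -
   define E where "E z = s *s (z - p0 z) + p0 z" for z
   have cE: "clin E" unfolding E_def by (rule clinI) (simp_all add: p_add p_scale vec_eq_iff algebra_simps)
   have pE: "p0 (E z) = p0 z" for z by (simp add: E_def p_add p_scale p_diff p_idem)
   have "E (U 1 z) = U s (E z)" for z unfolding U_def pE by (simp add: E_def p_add p_diff p_scale p_idem vec_eq_iff algebra_simps)
   hence "(%z. E (U 1 z)) = (%z. U s (E z))" by blast
   hence "Det E * Det (U 1) = Det (U s) * Det E" using Det_comp[OF cE cU[of 1]] Det_comp[OF cU[of s] cE] by metis
   moreover have "Det E ~= 0" proof -
    have "z = 0" if z: "E z = 0" for z proof -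
     have "p0 z = 0" using pE[of z] z by (simp add: clin_zero[OF pproj_clin])
     thus ?thesis using z s by (simp add: E_def)
    qed
    thus ?thesis using Det_nz_iff[OF cE] clin_bij_iff_inj[OF cE] by blast
   qed
   ultimately show ?thesis by simp
  qed
  have "polycurve (%s. Det (U s))" by (rule polycurve_det)
     (unfold matrix_def U_def vec_lambda_beta vector_add_component vector_smult_component,
     intro polycurve_add polycurve_mult polycurve_const polycurve_id)
  hence "Det (U 0) = Det (U 1)" by (rule polycurve_at_0[OF _ const])
  moreover have "U 0 = (%z. z)" by (auto simp: U_def)
  ultimately show ?thesis by (simp add: Det_id)
 qed
 ultimately show ?thesis by simp
qed

definition nrm :: "complex^'n^'n => complex^'n^'n" where
 "nrm A = mB (vp (A *v c)) c ** A"

lemma nrm_app: "nrm A *v z = bergman_op T (vp (A *v c)) c (A *v z)" by (simp add: nrm_def mv_mult matrix_works[OF bergman_clin])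
lemma frobenius_M: "z \<in> W0 ==> z \<in> M ==> bergman_op T (vp z) c z = p2 z" using frobenius_normal_form[of z] M_W0_iff[of z] by simp

lemma nrm_props:
 assumes A: "A \<in> KR" and W: "A *v c \<in> W0"
 shows "nrm A \<in> KR" "nrm A *v c = p2 (A *v c)" "normalised (nrm A)" "det (nrm A) = det A" "chi (nrm A) = chi A" proof -
 note v = vp_pspace[OF W]
 have AS: "A \<in> Str" using A KR_Str by blast
 show K: "nrm A \<in> KR" unfolding nrm_def by (rule KR_mult[OF frobenius_KR[OF v] A])
 have "A *v c \<in> M" using M_Str[OF AS] cc_M by simp
 thus c2: "nrm A *v c = p2 (A *v c)" using frobenius_M[OF W] by (simp add: nrm_app)
 have "p2 (A *v c) \<in> W0" using W0_cong[of "p2 (A *v c)" "A *v c"] p_on(1)[OF p_mem(1)] W by simp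
 thus "normalised (nrm A)" using K KR_Str p_mem(1) by (auto simp: normalised_def c2)
 show "det (nrm A) = det A" using frobenius_unimodular(1)[OF v] by (simp add: nrm_def det_mul)
 have "mB (vp (A *v c)) c \<in> Str" using frobenius_KR[OF v] KR_Str by blast
 thus "chi (nrm A) = chi A" unfolding nrm_def using chi_mult[OF _ AS] frobenius_unimodular(2)[OF v] by simp
qed

lemma continuous_on_Det:
 fixes f :: "complex => complex^'n => complex^'n"
 assumes "!!z. continuous_on S (%t. f t z)" shows "continuous_on S (%t. Det (f t))" unfolding det_def matrix_def vec_lambda_beta
 by (intro continuous_on_sum continuous_on_mult continuous_on_const continuous_on_prod continuous_on_component assms)

lemma vp_continuous: "continuous_on W0 vp" proof -
 have "continuous_on W0 (%z. \<chi> k. vp z $ k)"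
  by (intro continuous_on_vec_lambda continuous_at_imp_continuous_on ballI cdiff_continuous cdiff_vp)
 thus ?thesis by simp
qed

lemma nrm_one: "nrm (mat 1) = mat 1" proof -
 have "vp c = 0" by (rule vp_unique[OF c_W0]) (simp add: p_on c_pspace clin_zero[OF Px_clin])
 thus ?thesis by (intro matrix_eqI) (simp add: nrm_app bergman_op_def quad_op_def)
qed

text \<open>The square root of \<open>Det_hb_square\<close>: along a polynomial path to \<open>1\<close> the sign cannot change.\<close>

lemma Det_hb_KR:
 assumes q: "2 + a * (r - Suc l) = 2 * q" and A: "A \<in> KR" and W: "A *v c \<in> W0"
 shows "Det (hb (nrm A)) = Nm (c + p0 (nrm A *v c0)) ^ q" proof -
 obtain \<Gamma> where path: "poly_path A \<Gamma>" using KR_poly_path[OF A] by blast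
 have pc: "polycurve (%t. \<Gamma> t $ i $ j)" and g01: "\<Gamma> 0 = mat 1" "\<Gamma> 1 = A" for i j
  using path by (simp_all add: poly_path_def)
 define D where "D t = det (\<Gamma> t) * Det (Px (p2 (\<Gamma> t *v c) + c0))" for t
 have pD: "polycurve D" unfolding D_def
  by (intro polycurve_mult polycurve_det pc polycurve_polyfun[OF polyfun_W0] polycurve_mv polycurve_const)
 have D0: "D 0 ~= 0" using c_W0 by (simp add: D_def g01 W0_def)
 have "invertible A" by (rule KR_invertible[OF A])
 hence D1: "D 1 ~= 0" using W by (simp add: D_def g01 W0_def invertible_det_nz)
 let ?F = "{t. D t = 0}"
 have good: "\<Gamma> t \<in> KR" "\<Gamma> t *v c \<in> W0" if "t \<notin> ?F" for t
  using that path by (auto simp: D_def poly_path_def W0_def)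
 have cG: "continuous_on S (%t. \<Gamma> t *v z)" for S z unfolding matrix_vector_mult_def
  by (intro continuous_on_vec_lambda continuous_on_sum continuous_on_mult continuous_on_const polycurve_continuous pc)
 have cv: "continuous_on (- ?F) (%t. vp (\<Gamma> t *v c))" by (rule continuous_on_compose2[OF vp_continuous cG]) (use good in auto)
 have cn: "continuous_on (- ?F) (%t. nrm (\<Gamma> t) *v z)" for z
  unfolding nrm_app bergman_op_def quad_op_def by (intro continuous_intros cv cG)
 have cp: "continuous_on S (%t. p0 (h t))" if "continuous_on S h" for S and h :: "complex => complex^'n"
  by (rule continuous_on_compose2[OF clin_continuous[OF pproj_clin] that]) auto
 define N where "N t = Nm (c + p0 (nrm (\<Gamma> t) *v c0))" for t
 have cN: "continuous_on (- ?F) N" unfolding N_def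
  by (rule continuous_on_compose2[OF polyfun_continuous[OF polyfun_Nm, of UNIV]]) (auto intro!: continuous_intros cp cn)
 have cD: "continuous_on (- ?F) (%t. Det (hb (nrm (\<Gamma> t))))" unfolding block0_def by (intro continuous_on_Det continuous_intros cp cn)
 have N0: "N t ~= 0" if "t \<notin> ?F" for t proof -
  note n = nrm_props[OF good[OF that]]
  have "chi (nrm (\<Gamma> t)) ~= 0" using chi_nonzero n(1) KR_Str by blast
  thus ?thesis using chi_normalised[OF n(3)] by (simp add: N_def)
 qed
 have "Det (hb (nrm (\<Gamma> 1))) / N 1 ^ q = Det (hb (nrm (\<Gamma> 0))) / N 0 ^ q"
 proof (rule cofinite_constant[OF polycurve_zeros_finite[OF pD D0],
    where f = "%t. Det (hb (nrm (\<Gamma> t))) / N t ^ q" and V = "{1, -1}"])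
  show "continuous_on (- ?F) (%t. Det (hb (nrm (\<Gamma> t))) / N t ^ q)"
   by (intro continuous_on_divide continuous_on_power cN cD) (use N0 in auto)
  show "Det (hb (nrm (\<Gamma> t))) / N t ^ q \<in> {1, -1}" if "t \<notin> ?F" for t proof -
   have "nrm (\<Gamma> t) \<in> Str" using nrm_props(1)[OF good[OF that]] KR_Str by blast
   from Det_hb_square[OF this] have "(Det (hb (nrm (\<Gamma> t))))\<^sup>2 = (N t ^ q)\<^sup>2"
    unfolding q N_def by (simp add: power_mult[symmetric] mult.commute)
   hence "(Det (hb (nrm (\<Gamma> t))) / N t ^ q)\<^sup>2 = 1" using N0[OF that] by (simp add: power_divide)
   thus ?thesis by (simp add: power2_eq_1_iff)
  qed
 qed (use D0 D1 in auto)
 moreover have "hb (mat 1) = (%z. z)" by (rule ext) (simp add: block0_def p_idem)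
 moreover have "N 0 = 1" using p_on(9)[OF c0_pspace] Nm_un by (simp add: N_def g01 nrm_one un_split)
 ultimately have "Det (hb (nrm A)) / N 1 ^ q = 1" by (simp add: g01 nrm_one Det_id)
 thus ?thesis using N0[of 1] D1 by (simp add: N_def g01 field_simps)
qed

section \<open>The volume form at the base point\<close>

text \<open>A basis of the whole space that extends one of \<open>VV\<close>; \<open>ty\<close> marks the members in \<open>VV\<close> and \<open>pos\<close> enumerates them.\<close>

definition VV_basis :: "('n => bool) => ('n => nat) => ('n => complex^'n) => bool" where
 "VV_basis ty pos b \<longleftrightarrow> (ALL x. if ty x then b x \<in> VV else p0 (b x) = b x) &
   invertible (\<chi> i j. b j $ i) & bij_betw pos {x. ty x} {..<dd}"

lemma range_VV: "range (%z. z - p0 z) = VV" by (auto simp: VV_def p_diff p_idem image_iff) (metis diff_zero)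

lemma VV_basis_exists: "EX ty pos b. VV_basis ty pos b" proof -
 let ?P = "%k z. if k then z - p0 z else p0 z"
 have res: "resolution (UNIV :: bool set) ?P" unfolding resolution_def
  by (auto simp: UNIV_bool p_diff p_idem intro!: clin_sub clin_id pproj_clin)
 obtain ty :: "'n => bool" and b :: "'n => complex^'n" where
  b: "ALL x. ty x \<in> UNIV" "ALL x. ?P (ty x) (b x) = b x" "invertible (\<chi> i j. b j $ i)"
  "\<forall>k\<in>UNIV. card {x. ty x = k} = vec.dim (range (?P k))" by (rule adapted_basis[OF res], rule that)
 have "card {x. ty x} = dd" using range_VV b(4)[rule_format, of True] by (simp add: dd_def)
 then obtain pos where "bij_betw pos {x. ty x} {..<dd}" using ex_bij_betw_finite_nat[of "{x. ty x}"] by (auto simp: lessThan_atLeast0)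
 moreover have "if ty x then b x \<in> VV else p0 (b x) = b x" for x proof -
  have "(if ty x then b x - p0 (b x) else p0 (b x)) = b x" using b(2) by blast
  hence "ty x ==> p0 (b x) = 0" "\<not> ty x ==> p0 (b x) = b x" by (auto split: if_splits)
  thus ?thesis by (simp add: VV_def)
 qed
 ultimately show ?thesis using b(3) unfolding VV_basis_def by blast
qed

definition bty :: "'n => bool" where "bty = (SOME ty. EX pos b. VV_basis ty pos b)"
definition bpos :: "'n => nat" where "bpos = (SOME pos. EX b. VV_basis bty pos b)"
definition bas :: "'n => complex^'n" where "bas = (SOME b. VV_basis bty bpos b)"

lemma bas: "VV_basis bty bpos bas" proof -
 have "EX pos b. VV_basis bty pos b" unfolding bty_def using VV_basis_exists by (rule someI_ex)
 hence "EX b. VV_basis bty bpos b" unfolding bpos_def by (rule someI_ex)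
 thus ?thesis unfolding bas_def by (rule someI_ex)
qed

lemma bpos_less: "bty x ==> bpos x < dd" using bas by (auto simp: VV_basis_def bij_betw_def)

text \<open>The determinant of the vectors, completed by the basis vectors outside \<open>VV\<close>.\<close>

definition vol :: "(complex^'n) list => complex" where
 "vol vs = det (\<chi> i. if bty i then vs ! bpos i else bas i)"

lemma det_rows_map:
 fixes R :: "complex^'n^'n" shows "det (\<chi> i. A *v (R $ i)) = det A * det R" proof -
 have "(\<chi> i. A *v (R $ i)) = R ** transpose A"
  by (simp add: vec_eq_iff matrix_matrix_mult_def matrix_vector_mult_def transpose_def mult.commute)
 thus ?thesis by (simp add: det_mul det_transpose)
qed

lemma vol_normalised:
 assumes vs: "length vs = dd" "set vs \<subseteq> VV" shows "vol (map ((*v) G) vs) = Det (F1 G) * vol vs" proof -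
 let ?R = "(\<chi> i. if bty i then vs ! bpos i else bas i) :: complex^'n^'n"
 have "matrix (F1 G) *v (?R $ i) = (if bty i then map ((*v) G) vs ! bpos i else bas i)" for i proof (cases "bty i")
  case True
  hence "bpos i < length vs" using bpos_less vs by simp
  moreover hence "p0 (vs ! bpos i) = 0" using vs(2) by (auto simp: VV_def dest: nth_mem)
  ultimately show ?thesis using True by (simp add: matrix_works[OF F1_clin] F1_def)
 next
  case False
  hence "p0 (bas i) = bas i" using bas unfolding VV_basis_def by metis
  thus ?thesis using False by (simp add: matrix_works[OF F1_clin] F1_def)
 qed
 thus ?thesis using det_rows_map[of "matrix (F1 G)" ?R] by (simp add: vol_def)
qed

text \<open>The character by which the group acts on the invariant form.  For even exponent \<open>2q\<close> the factor \<open>chi\<^sup>q\<close> replaces the square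
  root in the determinant on \<open>Z\<^sub>0(c)\<close>.\<close>

definition kappa :: "nat => complex^'n^'n => complex" where
 "kappa q A = det A / chi A ^ q"

text \<open>The transformation rule behind the invariant form: near \<open>c\<close> the form is
  \<open>N(p2 z + c0)\<^sup>-\<^sup>q\<close> times the pullback of \<open>vol\<close> by the unipotent that normalises \<open>z\<close>.\<close>

lemma vol_transform:
 assumes q: "2 + a * (r - Suc l) = 2 * q" and A: "A \<in> KR" "A *v c \<in> W0" and vs: "length vs = dd" "set vs \<subseteq> VV"
 shows "vol (map ((*v) (nrm A)) vs) / Nm (p2 (A *v c) + c0) ^ q = kappa q A * vol vs" proof -
 note n = nrm_props[OF A]
 have chi: "chi A = Nm (p2 (A *v c) + c0) * Nm (c + p0 (nrm A *v c0))" using chi_normalised[OF n(3)] by (simp add: n(2,5))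
 have det: "det A = Det (F1 (nrm A)) * Nm (c + p0 (nrm A *v c0)) ^ q" using det_normalised[OF n(3)] Det_hb_KR[OF q A] by (simp add: n(4))
 have "chi A ~= 0" using chi_nonzero A(1) KR_Str by blast
 thus ?thesis unfolding vol_normalised[OF vs] kappa_def det chi power_mult_distrib by (simp add: chi field_simps)
qed

end

lemma holomorphic_wrt_local:
 fixes F :: "complex^'n => complex"
 assumes "!!x. x \<in> S ==> EX h N. open N & x \<in> N & cdiff h x & (\<forall>y\<in>S \<inter> N. F y = h y)"
 shows "holomorphic_wrt (*) F S" unfolding holomorphic_wrt_def proof
 fix x assume x: "x \<in> S"
 then obtain h N where h: "open N" "x \<in> N" "cdiff h x" "!!y. y \<in> S ==> y \<in> N ==> F y = h y" using assms[OF x] by blast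
 obtain h' where h': "(h has_derivative h') (at x)" "!!c v. h' (c *s v) = c * h' v" using h(3) by (elim cdiffE) blast
 obtain d where d: "d > 0" "ball x d \<subseteq> N" using h(1,2) openE by blast
 have "(F has_derivative h') (at x within S)" by (rule has_derivative_transform_within[OF has_derivative_at_withinI[OF h'(1)] d(1) x])
    (use d(2) h(4) in "auto simp: dist_commute subset_iff")
 thus "EX f'. (F has_derivative f') (at x within S) & (ALL c v. f' (c *s v) = c * f' v)" using h'(2) by blast
qed

context kepler_frame
begin

section \<open>Open orbits\<close>

definition orb :: "(complex^'n) set" where "orb = {A *v c |A. A \<in> KR}"

lemma c_orb: "c \<in> orb" using KR_one by (force simp: orb_def)

lemma orb_KR: assumes A: "A \<in> KR" shows "A *v z \<in> orb \<longleftrightarrow> z \<in> orb" proof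
 have *: "B *v z \<in> orb" if "B \<in> KR" "z \<in> orb" for B z using that KR_mult by (auto simp: orb_def matrix_vector_mul_assoc)
 show "z \<in> orb ==> A *v z \<in> orb" by (rule *[OF A])
 show "A *v z \<in> orb ==> z \<in> orb" using *[OF KR_inv[OF A], of "A *v z"] KR_invertible[OF A] by simp
qed

text \<open>In the Jordan algebra \<open>Z\<^sub>2(c)\<close> the following says \<open>B(c - u, c)c = u\<^sup>2\<close>.\<close>

lemma bergman_square: assumes u: "u \<in> pspace c 2" shows "bergman_op T (c - u) c c = quad_op T u c" proof -
 have c2: "T c c c = 2 *s c" "T c c u = 2 *s u" "T u c c = 2 *s u" using pspaceD[OF c_pspace] pspaceD[OF u] T_commute[of u c c] by simp_all
 show ?thesis by (simp add: bergman_op_def quad_op_def T_diff T_scale c2 vec_eq_iff field_simps)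
qed

text \<open>The map \<open>u \<mapsto> u\<^sup>2\<close> has derivative \<open>2\<close> at the unit \<open>c\<close> of \<open>Z\<^sub>2(c)\<close>, so its image contains a neighbourhood.\<close>

lemma square_open:
 assumes S: "open S" "c \<in> S" obtains U where "open U" "c \<in> U" "!!z. z \<in> U ==> \<exists>y\<in>S. p2 z = quad_op T (p2 y) c"
proof -
 define f where "f y = quad_op T (p2 y) c + (y - p2 y)" for y
 have bl: "bounded_linear p2" by (rule clin_bounded_linear[OF pproj_clin])
 have bb: "bounded_bilinear (%u w. T u c w)" unfolding bilinear_conv_bounded_bilinear[symmetric] bilinear_def
  by (auto intro!: linearI simp: T_add T_scale scaleR_eq_scale)
 have p2d: "(p2 has_derivative p2) (at c)" by (rule bounded_linear_imp_has_derivative[OF bl])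
 have quad: "quad_op T (p2 y) c = (1/2) *\<^sub>R T (p2 y) c (p2 y)" for y by (simp add: quad_op_def scaleR_eq_scale)
 have "(f has_derivative (%h. (1/2) *\<^sub>R (T (p2 c) c (p2 h) + T (p2 h) c (p2 c)) + (h - p2 h))) (at c)" unfolding f_def quad
  by (intro has_derivative_add has_derivative_diff has_derivative_scaleR_right has_derivative_ident
    bounded_bilinear.FDERIV[OF bb] p2d)
 moreover have "(1/2) *\<^sub>R (T (p2 c) c (p2 h) + T (p2 h) c (p2 c)) + (h - p2 h) = h + p2 h" for h
  using pspaceD[OF p_mem(1)[of h]] T_commute[of "p2 h" c c] unfolding p_on(1)[OF c_pspace] by (simp add: scaleR_eq_scale vec_eq_iff)
 ultimately have d: "(f has_derivative (%h. h + p2 h)) (at c)" by simp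
 let ?g = "%h. h - (1/2) *s p2 h"
 have cg: "clin ?g" by (rule clinI) (simp_all add: p_add p_scale vec_eq_iff algebra_simps)
 have idg: "(%h. h + p2 h) \<circ> ?g = id" by (rule ext) (simp add: p_diff p_scale p_on(1)[OF p_mem(1)] vec_eq_iff)
 have cf: "continuous_on UNIV f" unfolding f_def quad_op_def by (intro continuous_intros linear_continuous_on bl)
 have "f c \<in> interior (f ` S)" by (rule sussmann_open_mapping[OF open_UNIV cf UNIV_I d clin_bounded_linear[OF cg] idg])
    (use S in "auto simp: interior_open")
 moreover have "f c = c" using pspaceD[OF c_pspace] unfolding f_def quad_op_def p_on(1)[OF c_pspace] by (simp add: vec_eq_iff)
 ultimately have ci: "c \<in> interior (f ` S)" by simp
 define U where "U = p2 -` interior (f ` S)"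
 have "open U" unfolding U_def by (rule open_vimage[OF open_interior linear_continuous_on[OF bl]])
 moreover have "c \<in> U" using ci p_on(1)[OF c_pspace] by (simp add: U_def)
 moreover have "\<exists>y\<in>S. p2 z = quad_op T (p2 y) c" if "z \<in> U" for z proof -
  have "p2 z \<in> f ` S" using that interior_subset by (auto simp: U_def)
  then obtain y where y: "y \<in> S" "p2 z = f y" by blast
  have "T (p2 y) c (p2 y) \<in> pspace c 2" by (rule T_pspace[OF p_mem(1) c_pspace p_mem(1)]) simp
  hence "quad_op T (p2 y) c \<in> pspace c 2" unfolding quad_op_def by (rule pspace_scale)
  moreover have "p2 z = p2 (f y)" using y(2) p_on(1)[OF p_mem(1)] by metis
  ultimately have "p2 z = quad_op T (p2 y) c" by (simp add: f_def p_add p_diff p_on p_on(1)[OF p_mem(1)])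
  thus ?thesis using y(1) by blast
 qed
 ultimately show ?thesis by (rule that)
qed

text \<open>A unipotent operator moves \<open>z\<close> to its component in \<open>Z\<^sub>2(c)\<close>, which is a square \<open>u\<^sup>2 = B(c - u, c)c\<close>.\<close>

lemma orb_open_c: obtains U where "open U" "c \<in> U" "U \<inter> M \<subseteq> orb" proof -
 let ?S = "{y. Det (bergman_op T (c - p2 y) c) ~= 0}"
 have cp: "continuous_on UNIV p2" by (rule clin_continuous[OF pproj_clin])
 have "continuous_on UNIV (%y. Det (bergman_op T (c - p2 y) c))" unfolding det_def matrix_def vec_lambda_beta bergman_op_def quad_op_def
  by (intro continuous_on_sum continuous_on_mult continuous_on_const continuous_on_prod continuous_on_component continuous_intros cp)
 hence S: "open ?S" by (intro open_Collect_neq continuous_on_const)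
 have "bergman_op T (c - p2 c) c = (%z. z)" using p_on(1)[OF c_pspace] by (auto simp: bergman_op_def quad_op_def)
 hence "c \<in> ?S" by (simp add: Det_id)
 then obtain U where U: "open U" "c \<in> U" "!!z. z \<in> U ==> \<exists>y\<in>?S. p2 z = quad_op T (p2 y) c"
  using square_open[OF S] by blast
 have "z \<in> orb" if z: "z \<in> U" "z \<in> W0" "z \<in> M" for z proof -
  obtain y where y: "y \<in> ?S" "p2 z = quad_op T (p2 y) c" using U(3)[OF z(1)] by blast
  let ?B = "mB (c - p2 y) c"
  have B: "?B \<in> KR" using y(1) by (intro KR_gen) (simp add: invertible_det_nz)
  have n: "mB (vp z) c \<in> KR" by (rule frobenius_KR[OF vp_pspace[OF z(2)]])
  have "mB (vp z) c *v z = ?B *v c"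
   using frobenius_M[OF z(2,3)] bergman_square[OF p_mem(1)[of y]] y(2) by (simp add: matrix_works[OF bergman_clin])
  hence "mB (vp z) c *v z \<in> orb" using B c_orb orb_KR by simp
  thus "z \<in> orb" using orb_KR[OF n] by simp
 qed
 thus ?thesis using that[of "U \<inter> W0"] U W0_open c_W0 by blast
qed

text \<open>\<open>KR\<close> is normal in the structure group, so the manifold is a disjoint union of translates of the
  open orbit.\<close>

lemma orb_locally_constant:
 assumes z: "z \<in> M" obtains U where "open U" "z \<in> U" "!!x. x \<in> U ==> x \<in> M ==> x \<in> orb \<longleftrightarrow> z \<in> orb"
proof -
 obtain S where S: "S \<in> Str" "z = S *v c" using M_orbit[OF z] by blast
 have iS: "invertible S" using S by (simp add: Str_def)
 obtain U where U: "open U" "c \<in> U" "U \<inter> M \<subseteq> orb" by (rule orb_open_c)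
 have iff: "S *v y \<in> orb \<longleftrightarrow> S *v c \<in> orb" if y: "y \<in> orb" for y proof -
  obtain B where B: "B \<in> KR" "y = B *v c" using y by (auto simp: orb_def)
  have "S *v y = (S ** B ** matrix_inv S) *v (S *v c)" using iS by (simp add: B(2) mv_mult)
  thus ?thesis using orb_KR[OF KR_conj[OF S(1) B(1)]] by simp
 qed
 show ?thesis proof (rule that[of "(*v) S ` U"])
  show "open ((*v) S ` U)" by (rule open_linear_image[OF iS U(1)])
  show "z \<in> (*v) S ` U" using U S by blast
  fix x assume x: "x \<in> (*v) S ` U" "x \<in> M"
  then obtain y where y: "y \<in> U" "x = S *v y" by blast
  hence "y \<in> orb" using U(3) x(2) M_Str[OF S(1)] by blast
  thus "x \<in> orb \<longleftrightarrow> z \<in> orb" using iff y(2) S(2) by simp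
 qed
qed

section \<open>The invariant form\<close>

definition orb_elt :: "complex^'n => complex^'n^'n" where
 "orb_elt z = (SOME A. A \<in> KR & z = A *v c)"

lemma orb_elt: "z \<in> orb ==> orb_elt z \<in> KR & z = orb_elt z *v c" unfolding orb_elt_def by (rule someI_ex) (auto simp: orb_def)

text \<open>Transport the volume form from \<open>c\<close> over its orbit under \<open>KR\<close>, with the character as a factor; the form is \<open>0\<close> on the other
  orbits, which are open as well.\<close>

definition Theta :: "nat => complex^'n => (complex^'n) list => complex" where
 "Theta q z vs = (if z \<in> orb then kappa q (orb_elt z) * vol (map ((*v) (matrix_inv (orb_elt z))) vs) else 0)"

lemma kappa_mult: "A \<in> KR ==> B \<in> KR ==> kappa q (A ** B) = kappa q A * kappa q B"
 using chi_mult[OF subsetD[OF KR_Str] subsetD[OF KR_Str], of A B] by (simp add: kappa_def det_mul power_mult_distrib)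

lemma vp_c: "vp c = 0" by (rule vp_unique[OF c_W0]) (simp add: p_on c_pspace clin_zero[OF Px_clin])

lemma matrix_inv_mv_mult:
 "invertible A ==> invertible B ==> matrix_inv (A ** B) *v x = matrix_inv B *v (matrix_inv A *v x)"
 for A B :: "complex^'n^'n" proof -
 assume i: "invertible A" "invertible B"
 have "(A ** B) ** (matrix_inv B ** matrix_inv A) = A ** (B ** matrix_inv B) ** matrix_inv A" by (simp only: matrix_mul_assoc)
 also have "... = mat 1" using matrix_inv_mult[OF i(1)] matrix_inv_mult[OF i(2)] by simp
 finally show ?thesis by (simp add: matrix_inv_unique mv_mult)
qed

lemma tangent_orb: "A \<in> KR ==> tangent_space M (A *v c) = (*v) A ` VV" using tangent_space_orbit KR_Str by blast

lemma pull_back_VV: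
 assumes "A \<in> KR" "set vs \<subseteq> tangent_space M (A *v c)" shows "set (map ((*v) (matrix_inv A)) vs) \<subseteq> VV"
 using assms(2) KR_invertible[OF assms(1)] unfolding tangent_orb[OF assms(1)] by auto

end

locale even_kepler_frame = kepler_frame T r a e l
  for T :: "('n::finite) triple" and r a e l +
 fixes q :: nat assumes even_q: "2 + a * (r - Suc l) = 2 * q"
begin

text \<open>Independence of the choice of the group element: a stabiliser of \<open>c\<close> is its own normalised form, and \<open>vol_transform\<close>
  says that it acts on the volume form by the character.\<close>

lemma Theta_orbit:
 assumes A: "A \<in> KR" and vs: "length vs = dd" "set vs \<subseteq> tangent_space M (A *v c)"
 shows "Theta q (A *v c) vs = kappa q A * vol (map ((*v) (matrix_inv A)) vs)" proof -
 have O: "A *v c \<in> orb" using A by (auto simp: orb_def)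
 define B where "B = orb_elt (A *v c)"
 have B: "B \<in> KR" "A *v c = B *v c" using orb_elt[OF O] by (simp_all add: B_def)
 define C where "C = matrix_inv B ** A"
 have C: "C \<in> KR" unfolding C_def by (rule KR_mult[OF KR_inv[OF B(1)] A])
 have iB: "invertible B" and iA: "invertible A" using KR_invertible A B(1) by auto
 have Cc: "C *v c = c" using B(2) iB by (simp add: C_def mv_mult)
 have nC: "nrm C = C" by (rule matrix_eqI) (simp add: nrm_app Cc vp_c bergman_op_def quad_op_def)
 let ?ws = "map ((*v) (matrix_inv A)) vs"
 have v: "vol (map ((*v) C) ?ws) = kappa q C * vol ?ws" using vol_transform[OF even_q C, of ?ws] pull_back_VV[OF A vs(2)] vs(1) c_W0
  by (simp add: Cc nC p_on(1)[OF c_pspace] un_split[symmetric] Nm_un)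
 have m: "map ((*v) C) ?ws = map ((*v) (matrix_inv B)) vs" using iA by (simp add: C_def mv_mult)
 have "A = B ** C" unfolding C_def by (simp add: matrix_mul_assoc matrix_inv_mult[OF iB])
 hence "kappa q A = kappa q B * kappa q C" using kappa_mult[OF B(1) C] by simp
 moreover have "Theta q (A *v c) vs = kappa q B * vol (map ((*v) (matrix_inv B)) vs)" using O by (simp add: Theta_def B_def[symmetric])
 ultimately show ?thesis by (simp only: m[symmetric] v mult.assoc)
qed

lemma Theta_KR:
 assumes A: "A \<in> KR" and z: "z \<in> M" and vs: "length vs = dd" "set vs \<subseteq> tangent_space M z"
 shows "Theta q (A *v z) (map ((*v) A) vs) = kappa q A * Theta q z vs" proof (cases "z \<in> orb")
 case True
 then obtain B where B: "B \<in> KR" "z = B *v c" by (auto simp: orb_def)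
 have iA: "invertible A" and iB: "invertible B" using A B KR_invertible by auto
 have AB: "A ** B \<in> KR" by (rule KR_mult[OF A B(1)])
 have "set (map ((*v) A) vs) \<subseteq> tangent_space M ((A ** B) *v c)"
  using vs(2) by (auto simp: tangent_orb[OF AB] B(2) tangent_orb[OF B(1)] matrix_vector_mul_assoc image_iff dest!: subsetD)
 hence "Theta q ((A ** B) *v c) (map ((*v) A) vs) = kappa q (A ** B) * vol (map ((*v) (matrix_inv (A ** B))) (map ((*v) A) vs))"
  using Theta_orbit[OF AB, of "map ((*v) A) vs"] vs(1) by simp
 also have "map ((*v) (matrix_inv (A ** B))) (map ((*v) A) vs) = map ((*v) (matrix_inv B)) vs" using iA iB by (simp add: matrix_inv_mv_mult)
 finally show ?thesis using Theta_orbit[OF B(1) vs(1)] vs(2) by (simp add: B(2) matrix_vector_mul_assoc kappa_mult[OF A B(1)])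
next
 case False
 thus ?thesis using orb_KR[OF A] by (simp add: Theta_def)
qed

text \<open>An explicit holomorphic formula near \<open>c\<close>, from \<open>vol_transform\<close>.\<close>

lemma Theta_W0:
 assumes z: "z \<in> orb" "z \<in> W0" and vs: "length vs = dd" "set vs \<subseteq> tangent_space M z"
 shows "Theta q z vs = vol (map ((*v) (mB (vp z) c)) vs) / Nm (p2 z + c0) ^ q" proof -
 obtain A where A: "A \<in> KR" "z = A *v c" using z by (auto simp: orb_def)
 let ?ws = "map ((*v) (matrix_inv A)) vs"
 have v: "vol (map ((*v) (nrm A)) ?ws) / Nm (p2 (A *v c) + c0) ^ q = kappa q A * vol ?ws"
  by (rule vol_transform[OF even_q A(1)]) (use z A vs pull_back_VV[OF A(1)] in auto)
 have m: "map ((*v) (nrm A)) ?ws = map ((*v) (mB (vp z) c)) vs" using KR_invertible[OF A(1)] by (simp add: nrm_def A(2) mv_mult)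
 have "Theta q z vs = kappa q A * vol ?ws" using Theta_orbit[OF A(1) vs(1)] vs(2) by (simp add: A(2))
 thus ?thesis by (simp only: v[symmetric] m A(2))
qed

lemma vol_linear:
 assumes i: "i < dd" and vs: "length vs = dd" shows "vol (vs[i := s *s x + y]) = s * vol (vs[i := x]) + vol (vs[i := y])" proof -
 obtain k where k: "bty k" "bpos k = i"
  using bas i unfolding VV_basis_def bij_betw_def by (metis (mono_tags) imageE lessThan_iff mem_Collect_eq)
 have inj: "bpos m = i ==> bty m ==> m = k" for m using bas k unfolding VV_basis_def bij_betw_def inj_on_def by auto
 let ?R = "%m. if bty m then vs ! bpos m else bas m"
 have rows: "(if bty m then vs[i := w] ! bpos m else bas m) = (if m = k then w else ?R m)" for m w proof (cases "m = k")
  case True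
  thus ?thesis using k i vs by simp
 next
  case False
  hence "bty m ==> i ~= bpos m" using inj by blast
  thus ?thesis using False by (simp add: nth_list_update)
 qed
 have v: "vol (vs[i := w]) = det (\<chi> m. if m = k then w else ?R m)" for w unfolding vol_def by (simp only: rows)
 show ?thesis unfolding v using det_row_add[of k "%_. s *s x" "%_. y" ?R] det_row_mul[of k s "%_. x" ?R] by argo
qed

lemma vol_alternating:
 assumes ij: "i < j" "j < dd" and vs: "length vs = dd" "vs ! i = vs ! j" shows "vol vs = 0" proof -
 obtain k where k: "bty k" "bpos k = i"
  using bas ij unfolding VV_basis_def bij_betw_def by (metis (mono_tags) imageE lessThan_iff less_trans mem_Collect_eq)
 obtain m where m: "bty m" "bpos m = j"
  using bas ij unfolding VV_basis_def bij_betw_def by (metis (mono_tags) imageE lessThan_iff mem_Collect_eq)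
 have "k ~= m" using k m ij by auto
 thus ?thesis unfolding vol_def by (rule det_identical_rows) (use k m vs in "simp add: row_def vec_eq_iff")
qed

lemma Theta_alternating: assumes z: "z \<in> M" shows "alternating_form dd (tangent_space M z) (Theta q z)" proof (cases "z \<in> orb")
 case True
 have m: "map ((*v) B) (vs[i := x]) = (map ((*v) B) vs)[i := B *v x]" for B vs i x by (rule map_update)
 show ?thesis unfolding alternating_form_def using True vol_linear vol_alternating
  by (auto simp: Theta_def m clin_add[OF clin_matrix] clin_scale[OF clin_matrix] distrib_left)
next
 case False
 thus ?thesis by (simp add: alternating_form_def Theta_def)
qed

lemma cdiff_vol:
 assumes "!!i j. i < length fs ==> cdiff (%x. (fs ! i) x $ j) x" "length fs = dd" shows "cdiff (%x. vol (map (%f. f x) fs)) x"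
 unfolding vol_def proof (rule cdiff_det)
 fix i j
 show "cdiff (%x. (\<chi> i. if bty i then map (%f. f x) fs ! bpos i else bas i) $ i $ j) x"
  using assms bpos_less[of i] by (cases "bty i") (auto intro: cdiff_const)
qed

lemma chart_point:
 assumes ch: "slice_chart m M W f g V" and x: "x \<in> f ` W \<inter> V" shows "g x \<in> W" "g x \<in> M" "f (g x) = x"
  "set vs \<subseteq> V ==> set (map (frechet_derivative g (at x)) vs) \<subseteq> tangent_space M (g x)" proof -
 note D = slice_chartD[OF ch]
 have "x \<in> f ` (W \<inter> M)" using x D(8) by simp
 then obtain w where w: "w \<in> W" "w \<in> M" "x = f w" by blast
 hence gx: "g x = w" using D(5) by simp
 thus "g x \<in> W" "g x \<in> M" "f (g x) = x" using w by simp_all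
 obtain g' where g': "(g has_derivative g') (at (f w))" using slice_chart_inverse_derivative[OF ch w(1)] by blast
 hence "frechet_derivative g (at x) = g'" using frechet_derivative_at[OF g'] w(3) by simp
 thus "set vs \<subseteq> V ==> set (map (frechet_derivative g (at x)) vs) \<subseteq> tangent_space M (g x)"
  using tangent_space_slice(1)[OF ch w(1,2) g'] gx by auto
qed

text \<open>Near a point \<open>Ac\<close> of the orbit move back by \<open>A\<close> and use the explicit formula; near other points the form vanishes.\<close>

lemma Theta_chart_holomorphic:
 assumes ch: "slice_chart m M W f g V" and vs: "length vs = dd" "set vs \<subseteq> V"
 shows "holomorphic_wrt (*) (%x. Theta q (g x) (map (frechet_derivative g (at x)) vs)) (f ` W \<inter> V)"
proof (rule holomorphic_wrt_local)
 note D = slice_chartD[OF ch]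
 fix x0 assume x0: "x0 \<in> f ` W \<inter> V"
 note pt = chart_point[OF ch]
 let ?dg = "%x. frechet_derivative g (at x)"
 have dg: "(g has_derivative ?dg x) (at x)" "clin (?dg x)" if xW: "x \<in> f ` W" for x proof -
  obtain g' where "(g has_derivative g') (at x)" "clin g'" by (rule holomorphic_wrtD[OF D(4,2) xW])
  thus "(g has_derivative ?dg x) (at x)" "clin (?dg x)" using frechet_derivative_at[of g g' x] by simp_all
 qed
 have cg: "cdiff (%x. g x $ i) x" if "x \<in> f ` W" for x i
  by (rule cdiff_coord_of_derivative[OF dg(1)[OF that]]) (rule clin_scale[OF dg(2)[OF that]])
 have contg: "continuous_on (f ` W) g" using dg(1) by (intro continuous_at_imp_continuous_on ballI has_derivative_continuous)
 have cdg: "cdiff (%x. ?dg x v $ i) x" if "x \<in> f ` W" for x v i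
 proof (rule cdiff_directional_derivative[OF D(2) _ that, where g = "%x. g x $ i" and g' = "%z v. ?dg z v $ i"])
  fix z assume z: "z \<in> f ` W"
  show "((%x. g x $ i) has_derivative (%v. ?dg z v $ i)) (at z) & (ALL c v. ?dg z (c *s v) $ i = c * ?dg z v $ i)"
   using bounded_linear.has_derivative[OF bounded_linear_coord dg(1)[OF z]] clin_scale[OF dg(2)[OF z]] by simp
 qed
 obtain U where U: "open U" "g x0 \<in> U" "!!z. z \<in> U ==> z \<in> M ==> z \<in> orb \<longleftrightarrow> g x0 \<in> orb"
  using orb_locally_constant[OF pt(2)[OF x0]] by blast
 have openU: "open (f ` W \<inter> g -` U')" if "open U'" for U'
  using contg[unfolded continuous_on_open_vimage[OF D(2)], rule_format, OF that] by (simp only: Int_commute)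
 show "EX h N. open N & x0 \<in> N & cdiff h x0 &
   (\<forall>y\<in>f ` W \<inter> V \<inter> N. Theta q (g y) (map (?dg y) vs) = h y)" proof (cases "g x0 \<in> orb")
  case False
  show ?thesis proof (intro exI conjI ballI)
   show "open (f ` W \<inter> g -` U)" by (rule openU[OF U(1)])
   show "x0 \<in> f ` W \<inter> g -` U" using x0 U(2) by simp
   show "cdiff (%_. 0) x0" by (rule cdiff_const)
   fix y assume "y \<in> f ` W \<inter> V \<inter> (f ` W \<inter> g -` U)"
   hence "g y \<notin> orb" using U(3) pt(2)[of y] False by auto
   thus "Theta q (g y) (map (?dg y) vs) = 0" by (simp add: Theta_def)
  qed
 next
  case True
  then obtain A where A: "A \<in> KR" "g x0 = A *v c" by (auto simp: orb_def)
  note iA = KR_invertible[OF A(1)]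
  let ?U = "U \<inter> (*v) A ` W0"
  let ?y = "%x. matrix_inv A *v g x"
  let ?fs = "map (%v x. mB (vp (?y x)) c *v (matrix_inv A *v ?dg x v)) vs"
  let ?h = "%x. kappa q A * (vol (map (%F. F x) ?fs) / Nm (p2 (?y x) + c0) ^ q)"
  have y0: "?y x0 = c" using A(2) iA by simp
  have x0W: "x0 \<in> f ` W" using x0 by simp
  show ?thesis proof (intro exI conjI ballI)
   show "open (f ` W \<inter> g -` ?U)" by (rule openU) (intro open_Int U(1) open_linear_image[OF iA W0_open])
   show "x0 \<in> f ` W \<inter> g -` ?U" using x0 U(2) A(2) c_W0 by auto
   have cy: "cdiff (%x. ?y x $ i) x0" for i by (rule cdiff_compose[OF cdiff_clin[OF clin_matrix]]) (rule cg[OF x0W])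
   have cy2: "cdiff (%x. (p2 (?y x) + c0) $ i) x0" for i unfolding vector_add_component
    by (intro cdiff_add cdiff_const cdiff_compose[OF cdiff_clin[OF pproj_clin] cy])
   have cN: "cdiff (%x. Nm (p2 (?y x) + c0) ^ q) x0" by (intro cdiff_power cdiff_compose[OF polyfun_cdiff[OF polyfun_Nm] cy2])
   have N0: "Nm (p2 (?y x0) + c0) ^ q ~= 0" by (simp add: y0 p_on(1)[OF c_pspace] un_split[symmetric] Nm_un)
   have cvp: "cdiff (%x. vp (?y x) $ i) x0" for i by (rule cdiff_compose[OF cdiff_vp cy]) (simp add: y0 c_W0)
   have cd: "cdiff (%x. (matrix_inv A *v ?dg x v) $ i) x0" for v i by (rule cdiff_compose[OF cdiff_clin[OF clin_matrix]]) (rule cdg[OF x0W])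
   have cB: "cdiff (%x. (mB (vp (?y x)) c *v (matrix_inv A *v ?dg x v)) $ j) x0" for v j proof -
    have cT: "cdiff (%x. T (F x) c (G x) $ k) x0" if "!!i. cdiff (%x. F x $ i) x0" "!!i. cdiff (%x. G x $ i) x0" for F G k
     using cdiff_Tst[of F x0 "%_. st c" G k] that by (simp add: cdiff_const)
    have cQ: "cdiff (%x. quad_op T (F x) (st (G x)) $ k) x0" if "!!i. cdiff (%x. F x $ i) x0" "!!i. cdiff (%x. G x $ i) x0" for F G k
     unfolding quad_op_def vector_smult_component by (intro cdiff_mult cdiff_const cdiff_Tst that)
    have cl: "clin (%z. st (quad_op T c z))"
     unfolding quad_op_def by (rule clinI) (simp_all add: T_simps star_simps vec_eq_iff algebra_simps)
    have "bergman_op T u c z = z - T u c z + quad_op T u (st (st (quad_op T c z)))" for u z by (simp add: bergman_op_def)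
    thus ?thesis unfolding matrix_works[OF bergman_clin] vector_add_component vector_minus_component
     by (simp only: vector_add_component vector_minus_component)
       (intro cdiff_add cdiff_diff cd cT cvp cQ cdiff_compose[OF cdiff_clin[OF cl] cd])
   qed
   show "cdiff ?h x0" by (intro cdiff_mult cdiff_const cdiff_divide cdiff_vol cN N0) (use vs cB in auto)
   fix y assume y: "y \<in> f ` W \<inter> V \<inter> (f ` W \<inter> g -` ?U)"
   hence yV: "y \<in> f ` W \<inter> V" and yU: "g y \<in> U" and yW: "g y \<in> (*v) A ` W0" by auto
   have gO: "g y \<in> orb" using U(3)[OF yU pt(2)[OF yV]] True by simp
   have Ay: "A *v ?y y = g y" using iA by simp
   have oy: "?y y \<in> orb" "?y y \<in> W0" using gO orb_KR[OF A(1), of "?y y"] Ay yW iA by auto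
   have My: "?y y \<in> M" using pt(2)[OF yV] M_Str[of A "?y y"] A(1) KR_Str Ay by auto
   let ?us = "map (?dg y) vs"
   let ?ws = "map ((*v) (matrix_inv A)) ?us"
   have tw: "set ?ws \<subseteq> tangent_space M (?y y)" proof -
    have "tangent_space M (g y) = (*v) A ` tangent_space M (?y y)"
     using tangent_space_linear[OF iA, of M "?y y"] M_Str A(1) KR_Str unfolding Ay by blast
    thus ?thesis using pt(4)[OF yV vs(2)] iA by (auto dest!: subsetD)
   qed
   have "map ((*v) A) ?ws = ?us" using iA by simp
   hence "Theta q (g y) ?us = kappa q A * Theta q (?y y) ?ws" using Theta_KR[OF A(1) My _ tw] vs(1) by (simp only: Ay length_map)
   also have "Theta q (?y y) ?ws = vol (map ((*v) (mB (vp (?y y)) c)) ?ws) / Nm (p2 (?y y) + c0) ^ q"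
    by (rule Theta_W0[OF oy _ tw]) (simp add: vs)
   also have "map ((*v) (mB (vp (?y y)) c)) ?ws = map (%F. F y) ?fs" by simp
   finally show "Theta q (g y) ?us = ?h y" .
  qed
 qed
qed

lemma Theta_holomorphic: "holomorphic_form dd M (Theta q)"
 unfolding holomorphic_form_def using Theta_alternating Theta_chart_holomorphic by blast

lemma kappa_nonzero: "A \<in> KR ==> kappa q A ~= 0"
 using chi_nonzero[OF subsetD[OF KR_Str]] KR_invertible[of A] by (auto simp: kappa_def invertible_det_nz)

lemma kappa_inv: "A \<in> KR ==> kappa q (matrix_inv A) = 1 / kappa q A" proof -
 assume A: "A \<in> KR"
 have "kappa q (mat 1) = 1" by (simp add: kappa_def chi_one)
 hence "kappa q A * kappa q (matrix_inv A) = 1"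
  using kappa_mult[OF A KR_inv[OF A], of q] by (simp add: matrix_inv_mult(1)[OF KR_invertible[OF A]])
 thus ?thesis using kappa_nonzero[OF A] by (simp add: field_simps)
qed

text \<open>The kernel of a continuous character is a closed subgroup containing all commutators.\<close>

lemma K_ring0_kappa: "K_ring0 T \<subseteq> {A \<in> KR. kappa q A = 1}" unfolding K_ring0_def proof (rule hull_minimal)
 show "{A ** B ** matrix_inv A ** matrix_inv B |A B. A \<in> KR & B \<in> KR} \<subseteq> {A \<in> KR. kappa q A = 1}"
  using kappa_nonzero by (auto simp: KR_mult KR_inv kappa_mult kappa_inv)
 let ?H = "{A \<in> KR. kappa q A = 1}"
 have "matrix_group ?H" unfolding matrix_group_def using KR_one KR_invertible KR_inv KR_mult
  by (auto simp: kappa_mult kappa_inv) (simp add: kappa_def chi_one)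
 moreover have "?H = KR \<inter> {A. det A = chi A ^ q}" using chi_nonzero KR_Str by (auto simp: kappa_def)
 moreover have "closed {A :: complex^'n^'n. det A = chi A ^ q}" unfolding det_def
  by (intro closed_Collect_eq continuous_on_sum continuous_on_mult continuous_on_const continuous_on_prod
    continuous_on_power chi_continuous continuous_on_component continuous_on_id)
 ultimately show "matrix_group ?H & closedin (top_of_set KR) ?H" by (simp add: closedin_closed_Int)
qed

lemma Theta_invariant: "invariant_form (K_ring0 T) dd M (Theta q)" unfolding invariant_form_def proof (intro ballI allI impI, elim conjE)
 fix A z and vs :: "(complex^'n) list"
 assume A: "A \<in> K_ring0 T" and z: "z \<in> M" and vs: "length vs = dd" "set vs \<subseteq> tangent_space M z"
 have "A \<in> KR" "kappa q A = 1" using K_ring0_kappa A by auto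
 thus "Theta q (A *v z) (map ((*v) A) vs) = Theta q z vs" using Theta_KR[OF _ z vs] by simp
qed

lemma Theta_nonzero: "nonzero_form dd M (Theta q)" unfolding nonzero_form_def proof (intro bexI exI conjI)
 show "c \<in> M" by (rule cc_M)
 have bij: "bij_betw bpos {x. bty x} {..<dd}" using bas by (simp add: VV_basis_def)
 let ?vs = "map (%i. bas (inv_into {x. bty x} bpos i)) [0..<dd]"
 show len: "length ?vs = dd" by simp
 have iv: "inv_into {x. bty x} bpos i \<in> {x. bty x}" if "i < dd" for i using bij that by (intro inv_into_into) (simp add: bij_betw_def)
 have "set ?vs \<subseteq> VV" using bas iv unfolding VV_basis_def by auto
 thus t: "set ?vs \<subseteq> tangent_space M c" by (simp add: tangent_space_u(2)[OF c_pspace c_W0])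
 have one: "c = mat 1 *v c" "matrix_inv (mat 1) = (mat 1 :: complex^'n^'n)" by (simp_all add: matrix_inv_unique)
 have "(if bty i then ?vs ! bpos i else bas i) = bas i" for i using bij bpos_less[of i] by (auto simp: bij_betw_def inv_into_f_f)
 hence "vol ?vs = det (\<chi> i. bas i)" by (simp add: vol_def)
 also have "(\<chi> i. bas i) = transpose (\<chi> i j. bas j $ i)" by (simp add: transpose_def vec_eq_iff)
 also have "det ... = det ((\<chi> i j. bas j $ i) :: complex^'n^'n)" by (rule det_transpose)
 finally have "vol ?vs ~= 0" using bas by (simp add: VV_basis_def invertible_det_nz)
 moreover have "Theta q c ?vs = kappa q (mat 1) * vol ?vs" proof -
  have m: "map ((*v) (matrix_inv (mat 1))) ?vs = ?vs" unfolding one(2) by simp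
  have "set ?vs \<subseteq> tangent_space M (mat 1 *v c)" using t by (simp only: one(1)[symmetric])
  from Theta_orbit[OF KR_one len this] show ?thesis by (simp only: m one(1)[symmetric])
 qed
 ultimately show "Theta q c ?vs ~= 0" by (simp add: kappa_def chi_one)
qed

end

section \<open>Alternating forms of top degree\<close>

lemma alternating_form_linear:
 "alternating_form d V \<omega> ==> length vs = d ==> set vs \<subseteq> V ==> i < d ==> x \<in> V ==> y \<in> V ==>
   \<omega> (vs[i := c *s x + y]) = c * \<omega> (vs[i := x]) + \<omega> (vs[i := y])" and alternating_form_zero:
 "alternating_form d V \<omega> ==> length vs = d ==> set vs \<subseteq> V ==> i < j ==> j < d ==> vs ! i = vs ! j ==> \<omega> vs = 0"
 unfolding alternating_form_def by blast+

lemma alternating_form_scale: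
 assumes alt: "alternating_form d V \<omega>" and V: "vec.subspace V" and vs: "length vs = d" "set vs \<subseteq> V" "i < d" "x \<in> V"
 shows "\<omega> (vs[i := c *s x]) = c * \<omega> (vs[i := x])" proof -
 have 0: "0 \<in> V" by (rule vec.subspace_0[OF V])
 have "\<omega> (vs[i := 1 *s 0 + 0]) = 1 * \<omega> (vs[i := 0]) + \<omega> (vs[i := 0])"
  by (rule alternating_form_linear[OF alt vs(1-3) 0 0])
 hence "\<omega> (vs[i := 0]) = 0" by simp
 thus ?thesis using alternating_form_linear[OF alt vs 0, of c] by simp
qed

lemma alternating_form_scale_all:
 assumes alt: "alternating_form d V \<omega>" and V: "vec.subspace V" and vs: "length vs = d" "set vs \<subseteq> V"
 shows "\<omega> (map (%i. s i *s (vs ! i)) [0..<d]) = (\<Prod>i<d. s i) * \<omega> vs" proof -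
 let ?L = "%k. map (%i. if i < k then s i *s (vs ! i) else vs ! i) [0..<d]"
 have "k <= d ==> \<omega> (?L k) = (\<Prod>i<k. s i) * \<omega> vs" for k proof (induction k)
  case 0
  have "?L 0 = vs" using vs(1) by (intro nth_equalityI) auto
  thus ?case by simp
 next
  case (Suc k)
  have nV: "vs ! i \<in> V" if "i < d" for i using vs that by (metis nth_mem subsetD)
  have "?L (Suc k) = (?L k)[k := s k *s (vs ! k)]" by (intro nth_equalityI) (auto simp: nth_list_update less_Suc_eq)
  also have "\<omega> ... = s k * \<omega> ((?L k)[k := vs ! k])"
   by (rule alternating_form_scale[OF alt V]) (use Suc nV vec.subspace_scale[OF V] in auto)
  also have "(?L k)[k := vs ! k] = ?L k" by (intro nth_equalityI) (auto simp: nth_list_update)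
  finally show ?case using Suc by (simp add: mult.assoc mult.commute mult.left_commute)
 qed
 hence "\<omega> (?L d) = (\<Prod>i<d. s i) * \<omega> vs" by blast
 moreover have "?L d = map (%i. s i *s (vs ! i)) [0..<d]" by (rule map_cong) auto
 ultimately show ?thesis by (simp only:)
qed

text \<open>On a list of all basis vectors the diagonal map multiplies the form by the determinant, and on other lists of basis
  vectors an alternating form vanishes; linearity in one place after the other does the rest.\<close>

lemma alternating_form_vanishes:
 fixes b :: "'i => complex^'n"
 assumes alt: "alternating_form d V \<omega>" and V: "vec.subspace V"
  and I: "finite I" "card I = d" and b: "b ` I \<subseteq> V" "V \<subseteq> vec.span (b ` I)"
  and g: "!!i. i \<in> I ==> g (b i) = s i *s b i" and inv: "!!vs. length vs = d ==> set vs \<subseteq> V ==> \<omega> (map g vs) = \<omega> vs"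
  and det: "(\<Prod>i\<in>I. s i) ~= 1" and vs: "length vs = d" "set vs \<subseteq> V" shows "\<omega> vs = 0" proof -
 have basis: "\<omega> (map b xs) = 0" if xs: "length xs = d" "set xs \<subseteq> I" for xs proof (cases "distinct xs")
  case True
  hence sI: "set xs = I" using I xs distinct_card[of xs] card_subset_eq[OF I(1) xs(2)] by simp
  have sub: "set (map b xs) \<subseteq> V" using xs(2) b(1) by auto
  have "\<omega> (map b xs) = \<omega> (map g (map b xs))" by (rule inv[symmetric]) (use xs sub in auto)
  also have "map g (map b xs) = map (%i. s (xs ! i) *s (map b xs ! i)) [0..<d]" using xs g by (intro nth_equalityI) (auto simp: subset_iff)
  also have "\<omega> ... = (\<Prod>i<d. s (xs ! i)) * \<omega> (map b xs)"
   by (rule alternating_form_scale_all[OF alt V _ sub]) (use xs in simp)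
  also have "(\<Prod>i<d. s (xs ! i)) = (\<Prod>i\<in>I. s i)"
   using prod.reindex_bij_betw[OF bij_betw_nth[OF True refl refl], of s] xs(1) sI by simp
  finally show ?thesis using det by (metis mult_cancel_right1)
 next
  case False
  then obtain i j where "i < d" "j < d" "i ~= j" "xs ! i = xs ! j" using xs(1) by (auto simp: distinct_conv_nth)
  then obtain i j where ij: "i < j" "j < d" "xs ! i = xs ! j" by (metis linorder_neqE_nat)
  show ?thesis by (rule alternating_form_zero[OF alt _ _ ij(1,2)]) (use ij xs b(1) in auto)
 qed
 have "\<omega> vs = 0" if "k <= d" "length vs = d" "set vs \<subseteq> V" "!!i. k <= i ==> i < d ==> vs ! i \<in> b ` I" for k vs
  using that proof (induction k arbitrary: vs)
  case 0
  hence "ALL i<d. \<exists>x\<in>I. vs ! i = b x" by auto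
  then obtain x where x: "!!i. i < d ==> x i \<in> I" "!!i. i < d ==> vs ! i = b (x i)" by metis
  have "vs = map b (map x [0..<d])" using x(2) 0 by (intro nth_equalityI) auto
  moreover have "\<omega> (map b (map x [0..<d])) = 0" by (rule basis) (use x in auto)
  ultimately show ?case by simp
 next
  case (Suc k)
  let ?S = "{y \<in> V. \<omega> (vs[k := y]) = 0}"
  have kd: "k < d" using Suc by simp
  have "vec.subspace ?S" proof (rule vec.subspaceI)
   have 0: "0 \<in> V" by (rule vec.subspace_0[OF V])
   thus "0 \<in> ?S" using alternating_form_scale[OF alt V Suc.prems(2,3) kd 0, of 0] by simp
   show "x + y \<in> ?S" if "x \<in> ?S" "y \<in> ?S" for x y
    using that alternating_form_linear[OF alt Suc.prems(2,3) kd, of x y 1] vec.subspace_add[OF V] by simp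
   show "c *s x \<in> ?S" if "x \<in> ?S" for c x
    using that alternating_form_scale[OF alt V Suc.prems(2,3) kd, of x c] vec.subspace_scale[OF V] by simp
  qed
  moreover have "b ` I \<subseteq> ?S" proof
   fix y assume y: "y \<in> b ` I"
   have "\<omega> (vs[k := y]) = 0" proof (rule Suc.IH)
    show "set (vs[k := y]) \<subseteq> V" using y b(1) Suc.prems(3) set_update_subset_insert[of vs k y] by auto
    show "vs[k := y] ! i \<in> b ` I" if "k <= i" "i < d" for i using that y Suc.prems by (cases "i = k") auto
   qed (use Suc.prems in auto)
   thus "y \<in> ?S" using y b(1) by auto
  qed
  ultimately have "vec.span (b ` I) \<subseteq> ?S" by (rule vec.span_minimal[rotated])
  moreover have "vs ! k \<in> V" by (rule subsetD[OF Suc.prems(3) nth_mem]) (use Suc.prems(2) kd in simp)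
  ultimately have "vs ! k \<in> ?S" using b(2) by blast
  thus ?case by simp
 qed
 from this[of d vs] show ?thesis using vs by simp
qed

context kepler_frame
begin

section \<open>The odd case\<close>

lemma Aut_rho: "A \<in> Aut ==> A *v rho u s x = rho (A *v u) s (A *v x)"
 by (simp add: rho_def Aut_pspace[symmetric] clin_scale[OF clin_matrix] clin_add[OF clin_matrix])

abbreviation gam :: "complex^'n => complex^'n" where
 "gam z \<equiv> rho (e 1) (-1) (rho (e r) (-1) z)"

lemma one_r: "(1::nat) \<in> {1..r}" "r \<in> {1..r}" "(1::nat) ~= r" using l_pos l_less by auto
lemma gam_clin: "clin gam" by (rule clin_comp[OF rho_clin rho_clin])

text \<open>A reflection \<open>S\<close> exchanges \<open>e 1\<close> and \<open>e r\<close>, so its commutator with the reflection of \<open>e 1\<close> is the product of the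
  reflections of \<open>e 1\<close> and \<open>e r\<close>.\<close>

lemma gam_commutator:
 obtains S R where "S \<in> KR" "R \<in> KR" "!!z. (R ** S ** matrix_inv R ** matrix_inv S) *v z = gam z" proof -
 obtain v where v: "unit_vec 1 r v" by (rule unit_vec_exists[OF one_r a_nonzero])
 let ?d = "rot_idem 1 r v (pi/2/2)"
 have td: "tripotent T ?d" by (rule rot_idem_tripotent[OF one_r v])
 define S where "S = matrix (rho ?d (-1))"
 define R where "R = matrix (rho (e 1) (-1))"
 have SA: "S \<in> Aut" unfolding S_def by (rule rho_Aut[OF td]) simp
 have S: "S \<in> KR" unfolding S_def by (rule rho_KR[OF td]) simp
 have R: "R \<in> KR" unfolding R_def by (rule rho_KR[OF e_tripotent[OF one_r(1)]]) simp
 have Sapp: "S *v z = rho ?d (-1) z" and Rapp: "R *v z = rho (e 1) (-1) z" for z by (simp_all add: S_def R_def matrix_works[OF rho_clin])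
 have SS: "S *v (S *v z) = z" and RR: "R *v (R *v z) = z" for z
  unfolding Sapp Rapp rho_mult[OF td] rho_mult[OF e_tripotent[OF one_r(1)]] by simp_all
 have inv: "matrix_inv S = S" "matrix_inv R = R" by (rule matrix_inv_unique, rule matrix_eqI, simp add: mv_mult SS RR)+
 have Se: "S *v e 1 = e r" using rot_idem_reflect_i[OF one_r v, of "pi/2"] by (simp add: Sapp rot_idem_def)
 have "(R ** S ** matrix_inv R ** matrix_inv S) *v z = gam z" for z proof -
  have "S *v (R *v (S *v z)) = rho (S *v e 1) (-1) (S *v (S *v z))" unfolding Rapp by (rule Aut_rho[OF SA])
  thus ?thesis by (simp add: inv mv_mult SS Se Rapp)
 qed
 thus ?thesis using that S R by blast
qed

lemma gam_Z:
 assumes z: "z \<in> Z i j" shows "gam z = ((-1) ^ (of_bool (i = 1) + of_bool (j = 1)) * (-1) ^ (of_bool (i = r) + of_bool (j = r))) *s z"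
 by (simp add: rho_e[OF one_r(2) z] rho_e[OF one_r(1) z] clin_scale[OF rho_clin] mult.commute)

lemma gam_c: "gam c = c" proof -
 have "gam (e k) = e k" if "k \<in> {1..r}" for k using gam_Z[OF e_Z[OF that]] by (auto simp: of_bool_def)
 thus ?thesis unfolding esum_def[of "{1..l}"] clin_sum[OF gam_clin] using l_less by (intro sum.cong refl) auto
qed

definition sgn_gam :: "nat \<times> nat => complex" where
 "sgn_gam = (%(i, j). (-1) ^ (of_bool (i = 1) + of_bool (j = 1)) * (-1) ^ (of_bool (i = r) + of_bool (j = r)))"

text \<open>On \<open>Z i j\<close> the commutator is \<open>-1\<close> exactly when one of \<open>i, j\<close> is in \<open>{1, r}\<close> and the other one is not.  In the
  tangent space these are the \<open>Z 1 j\<close> with \<open>1 < j < r\<close> and the \<open>Z i r\<close> with \<open>1 < i \<le> l\<close>.\<close>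

lemma sgn_gam_prod:
 "(\<Prod>(i, j)\<in>pidx. (if i <= l then sgn_gam (i, j) else 1) ^ (if i = j then 1 else a)) = (-1) ^ (a * (r - 2) + a * (l - 1))" proof -
 let ?g = "%i. \<Prod>j\<in>{i..r}. (if i <= l then sgn_gam (i, j) else 1) ^ (if i = j then 1 else a)"
 have row: "?g i = (if i <= l then (-1) ^ a else 1)" if i: "i \<in> {2..r}" for i proof (cases "i <= l")
  case True
  hence "i < r" using l_less by simp
  have "?g i = (\<Prod>j\<in>{i..r}. if j = r then (-1) ^ a else 1)" using True i l_less by (intro prod.cong refl) (auto simp: sgn_gam_def)
  thus ?thesis using True `i < r` by (simp add: prod.delta)
 qed simp
 have I1: "{1..r} = insert 1 (insert r {2..r-1})" and I: "{1..r} = insert 1 {2..r}" using one_r by auto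
 have "?g 1 = (\<Prod>j\<in>{2..r-1}. ((-1)::complex) ^ a)" proof -
  have "?g 1 = (\<Prod>j\<in>{1..r}. if j \<in> {2..r-1} then (-1) ^ a else 1)"
   using l_pos one_r by (intro prod.cong refl) (auto simp: sgn_gam_def of_bool_def)
  also have "... = (\<Prod>j\<in>{2..r-1}. (-1) ^ a)" by (rule prod.mono_neutral_cong_right) auto
  finally show ?thesis .
 qed
 hence g1: "?g 1 = (-1) ^ (a * (r - 2))" by (simp add: power_mult[symmetric] numeral_2_eq_2)
 have "(\<Prod>i\<in>{2..r}. ?g i) = (\<Prod>i\<in>{2..r}. if i <= l then (-1) ^ a else 1)" using row by (intro prod.cong refl)
 also have "... = (\<Prod>i\<in>{2..l}. (-1) ^ a)" by (rule prod.mono_neutral_cong_right) (use l_less in auto)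
 finally have g2: "(\<Prod>i\<in>{2..r}. ?g i) = (-1) ^ (a * (l - 1))" by (simp add: power_mult[symmetric] numeral_2_eq_2 One_nat_def)
 have "(\<Prod>(i, j)\<in>pidx. (if i <= l then sgn_gam (i, j) else 1) ^ (if i = j then 1 else a)) = (\<Prod>i\<in>{1..r}. ?g i)"
  unfolding pidx_Sigma by (subst prod.Sigma) auto
 also have "... = (\<Prod>i\<in>insert 1 {2..r}. ?g i)" by (rule arg_cong[OF I])
 also have "... = ?g 1 * (\<Prod>i\<in>{2..r}. ?g i)" by (rule prod.insert) auto
 finally show ?thesis by (simp only: g1 g2 power_add)
qed

text \<open>In the odd case the commutator \<open>gam\<close> fixes \<open>c\<close> and has determinant \<open>-1\<close> on the tangent space.\<close>

lemma gam_form_vanishes: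
 assumes odd: "odd (2 + a * (r - Suc l))" and alt: "alternating_form dd VV \<omega>"
  and inv: "!!vs. length vs = dd ==> set vs \<subseteq> VV ==> \<omega> (map gam vs) = \<omega> vs"
  and vs: "length vs = dd" "set vs \<subseteq> VV" shows "\<omega> vs = 0" proof -
 obtain ty b where "frame_basis ty b" by (rule frame_basis_exists)
 note b = frame_basisD[OF this]
 define I where "I = {x. fst (ty x) <= l}"
 have pb: "p0 (b x) = (if x \<in> I then 0 else b x)" for x proof -
  obtain i j where t: "ty x = (i, j)" by (cases "ty x")
  have ij: "1 <= i" "i <= j" "j <= r" using b(1)[rule_format, of x] t by (auto simp: pidx_def)
  have "b x \<in> Z i j" using b(2)[rule_format, of x] t by simp
  hence "b x \<in> pspace c (of_bool (i <= l) + of_bool (j <= l))" by (rule Z_pspace_cc[OF _ l_le]) (use ij in auto)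
  thus ?thesis using pproj_pspace[of "b x" c "of_bool (i <= l) + of_bool (j <= l)" 0] ij t
   by (auto simp: I_def of_bool_def split: if_splits)
 qed
 have cq: "clin (%z. z - p0 z)" by (intro clin_sub clin_id pproj_clin)
 have cardI: "card I = dd" proof -
  have "trace (matrix (%z. z - p0 z)) = of_nat dd" using trace_idempotent[OF cq] by (simp add: p_diff p_idem range_VV dd_def)
  moreover have "trace (matrix (%z. z - p0 z)) = (\<Sum>x\<in>UNIV. if x \<in> I then 1 else 0)"
   by (rule trace_eigenbasis[OF cq b(3)]) (simp add: pb)
  ultimately have "of_nat (card I) = (of_nat dd :: complex)" by (simp add: sum.If_cases)
  thus ?thesis by simp
 qed
 have span: "VV \<subseteq> vec.span (b ` I)" proof
  fix z assume z: "z \<in> VV"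
  obtain y where y: "z = (\<Sum>j\<in>UNIV. y j *s b j)" by (rule basis_expand[OF b(3)], rule that)
  have "z = z - p0 z" using z by (simp add: VV_def)
  also have "... = (\<Sum>j\<in>UNIV. y j *s (b j - p0 (b j)))"
   unfolding y clin_sum[OF cq] by (simp add: clin_sum[OF pproj_clin] p_scale sum_subtractf vector_ssub_ldistrib)
  also have "... \<in> vec.span (b ` I)" by (rule vec.span_sum, rule vec.span_scale) (auto simp: pb intro: vec.span_base vec.span_zero)
  finally show "z \<in> vec.span (b ` I)" .
 qed
 show ?thesis proof (rule alternating_form_vanishes[OF alt VV_subspace _ cardI _ span _ inv _ vs, where s = "%x. sgn_gam (ty x)"])
  show "finite I" by simp
  show "b ` I \<subseteq> VV" using pb by (auto simp: VV_def)
  show "gam (b x) = sgn_gam (ty x) *s b x" if "x \<in> I" for x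
   using gam_Z[OF b(2)[rule_format, of x]] by (simp add: sgn_gam_def split: prod.split)
  have "(\<Prod>x\<in>I. sgn_gam (ty x)) = (\<Prod>x\<in>UNIV. (%(i, j). if i <= l then sgn_gam (i, j) else 1) (ty x))"
   by (rule prod.mono_neutral_cong_left) (auto simp: I_def split: prod.split)
  also have "... = (\<Prod>(i, j)\<in>pidx. (%(i, j). if i <= l then sgn_gam (i, j) else 1) (i, j) ^ (if i = j then 1 else a))"
   by (rule prod_by_type[OF b(1,4)])
  also have "... = (-1) ^ (a * (r - 2) + a * (l - 1))" using sgn_gam_prod by simp
  also have "... = -1" proof -
   have oa: "odd a" and ol: "odd (r - Suc l)" using odd by auto
   have "((r - 2) + (l - 1)) + (r - Suc l) = 2 * (r - 2)" using l_pos l_less by auto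
   hence "even (((r - 2) + (l - 1)) + (r - Suc l))" by (rule ssubst) (rule dvd_triv_left)
   hence "odd ((r - 2) + (l - 1))" using ol unfolding even_add[of "(r - 2) + (l - 1)"] by blast
   hence "odd (a * ((r - 2) + (l - 1)))" using oa unfolding even_mult_iff by blast
   thus ?thesis by (simp add: distrib_left)
  qed
  finally show "(\<Prod>x\<in>I. sgn_gam (ty x)) ~= 1" by simp
 qed auto
qed

lemma odd_no_form:
 assumes odd: "odd (2 + a * (r - Suc l))" and hol: "holomorphic_form dd M \<Theta>" and inv: "invariant_form (K_ring0 T) dd M \<Theta>"
 shows "\<not> nonzero_form dd M \<Theta>" proof
 assume "nonzero_form dd M \<Theta>"
 then obtain z vs where z: "z \<in> M" and vs: "length vs = dd" "set vs \<subseteq> tangent_space M z" "\<Theta> z vs ~= 0"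
  unfolding nonzero_form_def by blast
 obtain A where A: "A \<in> Str" "z = A *v c" using M_orbit[OF z] by blast
 have iA: "invertible A" using A by (simp add: Str_def)
 note tan = tangent_space_orbit[OF A(1), folded A(2)]
 define \<omega> where "\<omega> ws = \<Theta> z (map ((*v) A) ws)" for ws
 have alt0: "alternating_form dd (tangent_space M z) (\<Theta> z)" using hol z by (auto simp: holomorphic_form_def)
 have alt: "alternating_form dd VV \<omega>" unfolding alternating_form_def proof (intro conjI allI impI; elim conjE)
  fix vs i x y s
  assume h: "length vs = dd" "set vs \<subseteq> VV" "i < dd" "x \<in> VV" "y \<in> VV"
  have "\<Theta> z ((map ((*v) A) vs)[i := s *s (A *v x) + A *v y]) =
    s * \<Theta> z ((map ((*v) A) vs)[i := A *v x]) + \<Theta> z ((map ((*v) A) vs)[i := A *v y])"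
   by (rule alternating_form_linear[OF alt0]) (use h in "auto simp: tan")
  thus "\<omega> (vs[i := s *s x + y]) = s * \<omega> (vs[i := x]) + \<omega> (vs[i := y])"
   by (simp add: \<omega>_def map_update clin_add[OF clin_matrix] clin_scale[OF clin_matrix])
 next
  fix vs i j
  assume h: "length vs = dd" "set vs \<subseteq> VV" "i < j" "j < dd" "vs ! i = vs ! j"
  show "\<omega> vs = 0" unfolding \<omega>_def by (rule alternating_form_zero[OF alt0 _ _ h(3,4)]) (use h in "auto simp: tan")
 qed
 obtain S R where SR: "S \<in> KR" "R \<in> KR" "!!z. (R ** S ** matrix_inv R ** matrix_inv S) *v z = gam z"
  by (rule gam_commutator, rule that)
 have iS: "invertible S" and iR: "invertible R" using SR KR_invertible by auto
 define G where "G = A ** (R ** S ** matrix_inv R ** matrix_inv S) ** matrix_inv A"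
 have "G \<in> K_ring0 T" proof -
  let ?R = "A ** R ** matrix_inv A" and ?S = "A ** S ** matrix_inv A"
  have "G = ?R ** ?S ** matrix_inv ?R ** matrix_inv ?S" unfolding matrix_inv_conj[OF iA iR] matrix_inv_conj[OF iA iS] G_def
   by (rule matrix_eqI) (use iA in "simp add: mv_mult")
  moreover have "?R \<in> KR" "?S \<in> KR" using KR_conj[OF A(1)] SR by auto
  ultimately show ?thesis unfolding K_ring0_def by (intro hull_inc) blast
 qed
 have Gapp: "G *v (A *v x) = A *v gam x" for x using iA SR(3)[of x] by (simp add: G_def mv_mult)
 have gamVV: "gam x \<in> VV" if "x \<in> VV" for x proof -
  let ?g = "R ** S ** matrix_inv R ** matrix_inv S"
  have "?g \<in> KR" by (intro KR_mult KR_inv SR(1,2))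
  hence "normalised ?g" using KR_Str c_pspace c_W0 by (auto simp: normalised_def SR(3) gam_c)
  from normalised_VV[OF this \<open>x \<in> VV\<close>] show ?thesis by (simp only: SR(3))
 qed
 have "\<omega> (map gam ws) = \<omega> ws" if ws: "length ws = dd" "set ws \<subseteq> VV" for ws proof -
  have "map ((*v) A) (map gam ws) = map ((*v) G) (map ((*v) A) ws)" using Gapp by simp
  moreover have "G *v z = z" using Gapp[of c] gam_c A(2) by simp
  moreover have "set (map ((*v) A) ws) \<subseteq> tangent_space M z" using ws(2) by (auto simp: tan)
  ultimately show ?thesis using inv `G \<in> K_ring0 T` z ws(1) unfolding invariant_form_def \<omega>_def by (metis length_map)
 qed
 moreover have "set (map ((*v) (matrix_inv A)) vs) \<subseteq> VV" using vs(2) iA by (auto simp: tan)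
 ultimately have "\<omega> (map ((*v) (matrix_inv A)) vs) = 0" by (intro gam_form_vanishes[OF odd alt]) (use vs in auto)
 moreover have "map ((*v) A) (map ((*v) (matrix_inv A)) vs) = vs" using iA by (simp add: map_idI)
 ultimately show False using vs(3) by (simp only: \<omega>_def)
qed

end

context kepler_frame
begin

section \<open>Peirce multiplication and the odd case\<close>

lemma T_weight_zero:
 assumes "x \<in> Z i j" "y \<in> Z k m" "z \<in> Z n p" "q \<in> {1..r}"
  "int (of_bool (i = q) + of_bool (j = q)) - int (of_bool (k = q) + of_bool (m = q)) + int (of_bool (n = q) + of_bool (p = q)) < 0"
 shows "T x y z = 0"
 by (rule T_pspace_zero[OF e_tripotent[OF assms(4)] Z_pspace[OF assms(1,4)] Z_pspace[OF assms(2,4)] Z_pspace[OF assms(3,4)]])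
   (use assms(5) in auto)

text \<open>A Clifford relation for multiplications by elements of \<open>Z i j\<close> on \<open>Z j k\<close>.\<close>

lemma jo_anticommute:
 assumes x: "x \<in> Z i j" "x' \<in> Z i j" and y: "y \<in> Z j k"
  and ij: "i \<in> {1..r}" "j \<in> {1..r}" "k \<in> {1..r}" "i ~= j" "j ~= k" "i ~= k"
 shows "jo x (jo x' y) + jo x' (jo x y) = (bq x x' / 2) *s y" proof -
 have "T x (st y) x' = 0" by (rule T_weight_zero[OF x(1) st_Z[OF y] x(2) ij(3)]) (use ij in auto)
 hence "2 *s (jo (jo y x) x' + jo x (jo y x') - jo y (jo x x')) = 0" by (simp only: T_jo st_st)
 hence "jo (jo y x) x' + jo x (jo y x') - jo y (jo x x') = 0" unfolding vec.scale_eq_0_iff by simp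
 moreover have "jo (jo y x) x' = jo x' (jo x y)" "jo x (jo y x') = jo x (jo x' y)" by (metis jp_commute)+
 moreover have "jo y (jo x x') = (bq x x' / 2) *s y" proof -
  have "jo y (jo x x') = bq x x' *s (jo (e i) y + jo (e j) y)" unfolding jo_spin[OF x ij(1,2,4)] jp_scale jp_add by (simp only: jp_commute)
  thus ?thesis using jo_e[OF y ij(1)] jo_e[OF y ij(2)] ij by (simp add: vec_eq_iff)
 qed
 ultimately show ?thesis by (simp add: algebra_simps)
qed

lemma unit_vec_bq: assumes "unit_vec i j x" "i \<in> {1..r}" "j \<in> {1..r}" "i ~= j" shows "bq x x = 1" proof -
 have x: "x \<in> Z i j" "jo x x = e i + e j" using assms by (auto simp: unit_vec_def)
 have "bq x x *s (e i + e j) = e i + e j" using jo_spin[OF x(1) x(1) assms(2-4)] x(2) by (rule trans[OF sym])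
 hence "jo (e i) (bq x x *s (e i + e j)) = jo (e i) (e i + e j)" by (rule arg_cong)
 hence "bq x x *s e i = 1 *s e i" using assms by (simp add: jp_scale jp_add jo_e_e)
 thus ?thesis using e_nonzero[OF assms(2)] unfolding vec.scale_cancel_right by simp
qed

lemma jo_unit_twice:
 assumes x: "unit_vec i j x" and y: "y \<in> Z j k" and ij: "i \<in> {1..r}" "j \<in> {1..r}" "k \<in> {1..r}" "i ~= j" "j ~= k" "i ~= k"
 shows "jo x (jo x y) = (1/4) *s y" using jo_anticommute[OF _ _ y ij, of x x] x unit_vec_bq[OF x ij(1,2,4)]
 by (simp add: unit_vec_def vec_eq_iff field_simps)

lemma jo_assoc:
 assumes x: "x \<in> Z i j" and y: "y \<in> Z j k" and z: "z \<in> Z k m"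
  and ij: "i \<in> {1..r}" "j \<in> {1..r}" "k \<in> {1..r}" "m \<in> {1..r}" "i ~= j" "j ~= k" "i ~= k" "m ~= i" "m ~= j" "m ~= k"
 shows "jo x (jo y z) = jo (jo x y) z" proof -
 have "T y (st x) z = 0" by (rule T_weight_zero[OF y st_Z[OF x] z ij(1)]) (use ij in auto)
 moreover have "jo x z = 0" by (rule jo_disjoint[OF x z]) (use ij in auto)
 ultimately show ?thesis by (simp add: T_jo clin_zero[OF jp_clin])
qed

lemma ip_PP: assumes "(i, j) \<in> pidx" "i ~= j" shows "ip (PP (i, j) y) z = ip y (PP (i, j) z)" proof -
 have ij: "i \<in> {1..r}" "j \<in> {1..r}" using assms by (auto simp: pidx_def)
 have "pproj (e j) 1 (pproj (e i) 1 z) = pproj (e i) 1 (pproj (e j) 1 z)"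
  unfolding pproj_def[of "e i"] using pproj_L_commute[OF ij(2,1), of 1] by (simp add: clin_diff[OF pproj_clin] clin_scale[OF pproj_clin])
 thus ?thesis using assms(2) by (simp add: PP_def ip_pproj)
qed

lemma st_PP: assumes "(i, j) \<in> pidx" "i ~= j" shows "st (PP (i, j) z) = PP (i, j) (st z)" proof -
 have L: "L k (st z) = st (L k z)" if "k \<in> {1..r}" for k z unfolding L_jo[OF that] star_scale st_jo st_e[OF that] by simp
 hence "st (pproj (e k) m z) = pproj (e k) m (st z)" if "k \<in> {1..r}" for k m z using that by (simp add: pproj_def star_simps)
 thus ?thesis using assms by (auto simp: PP_def pidx_def)
qed

text \<open>For orthogonal unit vectors \<open>x, x'\<close> in \<open>Z 1 2\<close> the operator \<open>4 L\<^sub>x L\<^sub>x'\<close> is an invertible skew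
  operator on \<open>Z 2 3\<close>, so its dimension \<open>a\<close> is even.\<close>

lemma orthogonal_pair_even:
 assumes r3: "3 <= r" and x: "x \<in> Z 1 2" "st x = x" "bq x x = 1" and x': "x' \<in> Z 1 2" "st x' = x'" "bq x' x' = 1"
  and orth: "bq x x' = 0" shows "even a" proof -
 have idx: "(2, 3) \<in> pidx" "1 \<in> {1..r}" "2 \<in> {1..r}" "3 \<in> {1..r}" "(1::nat) ~= 2" "(2::nat) ~= 3" "(1::nat) ~= 3"
  using r3 by (auto simp: pidx_def)
 let ?P = "PP (2, 3)"
 have PZ: "?P z \<in> Z 2 3" for z by (rule PP_Z[OF idx(1)])
 have Pid: "?P z = z" if "z \<in> Z 2 3" for z using PP_on_Z[OF idx(1) idx(1) that] by simp
 have cP: "clin ?P" by (rule PP_clin)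
 define f where "f y z = 4 *s jo y (jo (x + x' - y) (?P z)) + (z - ?P z)" for y z
 have fx: "f x z = 4 *s jo x (jo x' (?P z)) + (z - ?P z)" "f x' z = 4 *s jo x' (jo x (?P z)) + (z - ?P z)" for z by (simp_all add: f_def)
 have cf: "clin (f y)" for y unfolding f_def
  by (rule clinI) (simp_all add: clin_add[OF cP] clin_scale[OF cP] jp_simps vec_eq_iff algebra_simps)
 have ch: "jo y (jo y' z) \<in> Z 2 3" if "y \<in> Z 1 2" "y' \<in> Z 1 2" "z \<in> Z 2 3" for y y' z proof -
  have "jo y' z \<in> Z 1 3" by (rule jo_chain[OF that(2,3)]) (use idx in auto)
  thus ?thesis using jo_chain[of y 2 1 "jo y' z" 3] that(1) idx Z_sym[of 2 1] by simp
 qed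
 have anti: "jo x' (jo x z) = - jo x (jo x' z)" if "z \<in> Z 2 3" for z
  using jo_anticommute[OF x(1) x'(1) that idx(2-7)] orth by (simp add: eq_neg_iff_add_eq_0 add.commute)
 have twice: "jo x (jo x z) = (1/4) *s z" "jo x' (jo x' z) = (1/4) *s z" if "z \<in> Z 2 3" for z
  using jo_anticommute[OF x(1) x(1) that idx(2-7)] jo_anticommute[OF x'(1) x'(1) that idx(2-7)] x(3) x'(3)
  by (simp_all add: vec_eq_iff field_simps)
 have adj: "ip (f x y) (st w) = ip y (st (f x' w))" for y w proof -
  have "ip (jo x (jo x' (?P y))) (st w) = ip (?P (jo x (jo x' (?P y)))) (st w)" by (simp add: Pid[OF ch[OF x(1) x'(1) PZ]])
  also have "... = ip (jo x (jo x' (?P y))) (st (?P w))" using ip_PP[OF idx(1)] st_PP[OF idx(1)] by simp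
  also have "... = ip (?P y) (st (jo x' (jo x (?P w))))" by (simp add: ip_jo x x' st_jo)
  also have "... = ip y (?P (st (jo x' (jo x (?P w)))))" by (rule ip_PP[OF idx(1,6)])
  also have "?P (st (jo x' (jo x (?P w)))) = st (?P (jo x' (jo x (?P w))))" by (rule st_PP[OF idx(1,6), symmetric])
  also have "?P (jo x' (jo x (?P w))) = jo x' (jo x (?P w))" by (rule Pid[OF ch[OF x'(1) x(1) PZ]])
  finally show ?thesis using ip_PP[OF idx(1)] st_PP[OF idx(1)] by (simp add: fx ip_simps star_simps)
 qed
 define D where "D z = z - 2 *s ?P z" for z
 have cD: "clin D" unfolding D_def by (intro clin_sub clin_id clin_cmul cP)
 have PD: "?P (D z) = - ?P z" for z by (simp add: D_def clin_diff[OF cP] clin_scale[OF cP] Pid[OF PZ] vec_eq_iff)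
 have "f x' = (%z. f x (D z))" proof
  fix z
  have "f x (D z) = - (4 *s jo x (jo x' (?P z))) + (z - ?P z)" unfolding fx PD jp_minus by (simp add: D_def vec_eq_iff)
  thus "f x' z = f x (D z)" by (simp add: fx anti[OF PZ] vec_eq_iff)
 qed
 hence "Det (f x) = Det (f x) * Det D" using Det_transpose[OF cf cf adj] Det_comp[OF cf[of x] cD] by simp
 moreover have "Det (f x) ~= 0" proof -
  have "z = 0" if z: "f x z = 0" for z proof -
   have J: "jo x (jo x' (?P z)) \<in> Z 2 3" by (rule ch[OF x(1) x'(1) PZ])
   have "?P (f x z) = 4 *s jo x (jo x' (?P z))" by (simp add: fx clin_add[OF cP] clin_diff[OF cP] clin_scale[OF cP] Pid[OF PZ] Pid[OF J])
   hence "4 *s jo x (jo x' (?P z)) = 0" using z clin_zero[OF cP] by simp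
   hence 0: "jo x (jo x' (?P z)) = 0" by (simp add: vec_eq_iff)
   have xP: "jo x' (?P z) \<in> Z 1 3" by (rule jo_chain[OF x'(1) PZ]) (use idx in auto)
   have "jo x' (jo x (jo x (jo x' (?P z)))) = 0" using 0 by (simp add: clin_zero[OF jp_clin])
   moreover have "jo x (jo x (jo x' (?P z))) = (1/4) *s jo x' (?P z)" proof -
    have x21: "x \<in> Z 2 1" using x(1) Z_sym[of 1 2] by simp
    from jo_anticommute[OF x21 x21 xP idx(3,2,4)] idx x(3) show ?thesis by (simp add: vec_eq_iff field_simps)
   qed
   ultimately have "(1/16) *s ?P z = 0" by (simp add: clin_scale[OF jp_clin] twice[OF PZ])
   hence "?P z = 0" by (simp add: vec_eq_iff)
   thus "z = 0" using z by (simp add: fx clin_zero[OF jp_clin])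
  qed
  thus ?thesis using Det_nz_iff[OF cf] clin_bij_iff_inj[OF cf] by blast
 qed
 ultimately have D1: "Det D = 1" by simp
 obtain ty b where "frame_basis ty b" by (rule frame_basis_exists)
 note b = frame_basisD[OF this]
 have "D (b y) = (if ty y = (2, 3) then -1 else 1) *s b y" for y
  using PP_on_Z[of "fst (ty y)" "snd (ty y)" 2 3 "b y"] b(1,2) idx(1) by (auto simp: D_def vec_eq_iff)
 hence "Det D = (\<Prod>y\<in>UNIV. if ty y = (2, 3) then -1 else 1)" by (rule Det_eigenbasis[OF cD b(3)])
 also have "... = (-1) ^ a" using b(4)[rule_format, OF idx(1)] by (simp add: prod.If_cases)
 finally show "even a" using D1 by (metis neg_one_odd_power one_neq_neg_one)
qed

text \<open>If \<open>Z 1 2\<close> were not spanned by one unit vector, it would contain another one that is orthogonal to it.\<close>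

lemma odd_multiplicity_one: assumes r3: "3 <= r" and odd: "odd a" shows "a = 1" proof (rule ccontr)
 assume "a ~= 1"
 have idx: "1 \<in> {1..r}" "2 \<in> {1..r}" "(1::nat) ~= 2" "(1, 2) \<in> pidx" using r3 by (auto simp: pidx_def)
 obtain x where ux: "unit_vec 1 2 x" by (rule unit_vec_exists[OF idx(1-3) a_nonzero])
 have x: "x \<in> Z 1 2" "st x = x" using ux by (auto simp: unit_vec_def)
 have bx: "bq x x = 1" by (rule unit_vec_bq[OF ux idx(1-3)])
 have "\<not> Z 1 2 \<subseteq> vec.span {x}" proof
  assume "Z 1 2 \<subseteq> vec.span {x}"
  hence "vec.dim (Z 1 2) <= card {x}" by (intro vec.dim_le_card) auto
  thus False using dim_Z[OF idx(4)] `a ~= 1` a_nonzero by simp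
 qed
 then obtain z where z: "z \<in> Z 1 2" "z \<notin> vec.span {x}" by blast
 let ?y = "z - bq z x *s x"
 have yZ: "?y \<in> Z 1 2" by (intro vec.subspace_diff[OF Z_subspace] vec.subspace_scale[OF Z_subspace] z x)
 have y0: "?y ~= 0" proof
  assume "?y = 0"
  hence "z = bq z x *s x" by simp
  thus False using z(2) by (metis vec.span_base vec.span_scale singletonI)
 qed
 have bqy: "bq ?y x = 0" using bx by (simp add: bq_def ip_simps diff_divide_distrib)
 obtain y1 y2 where y: "y1 \<in> Z 1 2" "st y1 = y1" "y2 \<in> Z 1 2" "st y2 = y2" "?y = y1 + \<i> *s y2"
  by (rule Z_real_decomp[OF yZ], rule that)
 have real: "ip y' x = of_real (Re (ip y' x))" if "st y' = y'" for y'
  using ip_st[of y' x] ip_cnj[of y' x] that x by (simp add: complex_eq_iff)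
 have "ip ?y x = 0" using bqy pnum_pos unfolding bq_def x(2) by simp
 hence "ip (y1 + \<i> *s y2) x = 0" by (simp only: y(5))
 hence "ip y1 x + \<i> * ip y2 x = 0" by (simp add: ip_simps)
 hence "of_real (Re (ip y1 x)) + \<i> * of_real (Re (ip y2 x)) = 0" using real[OF y(2)] real[OF y(4)] by simp
 hence "Re (ip y1 x) = 0" "Re (ip y2 x) = 0" by (simp_all add: complex_eq_iff)
 hence ip0: "ip y1 x = 0" "ip y2 x = 0" using real[OF y(2)] real[OF y(4)] by simp_all
 have "even a" if y': "y' \<in> Z 1 2" "st y' = y'" "ip y' x = 0" "y' ~= 0" for y' proof -
  obtain v t where v: "unit_vec 1 2 v" "y' = of_real t *s v" "t ~= 0" by (rule real_multiple_unit_vec[OF y'(1,2) idx(1-3) y'(4)], rule that)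
  have "ip v x = 0" using y'(3) v(2,3) by (simp add: ip_scale)
  hence "bq v x = 0" by (simp add: bq_def x)
  thus ?thesis using orthogonal_pair_even[OF r3 x bx _ _ unit_vec_bq[OF v(1) idx(1-3)]] v(1) bq_commute[of x v] by (simp add: unit_vec_def)
 qed
 moreover have "y1 ~= 0 \<or> y2 ~= 0" using y(5) y0 by auto
 ultimately show False using y ip0 odd by blast
qed

end

section \<open>The symmetric matrices\<close>

locale sym_frame = kepler_frame T r a e l
 for T :: "('n::finite) triple" and r a e l +
 fixes w :: "nat => complex^'n"
 assumes w: "!!j. 2 <= j ==> j <= r ==> unit_vec 1 j (w j)" and a1: "a = 1"
begin

text \<open>\<open>Y i j\<close> will correspond to the symmetric matrix \<open>E\<^sub>i\<^sub>j + E\<^sub>j\<^sub>i\<close>.\<close>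

definition Y :: "nat => nat => complex^'n" where
 "Y i j = (if i = j then 2 *s e i else if i = 1 then w j else if j = 1 then w i else 2 *s jo (w i) (w j))"

lemma Y_sym: "Y i j = Y j i" by (simp add: Y_def jp_commute)

lemma wZ: "j \<in> {1..r} ==> j ~= 1 ==> w j \<in> Z 1 j" "j \<in> {1..r} ==> j ~= 1 ==> w j \<in> Z j 1"
 "j \<in> {1..r} ==> j ~= 1 ==> st (w j) = w j" "j \<in> {1..r} ==> j ~= 1 ==> unit_vec j 1 (w j)"
 "j \<in> {1..r} ==> j ~= 1 ==> unit_vec 1 j (w j)" using w[of j] Z_sym[of 1 j] by (auto simp: unit_vec_def add.commute)

lemma r1: "1 \<in> {1..r}" using one_r by simp

lemma Y_Z: "i \<in> {1..r} ==> j \<in> {1..r} ==> Y i j \<in> Z i j" proof -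
 assume ij: "i \<in> {1..r}" "j \<in> {1..r}"
 consider "i = j" | "i ~= j" "i = 1" | "i ~= j" "j = 1" | "i ~= j" "i ~= 1" "j ~= 1" by blast
 thus ?thesis proof cases
  case 1 thus ?thesis using ij e_Z vec.subspace_scale[OF Z_subspace] by (simp add: Y_def)
 next
  case 2 thus ?thesis using wZ(1)[of j] ij by (simp add: Y_def)
 next
  case 3 thus ?thesis using wZ(2)[of i] ij by (simp add: Y_def)
 next
  case 4
  have "jo (w i) (w j) \<in> Z i j" by (rule jo_chain[OF wZ(2) wZ(1)]) (use ij 4 r1 in auto)
  thus ?thesis using 4 vec.subspace_scale[OF Z_subspace] by (simp add: Y_def)
 qed
qed

lemma Y_st: "i \<in> {1..r} ==> j \<in> {1..r} ==> st (Y i j) = Y i j"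
 using wZ(3)[of i] wZ(3)[of j] by (auto simp: Y_def star_scale st_e st_jo)

text \<open>The products of the \<open>w j\<close> generate the other basis elements, so everything follows from associativity along chains.\<close>

lemma Y_chain:
 assumes ij: "i \<in> {1..r}" "j \<in> {1..r}" "k \<in> {1..r}" "i ~= j" "j ~= k" "i ~= k" shows "jo (Y i j) (Y j k) = (1/2) *s Y i k"
proof -
 have b: "jo (w j) (Y j k) = (1/2) *s w k" if jk: "j \<in> {1..r}" "k \<in> {1..r}" "j ~= 1" "k ~= 1" "j ~= k" for j k proof -
  have "jo (w j) (jo (w j) (w k)) = (1/4) *s w k" by (rule jo_unit_twice[OF wZ(4) wZ(1)]) (use jk r1 in auto)
  thus ?thesis using jk by (simp add: Y_def jp_scale vec_eq_iff field_simps)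
 qed
 consider "j = 1" | "i = 1" | "k = 1" | "i ~= 1" "j ~= 1" "k ~= 1" by blast
 thus ?thesis proof cases
  case 1 thus ?thesis using ij by (simp add: Y_def vec_eq_iff)
 next
  case 2 thus ?thesis using ij b[of j k] by (simp add: Y_def)
 next
  case 3
  have "jo (Y i j) (Y j k) = jo (w j) (Y j i)" using 3 ij by (simp add: Y_def jp_commute)
  thus ?thesis using 3 ij b[of j i] by (simp add: Y_def)
 next
  case 4
  have "jo (Y i j) (Y j k) = 2 *s jo (jo (w i) (w j)) (Y j k)" using 4 ij by (simp add: Y_def jp_scale)
  also have "jo (jo (w i) (w j)) (Y j k) = jo (w i) (jo (w j) (Y j k))"
   by (rule jo_assoc[OF wZ(2) wZ(1) Y_Z, symmetric]) (use 4 ij r1 in auto)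
  also have "... = jo (w i) ((1/2) *s w k)" using b[of j k] 4 ij by simp
  finally show ?thesis using 4 ij by (simp add: Y_def jp_scale)
 qed
qed

lemma Y_square:
 assumes ij: "i \<in> {1..r}" "j \<in> {1..r}" "i ~= j" shows "jo (Y i j) (Y i j) = e i + e j" proof -
 consider "i = 1" | "j = 1" | "i ~= 1" "j ~= 1" by blast
 thus ?thesis proof cases
  case 1 thus ?thesis using wZ(5)[of j] ij by (simp add: Y_def unit_vec_def)
 next
  case 2 thus ?thesis using wZ(4)[of i] ij by (simp add: Y_def unit_vec_def)
 next
  case 3
  have wi: "w i \<in> Z i 1" "unit_vec i 1 (w i)" and wj: "unit_vec 1 j (w j)" "w j \<in> Z 1 j" using wZ ij 3 by auto
  have p: "jo (w i) (w j) \<in> Z i j" by (rule jo_chain[OF wi(1) wj(2)]) (use ij 3 r1 in auto)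
  have rij: "i ~= 1" "(1::nat) ~= j" using 3 by auto
  have "bq (jo (w i) (w j)) (jo (w i) (w j)) = ip (jo (w i) (w j)) (jo (w i) (w j)) / (2 * of_nat pnum)"
   using wZ(3) ij 3 by (simp add: bq_def st_jo)
  also have "ip (jo (w i) (w j)) (jo (w i) (w j)) = ip (w j) (jo (w i) (jo (w i) (w j)))"
   using ip_jo[of "w i" "w j" "jo (w i) (w j)"] wZ(3)[of i] ij 3 by simp
  also have "jo (w i) (jo (w i) (w j)) = (1/4) *s w j" by (rule jo_unit_twice[OF wi(2) wj(2)]) (use ij r1 rij in auto)
  also have "ip (w j) ((1/4) *s w j) / (2 * of_nat pnum) = bq (w j) (w j) / 4" using wZ(3)[of j] ij 3 by (simp add: bq_def ip_scale)
  also have "bq (w j) (w j) = 1" by (rule unit_vec_bq[OF wj(1)]) (use r1 ij rij in auto)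
  finally have "jo (jo (w i) (w j)) (jo (w i) (w j)) = (1/4) *s (e i + e j)" using jo_spin[OF p p ij] by (simp only:)
  thus ?thesis using 3 ij by (simp add: Y_def jp_scale vec_eq_iff)
 qed
qed

text \<open>The Jordan product \<open>(AB + BA)/2\<close> of the matrices \<open>E\<^sub>i\<^sub>j + E\<^sub>j\<^sub>i\<close>.\<close>

lemma Y_table:
 assumes "i \<in> {1..r}" "j \<in> {1..r}" "k \<in> {1..r}" "m \<in> {1..r}"
 shows "jo (Y i j) (Y k m) = (1/2) *s (of_bool (j = k) *s Y i m + of_bool (j = m) *s Y i k +
   of_bool (i = k) *s Y j m + of_bool (i = m) *s Y j k)" proof -
 have diag: "jo (2 *s e i) (Y k m) = (of_bool (k = i) + of_bool (m = i)) *s Y k m"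
  if "i \<in> {1..r}" "k \<in> {1..r}" "m \<in> {1..r}" for i k m unfolding jp_scale jo_e[OF Y_Z[OF that(2,3)] that(1)] vec.scale_scale
  by (rule arg_cong[where f = "%s. s *s Y k m"]) simp
 consider "i = j" | "i ~= j" "k = m" | "i ~= j" "k ~= m" by blast
 thus ?thesis proof cases
  case 1
  hence "Y i j = 2 *s e i" by (simp add: Y_def)
  hence "jo (Y i j) (Y k m) = (of_bool (k = i) + of_bool (m = i)) *s Y k m" using diag[of i k m] assms by simp
  thus ?thesis using 1 Y_sym[of k i] by (cases "k = i"; cases "m = i") (simp_all add: vec_eq_iff)
 next
  case 2
  hence "Y k m = 2 *s e k" by (simp add: Y_def)
  hence "jo (Y i j) (Y k m) = jo (2 *s e k) (Y i j)" by (simp add: jp_commute)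
  hence "jo (Y i j) (Y k m) = (of_bool (i = k) + of_bool (j = k)) *s Y i j" using diag[of k i j] assms by simp
  thus ?thesis using 2 Y_sym[of k j] by (cases "i = k"; cases "j = k") (simp_all add: vec_eq_iff)
 next
  case 3
  have dd: "Y i i = 2 *s e i" for i by (simp add: Y_def)
  consider "i = k" "j = m" | "i = m" "j = k" | "i = k" "j ~= m" | "i = m" "j ~= k" | "j = k" "i ~= m" | "j = m" "i ~= k"
   | "i ~= k" "i ~= m" "j ~= k" "j ~= m" by blast
  thus ?thesis proof cases
   case 1 thus ?thesis using 3 assms Y_square[of i j] by (auto simp: dd vec_eq_iff)
  next
   case c: 2
   have "jo (Y i j) (Y k m) = e i + e j" using Y_square[of i j] Y_sym[of i j] 3 c assms by simp
   thus ?thesis using 3 c by (simp add: dd vec_eq_iff)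
  next
   case c: 3
   have "jo (Y j i) (Y i m) = (1/2) *s Y j m" by (rule Y_chain) (use 3 c assms in auto)
   thus ?thesis using c 3 Y_sym[of i j] by auto
  next
   case c: 4
   have "jo (Y j i) (Y i k) = (1/2) *s Y j k" by (rule Y_chain) (use 3 c assms in auto)
   thus ?thesis using c 3 Y_sym[of i j] Y_sym[of k m] by auto
  next
   case c: 5
   have "jo (Y i j) (Y j m) = (1/2) *s Y i m" by (rule Y_chain) (use 3 c assms in auto)
   thus ?thesis using c 3 by auto
  next
   case c: 6
   have "jo (Y i j) (Y j k) = (1/2) *s Y i k" by (rule Y_chain) (use 3 c assms in auto)
   thus ?thesis using c 3 Y_sym[of k m] by auto
  next
   case c: 7
   have "jo (Y i j) (Y k m) = 0" by (rule jo_disjoint[OF Y_Z Y_Z]) (use c assms in auto)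
   thus ?thesis using c by simp
  qed
 qed
qed

definition psi :: "(nat => nat => complex) => complex^'n" where
 "psi A = (1/2) *s (\<Sum>i<r. \<Sum>j<r. A i j *s Y (Suc i) (Suc j))"

definition mprod :: "(nat => nat => complex) => (nat => nat => complex) => nat => nat => complex" where
 "mprod A B i j = (\<Sum>k<r. A i k * B k j)"

lemma psi_transpose: "psi (%i j. A j i) = psi A" proof -
 have "(\<Sum>i<r. \<Sum>j<r. A j i *s Y (Suc i) (Suc j)) = (\<Sum>j<r. \<Sum>i<r. A j i *s Y (Suc i) (Suc j))" by (rule sum.swap)
 also have "... = (\<Sum>i<r. \<Sum>j<r. A i j *s Y (Suc i) (Suc j))" by (intro sum.cong refl) (simp only: Y_sym)
 finally show ?thesis by (simp add: psi_def)
qed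

lemma psi_add: "psi (%i j. A i j + B i j) = psi A + psi B" by (simp add: psi_def sum.distrib vector_add_ldistrib vec_eq_iff field_simps)

lemma psi_scale: "psi (%i j. s * A i j) = s *s psi A"
 unfolding psi_def vec.scale_sum_right vec.scale_scale by (simp only: mult.left_commute mult.commute mult.assoc)

lemma psi_st: "st (psi A) = psi (%i j. cnj (A i j))" unfolding psi_def star_scale star_sum by (simp add: Y_st)

text \<open>By symmetry of the matrices the four terms of \<open>Y_table\<close> contribute equally.\<close>

lemma jo_psi:
 assumes A: "!!i j. A i j = A j i" and B: "!!i j. B i j = B j i" shows "jo (psi A) (psi B) = psi (mprod A B)" proof -
 define S where "S f = (\<Sum>i<r. \<Sum>j<r. \<Sum>k<r. \<Sum>m<r. (A i j * B k m) *s f i j k m)" for f :: "nat => nat => nat => nat => complex^'n"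
 let ?y = "%i j. Y (Suc i) (Suc j)"
 define f1 where "f1 i j k m = of_bool (j = k) *s ?y i m" for i j k m :: nat
 define f2 where "f2 i j k m = of_bool (j = m) *s ?y i k" for i j k m :: nat
 define f3 where "f3 i j k m = of_bool (i = k) *s ?y j m" for i j k m :: nat
 define f4 where "f4 i j k m = of_bool (i = m) *s ?y j k" for i j k m :: nat
 have swap1: "S (%i j. f j i) = S f" for f proof -
  have "S (%i j. f j i) = (\<Sum>j<r. \<Sum>i<r. \<Sum>k<r. \<Sum>m<r. (A i j * B k m) *s f j i k m)" unfolding S_def by (rule sum.swap)
  thus ?thesis unfolding S_def by (simp only: A)
 qed
 have swap2: "S (%i j k m. f i j m k) = S f" for f proof -
  have "(\<Sum>k<r. \<Sum>m<r. (A i j * B k m) *s f i j m k) = (\<Sum>m<r. \<Sum>k<r. (A i j * B m k) *s f i j m k)" for i j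
   by (subst sum.swap) (intro sum.cong refl, simp only: B)
  thus ?thesis unfolding S_def by (simp only:)
 qed
 have "f2 = (%i j k m. f1 i j m k)" "f3 = (%i j k m. f1 j i k m)" "f4 = (%i j k m. f2 j i k m)"
  by (simp_all add: fun_eq_iff f1_def f2_def f3_def f4_def)
 hence s2: "S f2 = S f1" and s3: "S f3 = S f1" and s4: "S f4 = S f2" using swap2[of f1] swap1[of f1] swap1[of f2] by simp_all
 have "(\<Sum>j<r. \<Sum>k<r. \<Sum>m<r. (A i j * B k m) *s f1 i j k m) = (\<Sum>m<r. mprod A B i m *s ?y i m)" for i proof -
  have "(\<Sum>j<r. \<Sum>k<r. \<Sum>m<r. (A i j * B k m) *s f1 i j k m) = (\<Sum>j<r. \<Sum>k<r. if k = j then (\<Sum>m<r. (A i j * B j m) *s ?y i m) else 0)"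
   by (intro sum.cong refl) (auto simp: f1_def)
  also have "... = (\<Sum>j<r. \<Sum>m<r. (A i j * B j m) *s ?y i m)" by (rule sum.cong[OF refl]) simp
  also have "... = (\<Sum>m<r. \<Sum>j<r. (A i j * B j m) *s ?y i m)" by (rule sum.swap)
  finally show ?thesis by (simp add: mprod_def vec.scale_sum_left)
 qed
 hence s1: "S f1 = (\<Sum>i<r. \<Sum>m<r. mprod A B i m *s ?y i m)" by (simp only: S_def)
 have "jo (psi A) (psi B) = (1/2 * (1/2)) *s S (%i j k m. jo (?y i j) (?y k m))" unfolding psi_def jp_scale S_def jp_sum(1)
  by (simp add: jp_sum(2) jp_scale vec.scale_sum_right vec.scale_scale)
 also have "S (%i j k m. jo (?y i j) (?y k m)) = S (%i j k m. (1/2) *s (f1 i j k m + f2 i j k m + f3 i j k m + f4 i j k m))" unfolding S_def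
 proof (intro sum.cong refl)
  fix i j k m assume "i \<in> {..<r}" "j \<in> {..<r}" "k \<in> {..<r}" "m \<in> {..<r}"
  hence "Suc i \<in> {1..r}" "Suc j \<in> {1..r}" "Suc k \<in> {1..r}" "Suc m \<in> {1..r}" by auto
  from Y_table[OF this] show "(A i j * B k m) *s jo (?y i j) (?y k m) = (A i j * B k m) *s ((1/2) *s (f1 i j k m + f2 i j k m + f3 i j k m + f4 i j k m))"
   by (simp only: f1_def f2_def f3_def f4_def nat.inject)
 qed
 also have "... = (1/2) *s (S f1 + S f2 + S f3 + S f4)" unfolding S_def vec.scale_sum_right[symmetric] sum.distrib[symmetric]
  unfolding vec.scale_sum_right by (intro sum.cong refl) (simp add: vec_eq_iff algebra_simps)
 also have "... = (1/2) *s (S f1 + S f1 + S f1 + S f1)" by (simp only: s2 s3 s4)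
 finally have "jo (psi A) (psi B) = (1/2 * (1/2)) *s ((1/2) *s (S f1 + S f1 + S f1 + S f1))" .
 also have "... = (1/2) *s S f1" by (simp add: vec_eq_iff)
 finally show ?thesis unfolding s1 psi_def .
qed

lemma mprod_assoc: "mprod (mprod A B) C = mprod A (mprod B C)" proof (intro ext)
 fix i j
 have "mprod (mprod A B) C i j = (\<Sum>k<r. \<Sum>m<r. A i m * B m k * C k j)" by (simp add: mprod_def sum_distrib_right)
 also have "... = (\<Sum>m<r. \<Sum>k<r. A i m * B m k * C k j)" by (rule sum.swap)
 finally show "mprod (mprod A B) C i j = mprod A (mprod B C) i j" by (simp add: mprod_def sum_distrib_left mult.assoc)
qed

text \<open>Both triple products are given by the same expression in their Jordan products and involutions.\<close>

lemma T_psi: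
 assumes U: "!!i j. U i j = U j i" and V: "!!i j. V i j = V j i" and W: "!!i j. W i j = W j i"
 shows "T (psi U) (psi V) (psi W) = psi (matrix_triple r U V W)" proof -
 define C where "C = (%i j. cnj (V i j))"
 have C: "C i j = C j i" for i j by (simp add: C_def V[of i j])
 define sy where "sy A B = (%i j. (1/2) * (mprod A B i j + mprod B A i j))" for A B
 have tr: "mprod A B j i = mprod B A i j" if "!!i j. A i j = A j i" "!!i j. B i j = B j i" for A B i j
  unfolding mprod_def using that(1)[of j] that(2)[of _ i] by (intro sum.cong refl) (simp only: mult.commute)
 have sys: "sy A B i j = sy A B j i" if "!!i j. A i j = A j i" "!!i j. B i j = B j i" for A B i j
  using tr[OF that, where i = i and j = j] tr[OF that, where i = j and j = i] by (simp add: sy_def add.commute)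
 have com: "psi (mprod A B) = psi (mprod B A)" if "!!i j. A i j = A j i" "!!i j. B i j = B j i" for A B
  by (rule trans[OF trans[OF jo_psi[symmetric] jp_commute] jo_psi]) (rule that)+
 have jo_sy: "jo (psi A) (psi B) = psi (sy A B)" if "!!i j. A i j = A j i" "!!i j. B i j = B j i" for A B
  unfolding sy_def psi_scale psi_add using jo_psi[OF that] com[OF that] by (simp add: vec_eq_iff)
 have half: "psi (mprod (sy A B) D) = (1/2) *s (psi (mprod A (mprod B D)) + psi (mprod B (mprod A D)))"
  "psi (mprod D (sy A B)) = (1/2) *s (psi (mprod D (mprod A B)) + psi (mprod D (mprod B A)))" for A B D proof -
  have "mprod (sy A B) D = (%i j. (1/2) * (mprod (mprod A B) D i j + mprod (mprod B A) D i j))"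
   by (intro ext) (simp add: sy_def mprod_def[of _ D] sum_distrib_left sum_distrib_right sum.distrib algebra_simps)
  thus "psi (mprod (sy A B) D) = (1/2) *s (psi (mprod A (mprod B D)) + psi (mprod B (mprod A D)))"
   by (simp only: psi_scale psi_add mprod_assoc)
  have "mprod D (sy A B) = (%i j. (1/2) * (mprod D (mprod A B) i j + mprod D (mprod B A) i j))"
   by (intro ext) (simp add: sy_def mprod_def[of D] sum_distrib_left sum.distrib algebra_simps)
  thus "psi (mprod D (sy A B)) = (1/2) *s (psi (mprod D (mprod A B)) + psi (mprod D (mprod B A)))" by (simp only: psi_scale psi_add)
 qed
 have tr3: "psi (mprod A (mprod B D)) = psi (mprod D (mprod B A))"
  if "!!i j. A i j = A j i" "!!i j. B i j = B j i" "!!i j. D i j = D j i" for A B D proof -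
  have "mprod A (mprod B D) j i = mprod D (mprod B A) i j" for i j proof -
   have "mprod A (mprod B D) j i = mprod (mprod D B) A i j" unfolding mprod_def[of A] mprod_def[of _ A]
    by (rule sum.cong[OF refl]) (simp only: tr[OF that(2,3)] that(1)[of j] mult.commute)
   thus ?thesis by (simp only: mprod_assoc)
  qed
  hence "psi (%i j. mprod A (mprod B D) j i) = psi (mprod D (mprod B A))" by simp
  thus ?thesis by (rule trans[OF psi_transpose[symmetric]])
 qed
 have "T (psi U) (psi V) (psi W) = 2 *s (jo (psi (sy C U)) (psi W) + jo (psi U) (psi (sy C W)) - jo (psi C) (psi (sy U W)))"
  unfolding T_jo[of "psi U"] psi_st C_def[symmetric] jo_sy[OF C U] jo_sy[OF C W] jo_sy[OF U W] ..
 also have "... = psi (mprod U (mprod C W)) + psi (mprod W (mprod C U))"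
  unfolding jo_psi[OF sys[OF C U] W] jo_psi[OF U sys[OF C W]] jo_psi[OF C sys[OF U W]] half
  using tr3[OF C U W] tr3[OF C W U] tr3[OF U C W] by (simp add: vec_eq_iff field_simps)
 also have "... = psi (matrix_triple r U V W)" proof -
  have "matrix_triple r U V W = (%i j. mprod U (mprod C W) i j + mprod W (mprod C U) i j)" unfolding matrix_triple_def mprod_def C_def
   by (intro ext) (simp only: sum.distrib sum_distrib_left mult.assoc V)
  thus ?thesis by (simp only: psi_add)
 qed
 finally show ?thesis .
qed

lemma ip_un_Y: assumes "i \<in> {1..r}" "m \<in> {1..r}" shows "ip un (Y i m) = of_bool (i = m) * (2 * of_nat pnum)" proof (cases "i = m")
 case True
 have "ip un (e i) = of_nat pnum" using assms(1) by (simp add: esum_def ip_sum ip_e_e)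
 thus ?thesis using True by (simp add: Y_def ip_scale)
next
 case False
 have "ip (e k) (Y i m) = 0" if "k \<in> {1..r}" for k by (rule ip_Z_orth[OF e_Z[OF that] Y_Z[OF assms] assms(1)]) (use False in auto)
 hence "ip un (Y i m) = 0" unfolding esum_def ip_sum by (intro sum.neutral) auto
 thus ?thesis using False by simp
qed

lemma ip_Y:
 assumes "i \<in> {1..r}" "j \<in> {1..r}" "k \<in> {1..r}" "m \<in> {1..r}"
 shows "ip (Y i j) (Y k m) = 2 * of_nat pnum * (of_bool (i = k & j = m) + of_bool (i = m & j = k))" proof -
 have "ip (Y i j) (Y k m) = ip un (jo (Y i j) (Y k m))" using ip_eq_un[of "Y i j" "Y k m"] Y_st assms by simp
 also have "... = (1/2) * (of_bool (j = k) * ip un (Y i m) + of_bool (j = m) * ip un (Y i k) +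
   of_bool (i = k) * ip un (Y j m) + of_bool (i = m) * ip un (Y j k))" unfolding Y_table[OF assms] by (simp add: ip_simps)
 also have "... = 2 * of_nat pnum * (of_bool (i = k & j = m) + of_bool (i = m & j = k))"
  unfolding ip_un_Y[OF assms(1,4)] ip_un_Y[OF assms(1,3)] ip_un_Y[OF assms(2,4)] ip_un_Y[OF assms(2,3)] of_bool_conj
  by (simp add: field_simps)
 finally show ?thesis .
qed

text \<open>The coefficients with respect to the basis, recovered by the trace form.\<close>

definition phi :: "complex^'n => nat => nat => complex" where
 "phi x i j = (if i < r & j < r then ip x (Y (Suc i) (Suc j)) / (2 * of_nat pnum) else 0)"

lemma phi_symmetric: "phi x \<in> symmetric_matrices r" by (auto simp: symmetric_matrices_def phi_def Y_sym)

lemma phi_psi: assumes A: "A \<in> symmetric_matrices r" shows "phi (psi A) = A" proof (intro ext)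
 fix i j
 show "phi (psi A) i j = A i j" proof (cases "i < r & j < r")
  case True
  have pick: "(\<Sum>k<r. \<Sum>m<r. A k m * of_bool (k = i' & m = j')) = A i' j'" if "i' < r" "j' < r" for i' j' proof -
   have "(\<Sum>k<r. \<Sum>m<r. A k m * of_bool (k = i' & m = j')) = (\<Sum>k<r. if k = i' then (\<Sum>m<r. if m = j' then A i' j' else 0) else 0)"
    by (intro sum.cong refl) (auto intro!: sum.cong sum.neutral)
   thus ?thesis using that by simp
  qed
  have idx: "Suc k \<in> {1..r}" if "k < r" for k using that by auto
  have "ip (psi A) (Y (Suc i) (Suc j)) = (1/2) * (\<Sum>k<r. \<Sum>m<r. A k m * ip (Y (Suc k) (Suc m)) (Y (Suc i) (Suc j)))"
   unfolding psi_def ip_scale ip_sum ..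
  also have "(\<Sum>k<r. \<Sum>m<r. A k m * ip (Y (Suc k) (Suc m)) (Y (Suc i) (Suc j)))
    = (\<Sum>k<r. \<Sum>m<r. 2 * of_nat pnum * (A k m * of_bool (k = i & m = j) + A k m * of_bool (k = j & m = i)))"
   using True by (intro sum.cong refl) (simp only: ip_Y[OF idx idx idx idx] lessThan_iff nat.inject, simp add: algebra_simps)
  also have "... = 2 * of_nat pnum * (A i j + A j i)" using True by (simp only: sum_distrib_left[symmetric] sum.distrib pick)
  also have "A j i = A i j" using A by (auto simp: symmetric_matrices_def)
  finally show ?thesis using True pnum_pos by (simp add: phi_def field_simps)
 next
  case False
  hence "A i j = 0" using A by (auto simp: symmetric_matrices_def)
  thus ?thesis using False by (auto simp: phi_def)
 qed
qed

lemma phi_inj: assumes "phi x = phi y" shows "x = y" proof -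
 have "x - y = 0" proof (rule ip_Z_ext)
  fix i j z assume ij: "(i, j) \<in> pidx" and z: "z \<in> Z i j"
  have i: "i \<in> {1..r}" "j \<in> {1..r}" using ij by (auto simp: pidx_def)
  have "ip (Y i j) (Y i j) ~= 0" unfolding ip_Y[OF i i] using pnum_pos by (cases "i = j") auto
  hence Yn: "Y i j ~= 0" by auto
  have "vec.dim (vec.span {Y i j}) = 1"
   using Yn vec.dim_eq_card_independent[of "{Y i j}"] vec.dependent_single[of "Y i j"] by (simp add: One_nat_def)
  hence "vec.span {Y i j} = Z i j" using dim_Z[OF ij] a1 Y_Z[OF i] Z_subspace
   by (intro vec.subspace_dim_equal vec.subspace_span vec.span_minimal) auto
  then obtain s where s: "z = s *s Y i j" using z by (auto simp: vec.span_singleton)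
  have "i - 1 < r" "j - 1 < r" "Suc (i - 1) = i" "Suc (j - 1) = j" using i by auto
  moreover have "phi x (i - 1) (j - 1) = phi y (i - 1) (j - 1)" using assms by simp
  ultimately have "ip x (Y i j) = ip y (Y i j)" using pnum_pos by (simp add: phi_def)
  thus "ip (x - y) z = 0" by (simp add: s ip_simps)
 qed
 thus ?thesis by simp
qed

lemma iso_symmetric: "iso_symmetric_matrices T r" unfolding iso_symmetric_matrices_def proof (intro exI conjI allI)
 have psi_phi: "psi (phi x) = x" for x by (rule phi_inj) (rule phi_psi[OF phi_symmetric])
 show "bij_betw phi UNIV (symmetric_matrices r)" by (rule bij_betw_byWitness[where f' = psi]) (use psi_phi phi_psi phi_symmetric in auto)
 show "phi (x + y) i j = phi x i j + phi y i j" for x y i j by (simp add: phi_def ip_simps add_divide_distrib)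
 show "phi (s *s x) i j = s * phi x i j" for s x i j by (simp add: phi_def ip_simps)
 fix u v w
 have sym: "phi x i j = phi x j i" for x i j using phi_symmetric[of x] by (auto simp: symmetric_matrices_def)
 have out: "phi x i j = 0" if "\<not> (i < r & j < r)" for x i j using that by (auto simp: phi_def)
 have "T u v w = psi (matrix_triple r (phi u) (phi v) (phi w))" using T_psi[of "phi u" "phi v" "phi w"] sym by (simp add: psi_phi)
 moreover have "matrix_triple r (phi u) (phi v) (phi w) \<in> symmetric_matrices r" unfolding symmetric_matrices_def
 proof (intro CollectI conjI allI impI)
  fix i j
  have "matrix_triple r (phi u) (phi v) (phi w) i j =
    (\<Sum>m<r. \<Sum>k<r. phi u i k * cnj (phi v m k) * phi w m j + phi w i k * cnj (phi v m k) * phi u m j)"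
   unfolding matrix_triple_def by (rule sum.swap)
  also have "... = matrix_triple r (phi u) (phi v) (phi w) j i" unfolding matrix_triple_def proof (intro sum.cong refl)
   fix m k
   show "phi u i k * cnj (phi v m k) * phi w m j + phi w i k * cnj (phi v m k) * phi u m j
    = phi u j m * cnj (phi v k m) * phi w k i + phi w j m * cnj (phi v k m) * phi u k i"
    unfolding sym[of u i] sym[of v m] sym[of w m] sym[of w i] sym[of u m] by (simp add: algebra_simps)
  qed
  finally show "matrix_triple r (phi u) (phi v) (phi w) i j = matrix_triple r (phi u) (phi v) (phi w) j i" .
 next
  fix i j assume "\<not> (i < r & j < r)"
  thus "matrix_triple r (phi u) (phi v) (phi w) i j = 0" by (auto simp: matrix_triple_def phi_def)
 qed
 ultimately show "phi (T u v w) = matrix_triple r (phi u) (phi v) (phi w)" by (simp add: phi_psi)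
qed

end

theorem theorem7p6:
  fixes T :: "('n::finite) triple"
    and e :: "nat \<Rightarrow> complex^'n"
    and r a b p l :: nat
  assumes "hermitian_jordan_triple T"
    and "irreducible_triple T"
    and "frame T r e"
    and "characteristic_multiplicities T r e a b"
    and "b = 0"
    and "p = genus r a b"
    and "0 < l" and "l < r"
  shows "((\<exists>\<Theta>. holomorphic_form (complex_dim (kepler T r e l)) (kepler T r e l) \<Theta> \<and>
                invariant_form (K_ring0 T) (complex_dim (kepler T r e l)) (kepler T r e l) \<Theta> \<and>
                nonzero_form (complex_dim (kepler T r e l)) (kepler T r e l) \<Theta>)
            \<longleftrightarrow> even (int p - int a * int l)) \<and>
         int p - int a * int l = 2 + int a * (int r - int l - 1) \<and>
         (odd (int p - int a * int l) \<longrightarrow> iso_symmetric_matrices T r \<and> even (r - l))"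
proof -
 interpret kepler_frame T r a e l by unfold_locales (use assms in auto)
 have dim: "complex_dim M = dd" by (rule complex_dim_M)
 have eq: "int p - int a * int l = 2 + int a * (int r - int l - 1)" using assms(5,6,8) by (simp add: genus_def of_nat_diff algebra_simps)
 also have "... = int (2 + a * (r - Suc l))" proof -
  obtain d where "r = Suc (l + d)" using less_imp_Suc_add[OF l_less] by blast
  thus ?thesis by (simp add: algebra_simps)
 qed
 finally have par: "even (int p - int a * int l) \<longleftrightarrow> even (2 + a * (r - Suc l))" by (simp only: even_of_nat)
 have exist: "(\<exists>\<Theta>. holomorphic_form dd M \<Theta> & invariant_form (K_ring0 T) dd M \<Theta> & nonzero_form dd M \<Theta>)
   \<longleftrightarrow> even (2 + a * (r - Suc l))" proof
  assume "even (2 + a * (r - Suc l))"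
  then obtain q where q: "2 + a * (r - Suc l) = 2 * q" by (rule evenE)
  interpret even_kepler_frame T r a e l q by unfold_locales (rule q)
  show "\<exists>\<Theta>. holomorphic_form dd M \<Theta> & invariant_form (K_ring0 T) dd M \<Theta> & nonzero_form dd M \<Theta>"
   using Theta_holomorphic Theta_invariant Theta_nonzero by blast
 qed (use odd_no_form in blast)
 have "iso_symmetric_matrices T r & even (r - l)" if odd: "odd (2 + a * (r - Suc l))" proof -
  have oa: "odd a" and orl: "odd (r - Suc l)" using odd by auto
  have rl: "r - l = Suc (r - Suc l)" using l_less by simp
  have "r - Suc l ~= 0" using orl by (metis even_zero)
  hence r3: "3 <= r" using l_pos by simp
  have a1: "a = 1" by (rule odd_multiplicity_one[OF r3 oa])
  have "EX v. unit_vec 1 j v" if "2 <= j" "j <= r" for j proof -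
   have "j \<in> {1..r}" "(1::nat) ~= j" using that by auto
   then obtain v where "unit_vec 1 j v" by (rule unit_vec_exists[OF one_r(1) _ _ a_nonzero])
   thus ?thesis by blast
  qed
  then obtain w where w: "!!j. 2 <= j ==> j <= r ==> unit_vec 1 j (w j)" by metis
  interpret sym_frame T r a e l w by unfold_locales (use w a1 in auto)
  show ?thesis using iso_symmetric orl rl by simp
 qed
 thus ?thesis using eq par exist dim by simp
qed

end
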